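(* Let $M$ be a compact connected Riemann surface of genus $g\ge1$ equipped with a projective structure $P$ (and a fixed theta characteristic), $E$ a holomorphic vector bundle on $M$ with a holomorphic connection $D_E$, and $F$ any holomorphic vector bundle on $M$. Let $k,n$ be integers with $k-1=n\ge0$. Then, under the canonical isomorphism $J^k(E\otimes\mathbf L^n)=E\otimes(\mathcal V_n\oplus\mathbf L^{-(k+1)})$ and the identification $TM=\mathbf L^2$, the symbol homomorphism $$\mathrm{Diff}^k_M(E\otimes\mathbf L^n,F)\longrightarrow\mathrm{Hom}(E\otimes\mathbf L^n,F)\otimes(TM)^{\otimes k}$$ coincides with $\mathrm{Id}_F\otimes p'$, where $$p':E^*\otimes(\mathcal V_n\oplus\mathbf L^{-(k+1)})^*\longrightarrow E^*\otimes(\mathbf L^{-(k+1)})^*$$ is the natural projection.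
   Context: Model. $\mathbb V$ is a two-dimensional complex vector space with a fixed $0\neq\omega\in\bigwedge^2\mathbb V$, $X=\mathbb P(\mathbb V)$ is the space of lines in $\mathbb V$, $\mathbb L\subset X\times\mathbb V$ the tautological line subbundle, $L=(X\times\mathbb V)/\mathbb L$, $\mathbb V_j=X\times\mathrm{Sym}^j(\mathbb V)$; negative powers of a line bundle are powers of its dual. $\omega$ gives $\mathrm{SL}(\mathbb V)$-equivariant isomorphisms $\mathbb V^*\cong\mathbb V$, $L^{-1}\cong\mathbb L$ (via $\mathbb L\otimes L=X\times\bigwedge^2\mathbb V$), and $\mathcal O_{X\times X}(\Delta)\cong p_1^*L\otimes p_2^*L$ (via the section defined by $\omega\in\mathbb V\otimes\mathbb V$), whose restriction to the diagonal $\Delta$ is $L^2\cong TX$. Bundles on $M$. A projective structure on $M$ is an equivalence class of holomorphic atlases $\{(U_i,\varphi_i)\}$, $\varphi_i:U_i\to X$ holomorphic embeddings, whose transition functions are restrictions of elements of $\mathrm{PGL}(\mathbb V)$; a fixed theta characteristic determines a lift of the transition cocycle to $\tau_{j,i}\in\mathrm{SL}(\mathbb V)$. $\mathcal V$ is the rank two bundle obtained by gluing the $U_i\times\mathbb V$ via $(y,v)\in U_j\times\mathbb V\mapsto(y,\tau_{i,j}(v))\in U_i\times\mathbb V$; the $\varphi_i^*\mathbb L$ glue to a line subbundle $\mathcal L\subset\mathcal V$, and $\mathbf L:=\mathcal V/\mathcal L$. The equivariant isomorphisms above give $\mathbf L=\mathcal L^*$ and $\mathbf L^2=TM$. $\mathcal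 V_j=\mathrm{Sym}^j(\mathcal V)$, $\mathcal V_0=\mathcal O_M$. Since $k=n+1$, the identification $TM=\mathbf L^2$ gives $\mathrm{Hom}(E\otimes\mathbf L^n,F)\otimes(TM)^{\otimes k}=F\otimes E^*\otimes(\mathbf L^{-(k+1)})^*$. Jets and symbols. For a holomorphic vector bundle $W$ on a Riemann surface $Y$ with projections $p_1,p_2:Y\times Y\to Y$ and diagonal $\Delta$, $J^k(W)=p_{1*}\bigl(p_2^*W/(p_2^*W\otimes\mathcal O(-(k+1)\Delta))\bigr)$, with natural exact sequence $0\to W\otimes K_Y^{\otimes k}\xrightarrow{\iota}J^k(W)\to J^{k-1}(W)\to0$, where $\mathcal O(-k\Delta)/\mathcal O(-(k+1)\Delta)=K_Y^{\otimes k}$ by $(z\circ p_2-z\circ p_1)^k\mapsto(dz)^{\otimes k}$. $\mathrm{Diff}^k_M(W,F)=\mathrm{Hom}(J^k(W),F)=F\otimes J^k(W)^*$; the symbol homomorphism is $\mathrm{Id}_F\otimes\iota^*:F\otimes J^k(W)^*\to F\otimes(W\otimes K_M^{\otimes k})^*=\mathrm{Hom}(W,F)\otimes(TM)^{\otimes k}$. Canonical isomorphism. For $k=n+1$, $J^k(E\otimes\mathbf L^n)=E\otimes(\mathcal V_n\oplus\mathbf L^{-(k+1)})$ is the composition of $J^k(E\otimes\mathbf L^n)=E\otimes J^k(\mathbf L^n)$ (parallel translation for the flat connection $D_E$) with the isomorphism $J^k(\mathbf L^n)=\mathcal V_n\oplus\mathbf L^{-(k+1)}$ obtained by transferring to $M$,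 via the charts, the following $\mathrm{SL}(\mathbb V)$-equivariant isomorphism $J^k(L^n)=\mathbb V_n\oplus L^{-(k+1)}$ on $X$. Let $\gamma_3:\mathbb V_n=X\times H^0(X,L^n)\to J^k(L^n)$ take a global section to its $k$-jet, and let $\beta:J^k(L^n)\to J^n(L^n)=\mathbb V_n$ be the natural projection ($J^n(L^n)=\mathbb V_n$ by $n$-jets of global sections); then $J^k(L^n)=\mathrm{image}(\gamma_3)\oplus\mathrm{kernel}(\beta)$, and the connecting homomorphism $J^k(L^n)\to R^1p_{1*}(p_2^*L^n\otimes\mathcal O(-(k+1)\Delta))$ maps $\mathrm{kernel}(\beta)$ isomorphically onto its target, which is $\mathbb L^{k+1}\otimes R^1p_{1*}(p_2^*L^{n-k-1})=\mathbb L^{k+1}=L^{-(k+1)}$ by the projection formula, Serre duality and $\mathbb L\cong L^{-1}$. *)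

theory Defs
  imports
    "HOL-Complex_Analysis.Complex_Analysis"
    "HOL-Homology.Homology"
    "HOL-Library.Function_Algebras"
begin

section \<open>Complex vector spaces of functions\<close>

text \<open>
  Every complex vector space below is a linear subspace of some space of functions
  \<open>'a \<Rightarrow> complex\<close> with pointwise operations (a choice of basis embeds any complex vector space
  in such a space).  The only exceptions are the fibres of jet bundles and the cohomology spaces,
  which are sets of equivalence classes.
\<close>

definition fscale :: "complex \<Rightarrow> ('a \<Rightarrow> complex) \<Rightarrow> 'a \<Rightarrow> complex" where
  "fscale c f = (\<lambda>a. c * f a)"

global_interpretation cfun: vector_space fscale
  by standard (auto simp: fscale_def fun_eq_iff algebra_simps)

definition linear_fun_on :: "('a \<Rightarrow> complex) set \<Rightarrow> (('a \<Rightarrow> complex) \<Rightarrow> complex) \<Rightarrow> bool" where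
  "linear_fun_on S \<xi> \<longleftrightarrow> (\<forall>u\<in>S. \<forall>v\<in>S. \<forall>c. \<xi> (fscale c u + v) = c * \<xi> u + \<xi> v)"

definition dual_space :: "('a \<Rightarrow> complex) set \<Rightarrow> (('a \<Rightarrow> complex) \<Rightarrow> complex) set" where
  "dual_space S = {\<xi>. linear_fun_on S \<xi> \<and> (\<forall>u. u \<notin> S \<longrightarrow> \<xi> u = 0)}"

text \<open>
  For subspaces \<open>S \<subseteq> 'a \<Rightarrow> complex\<close> and \<open>T \<subseteq> 'b \<Rightarrow> complex\<close> the product functions
  \<open>(a, b) \<mapsto> u a * v b\<close> span a copy of the tensor product inside \<open>'a \<times> 'b \<Rightarrow> complex\<close>.
\<close>

definition tens :: "('a \<Rightarrow> complex) \<Rightarrow> ('b \<Rightarrow> complex) \<Rightarrow> 'a \<times> 'b \<Rightarrow> complex" where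
  "tens u v = (\<lambda>(a, b). u a * v b)"

definition tensor_space ::
    "('a \<Rightarrow> complex) set \<Rightarrow> ('b \<Rightarrow> complex) set \<Rightarrow> ('a \<times> 'b \<Rightarrow> complex) set" where
  "tensor_space S T = cfun.span {tens u v |u v. u \<in> S \<and> v \<in> T}"

definition direct_sum ::
    "('a \<Rightarrow> complex) set \<Rightarrow> ('b \<Rightarrow> complex) set \<Rightarrow> ('a + 'b \<Rightarrow> complex) set" where
  "direct_sum S T = {case_sum u v |u v. u \<in> S \<and> v \<in> T}"

text \<open>\<open>Sym\<^sup>n(S)\<close>, realised as the homogeneous polynomial functions of degree \<open>n\<close> on the dual of
  \<open>S\<close>; the function displayed is the symmetric product \<open>v\<^sub>0 \<cdots> v\<^sub>n\<^sub>-\<^sub>1\<close>.\<close>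

definition sym_power :: "nat \<Rightarrow> ('a \<Rightarrow> complex) set \<Rightarrow> ((('a \<Rightarrow> complex) \<Rightarrow> complex) \<Rightarrow> complex) set" where
  "sym_power n S =
     cfun.span {(\<lambda>\<xi>. if \<xi> \<in> dual_space S then \<Prod>l<n. \<xi> (v l) else 0) |v :: nat \<Rightarrow> _. \<forall>l<n. v l \<in> S}"

text \<open>
  Let \<open>T\<close> be a hyperplane in \<open>S\<close>, so that \<open>\<ell> = S/T\<close> is a line whose bases are the classes \<open>[u]\<close>
  of the vectors \<open>u \<in> S - T\<close>.  For every integer \<open>m\<close> an element \<open>t\<close> of \<open>\<ell>\<^sup>m\<close> (a power of the dual
  line if \<open>m < 0\<close>) is recorded by its coordinates: \<open>t = f(u) [u]\<^sup>m\<close>.  In this form the products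
  \<open>\<ell>\<^sup>m \<otimes> \<ell>\<^sup>m\<^sup>' = \<ell>\<^sup>m\<^sup>+\<^sup>m\<^sup>'\<close> and the pairing \<open>\<ell>\<^sup>m \<otimes> \<ell>\<^sup>-\<^sup>m = \<complex>\<close> are pointwise multiplication.
\<close>

definition quot_power ::
    "('a \<Rightarrow> complex) set \<Rightarrow> ('a \<Rightarrow> complex) set \<Rightarrow> int \<Rightarrow> (('a \<Rightarrow> complex) \<Rightarrow> complex) set" where
  "quot_power S T m =
     {f. (\<forall>u. u \<notin> S - T \<longrightarrow> f u = 0) \<and>
         (\<forall>u\<in>S - T. \<forall>a\<in>T. \<forall>c. c \<noteq> 0 \<longrightarrow> f (fscale c u + a) = c powi (- m) * f u)}"

text \<open>The coordinate of a class of \<open>S/T\<close> with respect to the basis \<open>[u]\<close>, as a functional on \<open>S\<close>:\<close>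

definition quot_coord ::
    "('a \<Rightarrow> complex) set \<Rightarrow> ('a \<Rightarrow> complex) set \<Rightarrow> ('a \<Rightarrow> complex) \<Rightarrow> (('a \<Rightarrow> complex) \<Rightarrow> complex)" where
  "quot_coord S T u = (THE \<xi>. \<xi> \<in> dual_space S \<and> (\<forall>a\<in>T. \<xi> a = 0) \<and> \<xi> u = 1)"

text \<open>The element \<open>[b]\<^sup>m\<close> of \<open>(S/T)\<^sup>m\<close> for \<open>b \<in> S - T\<close>:\<close>

definition quot_frame ::
    "('a \<Rightarrow> complex) set \<Rightarrow> ('a \<Rightarrow> complex) set \<Rightarrow> int \<Rightarrow> ('a \<Rightarrow> complex) \<Rightarrow> (('a \<Rightarrow> complex) \<Rightarrow> complex)" where
  "quot_frame S T m b = (\<lambda>u. if u \<in> S - T then quot_coord S T u b powi m else 0)"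

text \<open>The homomorphism \<open>Sym\<^sup>n(S) \<rightarrow> Sym\<^sup>n(S/T) = (S/T)\<^sup>n\<close> induced by the quotient map:\<close>

definition sym_quot ::
    "('a \<Rightarrow> complex) set \<Rightarrow> ('a \<Rightarrow> complex) set \<Rightarrow> ((('a \<Rightarrow> complex) \<Rightarrow> complex) \<Rightarrow> complex)
       \<Rightarrow> (('a \<Rightarrow> complex) \<Rightarrow> complex)" where
  "sym_quot S T P = (\<lambda>u. if u \<in> S - T then P (quot_coord S T u) else 0)"


section \<open>Riemann surfaces\<close>

text \<open>A chart is its domain together with its coordinate; a Riemann surface is given by its atlas,
  which also determines the topology.\<close>

type_synonym 'p chart = "'p set \<times> ('p \<Rightarrow> complex)"

definition points :: "'p chart set \<Rightarrow> 'p set" where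
  "points A = (\<Union>(D, z)\<in>A. D)"

definition rs_open :: "'p chart set \<Rightarrow> 'p set \<Rightarrow> bool" where
  "rs_open A U \<longleftrightarrow> U \<subseteq> points A \<and> (\<forall>(D, z)\<in>A. open (z ` (U \<inter> D)))"

definition rs_topology :: "'p chart set \<Rightarrow> 'p topology" where
  "rs_topology A = topology (rs_open A)"

definition riemann_surface :: "'p chart set \<Rightarrow> bool" where
  "riemann_surface A \<longleftrightarrow>
     (\<forall>(D, z)\<in>A. inj_on z D \<and> open (z ` D)) \<and>
     (\<forall>(D, z)\<in>A. \<forall>(D', z')\<in>A. open (z ` (D \<inter> D')) \<and>
        (z' \<circ> inv_into D z) holomorphic_on z ` (D \<inter> D')) \<and>
     Hausdorff_space (rs_topology A)"

text \<open>A compact connected Riemann surface has genus \<open>g\<close> iff \<open>H\<^sub>1(M; \<int>) \<cong> \<int>\<^sup>2\<^sup>g\<close>.\<close>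

definition has_genus :: "'p chart set \<Rightarrow> nat \<Rightarrow> bool" where
  "has_genus A g \<longleftrightarrow> homology_group 1 (rs_topology A) \<cong> free_Abelian_group {..<2 * g}"

definition hol_fun :: "'p chart set \<Rightarrow> 'p set \<Rightarrow> ('p \<Rightarrow> complex) \<Rightarrow> bool" where
  "hol_fun A U f \<longleftrightarrow> (\<forall>(D, z)\<in>A. (f \<circ> inv_into D z) holomorphic_on z ` (U \<inter> D))"

definition hol_map :: "'p chart set \<Rightarrow> 'q chart set \<Rightarrow> 'p set \<Rightarrow> ('p \<Rightarrow> 'q) \<Rightarrow> bool" where
  "hol_map A A' U \<phi> \<longleftrightarrow> \<phi> ` U \<subseteq> points A' \<and>
     (\<forall>(D', z')\<in>A'. rs_open A (U \<inter> \<phi> -` D') \<and> hol_fun A (U \<inter> \<phi> -` D') (z' \<circ> \<phi>))"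

definition hol_embedding :: "'p chart set \<Rightarrow> 'q chart set \<Rightarrow> 'p set \<Rightarrow> ('p \<Rightarrow> 'q) \<Rightarrow> bool" where
  "hol_embedding A A' U \<phi> \<longleftrightarrow> rs_open A U \<and> rs_open A' (\<phi> ` U) \<and> inj_on \<phi> U \<and>
     hol_map A A' U \<phi> \<and> hol_map A' A (\<phi> ` U) (inv_into U \<phi>)"


section \<open>Holomorphic vector bundles, jets and symbols\<close>

text \<open>
  A holomorphic vector bundle is given by its fibres and by a family of local frames
  \<open>(D, r, b)\<close>, where \<open>b 0 x, \<dots>, b (r - 1) x\<close> is a basis of the fibre at \<open>x \<in> D\<close>; the frames define
  the holomorphic structure.
\<close>

record ('p, 'a) vbundle =
  fiber :: "'p \<Rightarrow> ('a \<Rightarrow> complex) set"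
  frames :: "('p set \<times> nat \<times> (nat \<Rightarrow> 'p \<Rightarrow> 'a \<Rightarrow> complex)) set"

definition hol_section ::
    "'p chart set \<Rightarrow> ('p, 'a) vbundle \<Rightarrow> 'p set \<Rightarrow> ('p \<Rightarrow> 'a \<Rightarrow> complex) \<Rightarrow> bool" where
  "hol_section A B U s \<longleftrightarrow>
     (\<forall>(D, r, b)\<in>frames B. \<exists>c :: nat \<Rightarrow> 'p \<Rightarrow> complex.
        (\<forall>l<r. hol_fun A (U \<inter> D) (c l)) \<and>
        (\<forall>x\<in>U \<inter> D. s x = (\<Sum>l<r. fscale (c l x) (b l x))))"

definition vector_bundle :: "'p chart set \<Rightarrow> ('p, 'a) vbundle \<Rightarrow> bool" where
  "vector_bundle A B \<longleftrightarrow>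
     (\<Union>(D, r, b)\<in>frames B. D) = points A \<and>
     (\<forall>(D, r, b)\<in>frames B. rs_open A D \<and>
        (\<forall>x\<in>D. fiber B x = cfun.span ((\<lambda>l. b l x) ` {..<r}) \<and>
                (\<forall>c. (\<Sum>l<r. fscale (c l) (b l x)) = 0 \<longrightarrow> (\<forall>l<r. c l = 0))) \<and>
        (\<forall>l<r. hol_section A B D (b l)))"

definition tensor_bundle ::
    "('p, 'a) vbundle \<Rightarrow> ('p, 'b) vbundle \<Rightarrow> ('p, 'a \<times> 'b) vbundle" where
  "tensor_bundle B C =
     \<lparr>fiber = (\<lambda>x. tensor_space (fiber B x) (fiber C x)),
      frames = {(D \<inter> D', r * r', \<lambda>l x. tens (b (l div r') x) (b' (l mod r') x)) |D r b D' r' b'.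
                  (D, r, b) \<in> frames B \<and> (D', r', b') \<in> frames C}\<rparr>"

text \<open>
  An element of \<open>K\<^sub>x\<^sup>m\<close> is recorded by its coefficients: for a chart \<open>\<kappa> = (D, z)\<close> around \<open>x\<close> it is
  \<open>\<sigma> \<kappa> (dz)\<^sup>m\<close>.
\<close>

definition coord_change :: "'p chart \<Rightarrow> 'p chart \<Rightarrow> 'p \<Rightarrow> complex" where
  "coord_change \<kappa> \<kappa>' x = deriv (snd \<kappa> \<circ> inv_into (fst \<kappa>') (snd \<kappa>')) (snd \<kappa>' x)"

definition canonical_power :: "'p chart set \<Rightarrow> nat \<Rightarrow> ('p, 'p chart) vbundle" where
  "canonical_power A m =
     \<lparr>fiber = (\<lambda>x. {\<sigma>. (\<forall>\<kappa>. \<not> (\<kappa> \<in> A \<and> x \<in> fst \<kappa>) \<longrightarrow> \<sigma> \<kappa> = 0) \<and>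
        (\<forall>\<kappa>\<in>A. \<forall>\<kappa>'\<in>A. x \<in> fst \<kappa> \<inter> fst \<kappa>' \<longrightarrow> \<sigma> \<kappa>' = coord_change \<kappa> \<kappa>' x ^ m * \<sigma> \<kappa>)}),
      frames = {(fst \<kappa>, 1, \<lambda>_ x \<kappa>'. if \<kappa>' \<in> A \<and> x \<in> fst \<kappa>' then coord_change \<kappa> \<kappa>' x ^ m else 0) |\<kappa>.
                  \<kappa> \<in> A}\<rparr>"

definition differential :: "'p chart set \<Rightarrow> ('p \<Rightarrow> complex) \<Rightarrow> 'p \<Rightarrow> 'p chart \<Rightarrow> complex" where
  "differential A f x =
     (\<lambda>(D, z). if (D, z) \<in> A \<and> x \<in> D then deriv (f \<circ> inv_into D z) (z x) else 0)"

text \<open>A holomorphic connection, as a sheaf operator \<open>B \<rightarrow> B \<otimes> K\<close>; local sections are functions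
  whose values off the open set in question are irrelevant.\<close>

definition hol_connection ::
    "'p chart set \<Rightarrow> ('p, 'a) vbundle
       \<Rightarrow> (('p \<Rightarrow> 'a \<Rightarrow> complex) \<Rightarrow> 'p \<Rightarrow> 'a \<times> 'p chart \<Rightarrow> complex) \<Rightarrow> bool" where
  "hol_connection A B conn \<longleftrightarrow>
     (\<forall>U s. rs_open A U \<and> hol_section A B U s \<longrightarrow>
        hol_section A (tensor_bundle B (canonical_power A 1)) U (conn s) \<and>
        (\<forall>t. hol_section A B U t \<longrightarrow>
           (\<forall>x\<in>U. conn (s + t) x = conn s x + conn t x) \<and>
           ((\<forall>x\<in>U. s x = t x) \<longrightarrow> (\<forall>x\<in>U. conn s x = conn t x))) \<and>
        (\<forall>f. hol_fun A U f \<longrightarrow>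
           (\<forall>x\<in>U. conn (\<lambda>y. fscale (f y) (s y)) x
                    = fscale (f x) (conn s x) + tens (s x) (differential A f x))))"

definition flat_near ::
    "'p chart set \<Rightarrow> ('p, 'a) vbundle
       \<Rightarrow> (('p \<Rightarrow> 'a \<Rightarrow> complex) \<Rightarrow> 'p \<Rightarrow> 'a \<times> 'p chart \<Rightarrow> complex)
       \<Rightarrow> 'p \<Rightarrow> ('p \<Rightarrow> 'a \<Rightarrow> complex) \<Rightarrow> bool" where
  "flat_near A B conn x e \<longleftrightarrow>
     (\<exists>U. rs_open A U \<and> x \<in> U \<and> hol_section A B U e \<and> (\<forall>y\<in>U. conn e y = 0))"

definition local_sections :: "'p chart set \<Rightarrow> ('p, 'a) vbundle \<Rightarrow> 'p \<Rightarrow> ('p \<Rightarrow> 'a \<Rightarrow> complex) set" where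
  "local_sections A B x = {s. \<exists>U. rs_open A U \<and> x \<in> U \<and> hol_section A B U s}"

text \<open>Membership of the germ of \<open>s\<close> at \<open>x\<close> in \<open>B \<otimes> \<O>(- m x)\<close>:\<close>

definition vanishes_to_order ::
    "'p chart set \<Rightarrow> ('p, 'a) vbundle \<Rightarrow> nat \<Rightarrow> 'p \<Rightarrow> ('p \<Rightarrow> 'a \<Rightarrow> complex) \<Rightarrow> bool" where
  "vanishes_to_order A B m x s \<longleftrightarrow>
     (\<exists>(D, z)\<in>A. \<exists>U t. rs_open A U \<and> x \<in> U \<and> U \<subseteq> D \<and> hol_section A B U t \<and>
        (\<forall>y\<in>U. s y = fscale ((z y - z x) ^ m) (t y)))"

text \<open>The fibre at \<open>x\<close> of \<open>J\<^sup>k(B) = p\<^sub>1\<^sub>*(p\<^sub>2\<^sup>*B / p\<^sub>2\<^sup>*B \<otimes> \<O>(-(k + 1)\<Delta>))\<close> consists of the local sections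
  at \<open>x\<close> modulo those vanishing to order \<open>k + 1\<close>.\<close>

definition jet ::
    "'p chart set \<Rightarrow> ('p, 'a) vbundle \<Rightarrow> nat \<Rightarrow> 'p \<Rightarrow> ('p \<Rightarrow> 'a \<Rightarrow> complex) \<Rightarrow> ('p \<Rightarrow> 'a \<Rightarrow> complex) set" where
  "jet A B k x s = {s' \<in> local_sections A B x. vanishes_to_order A B (k + 1) x (s' - s)}"

definition jet_fiber ::
    "'p chart set \<Rightarrow> ('p, 'a) vbundle \<Rightarrow> nat \<Rightarrow> 'p \<Rightarrow> ('p \<Rightarrow> 'a \<Rightarrow> complex) set set" where
  "jet_fiber A B k x = jet A B k x ` local_sections A B x"

text \<open>The fibre at \<open>x\<close> of \<open>Diff\<^sup>k(B, F) = Hom(J\<^sup>k(B), F)\<close>:\<close>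

definition diff_fiber ::
    "'p chart set \<Rightarrow> ('p, 'a) vbundle \<Rightarrow> ('p, 'f) vbundle \<Rightarrow> nat \<Rightarrow> 'p
       \<Rightarrow> (('p \<Rightarrow> 'a \<Rightarrow> complex) set \<Rightarrow> 'f \<Rightarrow> complex) set" where
  "diff_fiber A B F k x =
     {\<delta>. (\<forall>j\<in>jet_fiber A B k x. \<delta> j \<in> fiber F x) \<and>
         (\<forall>s\<in>local_sections A B x. \<forall>t\<in>local_sections A B x. \<forall>c.
            \<delta> (jet A B k x (\<lambda>y. fscale c (s y) + t y))
              = fscale c (\<delta> (jet A B k x s)) + \<delta> (jet A B k x t))}"

text \<open>The inclusion \<open>\<iota> : B \<otimes> K\<^sup>k \<rightarrow> J\<^sup>k(B)\<close>.  As \<open>K\<^sub>x\<^sup>k\<close> is spanned by \<open>(dz)\<^sup>k\<close>, an element \<open>T\<close> of the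
  fibre at \<open>x\<close> is \<open>T(-, \<kappa>) \<otimes> (dz)\<^sup>k\<close> for each chart \<open>\<kappa> = (D, z)\<close> around \<open>x\<close>.\<close>

definition jet_incl ::
    "'p chart set \<Rightarrow> ('p, 'a) vbundle \<Rightarrow> nat \<Rightarrow> 'p \<Rightarrow> ('a \<times> 'p chart \<Rightarrow> complex)
       \<Rightarrow> ('p \<Rightarrow> 'a \<Rightarrow> complex) set" where
  "jet_incl A B k x T =
     (THE j. \<exists>(D, z)\<in>A. \<exists>s\<in>local_sections A B x. x \<in> D \<and> s x = (\<lambda>a. T (a, (D, z))) \<and>
        j = jet A B k x (\<lambda>y. fscale ((z y - z x) ^ k) (s y)))"

text \<open>The symbol \<open>Id\<^sub>F \<otimes> \<iota>\<^sup>*\<close> in the fibre at \<open>x\<close>, with values in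
  \<open>Hom(B, F) \<otimes> (TM)\<^sup>k = Hom(B \<otimes> K\<^sup>k, F)\<close>:\<close>

definition symbol ::
    "'p chart set \<Rightarrow> ('p, 'a) vbundle \<Rightarrow> nat \<Rightarrow> 'p \<Rightarrow> (('p \<Rightarrow> 'a \<Rightarrow> complex) set \<Rightarrow> 'f \<Rightarrow> complex)
       \<Rightarrow> ('a \<times> 'p chart \<Rightarrow> complex) \<Rightarrow> 'f \<Rightarrow> complex" where
  "symbol A B k x \<delta> =
     (\<lambda>T\<in>fiber (tensor_bundle B (canonical_power A k)) x. \<delta> (jet_incl A B k x T))"


section \<open>The projective line\<close>

text \<open>The two-dimensional space \<open>\<V>\<close> is \<open>2 \<Rightarrow> complex\<close>, and a point of \<open>X = \<P>(\<V>)\<close> is a line in it.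
  The atlas consists of all affine coordinates \<open>z \<mapsto> [a + z b]\<close>.\<close>

type_synonym vec2 = "2 \<Rightarrow> complex"
type_synonym pline = "vec2 set"

definition affine_chart :: "vec2 \<Rightarrow> vec2 \<Rightarrow> pline chart" where
  "affine_chart a b =
     (range (\<lambda>z. cfun.span {a + fscale z b}), \<lambda>p. THE z. a + fscale z b \<in> p)"

definition P1 :: "pline chart set" where
  "P1 = {affine_chart a b |a b. a \<noteq> b \<and> cfun.independent {a, b}}"

text \<open>The line bundle \<open>L\<^sup>m\<close> on \<open>X\<close>, where \<open>L = \<V>/\<LL>\<close>; its frames are the powers of the sections of
  \<open>L\<close> given by constant vectors.\<close>

definition L_power :: "int \<Rightarrow> (pline, vec2) vbundle" where
  "L_power m =
     \<lparr>fiber = (\<lambda>p. quot_power UNIV p m),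
      frames = {({p \<in> points P1. b \<notin> p}, 1, \<lambda>_ p. quot_frame UNIV p m b) |b. b \<noteq> 0}\<rparr>"

definition mat_act :: "complex^2^2 \<Rightarrow> vec2 \<Rightarrow> vec2" where
  "mat_act g v = (\<lambda>\<alpha>. \<Sum>\<beta>\<in>UNIV. g $ \<alpha> $ \<beta> * v \<beta>)"

text \<open>A nonzero element of \<open>\<And>\<^sup>2\<V> \<subseteq> \<V> \<otimes> \<V>\<close>:\<close>

definition nonzero_bivector :: "(2 \<times> 2 \<Rightarrow> complex) \<Rightarrow> bool" where
  "nonzero_bivector w \<longleftrightarrow> w \<noteq> 0 \<and> (\<forall>\<alpha> \<beta>. w (\<beta>, \<alpha>) = - w (\<alpha>, \<beta>))"

text \<open>The section of \<open>p\<^sub>1\<^sup>*L \<otimes> p\<^sub>2\<^sup>*L\<close> on \<open>X \<times> X\<close> defined by \<open>w\<close> (its divisor is \<open>\<Delta>\<close>): at \<open>(p, q)\<close> it is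
  \<open>omega_section w p b q u\<close> times \<open>[b] \<otimes> [u]\<close>.  Under \<open>\<O>(\<Delta>) = p\<^sub>1\<^sup>*L \<otimes> p\<^sub>2\<^sup>*L\<close> it is the section \<open>1\<close>.\<close>

definition omega_section :: "(2 \<times> 2 \<Rightarrow> complex) \<Rightarrow> pline \<Rightarrow> vec2 \<Rightarrow> pline \<Rightarrow> vec2 \<Rightarrow> complex" where
  "omega_section w p b q u =
     (\<Sum>\<alpha>\<in>UNIV. \<Sum>\<beta>\<in>UNIV. w (\<alpha>, \<beta>) *
        quot_coord UNIV p b (\<lambda>\<gamma>. if \<gamma> = \<alpha> then 1 else 0) *
        quot_coord UNIV q u (\<lambda>\<gamma>. if \<gamma> = \<beta> then 1 else 0))"

text \<open>
  Restricting \<open>\<O>(\<Delta>) = p\<^sub>1\<^sup>*L \<otimes> p\<^sub>2\<^sup>*L\<close> to \<open>\<Delta>\<close> gives \<open>TX = L\<^sup>2\<close>.  Dually, \<open>K\<^sub>X = \<O>(-\<Delta>)/\<O>(-2\<Delta>)\<close> identifies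
  \<open>[b]\<^sup>-\<^sup>2\<close> at \<open>p\<close> with the differential at \<open>p\<close> of \<open>q \<mapsto> omega_section w p b q b\<close>.  The
  following is the coefficient of this one-form, pulled back by a local embedding \<open>\<phi>\<close> into \<open>X\<close>,
  with respect to \<open>dz\<close> for a chart \<open>(D, z)\<close>; equivalently, \<open>[b]\<^sup>2\<close> is \<open>\<partial>\<^sub>z\<close> divided by this coefficient.
\<close>

definition omega_form ::
    "(2 \<times> 2 \<Rightarrow> complex) \<Rightarrow> ('p \<Rightarrow> pline) \<Rightarrow> 'p chart \<Rightarrow> 'p \<Rightarrow> vec2 \<Rightarrow> complex" where
  "omega_form w \<phi> \<kappa> x b =
     deriv (\<lambda>\<zeta>. omega_section w (\<phi> x) b (\<phi> (inv_into (fst \<kappa>) (snd \<kappa>) \<zeta>)) b) (snd \<kappa> x)"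


section \<open>Cohomology on the projective line and Serre duality\<close>

text \<open>
  \<open>\<Gamma>\<close> is a sheaf, given by its sets of sections.  Open covers are indexed by the points of \<open>X\<close>,
  with \<open>q \<in> U q\<close>.  Every open cover has a refinement of this form, so these covers compute
  the Cech cohomology \<open>H\<^sup>1(X, \<Gamma>)\<close> as the colimit over all covers; \<open>cech_rel\<close> is equality in the colimit.
  The coboundary of a 0-cochain \<open>g\<close> is \<open>(q, r) \<mapsto> g r - g q\<close>.
\<close>

type_synonym 'a cochain1 = "(pline \<Rightarrow> pline set) \<times> (pline \<Rightarrow> pline \<Rightarrow> pline \<Rightarrow> 'a \<Rightarrow> complex)"

definition open_cover :: "(pline \<Rightarrow> pline set) \<Rightarrow> bool" where
  "open_cover U \<longleftrightarrow> (\<forall>q\<in>points P1. q \<in> U q \<and> rs_open P1 (U q))"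

definition cech_cocycles :: "(pline set \<Rightarrow> (pline \<Rightarrow> 'a \<Rightarrow> complex) set) \<Rightarrow> 'a cochain1 set" where
  "cech_cocycles \<Gamma> =
     {(U, c). open_cover U \<and>
        (\<forall>q\<in>points P1. \<forall>r\<in>points P1. c q r \<in> \<Gamma> (U q \<inter> U r)) \<and>
        (\<forall>q\<in>points P1. \<forall>r\<in>points P1. \<forall>t\<in>points P1. \<forall>y\<in>U q \<inter> U r \<inter> U t.
           c q r y + c r t y = c q t y)}"

definition cech_rel :: "(pline set \<Rightarrow> (pline \<Rightarrow> 'a \<Rightarrow> complex) set) \<Rightarrow> ('a cochain1 \<times> 'a cochain1) set" where
  "cech_rel \<Gamma> =
     {((U, c), (U', c')). (U, c) \<in> cech_cocycles \<Gamma> \<and> (U', c') \<in> cech_cocycles \<Gamma> \<and>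
        (\<exists>W g. open_cover W \<and>
           (\<forall>q\<in>points P1. W q \<subseteq> U q \<inter> U' q \<and> g q \<in> \<Gamma> (W q)) \<and>
           (\<forall>q\<in>points P1. \<forall>r\<in>points P1. \<forall>y\<in>W q \<inter> W r. c q r y - c' q r y = g r y - g q y))}"

definition H1 :: "(pline set \<Rightarrow> (pline \<Rightarrow> 'a \<Rightarrow> complex) set) \<Rightarrow> 'a cochain1 set set" where
  "H1 \<Gamma> = cech_cocycles \<Gamma> // cech_rel \<Gamma>"

definition L_sheaf :: "int \<Rightarrow> pline set \<Rightarrow> (pline \<Rightarrow> vec2 \<Rightarrow> complex) set" where
  "L_sheaf m U = {s. hol_section P1 (L_power m) U s}"

text \<open>\<open>L\<^sup>m \<otimes> \<O>(- d p)\<close>:\<close>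

definition L_twisted_sheaf :: "int \<Rightarrow> nat \<Rightarrow> pline \<Rightarrow> pline set \<Rightarrow> (pline \<Rightarrow> vec2 \<Rightarrow> complex) set" where
  "L_twisted_sheaf m d p U =
     {s. hol_section P1 (L_power m) U s \<and> (p \<in> U \<longrightarrow> vanishes_to_order P1 (L_power m) d p s)}"

text \<open>The fibre at \<open>p\<close> of the connecting homomorphism
  \<open>J\<^sup>k(L\<^sup>n) \<rightarrow> R\<^sup>1p\<^sub>1\<^sub>*(p\<^sub>2\<^sup>*L\<^sup>n \<otimes> \<O>(-(k + 1)\<Delta>))\<close>, that is, of the sequence
  \<open>0 \<rightarrow> L\<^sup>n \<otimes> \<O>(-(k + 1) p) \<rightarrow> L\<^sup>n \<rightarrow> J\<^sup>k(L\<^sup>n)\<^sub>p \<rightarrow> 0\<close> (the quotient being a skyscraper at \<open>p\<close>):\<close>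

definition connecting_hom ::
    "nat \<Rightarrow> nat \<Rightarrow> pline \<Rightarrow> (pline \<Rightarrow> vec2 \<Rightarrow> complex) set \<Rightarrow> vec2 cochain1 set" where
  "connecting_hom n k p j =
     {C. \<exists>U g. open_cover U \<and>
        (\<forall>q\<in>points P1. g q \<in> L_sheaf (int n) (U q) \<and>
           (p \<in> U q \<longrightarrow> jet P1 (L_power (int n)) k p (g q) = j)) \<and>
        ((U, \<lambda>q r. g r - g q), C) \<in> cech_rel (L_twisted_sheaf (int n) (k + 1) p)}"

text \<open>
  By \<open>\<O>(-\<Delta>) = p\<^sub>1\<^sup>*L\<^sup>-\<^sup>1 \<otimes> p\<^sub>2\<^sup>*L\<^sup>-\<^sup>1\<close>, multiplication by the \<open>d\<close>-th power of the section defined by \<open>w\<close> is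
  an isomorphism \<open>L\<^sub>p\<^sup>-\<^sup>d \<otimes> L\<^sup>n\<^sup>-\<^sup>d \<rightarrow> L\<^sup>n \<otimes> \<O>(- d p)\<close>.  The projection formula
  \<open>H\<^sup>1(X, L\<^sup>n \<otimes> \<O>(- d p)) = L\<^sub>p\<^sup>-\<^sup>d \<otimes> H\<^sup>1(X, L\<^sup>n\<^sup>-\<^sup>d)\<close> is the induced isomorphism; the right hand side is read
  through the basis \<open>[b]\<^sup>-\<^sup>d\<close> of \<open>L\<^sub>p\<^sup>-\<^sup>d\<close>.
\<close>

definition omega_multiple ::
    "(2 \<times> 2 \<Rightarrow> complex) \<Rightarrow> nat \<Rightarrow> pline \<Rightarrow> vec2 \<Rightarrow> vec2 cochain1 \<Rightarrow> vec2 cochain1" where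
  "omega_multiple w d p b =
     (\<lambda>(U, c). (U, \<lambda>q r y u. omega_section w p b y u ^ d * c q r y u))"

definition projection_formula ::
    "(2 \<times> 2 \<Rightarrow> complex) \<Rightarrow> int \<Rightarrow> nat \<Rightarrow> pline \<Rightarrow> vec2 \<Rightarrow> vec2 cochain1 set \<Rightarrow> vec2 cochain1 set" where
  "projection_formula w n d p b h =
     (THE h'. h' \<in> H1 (L_sheaf (n - int d)) \<and> (\<forall>C\<in>h'. omega_multiple w d p b C \<in> h))"

text \<open>The \<open>dz\<close>-coefficient of an element \<open>h\<close> of \<open>L\<^sub>y\<^sup>-\<^sup>2 = K\<^sub>X\<^sub>,\<^sub>y\<close> in a chart of \<open>X\<close>, and the residue at \<open>q\<close> of
  a section \<open>\<mu>\<close> of \<open>L\<^sup>-\<^sup>2\<close> on a punctured neighbourhood of \<open>q\<close>:\<close>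

definition form_coeff ::
    "(2 \<times> 2 \<Rightarrow> complex) \<Rightarrow> pline chart \<Rightarrow> pline \<Rightarrow> (vec2 \<Rightarrow> complex) \<Rightarrow> complex" where
  "form_coeff w \<kappa> y h = (THE c. \<forall>u. u \<notin> y \<longrightarrow> c = h u * omega_form w id \<kappa> y u)"

definition local_coeff ::
    "(2 \<times> 2 \<Rightarrow> complex) \<Rightarrow> pline chart \<Rightarrow> (pline \<Rightarrow> vec2 \<Rightarrow> complex) \<Rightarrow> complex \<Rightarrow> complex" where
  "local_coeff w \<kappa> \<mu> \<zeta> =
     (let y = inv_into (fst \<kappa>) (snd \<kappa>) \<zeta> in form_coeff w \<kappa> y (\<mu> y))"

definition form_residue :: "(2 \<times> 2 \<Rightarrow> complex) \<Rightarrow> pline \<Rightarrow> (pline \<Rightarrow> vec2 \<Rightarrow> complex) \<Rightarrow> complex" where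
  "form_residue w q \<mu> =
     (THE \<rho>. \<forall>\<kappa>\<in>P1. q \<in> fst \<kappa> \<longrightarrow> \<rho> = residue (local_coeff w \<kappa> \<mu>) (snd \<kappa> q))"

text \<open>
  The Serre duality isomorphism \<open>H\<^sup>1(X, L\<^sup>-\<^sup>2) = H\<^sup>1(X, K\<^sub>X) = H\<^sup>0(X, \<O>)\<^sup>* = \<complex>\<close>: a class represented by
  the coboundary \<open>\<mu> r - \<mu> q\<close> of a Mittag-Leffler distribution \<open>\<mu>\<close> of meromorphic one-forms
  (after a refinement, \<open>\<mu> q\<close> has no pole except at \<open>q\<close>) is mapped to the sum of the residues of \<open>\<mu>\<close>.
\<close>

definition serre_trace :: "(2 \<times> 2 \<Rightarrow> complex) \<Rightarrow> vec2 cochain1 set \<Rightarrow> complex" where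
  "serre_trace w h =
     (THE \<rho>. \<exists>(U, c)\<in>h. \<exists>W \<mu>. open_cover W \<and>
        (\<forall>q\<in>points P1. W q \<subseteq> U q \<and> \<mu> q \<in> L_sheaf (- 2) (W q - {q}) \<and>
           (\<forall>\<kappa>\<in>P1. q \<in> fst \<kappa> \<longrightarrow> local_coeff w \<kappa> (\<mu> q) meromorphic_on {snd \<kappa> q})) \<and>
        (\<forall>q\<in>points P1. \<forall>r\<in>points P1. \<forall>y\<in>W q \<inter> W r - {q, r}. c q r y = \<mu> r y - \<mu> q y) \<and>
        \<rho> = (\<Sum>q | q \<in> points P1 \<and> form_residue w q (\<mu> q) \<noteq> 0. form_residue w q (\<mu> q)))"

text \<open>The composition
  \<open>J\<^sup>k(L\<^sup>n)\<^sub>p \<rightarrow> H\<^sup>1(X, L\<^sup>n \<otimes> \<O>(-(k + 1) p)) = L\<^sub>p\<^sup>-\<^sup>(\<^sup>k\<^sup>+\<^sup>1\<^sup>) \<otimes> H\<^sup>1(X, L\<^sup>n\<^sup>-\<^sup>k\<^sup>-\<^sup>1) = L\<^sub>p\<^sup>-\<^sup>(\<^sup>k\<^sup>+\<^sup>1\<^sup>)\<close>, for \<open>k = n + 1\<close>:\<close>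

definition top_jet_map ::
    "(2 \<times> 2 \<Rightarrow> complex) \<Rightarrow> nat \<Rightarrow> nat \<Rightarrow> pline \<Rightarrow> (pline \<Rightarrow> vec2 \<Rightarrow> complex) set \<Rightarrow> vec2 \<Rightarrow> complex" where
  "top_jet_map w n k p j =
     (\<lambda>b. if b \<in> p then 0
          else serre_trace w (projection_formula w (int n) (k + 1) p b (connecting_hom n k p j)))"

text \<open>The section of \<open>L\<^sup>n\<close> defined by \<open>P \<in> Sym\<^sup>n(\<V>) = H\<^sup>0(X, L\<^sup>n)\<close>:\<close>

definition global_section ::
    "((vec2 \<Rightarrow> complex) \<Rightarrow> complex) \<Rightarrow> pline \<Rightarrow> vec2 \<Rightarrow> complex" where
  "global_section P = (\<lambda>y. sym_quot UNIV y P)"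

definition kernel_beta :: "nat \<Rightarrow> nat \<Rightarrow> pline \<Rightarrow> (pline \<Rightarrow> vec2 \<Rightarrow> complex) set set" where
  "kernel_beta n k p =
     {jet P1 (L_power (int n)) k p s |s. s \<in> local_sections P1 (L_power (int n)) p \<and>
        jet P1 (L_power (int n)) n p s = jet P1 (L_power (int n)) n p 0}"

text \<open>The isomorphism \<open>Sym\<^sup>n(\<V>) \<oplus> L\<^sub>p\<^sup>-\<^sup>(\<^sup>k\<^sup>+\<^sup>1\<^sup>) \<rightarrow> J\<^sup>k(L\<^sup>n)\<^sub>p = image(\<gamma>\<^sub>3) \<oplus> kernel(\<beta>)\<close>, which is \<open>\<gamma>\<^sub>3\<close> on
  the first summand and the inverse of \<open>top_jet_map\<close> on the second:\<close>

definition jet_iso_P1 ::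
    "(2 \<times> 2 \<Rightarrow> complex) \<Rightarrow> nat \<Rightarrow> nat \<Rightarrow> pline
       \<Rightarrow> ((vec2 \<Rightarrow> complex) \<Rightarrow> complex) \<Rightarrow> (vec2 \<Rightarrow> complex) \<Rightarrow> (pline \<Rightarrow> vec2 \<Rightarrow> complex) set" where
  "jet_iso_P1 w n k p P t =
     (THE j. \<exists>r\<in>local_sections P1 (L_power (int n)) p.
        jet P1 (L_power (int n)) k p r \<in> kernel_beta n k p \<and>
        top_jet_map w n k p (jet P1 (L_power (int n)) k p r) = t \<and>
        j = jet P1 (L_power (int n)) k p (global_section P + r))"


section \<open>Projective structures\<close>

text \<open>An atlas \<open>(dom i, dev i)\<^sub>i\<close> representing a projective structure, together with matrices
  \<open>trans i j\<close> lifting its transition functions to \<open>SL(\<V>)\<close>.\<close>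

record ('p, 'i) projective_atlas =
  idx :: "'i set"
  dom :: "'i \<Rightarrow> 'p set"
  dev :: "'i \<Rightarrow> 'p \<Rightarrow> pline"
  trans :: "'i \<Rightarrow> 'i \<Rightarrow> complex^2^2"

definition projective_structure :: "'p chart set \<Rightarrow> ('p, 'i) projective_atlas \<Rightarrow> bool" where
  "projective_structure A Q \<longleftrightarrow>
     (\<forall>i\<in>idx Q. hol_embedding A P1 (dom Q i) (dev Q i)) \<and>
     (\<Union>i\<in>idx Q. dom Q i) = points A \<and>
     (\<forall>i\<in>idx Q. \<forall>j\<in>idx Q. \<exists>h. invertible h \<and>
        (\<forall>x\<in>dom Q i \<inter> dom Q j. dev Q i x = mat_act h ` dev Q j x))"

text \<open>A theta characteristic enters only through the lift of the transition cocycle to \<open>SL(\<V>)\<close>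
  that it determines (it is recovered from the lift as the line bundle \<open>\<L>\<close>, whose square is \<open>K\<close>).\<close>

definition theta_lift :: "('p, 'i) projective_atlas \<Rightarrow> bool" where
  "theta_lift Q \<longleftrightarrow>
     (\<forall>i\<in>idx Q. \<forall>j\<in>idx Q. dom Q i \<inter> dom Q j \<noteq> {} \<longrightarrow>
        det (trans Q i j) = 1 \<and>
        (\<forall>x\<in>dom Q i \<inter> dom Q j. dev Q i x = mat_act (trans Q i j) ` dev Q j x)) \<and>
     (\<forall>i\<in>idx Q. \<forall>j\<in>idx Q. \<forall>l\<in>idx Q. dom Q i \<inter> dom Q j \<inter> dom Q l \<noteq> {} \<longrightarrow>
        trans Q i j ** trans Q j l = trans Q i l)"

text \<open>A point of the fibre of the glued bundle \<open>\<V>\<close> at \<open>x\<close> is the family of its representatives in the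
  \<open>U\<^sub>i \<times> \<V>\<close> with \<open>x \<in> U\<^sub>i\<close>.\<close>

definition component :: "'i \<Rightarrow> ('i \<times> 2 \<Rightarrow> complex) \<Rightarrow> vec2" where
  "component i v = (\<lambda>\<alpha>. v (i, \<alpha>))"

definition flat_fiber :: "('p, 'i) projective_atlas \<Rightarrow> 'p \<Rightarrow> ('i \<times> 2 \<Rightarrow> complex) set" where
  "flat_fiber Q x =
     {v. (\<forall>i. \<not> (i \<in> idx Q \<and> x \<in> dom Q i) \<longrightarrow> component i v = 0) \<and>
         (\<forall>i\<in>idx Q. \<forall>j\<in>idx Q. x \<in> dom Q i \<inter> dom Q j \<longrightarrow>
            component i v = mat_act (trans Q i j) (component j v))}"

definition taut_fiber :: "('p, 'i) projective_atlas \<Rightarrow> 'p \<Rightarrow> ('i \<times> 2 \<Rightarrow> complex) set" where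
  "taut_fiber Q x =
     {v \<in> flat_fiber Q x. \<forall>i\<in>idx Q. x \<in> dom Q i \<longrightarrow> component i v \<in> dev Q i x}"

text \<open>The class of \<open>(x, b) \<in> U\<^sub>i \<times> \<V>\<close> in the glued bundle:\<close>

definition glue :: "('p, 'i) projective_atlas \<Rightarrow> 'i \<Rightarrow> 'p \<Rightarrow> vec2 \<Rightarrow> 'i \<times> 2 \<Rightarrow> complex" where
  "glue Q i x b =
     (\<lambda>(j, \<alpha>). if j \<in> idx Q \<and> x \<in> dom Q j then mat_act (trans Q j i) b \<alpha> else 0)"

text \<open>The bundle \<open>\<^bold>L\<^sup>m\<close>, where \<open>\<^bold>L = \<V>/\<L>\<close>, framed by the powers of the classes of flat sections of \<open>\<V>\<close>:\<close>

definition bL_power :: "('p, 'i) projective_atlas \<Rightarrow> int \<Rightarrow> ('p, 'i \<times> 2 \<Rightarrow> complex) vbundle" where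
  "bL_power Q m =
     \<lparr>fiber = (\<lambda>x. quot_power (flat_fiber Q x) (taut_fiber Q x) m),
      frames = {({x \<in> dom Q i. b \<notin> dev Q i x}, 1,
                 \<lambda>_ x. quot_frame (flat_fiber Q x) (taut_fiber Q x) m (glue Q i x b)) |i b.
                  i \<in> idx Q \<and> b \<noteq> 0}\<rparr>"

text \<open>Passage to the projective line by the chart \<open>i\<close>, for elements of \<open>Sym\<^sup>n(\<V>\<^sub>x)\<close>, elements of \<open>\<^bold>L\<^sub>x\<^sup>m\<close> and
  local sections of \<open>\<^bold>L\<^sup>m\<close>:\<close>

definition chart_sym ::
    "('p, 'i) projective_atlas \<Rightarrow> 'i \<Rightarrow> 'p \<Rightarrow> ((('i \<times> 2 \<Rightarrow> complex) \<Rightarrow> complex) \<Rightarrow> complex)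
       \<Rightarrow> ((vec2 \<Rightarrow> complex) \<Rightarrow> complex)" where
  "chart_sym Q i x P =
     (\<lambda>\<xi>. if \<xi> \<in> dual_space UNIV
          then P (\<lambda>v. if v \<in> flat_fiber Q x then \<xi> (component i v) else 0) else 0)"

definition chart_elem ::
    "('p, 'i) projective_atlas \<Rightarrow> 'i \<Rightarrow> 'p \<Rightarrow> (('i \<times> 2 \<Rightarrow> complex) \<Rightarrow> complex) \<Rightarrow> (vec2 \<Rightarrow> complex)" where
  "chart_elem Q i x f = (\<lambda>b. f (glue Q i x b))"

definition chart_section ::
    "('p, 'i) projective_atlas \<Rightarrow> 'i \<Rightarrow> ('p \<Rightarrow> ('i \<times> 2 \<Rightarrow> complex) \<Rightarrow> complex)
       \<Rightarrow> (pline \<Rightarrow> vec2 \<Rightarrow> complex)" where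
  "chart_section Q i s =
     (\<lambda>y. let x = inv_into (dom Q i) (dev Q i) y in chart_elem Q i x (s x))"

text \<open>The isomorphism \<open>\<V>\<^sub>n \<oplus> \<^bold>L\<^sup>-\<^sup>(\<^sup>k\<^sup>+\<^sup>1\<^sup>) \<rightarrow> J\<^sup>k(\<^bold>L\<^sup>n)\<close> in the fibre at \<open>x\<close>:\<close>

definition jet_iso_bL ::
    "'p chart set \<Rightarrow> (2 \<times> 2 \<Rightarrow> complex) \<Rightarrow> ('p, 'i) projective_atlas \<Rightarrow> nat \<Rightarrow> nat \<Rightarrow> 'p
       \<Rightarrow> ((('i \<times> 2 \<Rightarrow> complex) \<Rightarrow> complex) \<Rightarrow> complex) \<Rightarrow> (('i \<times> 2 \<Rightarrow> complex) \<Rightarrow> complex)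
       \<Rightarrow> ('p \<Rightarrow> ('i \<times> 2 \<Rightarrow> complex) \<Rightarrow> complex) set" where
  "jet_iso_bL A w Q n k x P t =
     (THE j. \<exists>i\<in>idx Q. \<exists>s\<in>local_sections A (bL_power Q (int n)) x. x \<in> dom Q i \<and>
        jet P1 (L_power (int n)) k (dev Q i x) (chart_section Q i s)
          = jet_iso_P1 w n k (dev Q i x) (chart_sym Q i x P) (chart_elem Q i x t) \<and>
        j = jet A (bL_power Q (int n)) k x s)"

definition sum_fiber ::
    "('p, 'i) projective_atlas \<Rightarrow> nat \<Rightarrow> nat \<Rightarrow> 'p
       \<Rightarrow> ((('i \<times> 2 \<Rightarrow> complex) \<Rightarrow> complex) + ('i \<times> 2 \<Rightarrow> complex) \<Rightarrow> complex) set" where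
  "sum_fiber Q n k x =
     direct_sum (sym_power n (flat_fiber Q x)) (fiber (bL_power Q (- int (k + 1))) x)"

text \<open>
  The isomorphism \<open>E \<otimes> (\<V>\<^sub>n \<oplus> \<^bold>L\<^sup>-\<^sup>(\<^sup>k\<^sup>+\<^sup>1\<^sup>)) \<rightarrow> E \<otimes> J\<^sup>k(\<^bold>L\<^sup>n) \<rightarrow> J\<^sup>k(E \<otimes> \<^bold>L\<^sup>n)\<close> in the fibre at \<open>x\<close>: by parallel
  translation, \<open>e(x) \<otimes> j(s)\<close> is mapped to the jet of \<open>e \<otimes> s\<close> for a flat section \<open>e\<close> of \<open>E\<close>.
\<close>

definition canonical_iso ::
    "'p chart set \<Rightarrow> (2 \<times> 2 \<Rightarrow> complex) \<Rightarrow> ('p, 'i) projective_atlas \<Rightarrow> ('p, 'e) vbundle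
       \<Rightarrow> (('p \<Rightarrow> 'e \<Rightarrow> complex) \<Rightarrow> 'p \<Rightarrow> 'e \<times> 'p chart \<Rightarrow> complex) \<Rightarrow> nat \<Rightarrow> nat \<Rightarrow> 'p
       \<Rightarrow> ('e \<times> ((('i \<times> 2 \<Rightarrow> complex) \<Rightarrow> complex) + ('i \<times> 2 \<Rightarrow> complex)) \<Rightarrow> complex)
       \<Rightarrow> ('p \<Rightarrow> 'e \<times> ('i \<times> 2 \<Rightarrow> complex) \<Rightarrow> complex) set" where
  "canonical_iso A w Q E conn n k x T =
     (THE j. \<exists>N :: nat. \<exists>e P t s.
        (\<forall>l<N. flat_near A E conn x (e l) \<and>
           P l \<in> sym_power n (flat_fiber Q x) \<and>
           t l \<in> fiber (bL_power Q (- int (k + 1))) x \<and>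
           s l \<in> local_sections A (bL_power Q (int n)) x \<and>
           jet A (bL_power Q (int n)) k x (s l) = jet_iso_bL A w Q n k x (P l) (t l)) \<and>
        T = (\<Sum>l<N. tens (e l x) (case_sum (P l) (t l))) \<and>
        j = jet A (tensor_bundle E (bL_power Q (int n))) k x (\<lambda>y. \<Sum>l<N. tens (e l y) (s l y)))"

definition jet_linear_iso ::
    "'p chart set \<Rightarrow> ('p, 'a) vbundle \<Rightarrow> nat \<Rightarrow> 'p \<Rightarrow> ('b \<Rightarrow> complex) set
       \<Rightarrow> (('b \<Rightarrow> complex) \<Rightarrow> ('p \<Rightarrow> 'a \<Rightarrow> complex) set) \<Rightarrow> bool" where
  "jet_linear_iso A B k x S \<Phi> \<longleftrightarrow> bij_betw \<Phi> S (jet_fiber A B k x) \<and>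
     (\<forall>u\<in>S. \<forall>v\<in>S. \<forall>c. \<forall>s\<in>\<Phi> u. \<forall>t\<in>\<Phi> v.
        \<Phi> (fscale c u + v) = jet A B k x (\<lambda>y. fscale c (s y) + t y))"

text \<open>
  The isomorphism \<open>TM = \<^bold>L\<^sup>2\<close> is obtained from \<open>TX = L\<^sup>2\<close> through the charts.  In its dual form
  \<open>\<^bold>L\<^sup>-\<^sup>2 = K\<^sub>M\<close>, the element \<open>[u]\<^sup>-\<^sup>2\<close> is \<open>bL_form w Q \<kappa> x u\<close> times \<open>dz\<close> for a chart \<open>\<kappa> = (D, z)\<close> of \<open>M\<close>.
\<close>

definition bL_form ::
    "(2 \<times> 2 \<Rightarrow> complex) \<Rightarrow> ('p, 'i) projective_atlas \<Rightarrow> 'p chart \<Rightarrow> 'p \<Rightarrow> ('i \<times> 2 \<Rightarrow> complex) \<Rightarrow> complex" where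
  "bL_form w Q \<kappa> x u =
     (THE c. \<forall>i\<in>idx Q. x \<in> dom Q i \<longrightarrow> c = omega_form w (dev Q i) \<kappa> x (component i u))"

text \<open>The resulting isomorphism \<open>E \<otimes> \<^bold>L\<^sup>n\<^sup>-\<^sup>2\<^sup>k = (E \<otimes> \<^bold>L\<^sup>n) \<otimes> K\<^sup>k\<close>; note \<open>n - 2k = -(k + 1)\<close>.\<close>

definition twist_by_K ::
    "'p chart set \<Rightarrow> (2 \<times> 2 \<Rightarrow> complex) \<Rightarrow> ('p, 'i) projective_atlas \<Rightarrow> nat \<Rightarrow> 'p
       \<Rightarrow> ('e \<times> ('i \<times> 2 \<Rightarrow> complex) \<Rightarrow> complex) \<Rightarrow> (('e \<times> ('i \<times> 2 \<Rightarrow> complex)) \<times> 'p chart \<Rightarrow> complex)" where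
  "twist_by_K A w Q k x T =
     (\<lambda>((a, u), \<kappa>). if \<kappa> \<in> A \<and> x \<in> fst \<kappa> then T (a, u) * bL_form w Q \<kappa> x u ^ k else 0)"

text \<open>
  \<open>Id\<^sub>F \<otimes> p'\<close>, with \<open>F \<otimes> E\<^sup>* \<otimes> (-)\<^sup>*\<close> read as \<open>Hom(E \<otimes> -, F)\<close>: the projection of
  \<open>(\<V>\<^sub>n \<oplus> \<^bold>L\<^sup>-\<^sup>(\<^sup>k\<^sup>+\<^sup>1\<^sup>))\<^sup>*\<close> onto \<open>(\<^bold>L\<^sup>-\<^sup>(\<^sup>k\<^sup>+\<^sup>1\<^sup>))\<^sup>*\<close> restricts a homomorphism to the second summand.
\<close>

definition Id_tensor_projection ::
    "('a \<Rightarrow> complex) set \<Rightarrow> ('c \<Rightarrow> complex) set \<Rightarrow> (('a \<times> ('b + 'c) \<Rightarrow> complex) \<Rightarrow> 'f \<Rightarrow> complex)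
       \<Rightarrow> (('a \<times> 'c \<Rightarrow> complex) \<Rightarrow> 'f \<Rightarrow> complex)" where
  "Id_tensor_projection S T h =
     (\<lambda>v\<in>tensor_space S T. h (\<lambda>(a, q). case q of Inl b \<Rightarrow> 0 | Inr c \<Rightarrow> v (a, c)))"

end

theory Submission
 imports Defs
begin

text \<open>
 The question is local at a point \<open>x\<close>.  Let the chart of the projective structure send \<open>x\<close> to the line
 spanned by \<open>e\<close>, and complete \<open>e\<close> to a basis \<open>e, b\<close>.  In the trivialisation \<open>[b]\<^sup>n\<close> of \<open>\<^bold>L\<^sup>n\<close> the section of
 \<open>\<O>(\<Delta>)\<close> defined by \<open>w\<close> becomes a local coordinate \<open>\<omega>\<close> at \<open>x\<close>, the forms of degree \<open>n\<close> in \<open>e, b\<close> are the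
 polynomials of degree at most \<open>n\<close> in \<open>\<omega>\<close>, and \<open>[b]\<^sup>-\<^sup>(\<^sup>k\<^sup>+\<^sup>1\<^sup>)\<close> corresponds to \<open>\<omega>\<^sup>k\<close>: the connecting
 homomorphism of \<open>g [b]\<^sup>n\<close>, divided by \<open>\<omega>\<^sup>k\<^sup>+\<^sup>1\<close>, is a Mittag-Leffler distribution whose residue is
 the coefficient of \<open>\<omega>\<^sup>k\<close> in \<open>g\<close>.  With a flat frame of \<open>E\<close> (a linear differential equation) the
 isomorphism \<open>J\<^sup>k(E \<otimes> \<^bold>L\<^sup>n) = E \<otimes> (\<V>\<^sub>n \<oplus> \<^bold>L\<^sup>-\<^sup>(\<^sup>k\<^sup>+\<^sup>1\<^sup>))\<close> is therefore the Taylor expansion in \<open>\<omega>\<close>.  On the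
 other hand, \<open>K = \<^bold>L\<^sup>-\<^sup>2\<close> identifies \<open>[b]\<^sup>-\<^sup>2\<close> with \<open>d\<omega>\<close>, so the inclusion of
 \<open>E \<otimes> \<^bold>L\<^sup>n \<otimes> K\<^sup>k\<close> in the jets also sends \<open>[b]\<^sup>n\<^sup>-\<^sup>2\<^sup>k = [b]\<^sup>-\<^sup>(\<^sup>k\<^sup>+\<^sup>1\<^sup>)\<close> to \<open>\<omega>\<^sup>k\<close>.
\<close>

section \<open>Germs of functions on a Riemann surface\<close>

text \<open>Most maps in the statement are definite descriptions over choices: charts of M and of
  P1, covers and Mittag-Leffler distributions, flat sections, local representatives. The bulk of the
  work is to show that these choices do not matter. Each time there is one reason behind it: the
  change of variables for residues, the vanishing of the sum of residues on P1, the invariance of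
  the determinant \<open>br\<close> under SL(V), or the uniqueness of solutions of a linear
  differential equation. No constant survives because the same \<open>w\<close> enters everywhere.
  In the coordinate \<zeta> of \<open>affine_chart e b\<close> one has omega = C \<zeta> with C =
  \<open>w (1, 2) / br e b\<close>, and the one-form attached to [b]^-2 at the centre is C d\<zeta>.
  Hence the residue of (c / (C \<zeta>)) C d\<zeta> is exactly c, and the k-th power of this form
  has leading term omega^k. The exponents fit for k = n + 1: then dividing L^n by omega^(k+1) gives
  L^(-2), the canonical bundle, on which the trace lives, and n - 2k = -(k + 1).\<close>

definition complex_atlas :: "'p chart set \<Rightarrow> bool" where
 "complex_atlas A \<longleftrightarrow>
  (\<forall>(D, z)\<in>A. inj_on z D \<and> open (z ` D)) \<and>
  (\<forall>(D, z)\<in>A. \<forall>(D', z')\<in>A. open (z ` (D \<inter> D')) \<and>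
    (z' \<circ> inv_into D z) holomorphic_on z ` (D \<inter> D'))"

lemma riemann_surface_atlas: "riemann_surface A \<Longrightarrow> complex_atlas A"
 by (simp add: riemann_surface_def complex_atlas_def)

text \<open>Germs are compared through this filter, so that finitely many local identities combine
  without shrinking open sets by hand. At a point of an atlas, \<open>eventually\<close> unfolds to
  the existence of one open set.\<close>

definition nhds_rs :: "'p chart set \<Rightarrow> 'p \<Rightarrow> 'p filter" where
 "nhds_rs A x = (INF U\<in>{U. rs_open A U \<and> x \<in> U}. principal U)"

definition hol_at :: "'p chart set \<Rightarrow> 'p \<Rightarrow> ('p \<Rightarrow> complex) \<Rightarrow> bool" where
 "hol_at A x f \<longleftrightarrow> (\<exists>U. rs_open A U \<and> x \<in> U \<and> hol_fun A U f)"

lemma atlasD: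
 assumes "complex_atlas A" "(D, z) \<in> A"
 shows "inj_on z D" "open (z ` D)"
  and "(D', z') \<in> A \<Longrightarrow> open (z ` (D \<inter> D'))"
  and "(D', z') \<in> A \<Longrightarrow> (z' \<circ> inv_into D z) holomorphic_on z ` (D \<inter> D')"
 using assms unfolding complex_atlas_def by blast+

lemma rs_openD: "rs_open A U \<Longrightarrow> (D, z) \<in> A \<Longrightarrow> open (z ` (U \<inter> D))"
 by (auto simp: rs_open_def)

lemma rs_open_subset: "rs_open A U \<Longrightarrow> U \<subseteq> points A"
 by (simp add: rs_open_def)

lemma points_I: "(D, z) \<in> A \<Longrightarrow> x \<in> D \<Longrightarrow> x \<in> points A"
 by (auto simp: points_def)

lemma points_E:
 assumes "x \<in> points A"
 obtains D z where "(D, z) \<in> A" "x \<in> D"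
 using assms by (auto simp: points_def)

lemma rs_open_points: "complex_atlas A \<Longrightarrow> rs_open A (points A)"
proof -
 assume A: "complex_atlas A"
 have "points A \<inter> D = D" if "(D, z) \<in> A" for D z
  using that by (auto simp: points_def)
 then show ?thesis
  using A by (auto simp: rs_open_def complex_atlas_def)
qed

lemma rs_open_Int:
 assumes A: "complex_atlas A" and U: "rs_open A U" and V: "rs_open A V"
 shows "rs_open A (U \<inter> V)"
 unfolding rs_open_def
proof safe
 fix y assume "y \<in> U" then show "y \<in> points A"
  using U by (auto simp: rs_open_def)
next
 fix D z assume D: "(D, z) \<in> A"
 have "z ` (U \<inter> V \<inter> D) = z ` (U \<inter> D) \<inter> z ` (V \<inter> D)"
  using atlasD(1)[OF A D] by (auto simp: inj_on_def)
 then show "open (z ` (U \<inter> V \<inter> D))"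
  using rs_openD[OF U D] rs_openD[OF V D] by (simp only: open_Int)
qed

lemma rs_open_Union:
 assumes "\<And>U. U \<in> C \<Longrightarrow> rs_open A U"
 shows "rs_open A (\<Union>C)"
 unfolding rs_open_def
proof safe
 fix y U assume "y \<in> U" "U \<in> C" then show "y \<in> points A"
  using assms by (auto simp: rs_open_def)
next
 fix D z assume D: "(D, z) \<in> A"
 have "z ` (\<Union>C \<inter> D) = (\<Union>U\<in>C. z ` (U \<inter> D))" by auto
 then show "open (z ` (\<Union>C \<inter> D))"
  using assms rs_openD[OF _ D] by auto
qed

lemma rs_open_empty [simp]: "rs_open A {}"
 by (auto simp: rs_open_def)

lemma rs_open_localI:
 assumes "\<And>x. x \<in> U \<Longrightarrow> \<exists>V. rs_open A V \<and> x \<in> V \<and> V \<subseteq> U"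
 shows "rs_open A U"
proof -
 have "U = \<Union>{V. rs_open A V \<and> V \<subseteq> U}" using assms by blast
 moreover have "rs_open A (\<Union>{V. rs_open A V \<and> V \<subseteq> U})" by (rule rs_open_Union) auto
 ultimately show ?thesis by simp
qed

lemma rs_open_chart_preimage:
 assumes A: "complex_atlas A" and D: "(D, z) \<in> A" and V: "open V"
 shows "rs_open A {y \<in> D. z y \<in> V}"
 unfolding rs_open_def
proof safe
 fix y assume "y \<in> D" then show "y \<in> points A" using D by (rule points_I[rotated])
next
 fix D' z' assume D': "(D', z') \<in> A"
 note inj' = atlasD(1)[OF A D']
 have "z' ` ({y \<in> D. z y \<in> V} \<inter> D') = (z \<circ> inv_into D' z') -` V \<inter> z' ` (D' \<inter> D)"
  using inj' by (force simp: inv_into_f_f)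
 moreover have "continuous_on (z' ` (D' \<inter> D)) (z \<circ> inv_into D' z')"
  by (rule holomorphic_on_imp_continuous_on[OF atlasD(4)[OF A D' D]])
 ultimately show "open (z' ` ({y \<in> D. z y \<in> V} \<inter> D'))"
  using continuous_on_open_vimage[OF atlasD(3)[OF A D' D]] V by metis
qed

lemma rs_open_chart_dom: "complex_atlas A \<Longrightarrow> (D, z) \<in> A \<Longrightarrow> rs_open A D"
 using rs_open_chart_preimage[of A D z UNIV] by simp

lemma eventually_nhds_rs:
 assumes A: "complex_atlas A" and x: "x \<in> points A"
 shows "eventually P (nhds_rs A x) \<longleftrightarrow> (\<exists>U. rs_open A U \<and> x \<in> U \<and> (\<forall>y\<in>U. P y))"
 unfolding nhds_rs_def
proof (subst eventually_INF_base, goal_cases)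
 case 1 then show ?case using rs_open_points[OF A] x by blast
next
 case (2 U V) then show ?case
  using rs_open_Int[OF A, of U V] by (intro bexI[of _ "U \<inter> V"]) auto
next
 case 3 then show ?case by (auto simp: eventually_principal)
qed

lemma eventually_rs_open:
 assumes "complex_atlas A" "rs_open A U" "x \<in> U"
 shows "\<forall>\<^sub>F y in nhds_rs A x. y \<in> U"
proof -
 have "x \<in> points A" using assms rs_open_subset by blast
 then show ?thesis using assms(2,3) unfolding eventually_nhds_rs[OF assms(1) \<open>x \<in> points A\<close>] by blast
qed

lemma eventually_nhds_rs_x:
 assumes "complex_atlas A" "x \<in> points A" "eventually P (nhds_rs A x)"
 shows "P x"
 using assms(3) unfolding eventually_nhds_rs[OF assms(1,2)] by blast

context
 fixes A :: "'p chart set" and D :: "'p set" and z :: "'p \<Rightarrow> complex" and x :: 'p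
 assumes A: "complex_atlas A" and D: "(D, z) \<in> A" and x: "x \<in> D"
begin

lemma eventually_in_chart: "\<forall>\<^sub>F y in nhds_rs A x. y \<in> D"
 using eventually_rs_open rs_open_chart_dom A D x by metis

lemma inv_chart_x [simp]: "inv_into D z (z x) = x"
 using atlasD(1)[OF A D] x by simp

lemma eventually_in_chart_image: "\<forall>\<^sub>F \<zeta> in nhds (z x). \<zeta> \<in> z ` D"
 using atlasD(2)[OF A D] x by (intro eventually_nhds_in_open) auto

lemma eventually_nhds_rs_chart:
 "eventually P (nhds_rs A x) \<longleftrightarrow> eventually (\<lambda>\<zeta>. P (inv_into D z \<zeta>)) (nhds (z x))"
proof
 note inj = atlasD(1)[OF A D]
 have xp: "x \<in> points A" using points_I D x .
 assume "eventually P (nhds_rs A x)"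
 then obtain U where U: "rs_open A U" "x \<in> U" "\<forall>y\<in>U. P y"
  using eventually_nhds_rs[OF A xp] by blast
 have "\<forall>\<zeta>\<in>z ` (U \<inter> D). P (inv_into D z \<zeta>)"
  using U inj by auto
 then show "eventually (\<lambda>\<zeta>. P (inv_into D z \<zeta>)) (nhds (z x))"
  using rs_openD[OF U(1) D] U(2) x unfolding eventually_nhds by blast
next
 note inj = atlasD(1)[OF A D]
 have xp: "x \<in> points A" using points_I D x .
 assume "eventually (\<lambda>\<zeta>. P (inv_into D z \<zeta>)) (nhds (z x))"
 then obtain V where V: "open V" "z x \<in> V" "\<forall>\<zeta>\<in>V. P (inv_into D z \<zeta>)"
  unfolding eventually_nhds by blast
 have "P y" if "y \<in> D" "z y \<in> V" for y
  using V(3) that inj by force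
 moreover have "rs_open A {y \<in> D. z y \<in> V}"
  by (rule rs_open_chart_preimage[OF A D V(1)])
 ultimately show "eventually P (nhds_rs A x)"
  using eventually_nhds_rs[OF A xp] V(2) x by blast
qed

text \<open>Compatibility carries holomorphy from the chart \<open>(D, z)\<close> to every other
  chart, so a single chart decides. This reduces the calculus of germs below to
  \<open>analytic_on\<close> at one point.\<close>

lemma hol_at_chart: "hol_at A x f \<longleftrightarrow> (f \<circ> inv_into D z) analytic_on {z x}"
proof
 assume "hol_at A x f"
 then obtain U where U: "rs_open A U" "x \<in> U" "hol_fun A U f"
  unfolding hol_at_def by blast
 have "(f \<circ> inv_into D z) holomorphic_on z ` (U \<inter> D)"
  using U(3) D unfolding hol_fun_def by fast
 then show "(f \<circ> inv_into D z) analytic_on {z x}"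
  using rs_openD[OF U(1) D] U(2) x unfolding analytic_at by blast
next
 note inj = atlasD(1)[OF A D]
 assume "(f \<circ> inv_into D z) analytic_on {z x}"
 then obtain V where V: "open V" "z x \<in> V" "(f \<circ> inv_into D z) holomorphic_on V"
  unfolding analytic_at by blast
 let ?U = "{y \<in> D. z y \<in> V}"
 have "hol_fun A ?U f" unfolding hol_fun_def
 proof safe
  fix D' z' assume D': "(D', z') \<in> A"
  note inj' = atlasD(1)[OF A D']
  have 1: "((f \<circ> inv_into D z) \<circ> (z \<circ> inv_into D' z')) holomorphic_on z' ` (?U \<inter> D')"
  proof (rule holomorphic_on_compose_gen)
   show "z \<circ> inv_into D' z' holomorphic_on z' ` (?U \<inter> D')"
    by (rule holomorphic_on_subset[OF atlasD(4)[OF A D' D]]) auto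
   show "f \<circ> inv_into D z holomorphic_on V" by fact
   show "(z \<circ> inv_into D' z') ` z' ` (?U \<inter> D') \<subseteq> V"
    using inj' by auto
  qed
  show "f \<circ> inv_into D' z' holomorphic_on z' ` (?U \<inter> D')"
   by (rule holomorphic_transform[OF 1]) (use inj inj' in auto)
 qed
 moreover have "rs_open A ?U" by (rule rs_open_chart_preimage[OF A D V(1)])
 ultimately show "hol_at A x f"
  using V(2) x unfolding hol_at_def by blast
qed

lemma hol_at_coord: "hol_at A x z"
proof -
 have "(z \<circ> inv_into D z) analytic_on {z x} \<longleftrightarrow> (\<lambda>\<zeta>. \<zeta>) analytic_on {z x}"
  by (rule analytic_at_cong)
   (use eventually_in_chart_image in \<open>auto elim!: eventually_mono simp: f_inv_into_f\<close>)
 then show ?thesis by (simp add: hol_at_chart)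
qed

end

lemma hol_at_points: "hol_at A x f \<Longrightarrow> x \<in> points A"
 unfolding hol_at_def using rs_open_subset by blast

lemma hol_fun_iff_hol_at:
 assumes A: "complex_atlas A" and U: "rs_open A U"
 shows "hol_fun A U f \<longleftrightarrow> (\<forall>x\<in>U. hol_at A x f)"
proof
 assume "hol_fun A U f" then show "\<forall>x\<in>U. hol_at A x f"
  using U unfolding hol_at_def by blast
next
 assume *: "\<forall>x\<in>U. hol_at A x f"
 show "hol_fun A U f" unfolding hol_fun_def
 proof safe
  fix D z assume D: "(D, z) \<in> A"
  have "(f \<circ> inv_into D z) analytic_on z ` (U \<inter> D)"
   unfolding analytic_on_analytic_at[of _ "z ` (U \<inter> D)"]
   using * hol_at_chart[OF A D] by blast
  then show "f \<circ> inv_into D z holomorphic_on z ` (U \<inter> D)"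
   by (rule analytic_imp_holomorphic)
 qed
qed

lemma hol_fun_subset: "hol_fun A U f \<Longrightarrow> V \<subseteq> U \<Longrightarrow> hol_fun A V f"
 unfolding hol_fun_def by (auto intro: holomorphic_on_subset)

context
 fixes A :: "'p chart set" and x :: 'p
 assumes A: "complex_atlas A" and xp: "x \<in> points A"
begin

lemma hol_at_cong:
 assumes "\<forall>\<^sub>F y in nhds_rs A x. f y = g y"
 shows "hol_at A x f \<longleftrightarrow> hol_at A x g"
proof -
 obtain D z where D: "(D, z) \<in> A" "x \<in> D" using xp by (rule points_E)
 show ?thesis unfolding hol_at_chart[OF A D]
  by (rule analytic_at_cong)
   (use assms in \<open>simp_all add: eventually_nhds_rs_chart[OF A D]\<close>)
qed

lemma hol_at_const [intro, simp]: "hol_at A x (\<lambda>y. c)"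
proof -
 obtain D z where D: "(D, z) \<in> A" "x \<in> D" using xp by (rule points_E)
 show ?thesis unfolding hol_at_chart[OF A D] comp_def by simp
qed

lemma hol_at_compose:
 assumes "hol_at A x f" "h analytic_on {f x}"
 shows "hol_at A x (\<lambda>y. h (f y))"
proof -
 obtain D z where D: "(D, z) \<in> A" "x \<in> D" using xp by (rule points_E)
 have "(h \<circ> (f \<circ> inv_into D z)) analytic_on {z x}"
  by (rule analytic_on_compose) (use assms D in \<open>auto simp: hol_at_chart[OF A D] inv_chart_x[OF A D]\<close>)
 then show ?thesis unfolding hol_at_chart[OF A D] by (simp add: comp_def)
qed

lemma hol_at_add: "hol_at A x f \<Longrightarrow> hol_at A x g \<Longrightarrow> hol_at A x (\<lambda>y. f y + g y)"
 and hol_at_diff: "hol_at A x f \<Longrightarrow> hol_at A x g \<Longrightarrow> hol_at A x (\<lambda>y. f y - g y)"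
 and hol_at_mult: "hol_at A x f \<Longrightarrow> hol_at A x g \<Longrightarrow> hol_at A x (\<lambda>y. f y * g y)"
 and hol_at_power: "hol_at A x f \<Longrightarrow> hol_at A x (\<lambda>y. f y ^ m)"
 and hol_at_divide: "hol_at A x f \<Longrightarrow> hol_at A x g \<Longrightarrow> g x \<noteq> 0 \<Longrightarrow> hol_at A x (\<lambda>y. f y / g y)"
proof -
 obtain D z where D: "(D, z) \<in> A" "x \<in> D" using xp by (rule points_E)
 note [simp] = hol_at_chart[OF A D] comp_def inv_chart_x[OF A D]
 show "hol_at A x f \<Longrightarrow> hol_at A x g \<Longrightarrow> hol_at A x (\<lambda>y. f y + g y)"
  "hol_at A x f \<Longrightarrow> hol_at A x g \<Longrightarrow> hol_at A x (\<lambda>y. f y - g y)"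
  "hol_at A x f \<Longrightarrow> hol_at A x g \<Longrightarrow> hol_at A x (\<lambda>y. f y * g y)"
  "hol_at A x f \<Longrightarrow> hol_at A x (\<lambda>y. f y ^ m)"
  "hol_at A x f \<Longrightarrow> hol_at A x g \<Longrightarrow> g x \<noteq> 0 \<Longrightarrow> hol_at A x (\<lambda>y. f y / g y)"
  by (auto intro!: analytic_intros)
qed

lemma hol_at_sum: "(\<And>i. i \<in> I \<Longrightarrow> hol_at A x (f i)) \<Longrightarrow> hol_at A x (\<lambda>y. \<Sum>i\<in>I. f i y)"
 by (induction I rule: infinite_finite_induct) (simp_all add: hol_at_add)

lemma tendsto_hol_at:
 assumes "hol_at A x f" shows "(f \<longlongrightarrow> f x) (nhds_rs A x)"
proof -
 obtain D z where D: "(D, z) \<in> A" "x \<in> D" using xp by (rule points_E)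
 have "isCont (f \<circ> inv_into D z) (z x)"
  using assms hol_at_chart[OF A D] analytic_at_imp_isCont by blast
 then have "((f \<circ> inv_into D z) \<longlongrightarrow> f x) (nhds (z x))"
  by (simp add: continuous_at tendsto_nhds_iff comp_def inv_chart_x[OF A D])
 then show ?thesis unfolding tendsto_def eventually_nhds_rs_chart[OF A D] by simp
qed

lemma hol_at_nonzero:
 assumes "hol_at A x f" "f x \<noteq> 0" shows "\<forall>\<^sub>F y in nhds_rs A x. f y \<noteq> 0"
 using tendsto_imp_eventually_ne[OF tendsto_hol_at[OF assms(1)]] assms(2) by blast

lemma hol_at_eventually:
 assumes "hol_at A x f" shows "\<forall>\<^sub>F y in nhds_rs A x. hol_at A y f"
proof -
 obtain U where U: "rs_open A U" "x \<in> U" "hol_fun A U f"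
  using assms unfolding hol_at_def by blast
 then show ?thesis
  using eventually_rs_open[OF A U(1,2)] hol_fun_iff_hol_at[OF A U(1)]
  by (metis (mono_tags, lifting) eventually_mono)
qed

lemma eventually_neq_nontrivial: "\<not> eventually (\<lambda>y. y = x) (nhds_rs A x)"
proof
 assume *: "eventually (\<lambda>y. y = x) (nhds_rs A x)"
 obtain D z where D: "(D, z) \<in> A" "x \<in> D" using xp by (rule points_E)
 have "eventually (\<lambda>\<zeta>. inv_into D z \<zeta> = x) (nhds (z x))"
  using * unfolding eventually_nhds_rs_chart[OF A D] .
 then have "eventually (\<lambda>\<zeta>. \<zeta> = z x) (nhds (z x))"
  using eventually_in_chart_image[OF A D]
  by eventually_elim (metis f_inv_into_f)
 then have "eventually (\<lambda>_. False) (at (z x))"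
  unfolding eventually_at_filter by (auto elim: eventually_mono)
 then show False by simp
qed

text \<open>A nonzero value would persist near \<open>x\<close> by continuity, while
  \<open>x\<close> is not isolated. This supplies the value at \<open>x\<close> whenever an identity
  is first obtained by dividing by a function that vanishes there.\<close>

lemma hol_at_eq_punctured:
 assumes f: "hol_at A x f" and "\<forall>\<^sub>F y in nhds_rs A x. y \<noteq> x \<longrightarrow> f y = 0"
 shows "f x = 0"
proof (rule ccontr)
 assume "f x \<noteq> 0"
 then have "\<forall>\<^sub>F y in nhds_rs A x. f y \<noteq> 0" by (rule hol_at_nonzero[OF f])
 with assms(2) have "\<forall>\<^sub>F y in nhds_rs A x. y = x" by eventually_elim auto
 then show False using eventually_neq_nontrivial by blast
qed

end

text \<open>A local parameter, described by divisibility instead of a nonzero derivative: it divides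
  every germ that vanishes at \<open>x\<close>. In this form a chart coordinate and the section
  defined by \<open>w\<close> are interchangeable, and the property pulls back along local
  isomorphisms.\<close>

definition uniformizer :: "'p chart set \<Rightarrow> 'p \<Rightarrow> ('p \<Rightarrow> complex) \<Rightarrow> bool" where
 "uniformizer A x \<zeta> \<longleftrightarrow> hol_at A x \<zeta> \<and> \<zeta> x = 0 \<and> (\<forall>\<^sub>F y in nhds_rs A x. y \<noteq> x \<longrightarrow> \<zeta> y \<noteq> 0) \<and>
  (\<forall>f. hol_at A x f \<and> f x = 0 \<longrightarrow>
    (\<exists>g. hol_at A x g \<and> (\<forall>\<^sub>F y in nhds_rs A x. f y = \<zeta> y * g y)))"

text \<open>The power of a chart coordinate is chosen to match \<open>vanishes_to_order\<close>;
  \<open>vanish_at_uniformizer\<close> then allows any other local parameter.\<close>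

definition vanish_at :: "'p chart set \<Rightarrow> nat \<Rightarrow> 'p \<Rightarrow> ('p \<Rightarrow> complex) \<Rightarrow> bool" where
 "vanish_at A m x f \<longleftrightarrow>
  (\<exists>(D, z)\<in>A. x \<in> D \<and> (\<exists>g. hol_at A x g \<and>
    (\<forall>\<^sub>F y in nhds_rs A x. f y = (z y - z x) ^ m * g y)))"

lemma analytic_factor_zero:
 assumes "f analytic_on {a}" "f a = (0::complex)"
 obtains g where "g analytic_on {a}" "\<forall>\<^sub>F \<zeta> in nhds a. f \<zeta> = (\<zeta> - a) * g \<zeta>"
proof -
 obtain e where e: "e > 0" "f holomorphic_on ball a e"
  using assms(1) by (auto simp: analytic_on_def)
 \<comment> \<open>The difference quotient, completed by the derivative at \<open>a\<close>, has a
   removable singularity there by \<open>pole_lemma\<close>.\<close>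
 let ?g = "\<lambda>\<zeta>. if \<zeta> = a then deriv f a else (f \<zeta> - f a) / (\<zeta> - a)"
 have "?g holomorphic_on ball a e"
  by (rule pole_lemma[OF e(2)]) (use e in \<open>simp add: interior_open\<close>)
 then have "?g analytic_on {a}"
  using e(1) centre_in_ball open_ball unfolding analytic_at by blast
 moreover have "\<forall>\<^sub>F \<zeta> in nhds a. f \<zeta> = (\<zeta> - a) * ?g \<zeta>"
  using assms(2) by (auto intro!: always_eventually)
 ultimately show ?thesis by (rule that)
qed

lemma uniformizer_coord:
 assumes A: "complex_atlas A" and D: "(D, z) \<in> A" "x \<in> D"
 shows "uniformizer A x (\<lambda>y. z y - z x)"
 unfolding uniformizer_def
proof (intro conjI allI impI)
 have xp: "x \<in> points A" using points_I D .
 show "hol_at A x (\<lambda>y. z y - z x)"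
  by (intro hol_at_diff hol_at_coord[OF A D] hol_at_const A xp)
 show "\<forall>\<^sub>F y in nhds_rs A x. y \<noteq> x \<longrightarrow> z y - z x \<noteq> 0"
  using eventually_in_chart[OF A D]
  by eventually_elim (use atlasD(1)[OF A D(1)] D(2) in \<open>auto simp: inj_on_def\<close>)
 fix f assume f: "hol_at A x f \<and> f x = 0"
 then obtain g where g: "g analytic_on {z x}"
  "\<forall>\<^sub>F \<zeta> in nhds (z x). (f \<circ> inv_into D z) \<zeta> = (\<zeta> - z x) * g \<zeta>"
  using analytic_factor_zero[of "f \<circ> inv_into D z" "z x"] hol_at_chart[OF A D]
  by (auto simp: inv_chart_x[OF A D])
 have "hol_at A x (\<lambda>y. g (z y))"
  by (rule hol_at_compose[OF A xp hol_at_coord[OF A D] g(1)])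
 moreover have "\<forall>\<^sub>F y in nhds_rs A x. f y = (z y - z x) * g (z y)"
  unfolding eventually_nhds_rs_chart[OF A D]
  using g(2) eventually_in_chart_image[OF A D]
  by eventually_elim (simp add: f_inv_into_f)
 ultimately show "\<exists>g. hol_at A x g \<and> (\<forall>\<^sub>F y in nhds_rs A x. f y = (z y - z x) * g y)" by blast
qed simp

text \<open>It suffices that \<open>\<zeta>\<close> divides one known uniformizer
  \<open>\<xi>\<close>: whatever is divisible by \<open>\<xi>\<close> is then divisible by
  \<open>\<zeta>\<close>, and near \<open>x\<close> zeros of \<open>\<zeta>\<close> are zeros of
  \<open>\<xi>\<close>.\<close>

lemma uniformizerI:
 assumes A: "complex_atlas A" and \<xi>: "uniformizer A x \<xi>"
  and "hol_at A x \<zeta>" "\<zeta> x = 0"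
  and h: "hol_at A x h" "\<forall>\<^sub>F y in nhds_rs A x. \<xi> y = \<zeta> y * h y"
 shows "uniformizer A x \<zeta>"
 unfolding uniformizer_def
proof (intro conjI allI impI)
 have xp: "x \<in> points A" using assms(3) by (rule hol_at_points)
 have "\<forall>\<^sub>F y in nhds_rs A x. y \<noteq> x \<longrightarrow> \<xi> y \<noteq> 0"
  using \<xi> by (simp add: uniformizer_def)
 with h(2) show "\<forall>\<^sub>F y in nhds_rs A x. y \<noteq> x \<longrightarrow> \<zeta> y \<noteq> 0" by eventually_elim auto
 fix f assume "hol_at A x f \<and> f x = 0"
 then obtain g where g: "hol_at A x g" "\<forall>\<^sub>F y in nhds_rs A x. f y = \<xi> y * g y"
  using \<xi> by (auto simp: uniformizer_def)
 have "hol_at A x (\<lambda>y. h y * g y)" by (rule hol_at_mult[OF A xp h(1) g(1)])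
 moreover have "\<forall>\<^sub>F y in nhds_rs A x. f y = \<zeta> y * (h y * g y)"
  using g(2) h(2) by eventually_elim simp
 ultimately show "\<exists>g. hol_at A x g \<and> (\<forall>\<^sub>F y in nhds_rs A x. f y = \<zeta> y * g y)" by blast
qed fact+

text \<open>Each of two uniformizers vanishes at \<open>x\<close> and so is divisible by the other;
  this is raised to the power \<open>m\<close>.\<close>

lemma vanish_at_uniformizer:
 assumes A: "complex_atlas A" and \<zeta>: "uniformizer A x \<zeta>"
 shows "vanish_at A m x f \<longleftrightarrow>
     (\<exists>g. hol_at A x g \<and> (\<forall>\<^sub>F y in nhds_rs A x. f y = \<zeta> y ^ m * g y))"
proof -
 have xp: "x \<in> points A" using \<zeta> hol_at_points by (auto simp: uniformizer_def)
 have conv: "\<exists>g. hol_at A x g \<and> (\<forall>\<^sub>F y in nhds_rs A x. f y = \<zeta>2 y ^ m * g y)"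
  if \<zeta>1: "uniformizer A x \<zeta>1" and \<zeta>2: "uniformizer A x \<zeta>2"
   and ex: "\<exists>g. hol_at A x g \<and> (\<forall>\<^sub>F y in nhds_rs A x. f y = \<zeta>1 y ^ m * g y)" for \<zeta>1 \<zeta>2
 proof -
  obtain h where h: "hol_at A x h" "\<forall>\<^sub>F y in nhds_rs A x. \<zeta>1 y = \<zeta>2 y * h y"
   using \<zeta>1 \<zeta>2 unfolding uniformizer_def by blast
  obtain g where g: "hol_at A x g" "\<forall>\<^sub>F y in nhds_rs A x. f y = \<zeta>1 y ^ m * g y"
   using ex by blast
  have "hol_at A x (\<lambda>y. h y ^ m * g y)"
   by (intro hol_at_mult[OF A xp] hol_at_power[OF A xp] g h)
  moreover have "\<forall>\<^sub>F y in nhds_rs A x. f y = \<zeta>2 y ^ m * (h y ^ m * g y)"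
   using g(2) h(2) by eventually_elim (simp add: power_mult_distrib)
  ultimately show ?thesis by blast
 qed
 show ?thesis
 proof
  assume "vanish_at A m x f"
  then obtain D z where D: "(D, z) \<in> A" "x \<in> D"
   "\<exists>g. hol_at A x g \<and> (\<forall>\<^sub>F y in nhds_rs A x. f y = (z y - z x) ^ m * g y)"
   unfolding vanish_at_def by blast
  show "\<exists>g. hol_at A x g \<and> (\<forall>\<^sub>F y in nhds_rs A x. f y = \<zeta> y ^ m * g y)"
   by (rule conv[OF uniformizer_coord[OF A D(1,2)] \<zeta> D(3)])
 next
  assume *: "\<exists>g. hol_at A x g \<and> (\<forall>\<^sub>F y in nhds_rs A x. f y = \<zeta> y ^ m * g y)"
  obtain D z where D: "(D, z) \<in> A" "x \<in> D" using xp by (rule points_E)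
  show "vanish_at A m x f" unfolding vanish_at_def
   using conv[OF \<zeta> uniformizer_coord[OF A D] *] D by blast
 qed
qed

context
 fixes A :: "'p chart set" and x :: 'p
 assumes A: "complex_atlas A" and xp: "x \<in> points A"
begin

lemma uniformizer_exists: obtains \<zeta> where "uniformizer A x \<zeta>"
 using uniformizer_coord[OF A] points_E[OF xp] by metis

lemma vanish_at_cong:
 assumes "\<forall>\<^sub>F y in nhds_rs A x. f y = g y"
 shows "vanish_at A m x f \<longleftrightarrow> vanish_at A m x g"
proof -
 have "(\<forall>\<^sub>F y in nhds_rs A x. f y = h y) \<longleftrightarrow> (\<forall>\<^sub>F y in nhds_rs A x. g y = h y)" for h
  by (rule eventually_subst) (use assms in \<open>auto elim!: eventually_mono\<close>)
 then show ?thesis by (simp add: vanish_at_def)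
qed

text \<open>Holomorphic germs are treated as those of order \<open>0\<close>, which makes products
  with them a case of \<open>vanish_at_mult\<close>.\<close>

lemma vanish_at_0: "vanish_at A 0 x f \<longleftrightarrow> hol_at A x f"
proof -
 obtain \<zeta> where \<zeta>: "uniformizer A x \<zeta>" by (rule uniformizer_exists)
 show ?thesis unfolding vanish_at_uniformizer[OF A \<zeta>]
  using hol_at_cong[OF A xp] by auto
qed

lemma vanish_at_Suc:
 assumes \<zeta>: "uniformizer A x \<zeta>"
 shows "vanish_at A (Suc m) x f \<longleftrightarrow>
  (\<exists>g. vanish_at A m x g \<and> (\<forall>\<^sub>F y in nhds_rs A x. f y = \<zeta> y * g y))"
proof
 assume "vanish_at A (Suc m) x f"
 then obtain h where h: "hol_at A x h" "\<forall>\<^sub>F y in nhds_rs A x. f y = \<zeta> y ^ Suc m * h y"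
  unfolding vanish_at_uniformizer[OF A \<zeta>] by blast
 then have "vanish_at A m x (\<lambda>y. \<zeta> y ^ m * h y)" "\<forall>\<^sub>F y in nhds_rs A x. f y = \<zeta> y * (\<zeta> y ^ m * h y)"
  unfolding vanish_at_uniformizer[OF A \<zeta>] by (auto simp: mult.assoc)
 then show "\<exists>g. vanish_at A m x g \<and> (\<forall>\<^sub>F y in nhds_rs A x. f y = \<zeta> y * g y)" by blast
next
 assume "\<exists>g. vanish_at A m x g \<and> (\<forall>\<^sub>F y in nhds_rs A x. f y = \<zeta> y * g y)"
 then obtain g h where h: "\<forall>\<^sub>F y in nhds_rs A x. f y = \<zeta> y * g y" "hol_at A x h"
   "\<forall>\<^sub>F y in nhds_rs A x. g y = \<zeta> y ^ m * h y"
  unfolding vanish_at_uniformizer[OF A \<zeta>] by blast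
 have "\<forall>\<^sub>F y in nhds_rs A x. f y = \<zeta> y ^ Suc m * h y"
  using h(1,3) by eventually_elim simp
 with h(2) show "vanish_at A (Suc m) x f"
  unfolding vanish_at_uniformizer[OF A \<zeta>] by blast
qed

lemma vanish_at_add: "vanish_at A m x f \<Longrightarrow> vanish_at A m x g \<Longrightarrow> vanish_at A m x (\<lambda>y. f y + g y)"
 and vanish_at_mult: "vanish_at A m x f \<Longrightarrow> vanish_at A l x g \<Longrightarrow> vanish_at A (m + l) x (\<lambda>y. f y * g y)"
proof -
 obtain \<zeta> where \<zeta>: "uniformizer A x \<zeta>" by (rule uniformizer_exists)
 note v = vanish_at_uniformizer[OF A \<zeta>]
 show "vanish_at A m x (\<lambda>y. f y + g y)" if fg: "vanish_at A m x f" "vanish_at A m x g"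
 proof -
  obtain f' g' where h: "hol_at A x f'" "\<forall>\<^sub>F y in nhds_rs A x. f y = \<zeta> y ^ m * f' y"
   "hol_at A x g'" "\<forall>\<^sub>F y in nhds_rs A x. g y = \<zeta> y ^ m * g' y"
   using fg unfolding v by blast
  have "\<forall>\<^sub>F y in nhds_rs A x. f y + g y = \<zeta> y ^ m * (f' y + g' y)"
   using h(2,4) by eventually_elim (simp add: algebra_simps)
  then show ?thesis unfolding v using hol_at_add[OF A xp h(1,3)] by blast
 qed
 show "vanish_at A (m + l) x (\<lambda>y. f y * g y)" if fg: "vanish_at A m x f" "vanish_at A l x g"
 proof -
  obtain f' g' where h: "hol_at A x f'" "\<forall>\<^sub>F y in nhds_rs A x. f y = \<zeta> y ^ m * f' y"
   "hol_at A x g'" "\<forall>\<^sub>F y in nhds_rs A x. g y = \<zeta> y ^ l * g' y"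
   using fg unfolding v by blast
  have "\<forall>\<^sub>F y in nhds_rs A x. f y * g y = \<zeta> y ^ (m + l) * (f' y * g' y)"
   using h(2,4) by eventually_elim (simp add: algebra_simps power_add)
  then show ?thesis unfolding v using hol_at_mult[OF A xp h(1,3)] by blast
 qed
qed

lemma vanish_at_mult_hol: "hol_at A x h \<Longrightarrow> vanish_at A m x f \<Longrightarrow> vanish_at A m x (\<lambda>y. h y * f y)"
 using vanish_at_mult[of 0 h m f] by (simp add: vanish_at_0)

lemma vanish_at_cmult: "vanish_at A m x f \<Longrightarrow> vanish_at A m x (\<lambda>y. c * f y)"
 by (rule vanish_at_mult_hol[OF hol_at_const[OF A xp]])

lemma vanish_at_uminus: "vanish_at A m x f \<Longrightarrow> vanish_at A m x (\<lambda>y. - f y)"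
 using vanish_at_cmult[of m f "-1"] by simp

lemma vanish_at_zero: "vanish_at A m x (\<lambda>y. 0)"
proof -
 obtain \<zeta> where \<zeta>: "uniformizer A x \<zeta>" by (rule uniformizer_exists)
 show ?thesis unfolding vanish_at_uniformizer[OF A \<zeta>]
  by (rule exI[of _ "\<lambda>_. 0"]) (simp add: hol_at_const[OF A xp])
qed

lemma vanish_at_sum: "(\<And>i. i \<in> I \<Longrightarrow> vanish_at A m x (f i)) \<Longrightarrow> vanish_at A m x (\<lambda>y. \<Sum>i\<in>I. f i y)"
 by (induction I rule: infinite_finite_induct) (simp_all add: vanish_at_add vanish_at_zero)

lemma vanish_at_hol: "vanish_at A m x f \<Longrightarrow> hol_at A x f"
 and vanish_at_mono: "vanish_at A m x f \<Longrightarrow> l \<le> m \<Longrightarrow> vanish_at A l x f"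
proof -
 obtain \<zeta> where \<zeta>: "uniformizer A x \<zeta>" by (rule uniformizer_exists)
 note v = vanish_at_uniformizer[OF A \<zeta>]
 have \<zeta>h: "hol_at A x \<zeta>" using \<zeta> by (simp add: uniformizer_def)
 show mono: "vanish_at A l x f" if f: "vanish_at A m x f" and l: "l \<le> m" for l
 proof -
  obtain h where h: "hol_at A x h" "\<forall>\<^sub>F y in nhds_rs A x. f y = \<zeta> y ^ m * h y"
   using f unfolding v by blast
  have "\<forall>\<^sub>F y in nhds_rs A x. f y = \<zeta> y ^ l * (\<zeta> y ^ (m - l) * h y)"
   using h(2) by eventually_elim (simp add: l flip: mult.assoc power_add)
  then show ?thesis unfolding v
   using hol_at_mult[OF A xp hol_at_power[OF A xp \<zeta>h] h(1)] by blast
 qed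
 show "vanish_at A m x f \<Longrightarrow> hol_at A x f" using mono[of 0] by (simp add: vanish_at_0)
qed

lemma vanish_at_value: "vanish_at A (Suc m) x f \<Longrightarrow> f x = 0"
proof -
 obtain \<zeta> where \<zeta>: "uniformizer A x \<zeta>" by (rule uniformizer_exists)
 assume "vanish_at A (Suc m) x f"
 then obtain h where "\<forall>\<^sub>F y in nhds_rs A x. f y = \<zeta> y ^ Suc m * h y"
  unfolding vanish_at_uniformizer[OF A \<zeta>] by blast
 then show "f x = 0"
  using eventually_nhds_rs_x[OF A xp, of "\<lambda>y. f y = \<zeta> y ^ Suc m * h y"] \<zeta>
  by (simp add: uniformizer_def)
qed

lemma vanish_at_1: "hol_at A x f \<Longrightarrow> f x = 0 \<Longrightarrow> vanish_at A 1 x f"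
proof -
 obtain \<zeta> where \<zeta>: "uniformizer A x \<zeta>" by (rule uniformizer_exists)
 assume "hol_at A x f" "f x = 0"
 then show ?thesis using \<zeta> unfolding vanish_at_uniformizer[OF A \<zeta>]
  by (auto simp: uniformizer_def)
qed

lemma vanish_at_uniformizer_power: "uniformizer A x \<zeta> \<Longrightarrow> hol_at A x g \<Longrightarrow> vanish_at A m x (\<lambda>y. \<zeta> y ^ m * g y)"
 unfolding vanish_at_uniformizer[OF A] by auto

text \<open>Away from \<open>x\<close> one divides by \<open>\<zeta>\<close>; at \<open>x\<close>
  the two germs then agree because both are holomorphic and \<open>x\<close> is not
  isolated.\<close>

lemma vanish_at_cancel:
 assumes \<zeta>: "uniformizer A x \<zeta>" and g: "hol_at A x g" and v: "vanish_at A (Suc m) x (\<lambda>y. \<zeta> y * g y)"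
 shows "vanish_at A m x g"
proof -
 obtain h where h: "vanish_at A m x h" "\<forall>\<^sub>F y in nhds_rs A x. \<zeta> y * g y = \<zeta> y * h y"
  using v unfolding vanish_at_Suc[OF \<zeta>] by blast
 have "\<forall>\<^sub>F y in nhds_rs A x. y \<noteq> x \<longrightarrow> \<zeta> y \<noteq> 0"
  using \<zeta> by (simp add: uniformizer_def)
 with h(2) have e: "\<forall>\<^sub>F y in nhds_rs A x. y \<noteq> x \<longrightarrow> g y - h y = 0"
  by eventually_elim auto
 have "g x - h x = 0"
  by (rule hol_at_eq_punctured[OF A xp hol_at_diff[OF A xp g vanish_at_hol[OF h(1)]] e])
 with e have "\<forall>\<^sub>F y in nhds_rs A x. g y = h y" by (auto elim!: eventually_mono)
 then show ?thesis using h(1) vanish_at_cong by blast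
qed

lemma vanish_at_cancel_power:
 assumes \<zeta>: "uniformizer A x \<zeta>" and g: "hol_at A x g"
 shows "vanish_at A (l + m) x (\<lambda>y. \<zeta> y ^ l * g y) \<longleftrightarrow> vanish_at A m x g"
proof -
 have \<zeta>h: "hol_at A x \<zeta>" using \<zeta> by (simp add: uniformizer_def)
 show ?thesis
 proof
  show "vanish_at A (l + m) x (\<lambda>y. \<zeta> y ^ l * g y) \<Longrightarrow> vanish_at A m x g"
  proof (induction l)
   case (Suc l)
   have "vanish_at A (l + m) x (\<lambda>y. \<zeta> y ^ l * g y)"
    by (rule vanish_at_cancel[OF \<zeta> hol_at_mult[OF A xp hol_at_power[OF A xp \<zeta>h] g]])
     (use Suc.prems in \<open>simp add: mult.assoc\<close>)
   then show ?case by (rule Suc.IH)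
  qed simp
  show "vanish_at A m x g \<Longrightarrow> vanish_at A (l + m) x (\<lambda>y. \<zeta> y ^ l * g y)"
   by (rule vanish_at_mult) (use vanish_at_uniformizer_power[OF \<zeta> hol_at_const[OF A xp, of 1], of l] in simp_all)
 qed
qed

text \<open>The constant term is the value at \<open>x\<close>. Once it is known to be zero, one
  factor \<open>\<zeta>\<close> cancels and the shifted coefficients satisfy the same hypothesis
  with one order less.\<close>

lemma taylor_unique:
 assumes \<zeta>: "uniformizer A x \<zeta>" and v: "vanish_at A k x (\<lambda>y. \<Sum>j<k. a j * \<zeta> y ^ j)"
 shows "\<forall>j<k. a j = 0"
 using v
proof (induction k arbitrary: a)
 case (Suc k)
 have \<zeta>h: "hol_at A x \<zeta>" "\<zeta> x = 0" using \<zeta> by (simp_all add: uniformizer_def)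
 have s: "(\<Sum>j<Suc k. a j * \<zeta> y ^ j) = a 0 + \<zeta> y * (\<Sum>j<k. a (Suc j) * \<zeta> y ^ j)" for y
  by (simp add: sum.lessThan_Suc_shift sum_distrib_left algebra_simps del: sum.lessThan_Suc)
 have a0: "a 0 = 0"
  using vanish_at_value[OF Suc.prems] \<zeta>h(2) unfolding s by simp
 have "vanish_at A k x (\<lambda>y. \<Sum>j<k. a (Suc j) * \<zeta> y ^ j)"
  by (rule vanish_at_cancel[OF \<zeta>])
   (use Suc.prems a0 in \<open>auto simp: s simp del: sum.lessThan_Suc
    intro!: hol_at_sum[OF A xp] hol_at_mult[OF A xp] hol_at_power[OF A xp] hol_at_const[OF A xp] \<zeta>h\<close>)
 then have "\<forall>j<k. a (Suc j) = 0" by (rule Suc.IH)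
 with a0 show ?case by (auto simp: less_Suc_eq_0_disj)
qed simp

end

section \<open>Local frames, jets and tensor products\<close>

lemma sum_fun_apply: "(\<Sum>i\<in>I. f i) a = (\<Sum>i\<in>I. f i a)"
 by (induction I rule: infinite_finite_induct) auto

lemma fscale_apply [simp]: "fscale c f a = c * f a"
 by (simp add: fscale_def)

lemma tens_apply [simp]: "tens u v (a, b) = u a * v b"
 by (simp add: tens_def)

lemma tens_sum_left: "tens (\<Sum>i\<in>I. u i) v = (\<Sum>i\<in>I. tens (u i) v)"
 and tens_sum_right: "tens w (\<Sum>i\<in>I. t i) = (\<Sum>i\<in>I. tens w (t i))"
 by (auto simp: fun_eq_iff tens_def sum_fun_apply sum_distrib_right sum_distrib_left)

lemma tens_add_right: "tens u (v + v') = tens u v + tens u v'"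
 and tens_fscale_left: "tens (fscale c u) v = fscale c (tens u v)"
 and tens_fscale_right: "tens u (fscale c v) = fscale c (tens u v)"
 and tens_zero_right: "tens u 0 = 0"
 by (auto simp: fun_eq_iff tens_def algebra_simps)

lemma span_frame:
 "cfun.span (b ` {..<r::nat}) = {\<Sum>l<r. fscale (c l) (b l) |c. True}" (is "?L = ?R")
proof
 have "cfun.subspace ?R"
  unfolding cfun.subspace_def
 proof safe
  show "\<exists>c. 0 = (\<Sum>l<r. fscale (c l) (b l)) \<and> True"
   by (rule exI[of _ "\<lambda>_. 0"]) (simp add: cfun.scale_zero_left)
  show "\<exists>ca. (\<Sum>l<r. fscale (c l) (b l)) + (\<Sum>l<r. fscale (c' l) (b l)) = (\<Sum>l<r. fscale (ca l) (b l)) \<and> True" for c c'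
   by (rule exI[of _ "\<lambda>l. c l + c' l"]) (simp add: cfun.scale_left_distrib sum.distrib)
  show "\<exists>c'. fscale a (\<Sum>l<r. fscale (c l) (b l)) = (\<Sum>l<r. fscale (c' l) (b l)) \<and> True" for a c
   by (rule exI[of _ "\<lambda>l. a * c l"]) (simp add: cfun.scale_sum_right)
 qed
 moreover have "b ` {..<r} \<subseteq> ?R"
 proof safe
  fix l assume "l < r"
  then have "b l = (\<Sum>j<r. fscale (if j = l then 1 else 0) (b j))"
   by (simp add: fun_eq_iff sum_fun_apply if_distrib if_distribR cong: if_cong)
  then show "\<exists>c. b l = (\<Sum>l<r. fscale (c l) (b l)) \<and> True"
   by (intro exI[of _ "\<lambda>j. if j = l then 1 else 0"]) simp
 qed
 ultimately show "?L \<subseteq> ?R" by (rule cfun.span_minimal[rotated])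
 show "?R \<subseteq> ?L"
  by (auto intro!: cfun.span_sum intro: cfun.span_scale[OF cfun.span_base])
qed

text \<open>The first factor has a frame and the second is an arbitrary subspace: collecting the
  terms that belong to each \<open>b l\<close> leaves one vector of \<open>T\<close> per frame
  element. It serves both for \<open>T\<close> a line and for \<open>T\<close> the direct sum of a
  symmetric power and a line.\<close>

lemma tensor_space_frame:
 assumes T: "cfun.subspace T"
 shows "tensor_space (cfun.span (b ` {..<r::nat})) T
  = {\<Sum>l<r. tens (b l) (v l) |v. \<forall>l<r. v l \<in> T}" (is "?L = ?R")
proof
 have "cfun.subspace ?R"
  unfolding cfun.subspace_def
 proof safe
  show "\<exists>v. 0 = (\<Sum>l<r. tens (b l) (v l)) \<and> (\<forall>l<r. v l \<in> T)"
   by (rule exI[of _ "\<lambda>_. 0"]) (simp add: tens_zero_right cfun.subspace_0[OF T])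
  show "\<exists>w. (\<Sum>l<r. tens (b l) (v l)) + (\<Sum>l<r. tens (b l) (v' l)) = (\<Sum>l<r. tens (b l) (w l)) \<and> (\<forall>l<r. w l \<in> T)"
   if "\<forall>l<r. v l \<in> T" "\<forall>l<r. v' l \<in> T" for v v'
   by (rule exI[of _ "\<lambda>l. v l + v' l"])
    (simp add: tens_add_right sum.distrib cfun.subspace_add[OF T] that)
  show "\<exists>w. fscale a (\<Sum>l<r. tens (b l) (v l)) = (\<Sum>l<r. tens (b l) (w l)) \<and> (\<forall>l<r. w l \<in> T)"
   if "\<forall>l<r. v l \<in> T" for a v
   by (rule exI[of _ "\<lambda>l. fscale a (v l)"])
    (simp add: cfun.scale_sum_right tens_fscale_right cfun.subspace_scale[OF T] that)
 qed
 moreover have "{tens u v |u v. u \<in> cfun.span (b ` {..<r}) \<and> v \<in> T} \<subseteq> ?R"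
 proof safe
  fix u v assume u: "u \<in> cfun.span (b ` {..<r})" and v: "v \<in> T"
  obtain c where "u = (\<Sum>l<r. fscale (c l) (b l))" using u unfolding span_frame by blast
  then have "tens u v = (\<Sum>l<r. tens (b l) (fscale (c l) v))"
   by (simp add: tens_sum_left tens_fscale_left tens_fscale_right)
  then show "\<exists>w. tens u v = (\<Sum>l<r. tens (b l) (w l)) \<and> (\<forall>l<r. w l \<in> T)"
   using cfun.subspace_scale[OF T v] by (intro exI[of _ "\<lambda>l. fscale (c l) v"]) simp
 qed
 ultimately show "?L \<subseteq> ?R" unfolding tensor_space_def by (rule cfun.span_minimal[rotated])
 show "?R \<subseteq> ?L"
 proof safe
  fix v assume v: "\<forall>l<r. v l \<in> T"
  show "(\<Sum>l<r. tens (b l) (v l)) \<in> ?L" unfolding tensor_space_def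
  proof (intro cfun.span_sum cfun.span_base)
   fix l assume "l \<in> {..<r}"
   then show "tens (b l) (v l) \<in> {tens u v |u v. u \<in> cfun.span (b ` {..<r}) \<and> v \<in> T}"
    using v cfun.span_base[of "b l" "b ` {..<r}"] by blast
  qed
 qed
qed

text \<open>Fixing the second index at \<open>a\<close> turns the tensor relation into a linear
  relation among the \<open>b l\<close> with coefficients \<open>v l a\<close>.\<close>

lemma tens_frame_zero:
 fixes r :: nat
 assumes ind: "\<And>c. (\<Sum>l<r. fscale (c l) (b l)) = 0 \<Longrightarrow> \<forall>l<r. c l = 0"
  and z: "(\<Sum>l<r. tens (b l) (v l)) = 0" and l: "l < r"
 shows "v l = 0"
proof
 fix a
 have "(\<Sum>l<r. fscale (v l a) (b l)) = 0"
 proof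
  fix e show "(\<Sum>l<r. fscale (v l a) (b l)) e = 0 e"
   using fun_cong[OF z, of "(e, a)"] by (simp add: sum_fun_apply mult.commute)
 qed
 then have "\<forall>l<r. v l a = 0" by (rule ind)
 then show "v l a = 0 a" using l by simp
qed

lemma vector_bundleD:
 assumes "vector_bundle A B" "(D, r, b) \<in> frames B"
 shows "rs_open A D"
  and "x \<in> D \<Longrightarrow> fiber B x = cfun.span ((\<lambda>l. b l x) ` {..<r})"
  and "x \<in> D \<Longrightarrow> (\<Sum>l<r. fscale (c l) (b l x)) = 0 \<Longrightarrow> \<forall>l<r. c l = 0"
  and "l < r \<Longrightarrow> hol_section A B D (b l)"
proof -
 have *: "rs_open A D \<and> (\<forall>x\<in>D. fiber B x = cfun.span ((\<lambda>l. b l x) ` {..<r}) \<and>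
   (\<forall>c. (\<Sum>l<r. fscale (c l) (b l x)) = 0 \<longrightarrow> (\<forall>l<r. c l = 0))) \<and>
   (\<forall>l<r. hol_section A B D (b l))"
  using bspec[OF conjunct2[OF assms(1)[unfolded vector_bundle_def]] assms(2)] by simp
 show "rs_open A D" using * by simp
 show "x \<in> D \<Longrightarrow> fiber B x = cfun.span ((\<lambda>l. b l x) ` {..<r})" using * by simp
 show "x \<in> D \<Longrightarrow> (\<Sum>l<r. fscale (c l) (b l x)) = 0 \<Longrightarrow> \<forall>l<r. c l = 0" using * by simp
 show "l < r \<Longrightarrow> hol_section A B D (b l)" using * by simp
qed

lemma vector_bundle_frame:
 assumes "vector_bundle A B" "x \<in> points A"
 obtains D r b where "(D, r, b) \<in> frames B" "x \<in> D"
 using assms unfolding vector_bundle_def by blast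

lemma hol_sectionD:
 assumes "hol_section A B U s" "(D, r, b) \<in> frames B"
 obtains c where "\<And>l. l < r \<Longrightarrow> hol_fun A (U \<inter> D) (c l)"
  "\<And>x. x \<in> U \<Longrightarrow> x \<in> D \<Longrightarrow> s x = (\<Sum>l<r. fscale (c l x) (b l x))"
 using assms unfolding hol_section_def by fast

lemma hol_section_subset: "hol_section A B U s \<Longrightarrow> V \<subseteq> U \<Longrightarrow> hol_section A B V s"
 unfolding hol_section_def
proof safe
 fix D r b
 assume s: "\<forall>(D, r, b)\<in>frames B. \<exists>c. (\<forall>l<r. hol_fun A (U \<inter> D) (c l)) \<and>
   (\<forall>x\<in>U \<inter> D. s x = (\<Sum>l<r. fscale (c l x) (b l x)))"
  and V: "V \<subseteq> U" and D: "(D, r, b) \<in> frames B"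
 then obtain c where c: "\<forall>l<r. hol_fun A (U \<inter> D) (c l)"
  "\<forall>x\<in>U \<inter> D. s x = (\<Sum>l<r. fscale (c l x) (b l x))" by fast
 show "\<exists>c. (\<forall>l<r. hol_fun A (V \<inter> D) (c l)) \<and> (\<forall>x\<in>V \<inter> D. s x = (\<Sum>l<r. fscale (c l x) (b l x)))"
  by (rule exI[of _ c]) (use c V in \<open>auto intro: hol_fun_subset\<close>)
qed

lemma hol_fun_mult: "hol_fun A U f \<Longrightarrow> hol_fun A U g \<Longrightarrow> hol_fun A U (\<lambda>y. f y * g y)"
 unfolding hol_fun_def comp_def by (fastforce intro: holomorphic_on_mult)

lemma hol_fun_sum: "(\<And>i. i \<in> I \<Longrightarrow> hol_fun A U (f i)) \<Longrightarrow> hol_fun A U (\<lambda>y. \<Sum>i\<in>I. f i y)"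
 unfolding hol_fun_def comp_def by (fastforce intro: holomorphic_on_sum)

text \<open>One frame suffices to test holomorphy, since the frame vectors are holomorphic sections
  themselves and so supply the transition coefficients \<open>d\<close> to every other
  frame.\<close>

lemma hol_section_frame:
 assumes A: "complex_atlas A" and B: "vector_bundle A B" and D: "(D, r, b) \<in> frames B"
  and U: "U \<subseteq> D" and c: "\<And>l. l < r \<Longrightarrow> hol_fun A U (c l)"
  and s: "\<And>x. x \<in> U \<Longrightarrow> s x = (\<Sum>l<r. fscale (c l x) (b l x))"
 shows "hol_section A B U s"
 unfolding hol_section_def
proof safe
 fix D' r' b' assume D': "(D', r', b') \<in> frames B"
 have "\<exists>d. (\<forall>m<r'. hol_fun A (D \<inter> D') (d m)) \<and>
   (\<forall>x\<in>D \<inter> D'. b l x = (\<Sum>m<r'. fscale (d m x) (b' m x)))" if "l < r" for l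
  using vector_bundleD(4)[OF B D that] D' unfolding hol_section_def by fast
 then obtain d where d: "\<And>l m. l < r \<Longrightarrow> m < r' \<Longrightarrow> hol_fun A (D \<inter> D') (d l m)"
  "\<And>l x. l < r \<Longrightarrow> x \<in> D \<Longrightarrow> x \<in> D' \<Longrightarrow> b l x = (\<Sum>m<r'. fscale (d l m x) (b' m x))"
  by (metis IntI)
 let ?e = "\<lambda>m x. \<Sum>l<r. c l x * d l m x"
 have "hol_fun A (U \<inter> D') (?e m)" if "m < r'" for m
  by (intro hol_fun_sum hol_fun_mult)
   (use c d(1) that U in \<open>blast intro: hol_fun_subset\<close>)+
 moreover have "s x = (\<Sum>m<r'. fscale (?e m x) (b' m x))" if "x \<in> U" "x \<in> D'" for x
 proof -
  have "s x = (\<Sum>l<r. fscale (c l x) (\<Sum>m<r'. fscale (d l m x) (b' m x)))"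
   using s[OF that(1)] d(2) that U by (auto intro!: sum.cong)
  also have "\<dots> = (\<Sum>m<r'. \<Sum>l<r. fscale (c l x * d l m x) (b' m x))"
   by (subst sum.swap) (simp add: cfun.scale_sum_right)
  finally show ?thesis by (simp add: cfun.scale_sum_left)
 qed
 ultimately show "\<exists>c. (\<forall>l<r'. hol_fun A (U \<inter> D') (c l)) \<and>
   (\<forall>x\<in>U \<inter> D'. s x = (\<Sum>l<r'. fscale (c l x) (b' l x)))"
  by (intro exI[of _ ?e]) simp
qed

section \<open>Sections and orders of vanishing in a local frame\<close>

context
 fixes A :: "'p chart set" and B :: "('p, 'a) vbundle" and D r b and x :: 'p
 assumes A: "complex_atlas A" and B: "vector_bundle A B"
  and D: "(D, r, b) \<in> frames B" and x: "x \<in> D"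
begin

lemma frame_dom_points: "x \<in> points A"
 using vector_bundleD(1)[OF B D] x rs_open_subset by blast

lemma eventually_in_frame: "\<forall>\<^sub>F y in nhds_rs A x. y \<in> D"
 by (rule eventually_rs_open[OF A vector_bundleD(1)[OF B D] x])

lemma frame_coeff_unique:
 assumes "y \<in> D" "(\<Sum>l<r. fscale (c l) (b l y)) = (\<Sum>l<r. fscale (c' l) (b l y))" "l < r"
 shows "c l = c' l"
proof -
 have "(\<Sum>l<r. fscale (c l - c' l) (b l y)) = 0"
  using assms(2) by (simp add: cfun.scale_left_diff_distrib sum_subtractf)
 then show ?thesis using vector_bundleD(3)[OF B D assms(1), of "\<lambda>l. c l - c' l"] assms(3) by auto
qed

lemma hol_section_germ:
 assumes c: "\<And>l. l < r \<Longrightarrow> hol_at A x (c l)" and P: "eventually P (nhds_rs A x)"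
 obtains U where "rs_open A U" "x \<in> U" "U \<subseteq> D" "\<And>l. l < r \<Longrightarrow> hol_fun A U (c l)" "\<And>y. y \<in> U \<Longrightarrow> P y"
  "hol_section A B U (\<lambda>y. \<Sum>l<r. fscale (c l y) (b l y))"
proof -
 note xp = frame_dom_points
 have "\<forall>\<^sub>F y in nhds_rs A x. \<forall>l\<in>{..<r}. hol_at A y (c l)"
  using hol_at_eventually[OF A xp] c by (intro eventually_ball_finite) auto
 then have "\<forall>\<^sub>F y in nhds_rs A x. (\<forall>l<r. hol_at A y (c l)) \<and> P y \<and> y \<in> D"
  using P eventually_in_frame by eventually_elim auto
 then obtain U where U: "rs_open A U" "x \<in> U" "\<forall>y\<in>U. (\<forall>l<r. hol_at A y (c l)) \<and> P y \<and> y \<in> D"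
  unfolding eventually_nhds_rs[OF A xp] by blast
 have UD: "U \<subseteq> D" and h: "\<And>l. l < r \<Longrightarrow> hol_fun A U (c l)"
  using U hol_fun_iff_hol_at[OF A U(1)] by auto
 show ?thesis
  by (rule that[OF U(1,2) UD h]) (use U(3) hol_section_frame[OF A B D UD h] in auto)
qed

lemma local_sections_iff:
 "s \<in> local_sections A B x \<longleftrightarrow> (\<exists>c. (\<forall>l<r. hol_at A x (c l)) \<and>
   (\<forall>\<^sub>F y in nhds_rs A x. s y = (\<Sum>l<r. fscale (c l y) (b l y))))"
proof
 assume "s \<in> local_sections A B x"
 then obtain U where U: "rs_open A U" "x \<in> U" "hol_section A B U s"
  unfolding local_sections_def by blast
 obtain c where c: "\<And>l. l < r \<Longrightarrow> hol_fun A (U \<inter> D) (c l)"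
  "\<And>x. x \<in> U \<Longrightarrow> x \<in> D \<Longrightarrow> s x = (\<Sum>l<r. fscale (c l x) (b l x))"
  using hol_sectionD[OF U(3) D] by blast
 have UD: "rs_open A (U \<inter> D)" by (rule rs_open_Int[OF A U(1) vector_bundleD(1)[OF B D]])
 have "\<forall>\<^sub>F y in nhds_rs A x. y \<in> U \<inter> D" by (rule eventually_rs_open[OF A UD]) (use x U in auto)
 then have "\<forall>\<^sub>F y in nhds_rs A x. s y = (\<Sum>l<r. fscale (c l y) (b l y))"
  by eventually_elim (use c in auto)
 moreover have "\<forall>l<r. hol_at A x (c l)" unfolding hol_at_def using c(1) UD x U by blast
 ultimately show "\<exists>c. (\<forall>l<r. hol_at A x (c l)) \<and>
   (\<forall>\<^sub>F y in nhds_rs A x. s y = (\<Sum>l<r. fscale (c l y) (b l y)))" by blast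
next
 assume "\<exists>c. (\<forall>l<r. hol_at A x (c l)) \<and>
   (\<forall>\<^sub>F y in nhds_rs A x. s y = (\<Sum>l<r. fscale (c l y) (b l y)))"
 then obtain c where c: "\<forall>l<r. hol_at A x (c l)"
  "\<forall>\<^sub>F y in nhds_rs A x. s y = (\<Sum>l<r. fscale (c l y) (b l y))" by blast
 show "s \<in> local_sections A B x"
 proof (rule hol_section_germ[of c, OF c(1)[rule_format] c(2)])
  fix U assume U: "rs_open A U" "x \<in> U" "U \<subseteq> D" "\<And>l. l < r \<Longrightarrow> hol_fun A U (c l)"
   "\<And>y. y \<in> U \<Longrightarrow> s y = (\<Sum>l<r. fscale (c l y) (b l y))"
  have "hol_section A B U s" by (rule hol_section_frame[OF A B D U(3,4,5)])
  then show ?thesis using U(1,2) unfolding local_sections_def by blast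
 qed
qed

text \<open>The common factor in the definition multiplies all coefficients; conversely, finitely
  many coefficients divisible by the same power give one quotient section on a common
  neighbourhood.\<close>

lemma vanishes_to_order_iff:
 "vanishes_to_order A B m x s \<longleftrightarrow> (\<exists>c. (\<forall>l<r. vanish_at A m x (c l)) \<and>
   (\<forall>\<^sub>F y in nhds_rs A x. s y = (\<Sum>l<r. fscale (c l y) (b l y))))"
proof
 note xp = frame_dom_points
 assume "vanishes_to_order A B m x s"
 then obtain D' z U t where D': "(D', z) \<in> A" and U: "rs_open A U" "x \<in> U" "U \<subseteq> D'"
   "hol_section A B U t" and s: "\<forall>y\<in>U. s y = fscale ((z y - z x) ^ m) (t y)"
  unfolding vanishes_to_order_def by fast
 have xD': "x \<in> D'" using U by blast
 have "t \<in> local_sections A B x" using U unfolding local_sections_def by blast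
 then obtain c where c: "\<forall>l<r. hol_at A x (c l)"
   "\<forall>\<^sub>F y in nhds_rs A x. t y = (\<Sum>l<r. fscale (c l y) (b l y))"
  unfolding local_sections_iff by blast
 have "\<forall>l<r. vanish_at A m x (\<lambda>y. (z y - z x) ^ m * c l y)"
  using c(1) vanish_at_uniformizer_power[OF A xp uniformizer_coord[OF A D' xD']] by blast
 moreover have "\<forall>\<^sub>F y in nhds_rs A x. s y = (\<Sum>l<r. fscale ((z y - z x) ^ m * c l y) (b l y))"
  using c(2) eventually_rs_open[OF A U(1,2)]
  by eventually_elim (use s in \<open>auto simp: cfun.scale_sum_right\<close>)
 ultimately show "\<exists>c. (\<forall>l<r. vanish_at A m x (c l)) \<and>
   (\<forall>\<^sub>F y in nhds_rs A x. s y = (\<Sum>l<r. fscale (c l y) (b l y)))"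
  by (intro exI[of _ "\<lambda>l y. (z y - z x) ^ m * c l y"]) simp
next
 note xp = frame_dom_points
 assume "\<exists>c. (\<forall>l<r. vanish_at A m x (c l)) \<and>
   (\<forall>\<^sub>F y in nhds_rs A x. s y = (\<Sum>l<r. fscale (c l y) (b l y)))"
 then obtain c where c: "\<forall>l<r. vanish_at A m x (c l)"
   "\<forall>\<^sub>F y in nhds_rs A x. s y = (\<Sum>l<r. fscale (c l y) (b l y))" by blast
 obtain D' z where D': "(D', z) \<in> A" "x \<in> D'" using xp by (rule points_E)
 have "\<forall>l<r. \<exists>g. hol_at A x g \<and> (\<forall>\<^sub>F y in nhds_rs A x. c l y = (z y - z x) ^ m * g y)"
  using c(1) vanish_at_uniformizer[OF A uniformizer_coord[OF A D']] by blast
 then obtain g where g: "\<forall>l<r. hol_at A x (g l)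
   \<and> (\<forall>\<^sub>F y in nhds_rs A x. c l y = (z y - z x) ^ m * g l y)"
  by metis
 have "\<forall>\<^sub>F y in nhds_rs A x. \<forall>l\<in>{..<r}. c l y = (z y - z x) ^ m * g l y"
  using g by (intro eventually_ball_finite) auto
 then have ev: "\<forall>\<^sub>F y in nhds_rs A x. y \<in> D' \<and>
   s y = fscale ((z y - z x) ^ m) (\<Sum>l<r. fscale (g l y) (b l y))"
  using c(2) eventually_in_chart[OF A D']
  by eventually_elim (simp add: cfun.scale_sum_right)
 show "vanishes_to_order A B m x s"
 proof (rule hol_section_germ[of g, OF g[rule_format, THEN conjunct1] ev])
  fix U assume U: "rs_open A U" "x \<in> U"
   "\<And>y. y \<in> U \<Longrightarrow> y \<in> D' \<and> s y = fscale ((z y - z x) ^ m) (\<Sum>l<r. fscale (g l y) (b l y))"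
   "hol_section A B U (\<lambda>y. \<Sum>l<r. fscale (g l y) (b l y))"
  then have "U \<subseteq> D'" by blast
  with U D'(1) show ?thesis
   unfolding vanishes_to_order_def by (intro bexI[of _ "(D', z)"]) auto
 qed
qed

text \<open>Coefficients in a frame are unique, so those that witness the vanishing agree near
  \<open>x\<close> with the given ones.\<close>

lemma vanishes_coeff_iff:
 assumes c: "\<And>l. l < r \<Longrightarrow> hol_at A x (c l)"
  "\<forall>\<^sub>F y in nhds_rs A x. s y = (\<Sum>l<r. fscale (c l y) (b l y))"
 shows "vanishes_to_order A B m x s \<longleftrightarrow> (\<forall>l<r. vanish_at A m x (c l))"
proof
 note xp = frame_dom_points
 assume "vanishes_to_order A B m x s"
 then obtain c' where c': "\<forall>l<r. vanish_at A m x (c' l)"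
   "\<forall>\<^sub>F y in nhds_rs A x. s y = (\<Sum>l<r. fscale (c' l y) (b l y))"
  unfolding vanishes_to_order_iff by blast
 have "\<forall>\<^sub>F y in nhds_rs A x. \<forall>l<r. c l y = c' l y"
  using c(2) c'(2) eventually_in_frame
 proof eventually_elim
  case (elim y)
  have eq: "(\<Sum>l<r. fscale (c l y) (b l y)) = (\<Sum>l<r. fscale (c' l y) (b l y))"
   using elim(1,2) by (rule trans[OF sym])
  show ?case by (intro allI impI) (rule frame_coeff_unique[OF elim(3) eq])
 qed
 then have ev: "\<forall>\<^sub>F y in nhds_rs A x. c l y = c' l y" if "l < r" for l
  by eventually_elim (use that in auto)
 show "\<forall>l<r. vanish_at A m x (c l)"
  using c'(1) vanish_at_cong[OF A xp ev] by simp
qed (use c vanishes_to_order_iff in blast)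

end

context
 fixes A :: "'p chart set" and B :: "('p, 'a) vbundle" and x :: 'p
 assumes A: "complex_atlas A" and B: "vector_bundle A B" and xp: "x \<in> points A"
begin

lemma vanishes_lincomb:
 assumes "vanishes_to_order A B m x s" "vanishes_to_order A B m x t"
 shows "vanishes_to_order A B m x (\<lambda>y. fscale a (s y) + t y)"
proof -
 obtain D r b where D: "(D, r, b) \<in> frames B" "x \<in> D" using vector_bundle_frame[OF B xp] .
 obtain c d where c: "\<forall>l<r. vanish_at A m x (c l)"
   "\<forall>\<^sub>F y in nhds_rs A x. s y = (\<Sum>l<r. fscale (c l y) (b l y))"
  and d: "\<forall>l<r. vanish_at A m x (d l)"
   "\<forall>\<^sub>F y in nhds_rs A x. t y = (\<Sum>l<r. fscale (d l y) (b l y))"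
  using assms unfolding vanishes_to_order_iff[OF A B D] by blast
 have "\<forall>\<^sub>F y in nhds_rs A x. fscale a (s y) + t y = (\<Sum>l<r. fscale (a * c l y + d l y) (b l y))"
  using c(2) d(2) by eventually_elim
   (simp add: cfun.scale_sum_right cfun.scale_left_distrib sum.distrib)
 then show ?thesis unfolding vanishes_to_order_iff[OF A B D]
  using c(1) d(1) by (intro exI[of _ "\<lambda>l y. a * c l y + d l y"])
   (auto intro!: vanish_at_add[OF A xp] vanish_at_cmult[OF A xp])
qed

lemma local_sections_lincomb:
 assumes "s \<in> local_sections A B x" "t \<in> local_sections A B x"
 shows "(\<lambda>y. fscale a (s y) + t y) \<in> local_sections A B x"
proof -
 obtain D r b where D: "(D, r, b) \<in> frames B" "x \<in> D" using vector_bundle_frame[OF B xp] .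
 \<comment> \<open>Order \<open>0\<close> is no condition beyond holomorphy, so linear combinations
   of local sections are a case of \<open>vanishes_lincomb\<close>.\<close>
 have "s \<in> local_sections A B x \<longleftrightarrow> vanishes_to_order A B 0 x s" for s
  unfolding vanishes_to_order_iff[OF A B D] local_sections_iff[OF A B D] vanish_at_0[OF A xp] ..
 then show ?thesis using vanishes_lincomb[of 0] assms by blast
qed

lemma vanishes_local_section: "vanishes_to_order A B m x s \<Longrightarrow> s \<in> local_sections A B x"
proof -
 obtain D r b where D: "(D, r, b) \<in> frames B" "x \<in> D" using vector_bundle_frame[OF B xp] .
 show "vanishes_to_order A B m x s \<Longrightarrow> s \<in> local_sections A B x"
  unfolding vanishes_to_order_iff[OF A B D] local_sections_iff[OF A B D]
  using vanish_at_hol[OF A xp] by blast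
qed

lemma vanishes_zero: "vanishes_to_order A B m x 0"
proof -
 obtain D r b where D: "(D, r, b) \<in> frames B" "x \<in> D" using vector_bundle_frame[OF B xp] .
 show ?thesis unfolding vanishes_to_order_iff[OF A B D]
  by (rule exI[of _ "\<lambda>_ _. 0"]) (simp add: vanish_at_zero[OF A xp] cfun.scale_zero_left)
qed

lemma zero_local_section: "0 \<in> local_sections A B x"
 by (rule vanishes_local_section[OF vanishes_zero])

lemma vanishes_diff:
 assumes "vanishes_to_order A B m x s" "vanishes_to_order A B m x t"
 shows "vanishes_to_order A B m x (s - t)"
proof -
 have "s - t = (\<lambda>y. fscale (-1) (t y) + s y)" by (auto simp: fun_eq_iff)
 then show ?thesis using vanishes_lincomb[OF assms(2,1), of "-1"] by simp
qed

lemma local_sections_add: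
 assumes "s \<in> local_sections A B x" "t \<in> local_sections A B x"
 shows "s + t \<in> local_sections A B x"
proof -
 have "s + t = (\<lambda>y. fscale 1 (s y) + t y)" by (auto simp: fun_eq_iff)
 then show ?thesis using local_sections_lincomb[OF assms, of 1] by simp
qed

lemma jet_self: "s \<in> local_sections A B x \<Longrightarrow> s \<in> jet A B k x s"
 using vanishes_zero by (simp add: jet_def)

text \<open>\<open>jet\<close> is a coset of the sections vanishing to order \<open>k + 1\<close>,
  and two cosets of a subspace agree when their representatives differ by an element of it.\<close>

lemma jet_eq_iff:
 assumes s: "s \<in> local_sections A B x" and t: "t \<in> local_sections A B x"
 shows "jet A B k x s = jet A B k x t \<longleftrightarrow> vanishes_to_order A B (k + 1) x (s - t)"
proof
 assume "jet A B k x s = jet A B k x t"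
 then show "vanishes_to_order A B (k + 1) x (s - t)"
  using jet_self[OF s, of k] by (auto simp: jet_def)
next
 assume v: "vanishes_to_order A B (k + 1) x (s - t)"
 have "vanishes_to_order A B (k + 1) x (s' - s) \<longleftrightarrow> vanishes_to_order A B (k + 1) x (s' - t)" for s'
 proof
  assume w: "vanishes_to_order A B (k + 1) x (s' - s)"
  have "s' - t = (\<lambda>y. fscale 1 ((s' - s) y) + (s - t) y)" by (auto simp: fun_eq_iff)
  then show "vanishes_to_order A B (k + 1) x (s' - t)" using vanishes_lincomb[OF w v, of 1] by simp
 next
  assume w: "vanishes_to_order A B (k + 1) x (s' - t)"
  have "s' - s = (s' - t) - (s - t)" by simp
  then show "vanishes_to_order A B (k + 1) x (s' - s)" using vanishes_diff[OF w v] by simp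
 qed
 then show "jet A B k x s = jet A B k x t" by (simp add: jet_def)
qed

lemma vanishes_cong:
 assumes "\<forall>\<^sub>F y in nhds_rs A x. s y = t y"
 shows "vanishes_to_order A B m x s \<longleftrightarrow> vanishes_to_order A B m x t"
proof -
 obtain D r b where D: "(D, r, b) \<in> frames B" "x \<in> D" using vector_bundle_frame[OF B xp] .
 have "(\<forall>\<^sub>F y in nhds_rs A x. s y = h y) \<longleftrightarrow> (\<forall>\<^sub>F y in nhds_rs A x. t y = h y)" for h
  by (rule eventually_subst) (use assms in \<open>auto elim!: eventually_mono\<close>)
 then show ?thesis by (simp add: vanishes_to_order_iff[OF A B D])
qed

lemma local_sections_cong:
 assumes "\<forall>\<^sub>F y in nhds_rs A x. s y = t y"
 shows "s \<in> local_sections A B x \<longleftrightarrow> t \<in> local_sections A B x"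
proof -
 obtain D r b where D: "(D, r, b) \<in> frames B" "x \<in> D" using vector_bundle_frame[OF B xp] .
 have "(\<forall>\<^sub>F y in nhds_rs A x. s y = h y) \<longleftrightarrow> (\<forall>\<^sub>F y in nhds_rs A x. t y = h y)" for h
  by (rule eventually_subst) (use assms in \<open>auto elim!: eventually_mono\<close>)
 then show ?thesis by (simp add: local_sections_iff[OF A B D])
qed

end

text \<open>\<open>hol_section\<close> asks for coefficients on all of \<open>U \<inter> D\<close>
  at once. They can be chosen point by point, since uniqueness forces any choice to agree near each
  point with the holomorphic coefficients found there.\<close>

lemma hol_section_iff_local:
 assumes A: "complex_atlas A" and B: "vector_bundle A B" and U: "rs_open A U"
 shows "hol_section A B U s \<longleftrightarrow> (\<forall>x\<in>U. s \<in> local_sections A B x)"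
proof
 assume "hol_section A B U s" then show "\<forall>x\<in>U. s \<in> local_sections A B x"
  using U unfolding local_sections_def by blast
next
 assume *: "\<forall>x\<in>U. s \<in> local_sections A B x"
 show "hol_section A B U s" unfolding hol_section_def
 proof safe
  fix D r b assume D: "(D, r, b) \<in> frames B"
  have "\<forall>x\<in>D. s x \<in> fiber B x \<longrightarrow> (\<exists>c. s x = (\<Sum>l<r. fscale (c l) (b l x)))"
   using vector_bundleD(2)[OF B D] unfolding span_frame by blast
  then obtain c where c: "\<And>x. x \<in> D \<Longrightarrow> s x \<in> fiber B x \<Longrightarrow> s x = (\<Sum>l<r. fscale (c x l) (b l x))"
   by metis
  have loc: "s x \<in> fiber B x \<and> (\<forall>l<r. hol_at A x (\<lambda>y. c y l))" if x: "x \<in> U" "x \<in> D" for x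
  proof -
   have xp: "x \<in> points A" using U x rs_open_subset by blast
   obtain d where d: "\<forall>l<r. hol_at A x (d l)"
    "\<forall>\<^sub>F y in nhds_rs A x. s y = (\<Sum>l<r. fscale (d l y) (b l y))"
    using *[rule_format, OF x(1)] unfolding local_sections_iff[OF A B D x(2)] by blast
   have fib: "s y \<in> fiber B y" if "y \<in> D" "s y = (\<Sum>l<r. fscale (d l y) (b l y))" for y
    unfolding vector_bundleD(2)[OF B D that(1)] span_frame
    by (intro CollectI exI[of _ "\<lambda>l. d l y"]) (simp add: that(2))
   have "\<forall>\<^sub>F y in nhds_rs A x. \<forall>l<r. c y l = d l y"
    using d(2) eventually_in_frame[OF A B D x(2)]
   proof eventually_elim
    case (elim y)
    have "(\<Sum>l<r. fscale (c y l) (b l y)) = (\<Sum>l<r. fscale (d l y) (b l y))"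
     using c[OF elim(2) fib[OF elim(2,1)]] elim(1) by (rule trans[OF sym])
    from frame_coeff_unique[OF A B D x(2) elim(2) this] show ?case by simp
   qed
   then have ev: "\<forall>\<^sub>F y in nhds_rs A x. c y l = d l y" if "l < r" for l
    by eventually_elim (use that in auto)
   have "\<forall>l<r. hol_at A x (\<lambda>y. c y l)"
    using hol_at_cong[OF A xp ev] d(1) by simp
   moreover have "s x \<in> fiber B x"
    by (rule fib[OF x(2) eventually_nhds_rs_x[OF A xp d(2)]])
   ultimately show ?thesis by blast
  qed
  have "rs_open A (U \<inter> D)" by (rule rs_open_Int[OF A U vector_bundleD(1)[OF B D]])
  then have "\<forall>l<r. hol_fun A (U \<inter> D) (\<lambda>y. c y l)"
   using loc hol_fun_iff_hol_at[OF A] by auto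
  then show "\<exists>c. (\<forall>l<r. hol_fun A (U \<inter> D) (c l)) \<and>
    (\<forall>x\<in>U \<inter> D. s x = (\<Sum>l<r. fscale (c l x) (b l x)))"
   using loc c by (intro exI[of _ "\<lambda>l y. c y l"]) auto
 qed
qed

section \<open>Line bundles and tensor products with them\<close>

definition line_bundle :: "'p chart set \<Rightarrow> ('p, 'a) vbundle \<Rightarrow> bool" where
 "line_bundle A C \<longleftrightarrow> vector_bundle A C \<and> (\<forall>(D, r, b)\<in>frames C. r = 1)"

text \<open>The index arithmetic with \<open>div\<close> and \<open>mod\<close> in
  \<open>tensor_bundle\<close> disappears when the second factor has rank one.\<close>

lemma frames_tensor_line:
 assumes "line_bundle A C"
 shows "frames (tensor_bundle B C) =
  {(D \<inter> D', r, \<lambda>l x. tens (b l x) (b' 0 x)) |D r b D' b'. (D, r, b) \<in> frames B \<and> (D', 1, b') \<in> frames C}"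
 (is "?L = ?R")
proof
 show "?L \<subseteq> ?R"
 proof
  fix f assume "f \<in> ?L"
  then obtain D r b D' r' b' where f: "f = (D \<inter> D', r * r', \<lambda>l x. tens (b (l div r') x) (b' (l mod r') x))"
   and B: "(D, r, b) \<in> frames B" and C: "(D', r', b') \<in> frames C"
   by (auto simp: tensor_bundle_def)
  have "r' = 1" using assms C by (auto simp: line_bundle_def)
  then show "f \<in> ?R" using f B C by auto
 qed
 show "?R \<subseteq> ?L"
 proof
  fix f assume "f \<in> ?R"
  then obtain D r b D' b' where f: "f = (D \<inter> D', r, \<lambda>l x. tens (b l x) (b' 0 x))"
   and B: "(D, r, b) \<in> frames B" and C: "(D', 1, b') \<in> frames C"
   by blast
  then have "f = (D \<inter> D', r * 1, \<lambda>l x. tens (b (l div 1) x) (b' (l mod 1) x))" by simp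
  with B C have "\<exists>D r b D' r' b'. f = (D \<inter> D', r * r', \<lambda>l x. tens (b (l div r') x) (b' (l mod r') x)) \<and>
    (D, r, b) \<in> frames B \<and> (D', r', b') \<in> frames C"
   by (intro exI conjI)
  then show "f \<in> ?L" unfolding tensor_bundle_def by simp
 qed
qed

lemma line_frame_nonzero:
 assumes "line_bundle A C" "(D, 1, b) \<in> frames C" "x \<in> D"
 shows "b 0 x \<noteq> 0"
proof -
 have "vector_bundle A C" using assms(1) by (simp add: line_bundle_def)
 from vector_bundleD(3)[OF this assms(2,3), where c = "\<lambda>_. 1"] show ?thesis
  by (auto simp: cfun.scale_zero_right)
qed

lemma fiber_line:
 assumes "line_bundle A C" "(D, 1, b) \<in> frames C" "x \<in> D"
 shows "fiber C x = range (\<lambda>c. fscale c (b 0 x))"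
proof -
 have "vector_bundle A C" using assms(1) by (simp add: line_bundle_def)
 from vector_bundleD(2)[OF this assms(2,3)] show ?thesis by (simp add: cfun.span_singleton lessThan_Suc)
qed

lemma vector_bundle_tensor_line:
 assumes A: "complex_atlas A" and B: "vector_bundle A B" and L: "line_bundle A C"
 shows "vector_bundle A (tensor_bundle B C)"
proof -
 have C: "vector_bundle A C" using L by (simp add: line_bundle_def)
 have fib: "fiber (tensor_bundle B C) x = cfun.span ((\<lambda>l. tens (b l x) (b' 0 x)) ` {..<r})"
  if "(D, r, b) \<in> frames B" "(D', 1, b') \<in> frames C" "x \<in> D" "x \<in> D'" for D r b D' b' x
 proof -
  have "cfun.subspace (fiber C x)"
   using vector_bundleD(2)[OF C that(2,4)] by simp
  then have "fiber (tensor_bundle B C) x = {\<Sum>l<r. tens (b l x) (v l) |v. \<forall>l<r. v l \<in> fiber C x}"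
   using vector_bundleD(2)[OF B that(1,3)]
   by (simp add: tensor_bundle_def tensor_space_frame)
  also have "\<dots> = {\<Sum>l<r. fscale (c l) (tens (b l x) (b' 0 x)) |c. True}"
  proof safe
   fix v assume "\<forall>l<r. v l \<in> fiber C x"
   then have "\<forall>l<r. \<exists>c. v l = fscale c (b' 0 x)"
    unfolding fiber_line[OF L that(2,4)] by blast
   then obtain c where "\<And>l. l < r \<Longrightarrow> v l = fscale (c l) (b' 0 x)" by metis
   then have "(\<Sum>l<r. tens (b l x) (v l)) = (\<Sum>l<r. fscale (c l) (tens (b l x) (b' 0 x)))"
    by (simp add: tens_fscale_right)
   then show "\<exists>c. (\<Sum>l<r. tens (b l x) (v l)) = (\<Sum>l<r. fscale (c l) (tens (b l x) (b' 0 x))) \<and> True"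
    by blast
  next
   fix c :: "nat \<Rightarrow> complex"
   show "\<exists>v. (\<Sum>l<r. fscale (c l) (tens (b l x) (b' 0 x))) = (\<Sum>l<r. tens (b l x) (v l)) \<and>
       (\<forall>l<r. v l \<in> fiber C x)"
    by (rule exI[of _ "\<lambda>l. fscale (c l) (b' 0 x)"])
     (auto simp: fiber_line[OF L that(2,4)] tens_fscale_right)
  qed
  finally show ?thesis unfolding span_frame .
 qed
 have ind: "\<forall>l<r. c l = 0"
  if "(D, r, b) \<in> frames B" "(D', 1, b') \<in> frames C" "x \<in> D" "x \<in> D'"
   "(\<Sum>l<r. fscale (c l) (tens (b l x) (b' 0 x))) = 0" for D r b D' b' x c
 proof safe
  fix l assume l: "l < r"
  have "fscale (c l) (b' 0 x) = 0"
   by (rule tens_frame_zero[of "\<lambda>l. b l x" r "\<lambda>l. fscale (c l) (b' 0 x)", OF vector_bundleD(3)[OF B that(1,3)] _ l])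
    (use that(5) in \<open>simp_all add: tens_fscale_right\<close>)
  then show "c l = 0" using line_frame_nonzero[OF L that(2,4)] by (simp add: cfun.scale_eq_0_iff)
 qed
 have hol: "hol_section A (tensor_bundle B C) (D \<inter> D') (\<lambda>x. tens (b l x) (b' 0 x))"
  if D: "(D, r, b) \<in> frames B" "(D', 1, b') \<in> frames C" "l < r" for D r b D' b' l
  unfolding hol_section_def frames_tensor_line[OF L]
 proof safe
  fix D2 r2 b2 D2' b2'
  assume D2: "(D2, r2, b2) \<in> frames B" "(D2', 1::nat, b2') \<in> frames C"
  obtain c where c: "\<And>m. m < r2 \<Longrightarrow> hol_fun A (D \<inter> D2) (c m)"
   "\<And>x. x \<in> D \<Longrightarrow> x \<in> D2 \<Longrightarrow> b l x = (\<Sum>m<r2. fscale (c m x) (b2 m x))"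
   by (rule hol_sectionD[OF vector_bundleD(4)[OF B D(1,3)] D2(1)]) (rule that)
  obtain d where d: "\<And>m. m < 1 \<Longrightarrow> hol_fun A (D' \<inter> D2') (d m)"
   "\<And>x. x \<in> D' \<Longrightarrow> x \<in> D2' \<Longrightarrow> b' 0 x = (\<Sum>m<1::nat. fscale (d m x) (b2' m x))"
   by (rule hol_sectionD[OF vector_bundleD(4)[OF C D(2) zero_less_one] D2(2)]) (rule that)
  show "\<exists>c. (\<forall>la<r2. hol_fun A (D \<inter> D' \<inter> (D2 \<inter> D2')) (c la)) \<and>
     (\<forall>x\<in>D \<inter> D' \<inter> (D2 \<inter> D2'). tens (b l x) (b' 0 x) = (\<Sum>l<r2. fscale (c l x) (tens (b2 l x) (b2' 0 x))))"
  proof (intro exI[of _ "\<lambda>m x. c m x * d 0 x"] conjI allI impI ballI)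
   fix m assume m: "m < r2"
   show "hol_fun A (D \<inter> D' \<inter> (D2 \<inter> D2')) (\<lambda>x. c m x * d 0 x)"
    by (rule hol_fun_mult[OF hol_fun_subset[OF c(1)[OF m]] hol_fun_subset[OF d(1)]]) auto
  next
   fix x assume x: "x \<in> D \<inter> D' \<inter> (D2 \<inter> D2')"
   show "tens (b l x) (b' 0 x) = (\<Sum>l<r2. fscale (c l x * d 0 x) (tens (b2 l x) (b2' 0 x)))"
    using c(2)[of x] d(2)[of x] x
    by (simp add: tens_def fun_eq_iff sum_fun_apply sum_distrib_right sum_distrib_left mult_ac)
  qed
 qed
 show ?thesis unfolding vector_bundle_def
 proof (intro conjI)
  show "(\<Union>(D, r, b)\<in>frames (tensor_bundle B C). D) = points A"
  proof safe
   fix x D r b assume "(D, r, b) \<in> frames (tensor_bundle B C)" "x \<in> D"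
   then obtain D1 r1 b1 where "(D1, r1, b1) \<in> frames B" "x \<in> D1"
    unfolding frames_tensor_line[OF L] by blast
   then show "x \<in> points A" by (rule frame_dom_points[OF A B])
  next
   fix x assume x: "x \<in> points A"
   obtain D r b where D: "(D, r, b) \<in> frames B" "x \<in> D" using vector_bundle_frame[OF B x] .
   obtain D' r' b' where D': "(D', r', b') \<in> frames C" "x \<in> D'" using vector_bundle_frame[OF C x] .
   have "r' = 1" using L D' by (auto simp: line_bundle_def)
   then have "(D \<inter> D', r, \<lambda>l x. tens (b l x) (b' 0 x)) \<in> frames (tensor_bundle B C)"
    unfolding frames_tensor_line[OF L] using D D' by blast
   then show "x \<in> (\<Union>(D, r, b)\<in>frames (tensor_bundle B C). D)" using D D' by blast
  qed
  show "\<forall>(D, r, b)\<in>frames (tensor_bundle B C). rs_open A D \<and>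
    (\<forall>x\<in>D. fiber (tensor_bundle B C) x = cfun.span ((\<lambda>l. b l x) ` {..<r}) \<and>
        (\<forall>c. (\<Sum>l<r. fscale (c l) (b l x)) = 0 \<longrightarrow> (\<forall>l<r. c l = 0))) \<and>
    (\<forall>l<r. hol_section A (tensor_bundle B C) D (b l))"
   unfolding frames_tensor_line[OF L]
  proof (safe, goal_cases)
   case (1 _ _ _ D r b D' b')
   then show ?case using rs_open_Int[OF A vector_bundleD(1)[OF B] vector_bundleD(1)[OF C]] by blast
  next
   case (2 _ _ _ D r b D' b' x a) then show ?case using fib[of D r b D' b' x] by simp
  next
   case (3 _ _ _ D r b D' b' x a) then show ?case using fib[of D r b D' b' x] by simp
  next
   case (4 _ _ _ D r b D' b' x c l) then show ?case using ind[of D r b D' b' x c] by simp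
  next
   case (5 _ _ _ D r b D' b' l) then show ?case using hol[of D r b D' b' l] by simp
  qed
 qed
qed

text \<open>A vector \<open>u y\<close> on which the frame takes the value \<open>1\<close> turns
  the coefficient of a section into the evaluation \<open>s y (u y)\<close>. Sections of a line
  bundle thus become ordinary functions, provided that membership of the values in the fibres is
  stated separately.\<close>

lemma line_local_sections_iff:
 assumes A: "complex_atlas A" and C: "line_bundle A C" and D: "(D, 1, b) \<in> frames C" "x \<in> D"
  and u: "\<And>y. y \<in> D \<Longrightarrow> b 0 y (u y) = 1"
 shows "s \<in> local_sections A C x \<longleftrightarrow>
     (\<forall>\<^sub>F y in nhds_rs A x. s y \<in> fiber C y) \<and> hol_at A x (\<lambda>y. s y (u y))" (is ?T1)
  and "vanishes_to_order A C m x s \<longleftrightarrow>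
     (\<forall>\<^sub>F y in nhds_rs A x. s y \<in> fiber C y) \<and> vanish_at A m x (\<lambda>y. s y (u y))" (is ?T2)
proof -
 have VC: "vector_bundle A C" using C by (simp add: line_bundle_def)
 have xp: "x \<in> points A" by (rule frame_dom_points[OF A VC D])
 have fib: "v \<in> fiber C y \<longleftrightarrow> v = fscale (v (u y)) (b 0 y)" if y: "y \<in> D" for v y
 proof
  assume "v \<in> fiber C y"
  then obtain c where "v = fscale c (b 0 y)" unfolding fiber_line[OF C D(1) y] by blast
  then show "v = fscale (v (u y)) (b 0 y)" using u[OF y] by simp
 qed (auto simp: fiber_line[OF C D(1) y])
 show ?T2
 proof
  assume "vanishes_to_order A C m x s"
  then obtain c where c: "vanish_at A m x (c 0)"
   "\<forall>\<^sub>F y in nhds_rs A x. s y = fscale (c (0::nat) y) (b 0 y)"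
   unfolding vanishes_to_order_iff[OF A VC D] by auto
  have "\<forall>\<^sub>F y in nhds_rs A x. s y \<in> fiber C y \<and> s y (u y) = c 0 y"
   using c(2) eventually_in_frame[OF A VC D]
   by eventually_elim (auto simp: fib u)
  then have e: "\<forall>\<^sub>F y in nhds_rs A x. s y \<in> fiber C y" "\<forall>\<^sub>F y in nhds_rs A x. s y (u y) = c 0 y"
   by (auto simp: eventually_conj_iff)
  show "(\<forall>\<^sub>F y in nhds_rs A x. s y \<in> fiber C y) \<and> vanish_at A m x (\<lambda>y. s y (u y))"
   using c(1) vanish_at_cong[OF A xp e(2)] e(1) by simp
 next
  assume R: "(\<forall>\<^sub>F y in nhds_rs A x. s y \<in> fiber C y) \<and> vanish_at A m x (\<lambda>y. s y (u y))"
  have "\<forall>\<^sub>F y in nhds_rs A x. s y = fscale (s y (u y)) (b 0 y)"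
   using conjunct1[OF R] eventually_in_frame[OF A VC D] by eventually_elim (simp add: fib)
  then show "vanishes_to_order A C m x s"
   unfolding vanishes_to_order_iff[OF A VC D]
   using R by (intro exI[of _ "\<lambda>_ y. s y (u y)"]) simp
 qed
 show ?T1
 proof
  assume "s \<in> local_sections A C x"
  then obtain c where c: "hol_at A x (c 0)"
   "\<forall>\<^sub>F y in nhds_rs A x. s y = fscale (c (0::nat) y) (b 0 y)"
   unfolding local_sections_iff[OF A VC D] by auto
  have "\<forall>\<^sub>F y in nhds_rs A x. s y \<in> fiber C y \<and> s y (u y) = c 0 y"
   using c(2) eventually_in_frame[OF A VC D]
   by eventually_elim (auto simp: fib u)
  then have e: "\<forall>\<^sub>F y in nhds_rs A x. s y \<in> fiber C y" "\<forall>\<^sub>F y in nhds_rs A x. s y (u y) = c 0 y"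
   by (auto simp: eventually_conj_iff)
  show "(\<forall>\<^sub>F y in nhds_rs A x. s y \<in> fiber C y) \<and> hol_at A x (\<lambda>y. s y (u y))"
   using c(1) hol_at_cong[OF A xp e(2)] e(1) by simp
 next
  assume R: "(\<forall>\<^sub>F y in nhds_rs A x. s y \<in> fiber C y) \<and> hol_at A x (\<lambda>y. s y (u y))"
  have "\<forall>\<^sub>F y in nhds_rs A x. s y = fscale (s y (u y)) (b 0 y)"
   using conjunct1[OF R] eventually_in_frame[OF A VC D] by eventually_elim (simp add: fib)
  then show "s \<in> local_sections A C x"
   unfolding local_sections_iff[OF A VC D]
   using R by (intro exI[of _ "\<lambda>_ y. s y (u y)"]) simp
 qed
qed

section \<open>Powers of a quotient line\<close>

text \<open>A hyperplane is carried together with a linear form cutting it out: \<open>lam\<close>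
  embeds S/T into the complex numbers, so elements of powers of the quotient line become multiples
  of powers of \<open>lam\<close>.\<close>

definition hyperplane_fun ::
  "('a \<Rightarrow> complex) set \<Rightarrow> ('a \<Rightarrow> complex) set \<Rightarrow> (('a \<Rightarrow> complex) \<Rightarrow> complex) \<Rightarrow> bool" where
 "hyperplane_fun S T lam \<longleftrightarrow> cfun.subspace S \<and> linear_fun_on S lam \<and> T = {v \<in> S. lam v = 0}"

context
 fixes S T :: "('a \<Rightarrow> complex) set" and lam :: "('a \<Rightarrow> complex) \<Rightarrow> complex"
 assumes H: "hyperplane_fun S T lam"
begin

lemma hyperplane_T: "v \<in> T \<longleftrightarrow> v \<in> S \<and> lam v = 0"
 using H by (simp add: hyperplane_fun_def)

lemma hyperplane_lin: "u \<in> S \<Longrightarrow> v \<in> S \<Longrightarrow> lam (fscale c u + v) = c * lam u + lam v"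
 using H by (simp add: hyperplane_fun_def linear_fun_on_def)

lemma hyperplane_closed: "u \<in> S \<Longrightarrow> v \<in> S \<Longrightarrow> fscale c u + v \<in> S"
 using H by (simp add: hyperplane_fun_def cfun.subspace_add cfun.subspace_scale)

lemma hyperplane_decomp:
 assumes "u \<in> S" "lam u \<noteq> 0" "v \<in> S"
 obtains a where "a \<in> T" "v = fscale (lam v / lam u) u + a"
proof
 let ?a = "fscale (- (lam v / lam u)) u + v"
 show "?a \<in> T"
  using assms hyperplane_closed[OF assms(1,3), of "- (lam v / lam u)"]
   hyperplane_lin[OF assms(1,3), of "- (lam v / lam u)"] by (simp add: hyperplane_T)
 show "v = fscale (lam v / lam u) u + ?a" by (auto simp: fun_eq_iff)
qed

lemma quot_coord_eq:
 assumes u: "u \<in> S" "lam u \<noteq> 0"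
 shows "quot_coord S T u = (\<lambda>v. if v \<in> S then lam v / lam u else 0)" (is "_ = ?\<xi>")
 unfolding quot_coord_def
proof (rule the_equality)
 have "linear_fun_on S ?\<xi>" unfolding linear_fun_on_def
  using hyperplane_closed hyperplane_lin by (auto simp: add_divide_distrib)
 then show "?\<xi> \<in> dual_space S \<and> (\<forall>a\<in>T. ?\<xi> a = 0) \<and> ?\<xi> u = 1"
  using u by (auto simp: dual_space_def hyperplane_T)
next
 fix \<xi> assume \<xi>: "\<xi> \<in> dual_space S \<and> (\<forall>a\<in>T. \<xi> a = 0) \<and> \<xi> u = 1"
 show "\<xi> = ?\<xi>"
 proof
  fix v
  show "\<xi> v = ?\<xi> v"
  proof (cases "v \<in> S")
   case True
   obtain a where a: "a \<in> T" "v = fscale (lam v / lam u) u + a"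
    using hyperplane_decomp[OF u True] .
   have "\<xi> (fscale (lam v / lam u) u + a) = lam v / lam u * \<xi> u + \<xi> a"
    using \<xi> u(1) a(1) by (simp add: dual_space_def linear_fun_on_def hyperplane_T)
   then have "\<xi> v = lam v / lam u * \<xi> u + \<xi> a" by (simp flip: a(2))
   then show ?thesis using True \<xi> a(1) by simp
  qed (use \<xi> in \<open>simp add: dual_space_def\<close>)
 qed
qed

lemma quot_power_value:
 assumes f: "f \<in> quot_power S T m" and u: "u \<in> S" "lam u \<noteq> 0"
 shows "f v = (if v \<in> S \<and> lam v \<noteq> 0 then f u * (lam v / lam u) powi (- m) else 0)"
proof (cases "v \<in> S \<and> lam v \<noteq> 0")
 case True
 then obtain a where a: "a \<in> T" "v = fscale (lam v / lam u) u + a"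
  using hyperplane_decomp[OF u] by blast
 have "u \<in> S - T" using u by (simp add: hyperplane_T)
 then have "f (fscale (lam v / lam u) u + a) = (lam v / lam u) powi (- m) * f u"
  using f a(1) u True unfolding quot_power_def by simp
 then show ?thesis using True a(2) by simp
next
 case False
 then have "v \<notin> S - T" by (auto simp: hyperplane_T)
 then show ?thesis using f False by (auto simp: quot_power_def)
qed

text \<open>The coordinate of a fixed element scales by \<open>c powi (- m)\<close> when the basis
  [u] scales by \<open>c\<close>. Since \<open>lam\<close> measures the class of \<open>u\<close>,
  the coordinate must be a multiple of \<open>lam u powi (- m)\<close>.\<close>

lemma quot_power_iff:
 "f \<in> quot_power S T m \<longleftrightarrow> (\<exists>C. f = (\<lambda>u. if u \<in> S \<and> lam u \<noteq> 0 then C * lam u powi (- m) else 0))"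
proof
 assume f: "f \<in> quot_power S T m"
 show "\<exists>C. f = (\<lambda>u. if u \<in> S \<and> lam u \<noteq> 0 then C * lam u powi (- m) else 0)"
 proof (cases "\<exists>u\<in>S. lam u \<noteq> 0")
  case True
  then obtain u where u: "u \<in> S" "lam u \<noteq> 0" by blast
  show ?thesis
   by (rule exI[of _ "f u * (1 / lam u) powi (- m)"], rule ext, subst quot_power_value[OF f u])
    (simp flip: power_int_mult_distrib)
 next
  case False
  then have "f v = 0" for v using f by (auto simp: quot_power_def hyperplane_T)
  then show ?thesis using False by (intro exI[of _ 0] ext) auto
 qed
next
 assume "\<exists>C. f = (\<lambda>u. if u \<in> S \<and> lam u \<noteq> 0 then C * lam u powi (- m) else 0)"
 then obtain C where f: "f = (\<lambda>u. if u \<in> S \<and> lam u \<noteq> 0 then C * lam u powi (- m) else 0)" by blast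
 show "f \<in> quot_power S T m" unfolding quot_power_def f
  using hyperplane_closed hyperplane_lin by (auto simp: hyperplane_T power_int_mult_distrib)
qed

lemma quot_frame_eq:
 "quot_frame S T m b = (\<lambda>u. if u \<in> S \<and> lam u \<noteq> 0 then quot_coord S T u b powi m else 0)"
 unfolding quot_frame_def by (rule ext) (auto simp: hyperplane_T)

lemma quot_frame_value:
 "b \<in> S \<Longrightarrow> quot_frame S T m b = (\<lambda>u. if u \<in> S \<and> lam u \<noteq> 0 then (lam b / lam u) powi m else 0)"
 unfolding quot_frame_eq by (rule ext) (auto simp: quot_coord_eq)

lemma quot_power_frame:
 assumes b: "b \<in> S" "lam b \<noteq> 0"
 shows "quot_power S T m = range (\<lambda>c. fscale c (quot_frame S T m b))"
proof (rule equalityI; rule subsetI)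
 fix f assume f: "f \<in> quot_power S T m"
 have "f = fscale (f b) (quot_frame S T m b)"
 proof
  fix v show "f v = fscale (f b) (quot_frame S T m b) v"
   using b by (subst quot_power_value[OF f b]) (simp add: quot_frame_value power_int_minus power_int_divide_distrib)
 qed
 then show "f \<in> range (\<lambda>c. fscale c (quot_frame S T m b))" by blast
next
 fix f assume "f \<in> range (\<lambda>c. fscale c (quot_frame S T m b))"
 then obtain c where "f = fscale c (quot_frame S T m b)" by blast
 then have "f = (\<lambda>u. if u \<in> S \<and> lam u \<noteq> 0 then c * lam b powi m * lam u powi (- m) else 0)"
  using b by (auto simp: fun_eq_iff quot_frame_value power_int_divide_distrib power_int_minus field_simps)
 then show "f \<in> quot_power S T m" unfolding quot_power_iff by blast
qed

end

section \<open>The projective line\<close>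

text \<open>The determinant of two vectors. For nonzero \<open>v\<close> the linear form
  \<open>br v\<close> has the line of \<open>v\<close> as kernel, and matrices of determinant one
  preserve \<open>br\<close>; formulas written in brackets are therefore invariant under the
  transition matrices.\<close>

definition br :: "vec2 \<Rightarrow> vec2 \<Rightarrow> complex" where
 "br x y = x 1 * y 2 - x 2 * y 1"

lemma br_self [simp]: "br x x = 0"
 and br_zero [simp]: "br 0 x = 0" "br x 0 = 0"
 and br_add: "br (x + y) u = br x u + br y u" "br u (x + y) = br u x + br u y"
 and br_scale: "br (fscale c x) u = c * br x u" "br u (fscale c x) = c * br u x"
 and br_diff: "br (x - y) u = br x u - br y u" "br u (x - y) = br u x - br u y"
 by (simp_all add: br_def algebra_simps)

lemma br_swap: "br x y = - br y x"
 by (simp add: br_def)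

lemma br_plucker: "br a b * br c d = br a c * br b d - br a d * br b c"
 by (simp add: br_def algebra_simps)

lemma vec2_eqI: "x 1 = y 1 \<Longrightarrow> x 2 = y 2 \<Longrightarrow> x = (y :: vec2)"
 by (simp add: fun_eq_iff forall_2)

lemma br_cramer: "fscale (br a b) v = fscale (br v b) a + fscale (br a v) b"
 by (rule vec2_eqI) (simp_all add: br_def algebra_simps)

lemma line_mem_iff:
 assumes "v \<noteq> 0" shows "u \<in> cfun.span {v} \<longleftrightarrow> br v u = 0"
proof
 assume "u \<in> cfun.span {v}" then show "br v u = 0"
  by (auto simp: cfun.span_singleton br_scale)
next
 assume b: "br v u = 0"
 have "v 1 \<noteq> 0 \<or> v 2 \<noteq> 0" using assms vec2_eqI[of v 0] by auto
 then show "u \<in> cfun.span {v}"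
 proof
  assume n: "v 1 \<noteq> 0"
  have "u = fscale (u 1 / v 1) v"
   by (rule vec2_eqI) (use b n in \<open>simp_all add: br_def field_simps\<close>)
  then show ?thesis by (auto simp: cfun.span_singleton)
 next
  assume n: "v 2 \<noteq> 0"
  have "u = fscale (u 2 / v 2) v"
   by (rule vec2_eqI) (use b n in \<open>simp_all add: br_def field_simps\<close>)
  then show ?thesis by (auto simp: cfun.span_singleton)
 qed
qed

lemma line_eq_iff:
 assumes "v \<noteq> 0" "v' \<noteq> 0" shows "cfun.span {v} = cfun.span {v'} \<longleftrightarrow> br v v' = 0"
proof
 assume "cfun.span {v} = cfun.span {v'}"
 then have "v' \<in> cfun.span {v}" using cfun.span_base[of v' "{v'}"] by simp
 then show "br v v' = 0" using line_mem_iff[OF assms(1)] by simp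
next
 assume b: "br v v' = 0"
 have "v' \<in> cfun.span {v}" "v \<in> cfun.span {v'}"
  using b br_swap[of v v'] line_mem_iff assms by auto
 then show "cfun.span {v} = cfun.span {v'}"
  using cfun.span_minimal[OF _ cfun.subspace_span, of "{v'}" "{v}"]
   cfun.span_minimal[OF _ cfun.subspace_span, of "{v}" "{v'}"] by auto
qed

lemma independent_iff_br: "a \<noteq> b \<and> cfun.independent {a, b} \<longleftrightarrow> br a b \<noteq> 0"
proof (cases "b = 0")
 case True then show ?thesis by (auto simp: cfun.dependent_zero)
next
 case False
 then show ?thesis
  using cfun.independent_insert[of a "{b}"] line_mem_iff[OF False, of a] br_swap[of a b]
  by (auto simp: cfun.dependent_single)
qed

lemma br_exists: assumes "b \<noteq> 0" obtains a where "br a b \<noteq> 0"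
proof -
 have "b 1 \<noteq> 0 \<or> b 2 \<noteq> 0" using assms vec2_eqI[of b 0] by auto
 then have "br (\<lambda>i. if i = 1 then 1 else 0) b \<noteq> 0 \<or> br (\<lambda>i. if i = 1 then 0 else 1) b \<noteq> 0"
  by (auto simp: br_def)
 then show ?thesis using that by blast
qed

lemma br_nonzero: "br a b \<noteq> 0 \<Longrightarrow> a \<noteq> 0" "br a b \<noteq> 0 \<Longrightarrow> b \<noteq> 0"
 by auto

lemma affine_nonzero: "br a b \<noteq> 0 \<Longrightarrow> a + fscale \<zeta> b \<noteq> 0"
 by (rule br_nonzero(1)[of _ b]) (simp add: br_add br_scale)

lemma P1_iff: "\<kappa> \<in> P1 \<longleftrightarrow> (\<exists>a b. br a b \<noteq> 0 \<and> \<kappa> = affine_chart a b)"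
 unfolding P1_def independent_iff_br by blast

lemma affine_chart_P1: "br a b \<noteq> 0 \<Longrightarrow> affine_chart a b \<in> P1"
 unfolding P1_iff by blast

lemma affine_chart_dom':
 assumes ab: "br a b \<noteq> 0"
 shows "fst (affine_chart a b) = {cfun.span {v} |v. br v b \<noteq> 0}"
proof -
 \<comment> \<open>Solving \<open>br v (a + fscale \<zeta> b) = 0\<close> for \<open>\<zeta>\<close>
   gives the affine coordinate \<open>br a v / br v b\<close> of the line of
   \<open>v\<close>.\<close>
 have 1: "cfun.span {v} = cfun.span {a + fscale (br a v / br v b) b}" if "br v b \<noteq> 0" for v
  by (subst line_eq_iff) (use that ab br_swap[of v a] affine_nonzero[OF ab] br_nonzero[OF that] in \<open>simp_all add: br_add br_scale br_diff\<close>)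
 have 2: "br (a + fscale \<zeta> b) b \<noteq> 0" for \<zeta> using ab by (simp add: br_add br_scale)
 show ?thesis
 proof (rule equalityI; rule subsetI)
  fix p assume "p \<in> fst (affine_chart a b)"
  then obtain \<zeta> where "p = cfun.span {a + fscale \<zeta> b}" by (auto simp: affine_chart_def)
  then show "p \<in> {cfun.span {v} |v. br v b \<noteq> 0}" using 2[of \<zeta>] by blast
 next
  fix p assume "p \<in> {cfun.span {v} |v. br v b \<noteq> 0}"
  then obtain v where "p = cfun.span {v}" "br v b \<noteq> 0" by blast
  then have "p = cfun.span {a + fscale (br a v / br v b) b}" using 1 by simp
  then show "p \<in> fst (affine_chart a b)" by (auto simp: affine_chart_def)
 qed
qed

lemma points_P1: "p \<in> points P1 \<longleftrightarrow> (\<exists>v. v \<noteq> 0 \<and> p = cfun.span {v})"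
proof
 assume "p \<in> points P1"
 then obtain \<kappa> where "\<kappa> \<in> P1" "p \<in> fst \<kappa>" by (force simp: points_def)
 then obtain a b where ab: "br a b \<noteq> 0" "p \<in> fst (affine_chart a b)" unfolding P1_iff by blast
 obtain v where "p = cfun.span {v}" "br v b \<noteq> 0" using ab(2) unfolding affine_chart_dom'[OF ab(1)] by blast
 then show "\<exists>v. v \<noteq> 0 \<and> p = cfun.span {v}" using br_nonzero(1)[of v b] by blast
next
 assume "\<exists>v. v \<noteq> 0 \<and> p = cfun.span {v}"
 then obtain v where v: "v \<noteq> 0" "p = cfun.span {v}" by blast
 obtain b where "br b v \<noteq> 0" using br_exists[OF v(1)] .
 then have b: "br v b \<noteq> 0" using br_swap[of b v] by auto
 then have "p \<in> fst (affine_chart v b)" unfolding affine_chart_dom'[OF b] v(2) by blast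
 then show "p \<in> points P1"
  using points_I[of "fst (affine_chart v b)" "snd (affine_chart v b)"] affine_chart_P1[OF b] by simp
qed

lemma affine_chart_dom:
 assumes ab: "br a b \<noteq> 0"
 shows "fst (affine_chart a b) = {p \<in> points P1. b \<notin> p}"
 unfolding affine_chart_dom'[OF ab] points_P1
proof (rule equalityI; rule subsetI)
 fix p assume "p \<in> {cfun.span {v} |v. br v b \<noteq> 0}"
 then obtain v where v: "p = cfun.span {v}" "br v b \<noteq> 0" by blast
 then show "p \<in> {p. (\<exists>v. v \<noteq> 0 \<and> p = cfun.span {v}) \<and> b \<notin> p}"
  using br_nonzero(1)[OF v(2)] line_mem_iff[of v b] by auto
next
 fix p assume "p \<in> {p. (\<exists>v. v \<noteq> 0 \<and> p = cfun.span {v}) \<and> b \<notin> p}"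
 then obtain v where v: "v \<noteq> 0" "p = cfun.span {v}" "b \<notin> p" by blast
 then have "br v b \<noteq> 0" using line_mem_iff[of v b] by auto
 then show "p \<in> {cfun.span {v} |v. br v b \<noteq> 0}" using v(2) by blast
qed

lemma affine_chart_coord:
 assumes ab: "br a b \<noteq> 0" and v: "br v b \<noteq> 0"
 shows "snd (affine_chart a b) (cfun.span {v}) = br a v / br v b"
proof -
 have "a + fscale z b \<in> cfun.span {v} \<longleftrightarrow> z = br a v / br v b" for z
  using line_mem_iff[OF br_nonzero(1)[OF v]] v br_swap[of v a]
  by (auto simp: br_add br_scale field_simps add_eq_0_iff2)
 then show ?thesis unfolding affine_chart_def by simp
qed

lemma affine_chart_inv:
 assumes ab: "br a b \<noteq> 0"
 shows "inv_into (fst (affine_chart a b)) (snd (affine_chart a b)) \<zeta> = cfun.span {a + fscale \<zeta> b}"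
  and "inj_on (snd (affine_chart a b)) (fst (affine_chart a b))"
  and "snd (affine_chart a b) (cfun.span {a + fscale \<zeta> b}) = \<zeta>"
  and "cfun.span {a + fscale \<zeta> b} \<in> fst (affine_chart a b)"
proof -
 show inj: "inj_on (snd (affine_chart a b)) (fst (affine_chart a b))"
  unfolding affine_chart_dom'[OF ab]
 proof (rule inj_onI)
  fix p q assume pq: "p \<in> {cfun.span {v} |v. br v b \<noteq> 0}" "q \<in> {cfun.span {v} |v. br v b \<noteq> 0}"
   "snd (affine_chart a b) p = snd (affine_chart a b) q"
  then obtain v u where vu: "p = cfun.span {v}" "q = cfun.span {u}" "br v b \<noteq> 0" "br u b \<noteq> 0" by blast
  then have "br a v * br u b = br a u * br v b"
   using pq(3) by (simp add: affine_chart_coord[OF ab] field_simps)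
  then have "br a b * br v u = 0" using br_plucker[of a b v u] br_swap[of b v] br_swap[of b u]
   by (simp add: mult.commute)
  then show "p = q" unfolding vu(1,2)
   by (subst line_eq_iff) (use ab vu br_nonzero in auto)
 qed
 have n: "br (a + fscale \<zeta> b) b \<noteq> 0" using ab by (simp add: br_add br_scale)
 show c: "snd (affine_chart a b) (cfun.span {a + fscale \<zeta> b}) = \<zeta>"
  using ab by (simp add: affine_chart_coord[OF ab n]) (simp add: br_add br_scale)
 show d: "cfun.span {a + fscale \<zeta> b} \<in> fst (affine_chart a b)"
  unfolding affine_chart_dom'[OF ab] using n by blast
 show "inv_into (fst (affine_chart a b)) (snd (affine_chart a b)) \<zeta> = cfun.span {a + fscale \<zeta> b}"
  using inv_into_f_f[OF inj d] c by simp
qed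

text \<open>A transition map is the Moebius transformation
  \<open>br c (a + fscale \<zeta> b) / br (a + fscale \<zeta> b) d\<close>. The set where its
  denominator is nonzero is also the image of the overlap in the first chart.\<close>

lemma complex_atlas_P1: "complex_atlas P1"
 unfolding complex_atlas_def
proof (intro conjI ballI)
 fix \<kappa> assume "\<kappa> \<in> P1"
 then obtain a b where ab: "br a b \<noteq> 0" "\<kappa> = affine_chart a b" unfolding P1_iff by blast
 have "snd \<kappa> ` fst \<kappa> = UNIV"
  using affine_chart_inv(3,4)[OF ab(1)] ab(2) by (metis UNIV_eq_I imageI)
 then show "case \<kappa> of (D, z) \<Rightarrow> inj_on z D \<and> open (z ` D)"
  using affine_chart_inv(2)[OF ab(1)] ab(2) by (simp add: case_prod_beta)
next
 fix \<kappa> assume "\<kappa> \<in> P1"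
 then obtain a b where ab: "br a b \<noteq> 0" "\<kappa> = affine_chart a b" unfolding P1_iff by blast
 have "open (snd \<kappa> ` (fst \<kappa> \<inter> fst \<kappa>')) \<and>
   (snd \<kappa>' \<circ> inv_into (fst \<kappa>) (snd \<kappa>)) holomorphic_on snd \<kappa> ` (fst \<kappa> \<inter> fst \<kappa>')"
  if \<kappa>': "\<kappa>' \<in> P1" for \<kappa>'
 proof -
  obtain c d where cd: "br c d \<noteq> 0" "\<kappa>' = affine_chart c d" using \<kappa>' unfolding P1_iff by blast
  have mem: "cfun.span {a + fscale \<zeta> b} \<in> fst \<kappa>' \<longleftrightarrow> br (a + fscale \<zeta> b) d \<noteq> 0" for \<zeta>
  proof -
   have "cfun.span {a + fscale \<zeta> b} \<in> points P1"
    using affine_nonzero[OF ab(1)] unfolding points_P1 by blast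
   then show ?thesis
    unfolding cd(2) affine_chart_dom[OF cd(1)] using line_mem_iff[OF affine_nonzero[OF ab(1)], of d \<zeta>] by simp
  qed
  have im: "snd \<kappa> ` (fst \<kappa> \<inter> fst \<kappa>') = {\<zeta>. br (a + fscale \<zeta> b) d \<noteq> 0}" (is "?L = ?R")
  proof
   show "?R \<subseteq> ?L"
   proof
    fix \<zeta> assume "\<zeta> \<in> ?R"
    then have "cfun.span {a + fscale \<zeta> b} \<in> fst \<kappa> \<inter> fst \<kappa>'"
     using mem affine_chart_inv(4)[OF ab(1)] ab(2) by auto
    then show "\<zeta> \<in> ?L" using affine_chart_inv(3)[OF ab(1), of \<zeta>] ab(2) by (metis imageI)
   qed
   show "?L \<subseteq> ?R"
   proof safe
    fix p assume p: "p \<in> fst \<kappa>" "p \<in> fst \<kappa>'" "br (a + fscale (snd \<kappa> p) b) d = 0"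
    have "p = cfun.span {a + fscale (snd \<kappa> p) b}"
     using affine_chart_inv(1)[OF ab(1), of "snd \<kappa> p"] inv_into_f_f[OF affine_chart_inv(2)[OF ab(1)], of p] p(1) ab(2)
     by simp
    then show False using mem p by metis
   qed
  qed
  have "open {\<zeta>. br (a + fscale \<zeta> b) d \<noteq> 0}"
   unfolding br_add br_scale by (intro open_Collect_neq continuous_intros)
  moreover have "(snd \<kappa>' \<circ> inv_into (fst \<kappa>) (snd \<kappa>)) holomorphic_on {\<zeta>. br (a + fscale \<zeta> b) d \<noteq> 0}"
  proof (rule holomorphic_transform)
   show "(\<lambda>\<zeta>. br c (a + fscale \<zeta> b) / br (a + fscale \<zeta> b) d) holomorphic_on {\<zeta>. br (a + fscale \<zeta> b) d \<noteq> 0}"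
    unfolding br_add br_scale by (intro holomorphic_intros) auto
   fix \<zeta> assume "\<zeta> \<in> {\<zeta>. br (a + fscale \<zeta> b) d \<noteq> 0}"
   then show "br c (a + fscale \<zeta> b) / br (a + fscale \<zeta> b) d = (snd \<kappa>' \<circ> inv_into (fst \<kappa>) (snd \<kappa>)) \<zeta>"
    by (simp add: ab(2) cd(2) affine_chart_inv[OF ab(1)] affine_chart_coord[OF cd(1)])
  qed
  ultimately show ?thesis unfolding im by simp
 qed
 then show "case \<kappa> of (D, z) \<Rightarrow> \<forall>(D', z')\<in>P1. open (z ` (D \<inter> D')) \<and> z' \<circ> inv_into D z holomorphic_on z ` (D \<inter> D')"
  by (auto simp: case_prod_beta)
qed

context
 fixes a b :: vec2 and \<zeta>\<^sub>0 :: complex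
 assumes ab: "br a b \<noteq> 0"
begin

lemma P1_chart: "(fst (affine_chart a b), snd (affine_chart a b)) \<in> P1"
  "cfun.span {a + fscale \<zeta>\<^sub>0 b} \<in> fst (affine_chart a b)"
 using affine_chart_P1[OF ab] affine_chart_inv[OF ab] by simp_all

lemma hol_at_P1: "hol_at P1 (cfun.span {a + fscale \<zeta>\<^sub>0 b}) f \<longleftrightarrow>
  (\<lambda>\<zeta>. f (cfun.span {a + fscale \<zeta> b})) analytic_on {\<zeta>\<^sub>0}"
 unfolding hol_at_chart[OF complex_atlas_P1 P1_chart] affine_chart_inv[OF ab] comp_def ..

lemma eventually_P1: "eventually P (nhds_rs P1 (cfun.span {a + fscale \<zeta>\<^sub>0 b})) \<longleftrightarrow>
  eventually (\<lambda>\<zeta>. P (cfun.span {a + fscale \<zeta> b})) (nhds \<zeta>\<^sub>0)"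
 unfolding eventually_nhds_rs_chart[OF complex_atlas_P1 P1_chart] affine_chart_inv[OF ab] comp_def ..

end

section \<open>The line bundles L^m on the projective line\<close>

lemma hyperplane_line: "v \<noteq> 0 \<Longrightarrow> hyperplane_fun UNIV (cfun.span {v}) (br v)"
 unfolding hyperplane_fun_def linear_fun_on_def
 by (auto simp: line_mem_iff br_add br_scale cfun.subspace_UNIV)

lemma quot_coord_line: "br v b \<noteq> 0 \<Longrightarrow> quot_coord UNIV (cfun.span {v}) b = (\<lambda>u. br v u / br v b)"
 using quot_coord_eq[OF hyperplane_line, of v b] br_nonzero by auto

lemma points_P1_affine:
 assumes "p \<in> points P1" "b \<notin> p"
 obtains e where "p = cfun.span {e}" "br e b \<noteq> 0"
proof -
 obtain v where v: "v \<noteq> 0" "p = cfun.span {v}" using assms(1) unfolding points_P1 by blast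
 then show ?thesis using that[of v] assms(2) line_mem_iff[of v b] by simp
qed

lemma rs_open_affine: "b \<noteq> 0 \<Longrightarrow> rs_open P1 {p \<in> points P1. b \<notin> p}"
 by (rule br_exists[of b]) (simp_all add: rs_open_chart_dom[OF complex_atlas_P1 P1_chart(1)] flip: affine_chart_dom)

text \<open>In the affine coordinate with direction \<open>b'\<close> the bracket with
  \<open>b'\<close> is constant, so the transition function is a constant times a power of a linear
  polynomial that does not vanish at \<open>p\<close>.\<close>

lemma quot_frame_hol:
 assumes p: "p \<in> points P1" "b \<notin> p" "b' \<notin> p"
 shows "hol_at P1 p (\<lambda>q. quot_frame UNIV q m b b')"
proof -
 obtain e where e: "p = cfun.span {e}" "br e b' \<noteq> 0" using points_P1_affine[OF p(1,3)] .
 have b: "br e b \<noteq> 0" using p(2) e(1) line_mem_iff[OF br_nonzero(1)[OF e(2)], of b] by simp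
 have v: "quot_frame UNIV (cfun.span {e + fscale \<zeta> b'}) m b b' = (br (e + fscale \<zeta> b') b / br e b') powi m" for \<zeta>
  using e(2) by (subst quot_frame_value[OF hyperplane_line[OF affine_nonzero[OF e(2)]]])
   (simp_all add: br_add br_scale)
 have "hol_at P1 (cfun.span {e + fscale 0 b'}) (\<lambda>q. quot_frame UNIV q m b b')"
  unfolding hol_at_P1[OF e(2)] v br_add br_scale using e b
  by (intro analytic_intros) auto
 then show ?thesis by (simp add: e(1) cfun.scale_zero_left)
qed

lemma line_bundle_L: "line_bundle P1 (L_power m)"
proof -
 have fr: "frames (L_power m) = {({p \<in> points P1. b \<notin> p}, 1, \<lambda>_ p. quot_frame UNIV p m b) |b. b \<noteq> 0}"
  by (simp add: L_power_def)
 have fib: "fiber (L_power m) p = quot_power UNIV p m" for p by (simp add: L_power_def)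
 have qf: "quot_power UNIV p m = range (\<lambda>c. fscale c (quot_frame UNIV p m b))" "quot_frame UNIV p m b b = 1"
  if p: "p \<in> points P1" "b \<notin> p" for p b
 proof -
  obtain e where e: "p = cfun.span {e}" "br e b \<noteq> 0" using points_P1_affine[OF p] .
  note H = hyperplane_line[OF br_nonzero(1)[OF e(2)]]
  show "quot_power UNIV p m = range (\<lambda>c. fscale c (quot_frame UNIV p m b))"
   using quot_power_frame[OF H UNIV_I e(2)] e by simp
  show "quot_frame UNIV p m b b = 1" using e by (simp add: quot_frame_value[OF H])
 qed
 have "hol_section P1 (L_power m) {p \<in> points P1. b \<notin> p} (\<lambda>p. quot_frame UNIV p m b)" if b: "b \<noteq> 0" for b
  unfolding hol_section_def fr
 proof safe
  fix b' :: vec2 assume b': "b' \<noteq> 0"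
  show "\<exists>c. (\<forall>l<1. hol_fun P1 ({p \<in> points P1. b \<notin> p} \<inter> {p \<in> points P1. b' \<notin> p}) (c l)) \<and>
     (\<forall>x\<in>{p \<in> points P1. b \<notin> p} \<inter> {p \<in> points P1. b' \<notin> p}.
      quot_frame UNIV x m b = (\<Sum>l<1. fscale (c (l::nat) x) (quot_frame UNIV x m b')))"
  proof (intro exI[of _ "\<lambda>_ p. quot_frame UNIV p m b b'"] conjI allI impI ballI)
   have "rs_open P1 ({p \<in> points P1. b \<notin> p} \<inter> {p \<in> points P1. b' \<notin> p})"
    by (intro rs_open_Int complex_atlas_P1 rs_open_affine b b')
   then show "hol_fun P1 ({p \<in> points P1. b \<notin> p} \<inter> {p \<in> points P1. b' \<notin> p}) (\<lambda>p. quot_frame UNIV p m b b')"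
    using hol_fun_iff_hol_at[OF complex_atlas_P1] quot_frame_hol by auto
  next
   fix x assume x: "x \<in> {p \<in> points P1. b \<notin> p} \<inter> {p \<in> points P1. b' \<notin> p}"
   have "quot_frame UNIV x m b \<in> quot_power UNIV x m"
    unfolding qf(1)[of x b, simplified] using x qf(1)[of x b]
    by (auto intro!: image_eqI[of _ _ 1])
   then obtain c where "quot_frame UNIV x m b = fscale c (quot_frame UNIV x m b')"
    using qf(1)[of x b'] x by auto
   then show "quot_frame UNIV x m b = (\<Sum>l<1::nat. fscale (quot_frame UNIV x m b b') (quot_frame UNIV x m b'))"
    using qf(2)[of x b'] x by simp
  qed
 qed
 then have hol: "\<And>b. b \<noteq> 0 \<Longrightarrow> hol_section P1 (L_power m) {p \<in> points P1. b \<notin> p} (\<lambda>p. quot_frame UNIV p m b)" .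
 show ?thesis unfolding line_bundle_def vector_bundle_def
 proof (intro conjI)
  show "(\<Union>(D, r, b)\<in>frames (L_power m). D) = points P1"
  proof safe
   fix p assume "p \<in> points P1"
   then obtain v where v: "v \<noteq> 0" "p = cfun.span {v}" unfolding points_P1 by blast
   obtain b where "br b v \<noteq> 0" using br_exists[OF v(1)] .
   then have "b \<notin> p" "b \<noteq> 0" using v line_mem_iff[OF v(1)] br_swap[of b v] br_nonzero by auto
   then show "p \<in> (\<Union>(D, r, b)\<in>frames (L_power m). D)" unfolding fr using \<open>p \<in> points P1\<close> by blast
  qed (auto simp: fr)
  show "\<forall>(D, r, b)\<in>frames (L_power m). r = 1" by (auto simp: fr)
  show "\<forall>(D, r, b)\<in>frames (L_power m). rs_open P1 D \<and>
    (\<forall>x\<in>D. fiber (L_power m) x = cfun.span ((\<lambda>l. b l x) ` {..<r}) \<and>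
        (\<forall>c. (\<Sum>l<r. fscale (c l) (b l x)) = 0 \<longrightarrow> (\<forall>l<r. c l = 0))) \<and>
    (\<forall>l<r. hol_section P1 (L_power m) D (b l))"
   unfolding fr
  proof (safe, goal_cases)
   case (1 _ _ _ b) then show ?case by (rule rs_open_affine)
  next
   case (2 _ _ _ b p f) then show ?case by (simp add: fib qf(1)[of p b] lessThan_Suc cfun.span_singleton)
  next
   case (3 _ _ _ b p f) then show ?case by (simp add: fib qf(1)[of p b] lessThan_Suc cfun.span_singleton)
  next
   case (4 _ _ _ b p c l)
   then have s: "fscale (c 0) (quot_frame UNIV p m b) = 0" by simp
   show ?case using fun_cong[OF s, of b] 4 qf(2)[of p b] by simp
  next
   case (5 _ _ _ b l) then show ?case using hol by blast
  qed
 qed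
qed

lemma vector_bundle_L: "vector_bundle P1 (L_power m)"
 using line_bundle_L by (simp add: line_bundle_def)

text \<open>A constant vector \<open>b\<close> serves as trivialising vector on all lines that do
  not contain it: in the frame [b]^m a section is read as \<open>s y b\<close>.\<close>

lemma L_local:
 assumes p: "p \<in> points P1" "b \<notin> p"
 shows "s \<in> local_sections P1 (L_power m) p \<longleftrightarrow>
     (\<forall>\<^sub>F y in nhds_rs P1 p. s y \<in> quot_power UNIV y m) \<and> hol_at P1 p (\<lambda>y. s y b)"
  and "vanishes_to_order P1 (L_power m) d p s \<longleftrightarrow>
     (\<forall>\<^sub>F y in nhds_rs P1 p. s y \<in> quot_power UNIV y m) \<and> vanish_at P1 d p (\<lambda>y. s y b)"
proof -
 have b0: "b \<noteq> 0" using p cfun.span_zero unfolding points_P1 by auto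
 have D: "({p \<in> points P1. b \<notin> p}, 1, \<lambda>_ p. quot_frame UNIV p m b) \<in> frames (L_power m)"
  using b0 by (auto simp: L_power_def)
 have u: "quot_frame UNIV y m b b = 1" if y: "y \<in> {p \<in> points P1. b \<notin> p}" for y
 proof -
  obtain e where e: "y = cfun.span {e}" "br e b \<noteq> 0" using points_P1_affine[of y b] y by auto
  then show ?thesis using quot_frame_value[OF hyperplane_line[OF br_nonzero(1)[OF e(2)]]] by simp
 qed
 have x: "p \<in> {p \<in> points P1. b \<notin> p}" using p by simp
 have fib: "fiber (L_power m) y = quot_power UNIV y m" for y by (simp add: L_power_def)
 show "s \<in> local_sections P1 (L_power m) p \<longleftrightarrow>
     (\<forall>\<^sub>F y in nhds_rs P1 p. s y \<in> quot_power UNIV y m) \<and> hol_at P1 p (\<lambda>y. s y b)"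
  using line_local_sections_iff(1)[where u = "\<lambda>_. b", OF complex_atlas_P1 line_bundle_L D x u]
  unfolding fib .
 show "vanishes_to_order P1 (L_power m) d p s \<longleftrightarrow>
     (\<forall>\<^sub>F y in nhds_rs P1 p. s y \<in> quot_power UNIV y m) \<and> vanish_at P1 d p (\<lambda>y. s y b)"
  using line_local_sections_iff(2)[where u = "\<lambda>_. b", OF complex_atlas_P1 line_bundle_L D x u]
  unfolding fib .
qed

section \<open>The section defined by the bivector\<close>

lemma bivector_entries:
 assumes "nonzero_bivector w"
 shows "w (1, 1) = 0" "w (2, 2) = 0" "w (2, 1) = - w (1, 2)" "w (1, 2) \<noteq> 0"
proof -
 have a: "w (\<beta>, \<alpha>) = - w (\<alpha>, \<beta>)" for \<alpha> \<beta> using assms unfolding nonzero_bivector_def by blast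
 have "w (\<alpha>, \<alpha>) + w (\<alpha>, \<alpha>) = 0" for \<alpha> by (subst a) simp
 then show d: "w (1, 1) = 0" "w (2, 2) = 0" by simp_all
 show s: "w (2, 1) = - w (1, 2)" by (rule a)
 show "w (1, 2) \<noteq> 0"
 proof
  assume "w (1, 2) = 0"
  with d s have "w (\<alpha>, \<beta>) = 0" for \<alpha> \<beta> using exhaust_2[of \<alpha>] exhaust_2[of \<beta>] by auto
  then have "w = 0" by (auto simp: fun_eq_iff)
  then show False using assms unfolding nonzero_bivector_def by blast
 qed
qed

text \<open>Antisymmetry leaves one independent entry, so \<open>w\<close> is
  \<open>w (1, 2)\<close> times the determinant; the two brackets in the denominator express it in
  the bases [b] and [u]. The zero locus \<open>br e v = 0\<close> is the diagonal.\<close>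

lemma omega_section_eq:
 assumes w: "nonzero_bivector w" and "br e b \<noteq> 0" "br v u \<noteq> 0"
 shows "omega_section w (cfun.span {e}) b (cfun.span {v}) u = w (1, 2) * br e v / (br e b * br v u)"
proof -
 have "br v (\<lambda>\<gamma>. if \<gamma> = 1 then 1 else 0) = - v 2" "br v (\<lambda>\<gamma>. if \<gamma> = 2 then 1 else 0) = v 1" for v
  by (simp_all add: br_def)
 then show ?thesis
  unfolding omega_section_def quot_coord_line[OF assms(2)] quot_coord_line[OF assms(3)]
  using bivector_entries[OF w] assms
  by (simp add: sum_2 br_def[of e v] divide_simps) (simp add: algebra_simps)
qed

lemma not_mem_line: "v \<noteq> 0 \<Longrightarrow> u \<notin> cfun.span {v} \<longleftrightarrow> br v u \<noteq> 0"
 using line_mem_iff by simp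

lemma omega_hol_at:
 assumes w: "nonzero_bivector w" and p: "p \<in> points P1" "b \<notin> p" and x: "x \<in> points P1" "u \<notin> x"
 shows "hol_at P1 x (\<lambda>y. omega_section w p b y u)"
proof -
 obtain e where e: "p = cfun.span {e}" "br e b \<noteq> 0" using points_P1_affine[OF p] .
 obtain a where a: "x = cfun.span {a}" "br a u \<noteq> 0" using points_P1_affine[OF x] .
 have v: "omega_section w p b (cfun.span {a + fscale \<zeta> u}) u = w (1, 2) * br e (a + fscale \<zeta> u) / (br e b * br a u)" for \<zeta>
  unfolding e(1) using a(2) by (subst omega_section_eq[OF w e(2)]) (simp_all add: br_add br_scale)
 have "hol_at P1 (cfun.span {a + fscale 0 u}) (\<lambda>y. omega_section w p b y u)"
  unfolding hol_at_P1[OF a(2)] v br_add br_scale using e a by (intro analytic_intros) auto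
 then show ?thesis by (simp add: a(1) cfun.scale_zero_left)
qed

lemma omega_uniformizer:
 assumes w: "nonzero_bivector w" and p: "p \<in> points P1" "b \<notin> p"
 shows "uniformizer P1 p (\<lambda>y. omega_section w p b y b)"
proof -
 obtain e where e: "p = cfun.span {e}" "br e b \<noteq> 0" using points_P1_affine[OF p] .
 have pe: "cfun.span {e + fscale 0 b} = p" using e by (simp add: cfun.scale_zero_left)
 \<comment> \<open>In the affine coordinate centred at \<open>p\<close> with direction
   \<open>b\<close> the section is linear, omega = K \<zeta>, because
   \<open>br (e + fscale \<zeta> b) b\<close> stays equal to \<open>br e b\<close>.\<close>
 define K where "K = w (1, 2) / br e b"
 have K: "K \<noteq> 0" using e bivector_entries[OF w] by (simp add: K_def)
 have om: "omega_section w p b (cfun.span {e + fscale \<zeta> b}) b = K * \<zeta>" for \<zeta>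
  unfolding e(1) using e(2) by (subst omega_section_eq[OF w e(2)]) (simp_all add: br_add br_scale K_def)
 let ?z = "snd (affine_chart e b)"
 have z: "uniformizer P1 p (\<lambda>y. ?z y - ?z p)"
  using uniformizer_coord[OF complex_atlas_P1 P1_chart(1)[OF e(2)] P1_chart(2)[OF e(2), of 0]] unfolding pe .
 show ?thesis
 proof (rule uniformizerI[OF complex_atlas_P1 z])
  show "hol_at P1 p (\<lambda>y. omega_section w p b y b)" by (rule omega_hol_at[OF w p p])
  show "omega_section w p b p b = 0" using om[of 0] unfolding pe by simp
  show "hol_at P1 p (\<lambda>_. 1 / K)" by (rule hol_at_const[OF complex_atlas_P1 p(1)])
  have z0: "?z p = 0" using affine_chart_inv(3)[OF e(2), of 0] unfolding pe .
  have "\<forall>\<^sub>F y in nhds_rs P1 (cfun.span {e + fscale 0 b}). ?z y - ?z p = omega_section w p b y b * (1 / K)"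
   unfolding eventually_P1[OF e(2)] om
   using K affine_chart_inv(3)[OF e(2)] z0 by simp
  then show "\<forall>\<^sub>F y in nhds_rs P1 p. ?z y - ?z p = omega_section w p b y b * (1 / K)" by (simp only: pe)
 qed
qed

lemma omega_nonzero:
 assumes w: "nonzero_bivector w" and p: "p \<in> points P1" "b \<notin> p" and y: "y \<in> points P1" "u \<notin> y"
 shows "omega_section w p b y u = 0 \<longleftrightarrow> y = p"
proof -
 obtain e where e: "p = cfun.span {e}" "br e b \<noteq> 0" using points_P1_affine[OF p] .
 obtain v where v: "y = cfun.span {v}" "br v u \<noteq> 0" using points_P1_affine[OF y] .
 have "y = p \<longleftrightarrow> br v e = 0" unfolding e v by (rule line_eq_iff) (use e v br_nonzero in auto)
 then show ?thesis unfolding e(1) v(1) omega_section_eq[OF w e(2) v(2)]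
  using e v bivector_entries[OF w] br_swap[of e v] by simp
qed

lemma quot_power_line:
 assumes "v \<noteq> 0"
 shows "f \<in> quot_power UNIV (cfun.span {v}) m \<longleftrightarrow> (\<exists>C. f = (\<lambda>u. if br v u \<noteq> 0 then C * br v u powi (- m) else 0))"
 using quot_power_iff[OF hyperplane_line[OF assms], of f m] by simp

lemma quot_power_zero: "f \<in> quot_power UNIV y m \<Longrightarrow> u \<in> y \<Longrightarrow> f u = 0"
 by (auto simp: quot_power_def)

lemma quot_power_eqI:
 assumes y: "y \<in> points P1" "b \<notin> y" and f: "f \<in> quot_power UNIV y m" "g \<in> quot_power UNIV y m" and "f b = g b"
 shows "f = g"
proof -
 obtain v where v: "y = cfun.span {v}" "br v b \<noteq> 0" using points_P1_affine[OF y] .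
 note H = hyperplane_line[OF br_nonzero(1)[OF v(2)]]
 show ?thesis
  using quot_power_value[OF H f(1)[unfolded v(1)] UNIV_I v(2)] quot_power_value[OF H f(2)[unfolded v(1)] UNIV_I v(2)] assms(5)
  by (simp add: fun_eq_iff)
qed

lemma quot_power_subspace:
 "0 \<in> quot_power S T m"
 "f \<in> quot_power S T m \<Longrightarrow> g \<in> quot_power S T m \<Longrightarrow> fscale c f + g \<in> quot_power S T m"
 "f \<in> quot_power S T m \<Longrightarrow> g \<in> quot_power S T m \<Longrightarrow> f - g \<in> quot_power S T m"
 by (auto simp: quot_power_def algebra_simps)

text \<open>An element of weight m is \<open>C * br v u powi (- m)\<close>, and omega is a constant
  over \<open>br v u\<close>; so each factor omega raises the weight by one and each division lowers
  it. The constant is nonzero exactly when \<open>y \<noteq> p\<close>.\<close>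

lemma omega_mult_quot_power:
 assumes w: "nonzero_bivector w" and p: "p \<in> points P1" "b \<notin> p" and y: "y \<in> points P1"
  and f: "f \<in> quot_power UNIV y m"
 shows "(\<lambda>u. omega_section w p b y u ^ d * f u) \<in> quot_power UNIV y (m + int d)"
  and "y \<noteq> p \<Longrightarrow> (\<lambda>u. f u / omega_section w p b y u ^ d) \<in> quot_power UNIV y (m - int d)"
proof -
 obtain e where e: "p = cfun.span {e}" "br e b \<noteq> 0" using points_P1_affine[OF p] .
 obtain v where v: "v \<noteq> 0" "y = cfun.span {v}" using y unfolding points_P1 by blast
 obtain C where C: "f = (\<lambda>u. if br v u \<noteq> 0 then C * br v u powi (- m) else 0)"
  using f unfolding v(2) quot_power_line[OF v(1)] by blast
 let ?K = "w (1, 2) * br e v / br e b"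
 have om: "omega_section w p b y u = ?K / br v u" if "br v u \<noteq> 0" for u
  unfolding e(1) v(2) omega_section_eq[OF w e(2) that] by simp
 have "(\<lambda>u. omega_section w p b y u ^ d * f u) = (\<lambda>u. if br v u \<noteq> 0 then (?K ^ d * C) * br v u powi (- (m + int d)) else 0)"
 proof
  fix u
  have pw: "br v u powi (- (m + int d)) = br v u powi (- m) / br v u ^ d" if "br v u \<noteq> 0"
   using power_int_diff[of "br v u" "- m" "int d"] that by simp
  show "omega_section w p b y u ^ d * f u = (if br v u \<noteq> 0 then (?K ^ d * C) * br v u powi (- (m + int d)) else 0)"
   unfolding C using om[of u] pw by (auto simp: power_divide power_mult_distrib)
 qed
 then show "(\<lambda>u. omega_section w p b y u ^ d * f u) \<in> quot_power UNIV y (m + int d)"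
  unfolding v(2) quot_power_line[OF v(1)] by blast
 assume "y \<noteq> p"
 then have "br e v \<noteq> 0" using line_eq_iff[of e v] e v br_nonzero(1)[OF e(2)] by auto
 then have K: "?K \<noteq> 0" using e bivector_entries[OF w] by simp
 have "(\<lambda>u. f u / omega_section w p b y u ^ d) = (\<lambda>u. if br v u \<noteq> 0 then (C / ?K ^ d) * br v u powi (- (m - int d)) else 0)"
 proof
  fix u
  have pw: "br v u powi (- (m - int d)) = br v u powi (- m) * br v u ^ d" if "br v u \<noteq> 0"
   using power_int_add[of "br v u" "- m" "int d"] that by (simp add: algebra_simps)
  show "f u / omega_section w p b y u ^ d = (if br v u \<noteq> 0 then (C / ?K ^ d) * br v u powi (- (m - int d)) else 0)"
   unfolding C using om[of u] pw K by (auto simp: power_divide power_mult_distrib)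
 qed
 then show "(\<lambda>u. f u / omega_section w p b y u ^ d) \<in> quot_power UNIV y (m - int d)"
  unfolding v(2) quot_power_line[OF v(1)] by blast
qed

lemma local_section_value:
 assumes "x \<in> points P1" "s \<in> local_sections P1 (L_power m) x"
 shows "s x \<in> quot_power UNIV x m"
proof -
 obtain v where v: "v \<noteq> 0" "x = cfun.span {v}" using assms(1) unfolding points_P1 by blast
 obtain b where "br b v \<noteq> 0" using br_exists[OF v(1)] .
 then have b: "b \<notin> x" using v line_mem_iff[OF v(1), of b] br_swap[of b v] by simp
 have "\<forall>\<^sub>F y in nhds_rs P1 x. s y \<in> quot_power UNIV y m"
  using assms(2) L_local(1)[OF assms(1) b] by blast
 then show ?thesis by (rule eventually_nhds_rs_x[OF complex_atlas_P1 assms(1)])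
qed

lemma points_P1_complement:
 assumes "p \<in> points P1" obtains b where "b \<notin> p"
proof -
 obtain v where v: "v \<noteq> 0" "p = cfun.span {v}" using assms(1) unfolding points_P1 by blast
 obtain b where "br b v \<noteq> 0" using br_exists[OF v(1)] .
 then show ?thesis using that[of b] v line_mem_iff[OF v(1), of b] br_swap[of b v] by simp
qed

lemma eventually_points:
 assumes "x \<in> points P1" shows "\<forall>\<^sub>F y in nhds_rs P1 x. y \<in> points P1"
 by (rule eventually_rs_open[OF complex_atlas_P1 rs_open_points[OF complex_atlas_P1] assms])

lemma eventually_not_mem:
 assumes "x \<in> points P1" "u \<notin> x" shows "\<forall>\<^sub>F y in nhds_rs P1 x. u \<notin> y"
proof -
 have "u \<noteq> 0" using assms cfun.span_zero unfolding points_P1 by auto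
 then have "rs_open P1 {y \<in> points P1. u \<notin> y}" by (rule rs_open_affine)
 from eventually_rs_open[OF complex_atlas_P1 this, of x] assms
 show ?thesis by (auto elim: eventually_mono)
qed

lemma eventually_neq:
 assumes "x \<in> points P1" "x \<noteq> p" "p \<in> points P1" shows "\<forall>\<^sub>F y in nhds_rs P1 x. y \<noteq> p"
proof -
 obtain v where v: "v \<noteq> 0" "p = cfun.span {v}" using assms(3) unfolding points_P1 by blast
 obtain a where a: "a \<noteq> 0" "x = cfun.span {a}" using assms(1) unfolding points_P1 by blast
 have "br a v \<noteq> 0" using line_eq_iff[OF a(1) v(1)] a v assms(2) by blast
 then have "v \<notin> x" using line_mem_iff[OF a(1), of v] a by simp
 from eventually_not_mem[OF assms(1) this] show ?thesis
 proof eventually_elim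
  case (elim y) then show ?case using v(2) cfun.span_base[of v "{v}"] by auto
 qed
qed

lemma omega_mult_local:
 assumes w: "nonzero_bivector w" and p: "p \<in> points P1" "b \<notin> p" and x: "x \<in> points P1"
  and s: "s \<in> local_sections P1 (L_power m) x"
 shows "(\<lambda>y u. omega_section w p b y u ^ d * s y u) \<in> local_sections P1 (L_power (m + int d)) x"
  and "x = p \<Longrightarrow> vanishes_to_order P1 (L_power (m + int d)) d p (\<lambda>y u. omega_section w p b y u ^ d * s y u)"
  and "x \<noteq> p \<Longrightarrow> (\<lambda>y u. s y u / omega_section w p b y u ^ d) \<in> local_sections P1 (L_power (m - int d)) x"
proof -
 obtain u where u: "u \<notin> x" using points_P1_complement[OF x] .
 have s': "\<forall>\<^sub>F y in nhds_rs P1 x. s y \<in> quot_power UNIV y m" "hol_at P1 x (\<lambda>y. s y u)"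
  using s L_local(1)[OF x u] by auto
 have e1: "\<forall>\<^sub>F y in nhds_rs P1 x. (\<lambda>u. omega_section w p b y u ^ d * s y u) \<in> quot_power UNIV y (m + int d)"
  using s'(1) eventually_points[OF x] by eventually_elim (rule omega_mult_quot_power(1)[OF w p])
 show "(\<lambda>y u. omega_section w p b y u ^ d * s y u) \<in> local_sections P1 (L_power (m + int d)) x"
  unfolding L_local(1)[OF x u]
  by (rule conjI[OF e1 hol_at_mult[OF complex_atlas_P1 x hol_at_power[OF complex_atlas_P1 x omega_hol_at[OF w p x u]] s'(2)]])
 {
  assume "x = p"
  then have "hol_at P1 p (\<lambda>y. s y b)" using s L_local(1)[OF p] by blast
  from vanish_at_uniformizer_power[OF complex_atlas_P1 p(1) omega_uniformizer[OF w p] this, of d]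
  show "vanishes_to_order P1 (L_power (m + int d)) d p (\<lambda>y u. omega_section w p b y u ^ d * s y u)"
   unfolding L_local(2)[OF p] using e1 \<open>x = p\<close> by simp
 }
 {
  assume n: "x \<noteq> p"
  have e2: "\<forall>\<^sub>F y in nhds_rs P1 x. (\<lambda>u. s y u / omega_section w p b y u ^ d) \<in> quot_power UNIV y (m - int d)"
   using s'(1) eventually_points[OF x] eventually_neq[OF x n p(1)]
   by eventually_elim (rule omega_mult_quot_power(2)[OF w p])
  have "omega_section w p b x u ^ d \<noteq> 0" using omega_nonzero[OF w p x u] n by simp
  from hol_at_divide[OF complex_atlas_P1 x s'(2) hol_at_power[OF complex_atlas_P1 x omega_hol_at[OF w p x u]] this]
  show "(\<lambda>y u. s y u / omega_section w p b y u ^ d) \<in> local_sections P1 (L_power (m - int d)) x"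
   unfolding L_local(1)[OF x u] by (rule conjI[OF e2])
 }
qed

text \<open>Off \<open>p\<close> one divides pointwise. At \<open>p\<close> the quotient is given by
  the value of the holomorphic cofactor \<open>g\<close> in the frame [b], which extends it across
  the zero of omega.\<close>

lemma omega_divide:
 assumes w: "nonzero_bivector w" and p: "p \<in> points P1" "b \<notin> p" and U: "rs_open P1 U" and d: "d > 0"
  and s: "s \<in> L_twisted_sheaf m d p U"
 obtains t where "t \<in> L_sheaf (m - int d) U" "\<And>y. y \<in> U \<Longrightarrow> s y = (\<lambda>u. omega_section w p b y u ^ d * t y u)"
proof -
 note A = complex_atlas_P1
 have sl: "s \<in> local_sections P1 (L_power m) x" if "x \<in> U" for x
  using s U that unfolding L_twisted_sheaf_def local_sections_def by blast
 have Up: "x \<in> points P1" if "x \<in> U" for x using U that rs_open_subset by blast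
 have "\<exists>g. p \<in> U \<longrightarrow> hol_at P1 p g \<and> (\<forall>\<^sub>F y in nhds_rs P1 p. s y b = omega_section w p b y b ^ d * g y)"
 proof (cases "p \<in> U")
  case True
  then have "vanish_at P1 d p (\<lambda>y. s y b)"
   using s L_local(2)[OF p] unfolding L_twisted_sheaf_def by blast
  then show ?thesis unfolding vanish_at_uniformizer[OF A omega_uniformizer[OF w p]] by blast
 qed blast
 then obtain g where g': "p \<in> U \<longrightarrow> hol_at P1 p g \<and>
   (\<forall>\<^sub>F y in nhds_rs P1 p. s y b = omega_section w p b y b ^ d * g y)" by blast
 then have g: "p \<in> U \<Longrightarrow> hol_at P1 p g"
   "p \<in> U \<Longrightarrow> \<forall>\<^sub>F y in nhds_rs P1 p. s y b = omega_section w p b y b ^ d * g y" by simp_all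
 obtain e where e: "p = cfun.span {e}" "br e b \<noteq> 0" using points_P1_affine[OF p] .
 note H = hyperplane_line[OF br_nonzero(1)[OF e(2)], folded e(1)]
 define t where "t = (\<lambda>y. if y = p then fscale (g p) (quot_frame UNIV p (m - int d) b)
             else (\<lambda>u. s y u / omega_section w p b y u ^ d))"
 have tp: "t p \<in> quot_power UNIV p (m - int d)" "t p b = g p"
  using quot_power_frame[OF H UNIV_I e(2), of "m - int d"] e(2)
  by (auto simp: t_def quot_frame_value[OF H])
 have tl: "t \<in> local_sections P1 (L_power (m - int d)) x" if x: "x \<in> U" for x
 proof (cases "x = p")
  case False
  have ev: "\<forall>\<^sub>F y in nhds_rs P1 x. t y = (\<lambda>u. s y u / omega_section w p b y u ^ d)"
   using eventually_neq[OF Up[OF x] False p(1)] by eventually_elim (simp add: t_def)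
  show ?thesis
   unfolding local_sections_cong[OF A vector_bundle_L Up[OF x] ev]
   by (rule omega_mult_local(3)[OF w p Up[OF x] sl[OF x] False])
 next
  case True
  then have pU: "p \<in> U" using x by simp
  have sp: "\<forall>\<^sub>F y in nhds_rs P1 p. s y \<in> quot_power UNIV y m" using sl[OF pU] L_local(1)[OF p] by blast
  have tq: "\<forall>\<^sub>F y in nhds_rs P1 p. t y \<in> quot_power UNIV y (m - int d)"
   using sp eventually_points[OF p(1)]
  proof eventually_elim
   case (elim y)
   show ?case
    using tp(1) omega_mult_quot_power(2)[OF w p elim(2,1), of d] by (cases "y = p") (simp_all add: t_def)
  qed
  have ev: "\<forall>\<^sub>F y in nhds_rs P1 p. g y = t y b"
   using g(2)[OF pU] eventually_points[OF p(1)] eventually_not_mem[OF p]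
  proof eventually_elim
   case (elim y)
   then show ?case using tp(2) omega_nonzero[OF w p elim(2,3)] by (cases "y = p") (simp_all add: t_def)
  qed
  have "hol_at P1 p (\<lambda>y. t y b)" using g(1)[OF pU] hol_at_cong[OF A p(1) ev] by simp
  with tq show ?thesis unfolding True L_local(1)[OF p] by blast
 qed
 have val: "s y = (\<lambda>u. omega_section w p b y u ^ d * t y u)" if y: "y \<in> U" for y
 proof (rule ext)
  fix u
  have sq: "s y \<in> quot_power UNIV y m" by (rule local_section_value[OF Up[OF y] sl[OF y]])
  show "s y u = omega_section w p b y u ^ d * t y u"
  proof (cases "u \<in> y")
   case True
   then show ?thesis
    using quot_power_zero[OF sq] quot_power_zero[OF local_section_value[OF Up[OF y] tl[OF y]]] by simp
  next
   case False
   show ?thesis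
   proof (cases "y = p")
    case True
    have "vanish_at P1 d p (\<lambda>y. s y b)"
     using s L_local(2)[OF p] y True unfolding L_twisted_sheaf_def by blast
    \<comment> \<open>Positivity of \<open>d\<close> enters here: at \<open>p\<close> the right-hand
      side is zero, and so is \<open>s\<close>.\<close>
    then have "s p b = 0" using d vanish_at_value[OF A p(1), of "d - 1"] by simp
    then have "s p = 0" using quot_power_eqI[OF p sq[unfolded True] quot_power_subspace(1)] by simp
    then show ?thesis using omega_nonzero[OF w p Up[OF y] False] True d by simp
   next
    case n: False
    then show ?thesis using omega_nonzero[OF w p Up[OF y] False] by (simp add: t_def)
   qed
  qed
 qed
 have "t \<in> L_sheaf (m - int d) U"
  using tl unfolding L_sheaf_def mem_Collect_eq hol_section_iff_local[OF A vector_bundle_L U] by blast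
 then show ?thesis using val by (rule that)
qed

section \<open>Cech cohomology of the twisted sheaves\<close>

definition additive_sheaf :: "(pline set \<Rightarrow> (pline \<Rightarrow> 'a \<Rightarrow> complex) set) \<Rightarrow> bool" where
 "additive_sheaf \<Gamma> \<longleftrightarrow>
  (\<forall>U V s. rs_open P1 U \<and> rs_open P1 V \<and> V \<subseteq> U \<and> s \<in> \<Gamma> U \<longrightarrow> s \<in> \<Gamma> V) \<and>
  (\<forall>U s t. rs_open P1 U \<and> s \<in> \<Gamma> U \<and> t \<in> \<Gamma> U \<longrightarrow> s - t \<in> \<Gamma> U) \<and>
  (\<forall>U. rs_open P1 U \<longrightarrow> 0 \<in> \<Gamma> U)"

context
 fixes \<Gamma> :: "pline set \<Rightarrow> (pline \<Rightarrow> 'a \<Rightarrow> complex) set"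
 assumes \<Gamma>: "additive_sheaf \<Gamma>"
begin

lemma sheaf_restrict: "s \<in> \<Gamma> U \<Longrightarrow> rs_open P1 U \<Longrightarrow> rs_open P1 V \<Longrightarrow> V \<subseteq> U \<Longrightarrow> s \<in> \<Gamma> V"
 and sheaf_diff: "rs_open P1 U \<Longrightarrow> s \<in> \<Gamma> U \<Longrightarrow> t \<in> \<Gamma> U \<Longrightarrow> s - t \<in> \<Gamma> U"
 and sheaf_zero: "rs_open P1 U \<Longrightarrow> 0 \<in> \<Gamma> U"
 using \<Gamma> unfolding additive_sheaf_def by blast+

lemma sheaf_add:
 assumes "rs_open P1 U" "s \<in> \<Gamma> U" "t \<in> \<Gamma> U" shows "s + t \<in> \<Gamma> U"
 using sheaf_diff[OF assms(1,2) sheaf_diff[OF assms(1) sheaf_zero[OF assms(1)] assms(3)]] by simp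

lemma cech_relI:
 assumes "(U, c) \<in> cech_cocycles \<Gamma>" "(U', c') \<in> cech_cocycles \<Gamma>" "open_cover W"
  and "\<And>q. q \<in> points P1 \<Longrightarrow> W q \<subseteq> U q \<inter> U' q"
  and "\<And>q. q \<in> points P1 \<Longrightarrow> g q \<in> \<Gamma> (W q)"
  and "\<And>q r y. q \<in> points P1 \<Longrightarrow> r \<in> points P1 \<Longrightarrow> y \<in> W q \<Longrightarrow> y \<in> W r \<Longrightarrow> c q r y - c' q r y = g r y - g q y"
 shows "((U, c), (U', c')) \<in> cech_rel \<Gamma>"
 unfolding cech_rel_def mem_Collect_eq case_prod_conv
 using assms by (intro conjI exI[of _ W] exI[of _ g] ballI) auto

lemma cech_relE:
 assumes "((U, c), (U', c')) \<in> cech_rel \<Gamma>"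
 obtains W g where "(U, c) \<in> cech_cocycles \<Gamma>" "(U', c') \<in> cech_cocycles \<Gamma>" "open_cover W"
  "\<And>q. q \<in> points P1 \<Longrightarrow> W q \<subseteq> U q \<inter> U' q"
  "\<And>q. q \<in> points P1 \<Longrightarrow> g q \<in> \<Gamma> (W q)"
  "\<And>q r y. q \<in> points P1 \<Longrightarrow> r \<in> points P1 \<Longrightarrow> y \<in> W q \<Longrightarrow> y \<in> W r \<Longrightarrow> c q r y - c' q r y = g r y - g q y"
proof -
 obtain W g where *: "(U, c) \<in> cech_cocycles \<Gamma>" "(U', c') \<in> cech_cocycles \<Gamma>" "open_cover W"
  "\<forall>q\<in>points P1. W q \<subseteq> U q \<inter> U' q \<and> g q \<in> \<Gamma> (W q)"
  "\<forall>q\<in>points P1. \<forall>r\<in>points P1. \<forall>y\<in>W q \<inter> W r. c q r y - c' q r y = g r y - g q y"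
  using assms unfolding cech_rel_def mem_Collect_eq case_prod_conv by blast
 show ?thesis by (rule that[OF *(1-3)]) (use *(4,5) in auto)
qed

lemma cech_cocyclesD:
 assumes "(U, c) \<in> cech_cocycles \<Gamma>"
 shows "open_cover U"
  and "q \<in> points P1 \<Longrightarrow> r \<in> points P1 \<Longrightarrow> c q r \<in> \<Gamma> (U q \<inter> U r)"
  and "q \<in> points P1 \<Longrightarrow> r \<in> points P1 \<Longrightarrow> t \<in> points P1 \<Longrightarrow> y \<in> U q \<Longrightarrow> y \<in> U r \<Longrightarrow> y \<in> U t \<Longrightarrow>
     c q r y + c r t y = c q t y"
 using assms unfolding cech_cocycles_def by auto

lemma cech_cocycle_diag:
 assumes "(U, c) \<in> cech_cocycles \<Gamma>" "q \<in> points P1" "y \<in> U q"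
 shows "c q q y = 0"
 using cech_cocyclesD(3)[OF assms(1) assms(2) assms(2) assms(2) assms(3) assms(3) assms(3)] by simp

end

lemma open_coverD: "open_cover U \<Longrightarrow> q \<in> points P1 \<Longrightarrow> q \<in> U q \<and> rs_open P1 (U q)"
 by (simp add: open_cover_def)

lemma open_cover_Int: "open_cover U \<Longrightarrow> open_cover V \<Longrightarrow> open_cover (\<lambda>q. U q \<inter> V q)"
 by (auto simp: open_cover_def intro: rs_open_Int[OF complex_atlas_P1])

lemma rs_open_remove:
 assumes "rs_open P1 U" "p \<in> points P1" shows "rs_open P1 (U - {p})"
proof -
 obtain v where v: "v \<noteq> 0" "p = cfun.span {v}" using assms(2) unfolding points_P1 by blast
 \<comment> \<open>A line equals \<open>p\<close> as soon as it contains the spanning vector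
   \<open>v\<close>, so removing \<open>p\<close> is intersecting with an affine domain.\<close>
 have "U - {p} = U \<inter> {q \<in> points P1. v \<notin> q}"
 proof -
  have "q = p \<longleftrightarrow> v \<in> q" if "q \<in> U" for q
  proof -
   have "q \<in> points P1" using that assms(1) rs_open_subset by blast
   then obtain u where u: "u \<noteq> 0" "q = cfun.span {u}" unfolding points_P1 by blast
   show ?thesis unfolding u(2) v(2) line_mem_iff[OF u(1)] line_eq_iff[OF u(1) v(1)] ..
  qed
  then show ?thesis using rs_open_subset[OF assms(1)] by blast
 qed
 then show ?thesis using rs_open_Int[OF complex_atlas_P1 assms(1) rs_open_affine[OF v(1)]] by simp
qed

text \<open>Symmetry negates the 0-cochain; transitivity adds the two 0-cochains on the intersection
  of the refining covers.\<close>

lemma equiv_cech_rel: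
 assumes \<Gamma>: "additive_sheaf \<Gamma>"
 shows "equiv (cech_cocycles \<Gamma>) (cech_rel \<Gamma>)"
proof (rule equivI)
 show "cech_rel \<Gamma> \<subseteq> cech_cocycles \<Gamma> \<times> cech_cocycles \<Gamma>" by (auto simp: cech_rel_def)
 show "refl_on (cech_cocycles \<Gamma>) (cech_rel \<Gamma>)"
 proof (rule refl_onI)
  fix C assume "C \<in> cech_cocycles \<Gamma>"
  then obtain U c where C: "C = (U, c)" "(U, c) \<in> cech_cocycles \<Gamma>" by (cases C) auto
  note oc = cech_cocyclesD(1)[OF \<Gamma> C(2)]
  show "(C, C) \<in> cech_rel \<Gamma>" unfolding C(1)
   by (rule cech_relI[OF \<Gamma> C(2) C(2) oc, of "\<lambda>_. 0"]) (auto intro!: sheaf_zero[OF \<Gamma>] dest: open_coverD[OF oc])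
 qed
 show "sym (cech_rel \<Gamma>)"
 proof (rule symI)
  fix C C' assume CC: "(C, C') \<in> cech_rel \<Gamma>"
  obtain U c U' c' where C: "C = (U, c)" "C' = (U', c')" by (cases C, cases C') auto
  show "(C', C) \<in> cech_rel \<Gamma>" unfolding C
  proof (rule cech_relE[OF \<Gamma> CC[unfolded C]])
   fix W g assume *: "(U, c) \<in> cech_cocycles \<Gamma>" "(U', c') \<in> cech_cocycles \<Gamma>" "open_cover W"
    "\<And>q. q \<in> points P1 \<Longrightarrow> W q \<subseteq> U q \<inter> U' q" "\<And>q. q \<in> points P1 \<Longrightarrow> g q \<in> \<Gamma> (W q)"
    and eq: "\<And>q r y. q \<in> points P1 \<Longrightarrow> r \<in> points P1 \<Longrightarrow> y \<in> W q \<Longrightarrow> y \<in> W r \<Longrightarrow> c q r y - c' q r y = g r y - g q y"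
   show "((U', c'), (U, c)) \<in> cech_rel \<Gamma>"
   proof (rule cech_relI[OF \<Gamma> *(2,1,3)])
    show "W q \<subseteq> U' q \<inter> U q" if "q \<in> points P1" for q using *(4)[OF that] by blast
    show "0 - g q \<in> \<Gamma> (W q)" if q: "q \<in> points P1" for q
     using open_coverD[OF *(3) q] by (intro sheaf_diff[OF \<Gamma>] sheaf_zero[OF \<Gamma>] *(5) q) auto
    show "c' q r y - c q r y = (0 - g r) y - (0 - g q) y"
     if "q \<in> points P1" "r \<in> points P1" "y \<in> W q" "y \<in> W r" for q r y
    proof -
     have "c' q r y - c q r y = - (c q r y - c' q r y)" by simp
     also have "\<dots> = - (g r y - g q y)" by (simp only: eq[OF that])
     also have "\<dots> = (0 - g r) y - (0 - g q) y" by simp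
     finally show ?thesis .
    qed
   qed
  qed
 qed
 show "trans_on UNIV (cech_rel \<Gamma>)"
 proof (rule transI)
  fix C C' C'' assume CC: "(C, C') \<in> cech_rel \<Gamma>" "(C', C'') \<in> cech_rel \<Gamma>"
  obtain U c U' c' U'' c'' where C: "C = (U, c)" "C' = (U', c')" "C'' = (U'', c'')"
   by (cases C, cases C', cases C'') auto
  show "(C, C'') \<in> cech_rel \<Gamma>" unfolding C
  proof (rule cech_relE[OF \<Gamma> CC(1)[unfolded C]], rule cech_relE[OF \<Gamma> CC(2)[unfolded C]])
   fix W g W' g' assume *: "(U, c) \<in> cech_cocycles \<Gamma>" "open_cover W"
    "\<And>q. q \<in> points P1 \<Longrightarrow> W q \<subseteq> U q \<inter> U' q" "\<And>q. q \<in> points P1 \<Longrightarrow> g q \<in> \<Gamma> (W q)"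
    and eq: "\<And>q r y. q \<in> points P1 \<Longrightarrow> r \<in> points P1 \<Longrightarrow> y \<in> W q \<Longrightarrow> y \<in> W r \<Longrightarrow> c q r y - c' q r y = g r y - g q y"
    and B1: "(U'', c'') \<in> cech_cocycles \<Gamma>" "open_cover W'"
    "\<And>q. q \<in> points P1 \<Longrightarrow> W' q \<subseteq> U' q \<inter> U'' q" "\<And>q. q \<in> points P1 \<Longrightarrow> g' q \<in> \<Gamma> (W' q)"
    and eq': "\<And>q r y. q \<in> points P1 \<Longrightarrow> r \<in> points P1 \<Longrightarrow> y \<in> W' q \<Longrightarrow> y \<in> W' r \<Longrightarrow> c' q r y - c'' q r y = g' r y - g' q y"
   note oc = open_cover_Int[OF *(2) B1(2)]
   show "((U, c), (U'', c'')) \<in> cech_rel \<Gamma>"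
   proof (rule cech_relI[OF \<Gamma> *(1) B1(1) oc])
    show "W q \<inter> W' q \<subseteq> U q \<inter> U'' q" if "q \<in> points P1" for q using *(3)[OF that] B1(3)[OF that] by blast
    show "g q + g' q \<in> \<Gamma> (W q \<inter> W' q)" if q: "q \<in> points P1" for q
    proof (rule sheaf_add[OF \<Gamma>])
     show o: "rs_open P1 (W q \<inter> W' q)" using open_coverD[OF oc q] by simp
     show "g q \<in> \<Gamma> (W q \<inter> W' q)" using open_coverD[OF *(2) q] by (intro sheaf_restrict[OF \<Gamma> *(4)[OF q] _ o]) auto
     show "g' q \<in> \<Gamma> (W q \<inter> W' q)" using open_coverD[OF B1(2) q] by (intro sheaf_restrict[OF \<Gamma> B1(4)[OF q] _ o]) auto
    qed
    show "c q r y - c'' q r y = (g r + g' r) y - (g q + g' q) y"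
     if "q \<in> points P1" "r \<in> points P1" "y \<in> W q \<inter> W' q" "y \<in> W r \<inter> W' r" for q r y
     using arg_cong2[OF eq[of q r y] eq'[of q r y], of plus] that by (simp add: algebra_simps)
   qed
  qed
 qed
qed

lemma L_sheaf_iff: "rs_open P1 U \<Longrightarrow> s \<in> L_sheaf m U \<longleftrightarrow> (\<forall>x\<in>U. s \<in> local_sections P1 (L_power m) x)"
 by (simp add: L_sheaf_def hol_section_iff_local[OF complex_atlas_P1 vector_bundle_L])

lemma L_twisted_iff: "s \<in> L_twisted_sheaf m d p U \<longleftrightarrow>
  s \<in> L_sheaf m U \<and> (p \<in> U \<longrightarrow> vanishes_to_order P1 (L_power m) d p s)"
 by (simp add: L_twisted_sheaf_def L_sheaf_def)

lemma local_sections_diff_L: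
 assumes "x \<in> points P1" "s \<in> local_sections P1 (L_power m) x" "t \<in> local_sections P1 (L_power m) x"
 shows "s - t \<in> local_sections P1 (L_power m) x"
proof -
 have "s - t = (\<lambda>y. fscale (-1) (t y) + s y)" by (auto simp: fun_eq_iff)
 then show ?thesis using local_sections_lincomb[OF complex_atlas_P1 vector_bundle_L assms(1) assms(3,2), of "-1"] by simp
qed

lemma additive_L_sheaf: "additive_sheaf (L_sheaf m)"
 unfolding additive_sheaf_def
proof (intro conjI allI impI; (elim conjE)?)
 fix U V s assume "rs_open P1 U" "rs_open P1 V" "V \<subseteq> U" "s \<in> L_sheaf m U"
 then show "s \<in> L_sheaf m V" by (auto simp: L_sheaf_iff)
next
 fix U s t assume U: "rs_open P1 U" and "s \<in> L_sheaf m U" "t \<in> L_sheaf m U"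
 then show "s - t \<in> L_sheaf m U"
  using rs_open_subset[OF U] by (auto simp: L_sheaf_iff intro!: local_sections_diff_L)
next
 fix U assume "rs_open P1 U"
 then show "0 \<in> L_sheaf m U"
  using rs_open_subset[of P1 U] zero_local_section[OF complex_atlas_P1 vector_bundle_L] by (auto simp: L_sheaf_iff)
qed

lemma additive_L_twisted: "additive_sheaf (L_twisted_sheaf m d p)"
 unfolding additive_sheaf_def L_twisted_iff
proof (intro conjI allI impI; (elim conjE)?)
 fix U V s assume "rs_open P1 U" "rs_open P1 V" "V \<subseteq> U" "s \<in> L_sheaf m U"
 then show "s \<in> L_sheaf m V" by (auto simp: L_sheaf_iff)
next
 fix U V s assume "V \<subseteq> U" "p \<in> U \<longrightarrow> vanishes_to_order P1 (L_power m) d p s" "p \<in> V"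
 then show "vanishes_to_order P1 (L_power m) d p s" by blast
next
 fix U s t assume U: "rs_open P1 U" and "s \<in> L_sheaf m U" "t \<in> L_sheaf m U"
 then show "s - t \<in> L_sheaf m U" by (rule sheaf_diff[OF additive_L_sheaf])
next
 fix U s t assume U: "rs_open P1 U" "p \<in> U" and "p \<in> U \<longrightarrow> vanishes_to_order P1 (L_power m) d p s"
  "p \<in> U \<longrightarrow> vanishes_to_order P1 (L_power m) d p t"
 moreover have "p \<in> points P1" using U rs_open_subset by blast
 ultimately show "vanishes_to_order P1 (L_power m) d p (s - t)"
  by (intro vanishes_diff[OF complex_atlas_P1 vector_bundle_L]) auto
next
 fix U assume "rs_open P1 U" then show "0 \<in> L_sheaf m U" by (rule sheaf_zero[OF additive_L_sheaf])
next
 fix U assume "rs_open P1 U" "p \<in> U"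
 then have "p \<in> points P1" using rs_open_subset by blast
 then show "vanishes_to_order P1 (L_power m) d p 0" by (rule vanishes_zero[OF complex_atlas_P1 vector_bundle_L])
qed

section \<open>Cochains lifting a jet, and the connecting homomorphism\<close>

definition jet_lift ::
  "nat \<Rightarrow> nat \<Rightarrow> pline \<Rightarrow> (pline \<Rightarrow> vec2 \<Rightarrow> complex) set \<Rightarrow> (pline \<Rightarrow> pline set)
   \<Rightarrow> (pline \<Rightarrow> pline \<Rightarrow> vec2 \<Rightarrow> complex) \<Rightarrow> bool" where
 "jet_lift n k p j U g \<longleftrightarrow> open_cover U \<and>
  (\<forall>q\<in>points P1. g q \<in> L_sheaf (int n) (U q) \<and>
    (p \<in> U q \<longrightarrow> jet P1 (L_power (int n)) k p (g q) = j))"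

lemma jet_lift_vanishes:
 assumes p: "p \<in> points P1" and lift: "jet_lift n k p j U g" "jet_lift n k p j U' g'"
  and q: "q \<in> points P1" "r \<in> points P1" and pU: "p \<in> U q" "p \<in> U' r"
 shows "vanishes_to_order P1 (L_power (int n)) (k + 1) p (g q - g' r)"
proof -
 have "g q \<in> local_sections P1 (L_power (int n)) p" "g' r \<in> local_sections P1 (L_power (int n)) p"
  using lift q pU L_sheaf_iff[of "U q"] L_sheaf_iff[of "U' r"] open_coverD unfolding jet_lift_def by blast+
 moreover have "jet P1 (L_power (int n)) k p (g q) = jet P1 (L_power (int n)) k p (g' r)"
  using lift q pU unfolding jet_lift_def by simp
 ultimately show ?thesis using jet_eq_iff[OF complex_atlas_P1 vector_bundle_L p] by blast
qed

lemma jet_lift_cocycle: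
 assumes p: "p \<in> points P1" and lift: "jet_lift n k p j U g"
 shows "(U, \<lambda>q r. g r - g q) \<in> cech_cocycles (L_twisted_sheaf (int n) (k + 1) p)"
proof -
 have oc: "open_cover U" using lift by (simp add: jet_lift_def)
 have "g r - g q \<in> L_twisted_sheaf (int n) (k + 1) p (U q \<inter> U r)" if q: "q \<in> points P1" "r \<in> points P1" for q r
  unfolding L_twisted_iff
 proof
  have o: "rs_open P1 (U q \<inter> U r)" using oc q by (auto intro: rs_open_Int[OF complex_atlas_P1] dest: open_coverD)
  have "g r \<in> L_sheaf (int n) (U r)" "g q \<in> L_sheaf (int n) (U q)"
   using lift q by (simp_all add: jet_lift_def)
  then show "g r - g q \<in> L_sheaf (int n) (U q \<inter> U r)"
   using oc q o
   by (intro sheaf_diff[OF additive_L_sheaf o]) (auto intro: sheaf_restrict[OF additive_L_sheaf] dest: open_coverD)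
  show "p \<in> U q \<inter> U r \<longrightarrow> vanishes_to_order P1 (L_power (int n)) (k + 1) p (g r - g q)"
   using jet_lift_vanishes[OF p lift lift q(2,1)] by blast
 qed
 then show ?thesis using oc by (simp add: cech_cocycles_def)
qed

text \<open>Two lifts of the same jet differ by a 0-cochain that vanishes to order
  \<open>k + 1\<close> at \<open>p\<close>, which is exactly a 0-cochain of the twisted
  sheaf.\<close>

lemma jet_lift_rel:
 assumes p: "p \<in> points P1" and lift: "jet_lift n k p j U g" "jet_lift n k p j U' g'"
 shows "((U, \<lambda>q r. g r - g q), (U', \<lambda>q r. g' r - g' q)) \<in> cech_rel (L_twisted_sheaf (int n) (k + 1) p)"
proof -
 have oc: "open_cover U" "open_cover U'" using lift by (simp_all add: jet_lift_def)
 note ocI = open_cover_Int[OF oc]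
 show ?thesis
 proof (rule cech_relI[OF additive_L_twisted jet_lift_cocycle[OF p lift(1)] jet_lift_cocycle[OF p lift(2)] ocI])
  show "U q \<inter> U' q \<subseteq> U q \<inter> U' q" for q by simp
  show "g q - g' q \<in> L_twisted_sheaf (int n) (k + 1) p (U q \<inter> U' q)" if q: "q \<in> points P1" for q
   unfolding L_twisted_iff
  proof
   have o: "rs_open P1 (U q \<inter> U' q)" using open_coverD[OF ocI q] by simp
   have "g q \<in> L_sheaf (int n) (U q)" "g' q \<in> L_sheaf (int n) (U' q)"
    using lift q by (simp_all add: jet_lift_def)
   then show "g q - g' q \<in> L_sheaf (int n) (U q \<inter> U' q)"
    using oc q o
    by (intro sheaf_diff[OF additive_L_sheaf o]) (auto intro: sheaf_restrict[OF additive_L_sheaf] dest: open_coverD)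
   show "p \<in> U q \<inter> U' q \<longrightarrow> vanishes_to_order P1 (L_power (int n)) (k + 1) p (g q - g' q)"
    using jet_lift_vanishes[OF p lift q q] by blast
  qed
  show "(g r - g q) y - (g' r - g' q) y = (g r - g' r) y - (g q - g' q) y" for q r y
   by (simp add: algebra_simps)
 qed
qed

text \<open>\<open>connecting_hom\<close> collects the cocycles of all lifts. By
  \<open>jet_lift_rel\<close> they lie in one class, so any convenient lift computes it.\<close>

lemma connecting_hom_eq:
 assumes p: "p \<in> points P1" and lift: "jet_lift n k p j U g"
 shows "connecting_hom n k p j = cech_rel (L_twisted_sheaf (int n) (k + 1) p) `` {(U, \<lambda>q r. g r - g q)}"
proof (rule equalityI; rule subsetI)
 let ?R = "cech_rel (L_twisted_sheaf (int n) (k + 1) p)"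
 have tr: "trans_on UNIV ?R" using equiv_cech_rel[OF additive_L_twisted] by (simp add: equiv_def)
 fix C assume "C \<in> connecting_hom n k p j"
 then obtain U' g' where *: "jet_lift n k p j U' g'" "((U', \<lambda>q r. g' r - g' q), C) \<in> ?R"
  unfolding connecting_hom_def jet_lift_def by blast
 then show "C \<in> ?R `` {(U, \<lambda>q r. g r - g q)}"
  using transD[OF tr jet_lift_rel[OF p lift *(1)] *(2)] by simp
next
 fix C assume "C \<in> cech_rel (L_twisted_sheaf (int n) (k + 1) p) `` {(U, \<lambda>q r. g r - g q)}"
 then show "C \<in> connecting_hom n k p j"
  using lift unfolding connecting_hom_def jet_lift_def by blast
qed

section \<open>Residues of meromorphic one-forms\<close>

lemma isolated_singularity_iff_eventually:
 "isolated_singularity_at f z \<longleftrightarrow> (\<exists>s. open s \<and> z \<in> s \<and> f holomorphic_on s - {z})"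
proof
 assume "isolated_singularity_at f z"
 then obtain r where "r > 0" "f analytic_on ball z r - {z}" unfolding isolated_singularity_at_def by blast
 then show "\<exists>s. open s \<and> z \<in> s \<and> f holomorphic_on s - {z}"
  using analytic_imp_holomorphic by (intro exI[of _ "ball z r"]) auto
next
 assume "\<exists>s. open s \<and> z \<in> s \<and> f holomorphic_on s - {z}"
 then obtain s where s: "open s" "z \<in> s" "f holomorphic_on s - {z}" by blast
 then obtain r where r: "r > 0" "ball z r \<subseteq> s" using open_contains_ball by blast
 have "f holomorphic_on ball z r - {z}" by (rule holomorphic_on_subset[OF s(3)]) (use r in auto)
 then have "f analytic_on ball z r - {z}"
  by (subst analytic_on_open) auto
 then show "isolated_singularity_at f z" using r(1) unfolding isolated_singularity_at_def by blast
qed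

lemma residue_analytic: "f analytic_on {z} \<Longrightarrow> residue f z = 0"
 unfolding analytic_at using residue_holo by blast

lemma isolated_common_nbhd:
 assumes "isolated_singularity_at f z" "isolated_singularity_at g z"
 obtains s where "open s" "z \<in> s" "f holomorphic_on s - {z}" "g holomorphic_on s - {z}"
proof -
 obtain s t where s: "open s" "z \<in> s" "f holomorphic_on s - {z}" and t: "open t" "z \<in> t" "g holomorphic_on t - {z}"
  using assms unfolding isolated_singularity_iff_eventually by blast
 show ?thesis
  by (rule that[of "s \<inter> t"]) (use s t in \<open>auto intro: holomorphic_on_subset\<close>)
qed

lemma residue_add_isolated:
 assumes "isolated_singularity_at f z" "isolated_singularity_at g z"
 shows "residue (\<lambda>z. f z + g z) z = residue f z + residue g z"
  and "residue (\<lambda>z. f z - g z) z = residue f z - residue g z"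
  and "isolated_singularity_at (\<lambda>z. f z + g z) z"
  and "isolated_singularity_at (\<lambda>z. f z - g z) z"
proof -
 obtain s where s: "open s" "z \<in> s" "f holomorphic_on s - {z}" "g holomorphic_on s - {z}"
  using isolated_common_nbhd[OF assms] .
 show "residue (\<lambda>z. f z + g z) z = residue f z + residue g z" by (rule residue_add[OF s])
 show "residue (\<lambda>z. f z - g z) z = residue f z - residue g z" by (rule residue_diff[OF s])
 show "isolated_singularity_at (\<lambda>z. f z + g z) z" "isolated_singularity_at (\<lambda>z. f z - g z) z"
  unfolding isolated_singularity_iff_eventually
  using s holomorphic_on_add[OF s(3,4)] holomorphic_on_diff[OF s(3,4)] by blast+
qed

lemma isolated_analytic: "f analytic_on {z} \<Longrightarrow> isolated_singularity_at f z"
 unfolding isolated_singularity_iff_eventually analytic_at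
 by (meson Diff_subset holomorphic_on_subset)

text \<open>The residue is an integral over a small circle, and a function with a primitive
  integrates to zero over a closed path.\<close>

lemma residue_derivative_zero:
 assumes s: "open s" "z \<in> s"
  and F: "\<And>w. w \<in> s - {z} \<Longrightarrow> (F has_field_derivative f w) (at w)"
 shows "residue f z = 0"
proof -
 have op: "open (s - {z})" using s(1) by (simp add: open_delete)
 have Fh: "F holomorphic_on s - {z}"
  using F op by (metis holomorphic_on_open)
 have "f holomorphic_on s - {z}"
 proof (rule holomorphic_transform)
  show "deriv F holomorphic_on s - {z}" by (rule holomorphic_deriv[OF Fh op])
  show "deriv F w = f w" if "w \<in> s - {z}" for w using F[OF that] by (rule DERIV_imp_deriv)
 qed
 moreover obtain r where r: "r > 0" "cball z r \<subseteq> s" using s open_contains_cball by blast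
 ultimately have 1: "(f has_contour_integral 2 * pi * \<i> * residue f z) (circlepath z r)"
  by (intro base_residue[OF s]) auto
 have "(f has_contour_integral (F (pathfinish (circlepath z r)) - F (pathstart (circlepath z r)))) (circlepath z r)"
 proof (rule contour_integral_primitive)
  show "path_image (circlepath z r) \<subseteq> s - {z}"
   using r by (auto simp: path_image_circlepath)
  show "(F has_field_derivative f w) (at w within s - {z})" if "w \<in> s - {z}" for w
   using F[OF that] by (rule has_field_derivative_at_within)
 qed simp
 then have "(f has_contour_integral 0) (circlepath z r)" by simp
 then have "2 * pi * \<i> * residue f z = 0" using 1 has_contour_integral_unique by blast
 then show ?thesis by simp
qed

lemma analytic_factor:
 assumes "f analytic_on {a::complex}"
 obtains g where "g analytic_on {a}" "\<forall>\<^sub>F \<zeta> in nhds a. f \<zeta> = f a + (\<zeta> - a) * g \<zeta>" "g a = deriv f a"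
proof -
 obtain e where e: "e > 0" "f holomorphic_on ball a e"
  using assms(1) by (auto simp: analytic_on_def)
 let ?g = "\<lambda>\<zeta>. if \<zeta> = a then deriv f a else (f \<zeta> - f a) / (\<zeta> - a)"
 have "?g holomorphic_on ball a e"
  by (rule pole_lemma[OF e(2)]) (use e in \<open>simp add: interior_open\<close>)
 then have "?g analytic_on {a}"
  using e(1) centre_in_ball open_ball unfolding analytic_at by blast
 moreover have "\<forall>\<^sub>F \<zeta> in nhds a. f \<zeta> = f a + (\<zeta> - a) * ?g \<zeta>"
  by (auto intro!: always_eventually)
 ultimately show ?thesis by (rule that) simp
qed

text \<open>The leading power of the Laurent expansion is split into its nonnegative part
  \<open>M\<close> and its negative part \<open>N\<close>; the remaining power series converges near
  \<open>w\<close>.\<close>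

lemma meromorphic_quotient:
 assumes "f meromorphic_on {w}"
 obtains h N where "h analytic_on {w}" "\<forall>\<^sub>F z in at w. f z = h z / (z - w) ^ N"
proof -
 obtain F where F: "(\<lambda>z. f (w + z)) has_laurent_expansion F"
  using assms unfolding meromorphic_on_def by blast
 define g where "g = eval_fps (fls_base_factor_to_fps F)"
 have "fps_conv_radius (fls_base_factor_to_fps F) > 0"
  using F by (simp add: has_laurent_expansion_def fls_conv_radius_altdef)
 then have g: "g analytic_on {0}" unfolding g_def
  by (intro analytic_on_eval_fps) (auto simp: in_eball_iff simp flip: zero_ereal_def)
 have ev: "\<forall>\<^sub>F z in at 0. f (w + z) = g z * z powi fls_subdegree F"
  using F unfolding has_laurent_expansion_def g_def eval_fls_def by (auto elim!: eventually_mono)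
 define N where "N = nat (- fls_subdegree F)"
 define M where "M = nat (fls_subdegree F)"
 have ev2: "\<forall>\<^sub>F z in at w. f z = g (z - w) * (z - w) powi fls_subdegree F"
  using ev unfolding at_to_0[of w] eventually_filtermap by (simp add: add.commute)
 have "(\<lambda>z. g (z - w)) analytic_on {w}"
  by (rule analytic_on_compose_gen[of "\<lambda>z. z - w" "{w}" g "{0}", unfolded comp_def])
   (use g in \<open>auto intro!: analytic_intros\<close>)
 then have "(\<lambda>z. g (z - w) * (z - w) ^ M) analytic_on {w}" by (auto intro!: analytic_intros)
 moreover have "\<forall>\<^sub>F z in at w. z \<noteq> w" by (simp add: eventually_at_filter)
 then have "\<forall>\<^sub>F z in at w. f z = (g (z - w) * (z - w) ^ M) / (z - w) ^ N"
  using ev2 by eventually_elim (auto simp: M_def N_def power_int_def divide_inverse power_inverse)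
 ultimately show ?thesis by (rule that)
qed

text \<open>A polar term of order at least two is exact, with this primitive.\<close>

lemma has_field_derivative_inverse_power:
 fixes f :: "complex \<Rightarrow> complex"
 assumes "(f has_field_derivative f') (at z)" "f z \<noteq> 0"
 shows "((\<lambda>z. - (c / of_nat (Suc M)) * inverse (f z) ^ Suc M) has_field_derivative
     c / f z ^ Suc (Suc M) * f') (at z)"
proof -
 have "((\<lambda>z. - (c / of_nat (Suc M)) * inverse (f z) ^ Suc M) has_field_derivative
   - (c / of_nat (Suc M)) * (of_nat (Suc M) * (- (inverse (f z) * f' * inverse (f z)) * inverse (f z) ^ M))) (at z)"
  using DERIV_cmult[OF DERIV_power[OF DERIV_inverse'[OF assms], of "Suc M"], of "- (c / of_nat (Suc M))"]
  by simp
 then show ?thesis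
  by (rule DERIV_cong) (simp add: divide_inverse power_inverse del: of_nat_Suc)
qed

text \<open>Induction on the pole order splits off one polar term at a time. Terms of order at least
  two are exact in both variables, so both residues vanish. For the simple pole write \<phi> \<zeta>
  - w as (\<zeta> - v) times \<open>u \<zeta>\<close>: the value \<open>u v = deriv \<phi> v\<close>
  cancels the derivative.\<close>

lemma residue_change_of_variable:
 fixes f \<phi> :: "complex \<Rightarrow> complex"
 assumes \<phi>: "\<phi> analytic_on {v}" "deriv \<phi> v \<noteq> 0" and f: "f meromorphic_on {\<phi> v}"
 shows "residue (\<lambda>\<zeta>. f (\<phi> \<zeta>) * deriv \<phi> \<zeta>) v = residue f (\<phi> v)"
proof -
 define w where "w = \<phi> v"
 obtain u where u: "u analytic_on {v}" "\<forall>\<^sub>F \<zeta> in nhds v. \<phi> \<zeta> = \<phi> v + (\<zeta> - v) * u \<zeta>" "u v = deriv \<phi> v"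
  using analytic_factor[OF \<phi>(1)] .
 have uc: "isCont u v" using u(1) by (rule analytic_at_imp_isCont)
 have unz: "\<forall>\<^sub>F \<zeta> in nhds v. u \<zeta> \<noteq> 0"
  using tendsto_imp_eventually_ne[of u "u v" "nhds v" 0] uc u(3) \<phi>(2)
  by (simp add: isCont_def tendsto_nhds_iff)
 have \<phi>w: "\<forall>\<^sub>F \<zeta> in at v. \<phi> \<zeta> \<noteq> w"
  unfolding eventually_at_filter using u(2) unz by eventually_elim (auto simp: w_def)
 have \<phi>lim: "filterlim \<phi> (at w) (at v)"
 proof -
  have "isCont \<phi> v" using \<phi>(1) by (rule analytic_at_imp_isCont)
  then show ?thesis using \<phi>w by (simp add: filterlim_at isCont_def w_def)
 qed
 have \<phi>': "deriv \<phi> analytic_on {v}" by (rule analytic_deriv[OF \<phi>(1)])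
 have comp: "(\<lambda>\<zeta>. h (\<phi> \<zeta>)) analytic_on {v}" if "h analytic_on {w}" for h
  using analytic_on_compose[OF \<phi>(1), of h] that by (simp add: comp_def w_def)
 obtain s0 where s0: "open s0" "v \<in> s0" "\<phi> holomorphic_on s0" using \<phi>(1) unfolding analytic_at by blast
 obtain s1 where s1: "open s1" "v \<in> s1" "\<And>\<zeta>. \<zeta> \<in> s1 \<Longrightarrow> \<zeta> \<noteq> v \<Longrightarrow> \<phi> \<zeta> \<noteq> w"
  using \<phi>w unfolding eventually_at_topological by blast
 define s where "s = s0 \<inter> s1"
 have s: "open s" "v \<in> s" "\<phi> holomorphic_on s" "\<And>\<zeta>. \<zeta> \<in> s \<Longrightarrow> \<zeta> \<noteq> v \<Longrightarrow> \<phi> \<zeta> \<noteq> w"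
  using s0 s1 by (auto simp: s_def intro: holomorphic_on_subset)
 have pole: "residue (\<lambda>\<zeta>. c / (\<phi> \<zeta> - w) ^ Suc N * deriv \<phi> \<zeta>) v = residue (\<lambda>\<zeta>. c / (\<zeta> - w) ^ Suc N) w" for c N
 proof (cases N)
  case 0
  have "(\<lambda>\<zeta>. c * deriv \<phi> \<zeta> / u \<zeta>) analytic_on {v}"
   by (intro analytic_intros \<phi>' u(1)) (use u(3) \<phi>(2) in auto)
  then obtain t where t: "open t" "v \<in> t" "(\<lambda>\<zeta>. c * deriv \<phi> \<zeta> / u \<zeta>) holomorphic_on t"
   unfolding analytic_at by blast
  have "residue (\<lambda>\<zeta>. c / (\<phi> \<zeta> - w) ^ Suc N * deriv \<phi> \<zeta>) v = residue (\<lambda>\<zeta>. (c * deriv \<phi> \<zeta> / u \<zeta>) / (\<zeta> - v)) v"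
  proof (rule residue_cong[OF _ refl])
   show "\<forall>\<^sub>F \<zeta> in at v. c / (\<phi> \<zeta> - w) ^ Suc N * deriv \<phi> \<zeta> = (c * deriv \<phi> \<zeta> / u \<zeta>) / (\<zeta> - v)"
    unfolding eventually_at_filter using u(2) by eventually_elim (simp add: 0 w_def)
  qed
  also have "\<dots> = c * deriv \<phi> v / u v" by (rule residue_simple[OF t])
  also have "\<dots> = c" using u(3) \<phi>(2) by simp
  also have "\<dots> = residue (\<lambda>\<zeta>. c / (\<zeta> - w)) w"
   using residue_simple[of UNIV w "\<lambda>_. c"] by simp
  finally show ?thesis by (simp add: 0)
 next
  case (Suc M)
  have "residue (\<lambda>\<zeta>. c / (\<phi> \<zeta> - w) ^ Suc N * deriv \<phi> \<zeta>) v = 0"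
  proof (rule residue_derivative_zero[OF s(1,2)])
   fix \<zeta> assume \<zeta>: "\<zeta> \<in> s - {v}"
   have "(\<phi> has_field_derivative deriv \<phi> \<zeta>) (at \<zeta>)"
    using s \<zeta> holomorphic_derivI by blast
   then have "((\<lambda>\<zeta>. \<phi> \<zeta> - w) has_field_derivative deriv \<phi> \<zeta>) (at \<zeta>)"
    by (auto intro!: derivative_eq_intros)
   moreover have "\<phi> \<zeta> - w \<noteq> 0" using s(4) \<zeta> by auto
   ultimately show "((\<lambda>\<zeta>. - (c / of_nat N) * inverse (\<phi> \<zeta> - w) ^ N) has_field_derivative
     c / (\<phi> \<zeta> - w) ^ Suc N * deriv \<phi> \<zeta>) (at \<zeta>)"
    unfolding Suc using has_field_derivative_inverse_power[of "\<lambda>\<zeta>. \<phi> \<zeta> - w" "deriv \<phi> \<zeta>" \<zeta> c M]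
    by simp
  qed
  moreover have "residue (\<lambda>\<zeta>. c / (\<zeta> - w) ^ Suc N) w = 0"
  proof (rule residue_derivative_zero[OF open_UNIV UNIV_I])
   fix \<zeta> assume \<zeta>: "\<zeta> \<in> UNIV - {w}"
   then have "\<zeta> - w \<noteq> 0" by simp
   moreover have "((\<lambda>\<zeta>. \<zeta> - w) has_field_derivative 1) (at \<zeta>)"
    by (auto intro!: derivative_eq_intros)
   ultimately show "((\<lambda>\<zeta>. - (c / of_nat N) * inverse (\<zeta> - w) ^ N) has_field_derivative
     c / (\<zeta> - w) ^ Suc N) (at \<zeta>)"
    unfolding Suc using has_field_derivative_inverse_power[of "\<lambda>\<zeta>. \<zeta> - w" 1 \<zeta> c M] by simp
  qed
  ultimately show ?thesis by simp
 qed
 have iso1: "isolated_singularity_at (\<lambda>\<zeta>. h \<zeta> / (\<zeta> - w) ^ N) w" if "h analytic_on {w}" for h N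
 proof -
  obtain t where "open t" "w \<in> t" "h holomorphic_on t" using \<open>h analytic_on {w}\<close> unfolding analytic_at by blast
  then show ?thesis unfolding isolated_singularity_iff_eventually
   by (intro exI[of _ t] conjI holomorphic_intros) (auto intro: holomorphic_on_subset)
 qed
 have iso2: "isolated_singularity_at (\<lambda>\<zeta>. h (\<phi> \<zeta>) / (\<phi> \<zeta> - w) ^ N * deriv \<phi> \<zeta>) v" if "h analytic_on {w}" for h N
 proof -
  obtain t where t: "open t" "v \<in> t" "(\<lambda>\<zeta>. h (\<phi> \<zeta>)) holomorphic_on t"
   using comp[OF \<open>h analytic_on {w}\<close>] unfolding analytic_at by blast
  have "deriv \<phi> holomorphic_on s" by (rule holomorphic_deriv[OF s(3,1)])
  then show ?thesis unfolding isolated_singularity_iff_eventually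
   using s t by (intro exI[of _ "s \<inter> t"] conjI holomorphic_intros) (auto intro: holomorphic_on_subset)
 qed
 have main: "residue (\<lambda>\<zeta>. h (\<phi> \<zeta>) / (\<phi> \<zeta> - w) ^ N * deriv \<phi> \<zeta>) v = residue (\<lambda>\<zeta>. h \<zeta> / (\<zeta> - w) ^ N) w"
  if "h analytic_on {w}" for h N
  using that
 proof (induction N arbitrary: h)
  case 0
  have "(\<lambda>\<zeta>. h (\<phi> \<zeta>) * deriv \<phi> \<zeta>) analytic_on {v}" by (intro analytic_intros comp 0 \<phi>')
  then show ?case using residue_analytic[OF 0] residue_analytic by simp
 next
  case (Suc N)
  obtain g where g: "g analytic_on {w}" "\<forall>\<^sub>F \<zeta> in nhds w. h \<zeta> = h w + (\<zeta> - w) * g \<zeta>"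
   using analytic_factor[OF Suc.prems] by metis
  have e1: "\<forall>\<^sub>F \<zeta> in at w. h \<zeta> / (\<zeta> - w) ^ Suc N = h w / (\<zeta> - w) ^ Suc N + g \<zeta> / (\<zeta> - w) ^ N"
   unfolding eventually_at_filter using g(2)
  proof eventually_elim
   case (elim \<zeta>)
   show ?case unfolding elim by (simp add: add_divide_distrib)
  qed
  have c: "(\<lambda>_. h w) analytic_on {w}" by simp
  have "residue (\<lambda>\<zeta>. h \<zeta> / (\<zeta> - w) ^ Suc N) w =
    residue (\<lambda>\<zeta>. h w / (\<zeta> - w) ^ Suc N) w + residue (\<lambda>\<zeta>. g \<zeta> / (\<zeta> - w) ^ N) w"
   using residue_add_isolated(1)[OF iso1[OF c] iso1[OF g(1)], of "Suc N" N] residue_cong[OF e1 refl] by simp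
  moreover have "\<forall>\<^sub>F \<zeta> in at v. h (\<phi> \<zeta>) / (\<phi> \<zeta> - w) ^ Suc N * deriv \<phi> \<zeta> =
    h w / (\<phi> \<zeta> - w) ^ Suc N * deriv \<phi> \<zeta> + g (\<phi> \<zeta>) / (\<phi> \<zeta> - w) ^ N * deriv \<phi> \<zeta>"
   using eventually_compose_filterlim[OF e1 \<phi>lim] by eventually_elim (simp add: distrib_right)
  from residue_cong[OF this refl]
  have "residue (\<lambda>\<zeta>. h (\<phi> \<zeta>) / (\<phi> \<zeta> - w) ^ Suc N * deriv \<phi> \<zeta>) v =
    residue (\<lambda>\<zeta>. h w / (\<phi> \<zeta> - w) ^ Suc N * deriv \<phi> \<zeta>) v + residue (\<lambda>\<zeta>. g (\<phi> \<zeta>) / (\<phi> \<zeta> - w) ^ N * deriv \<phi> \<zeta>) v"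
   using residue_add_isolated(1)[OF iso2[OF c] iso2[OF g(1)], of "Suc N" N] by simp
  ultimately show ?case using pole Suc.IH[OF g(1)] by simp
 qed
 obtain h N where h: "h analytic_on {w}" "\<forall>\<^sub>F z in at w. f z = h z / (z - w) ^ N"
  using meromorphic_quotient[OF f] by (auto simp: w_def)
 have "residue (\<lambda>\<zeta>. f (\<phi> \<zeta>) * deriv \<phi> \<zeta>) v = residue (\<lambda>\<zeta>. h (\<phi> \<zeta>) / (\<phi> \<zeta> - w) ^ N * deriv \<phi> \<zeta>) v"
 proof (rule residue_cong[OF _ refl])
  show "\<forall>\<^sub>F \<zeta> in at v. f (\<phi> \<zeta>) * deriv \<phi> \<zeta> = h (\<phi> \<zeta>) / (\<phi> \<zeta> - w) ^ N * deriv \<phi> \<zeta>"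
   using eventually_compose_filterlim[OF h(2) \<phi>lim] by eventually_elim simp
 qed
 also have "\<dots> = residue (\<lambda>\<zeta>. h \<zeta> / (\<zeta> - w) ^ N) w" by (rule main[OF h(1)])
 also have "\<dots> = residue f w"
  by (rule residue_cong[OF _ refl]) (use h(2) in \<open>auto elim: eventually_mono\<close>)
 finally show ?thesis by (simp add: w_def)
qed

text \<open>The condition at infinity says that f dz extends holomorphically there: with z =
  1/\<zeta> one has dz = -d\<zeta>/\<zeta>^2. It bounds f by a constant over |z|^2, so the integral
  over the circle of radius R is O(1/R), while for all large R it equals 2 pi i times the
  sum.\<close>

lemma sum_residues_zero:
 assumes S: "finite S" and f: "f holomorphic_on - S"
  and inf: "g analytic_on {0}" "\<forall>\<^sub>F \<zeta> in at 0. f (1 / \<zeta>) = \<zeta>\<^sup>2 * g \<zeta>"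
 shows "(\<Sum>p\<in>S. residue f p) = 0"
proof -
 have "isCont g 0" using inf(1) by (rule analytic_at_imp_isCont)
 then have "\<forall>\<^sub>F \<zeta> in nhds 0. dist (g \<zeta>) (g 0) < 1"
  by (simp add: isCont_def tendsto_nhds_iff flip: tendsto_iff) (metis tendstoD tendsto_nhds_iff zero_less_one)
 then have "\<forall>\<^sub>F \<zeta> in at 0. dist (g \<zeta>) (g 0) < 1 \<and> f (1 / \<zeta>) = \<zeta>\<^sup>2 * g \<zeta>"
  using inf(2) by (auto simp: eventually_conj_iff eventually_at_filter elim: eventually_mono)
 then obtain d where d: "d > 0" "\<And>\<zeta>. \<zeta> \<noteq> 0 \<Longrightarrow> norm \<zeta> < d \<Longrightarrow> dist (g \<zeta>) (g 0) < 1 \<and> f (1 / \<zeta>) = \<zeta>\<^sup>2 * g \<zeta>"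
  unfolding eventually_at by (auto simp: dist_norm)
 define C where "C = norm (g 0) + 1"
 have C: "C > 0" by (simp add: C_def add_nonneg_pos)
 have bnd: "norm (f z) \<le> C / (norm z)\<^sup>2" if "norm z > 1 / d" for z
 proof -
  have z: "norm z > 0" using that d(1) by (meson divide_pos_pos less_trans zero_less_one)
  then have z: "z \<noteq> 0" "norm (1 / z) < d" using that d(1) by (auto simp: norm_divide field_simps)
  have dz: "dist (g (1 / z)) (g 0) < 1" "f (1 / (1 / z)) = (1 / z)\<^sup>2 * g (1 / z)"
   using d(2)[of "1 / z"] z by auto
  have "norm (g (1 / z)) \<le> C" using dz(1) norm_triangle_ineq2[of "g (1 / z)" "g 0"]
   by (simp add: C_def dist_norm)
  moreover have "norm (f z) = norm (g (1 / z)) / (norm z)\<^sup>2" using dz(2)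
   by (simp add: norm_mult norm_divide norm_power power_divide)
  ultimately show ?thesis by (simp add: divide_right_mono)
 qed
 obtain B where B: "\<And>p. p \<in> S \<Longrightarrow> norm p < B" "B > 1 / d" "B > 0"
 proof -
  have "bounded S" using S by (rule finite_imp_bounded)
  then obtain B0 where "\<forall>p\<in>S. norm p \<le> B0" unfolding bounded_iff by blast
  moreover have "1 / d > 0" using d(1) by simp
  ultimately show ?thesis by (intro that[of "max B0 (1 / d) + 1"]) (fastforce, fastforce, simp add: add_pos_pos less_max_iff_disj)
 qed
 define \<Sigma> where "\<Sigma> = (\<Sum>p\<in>S. residue f p)"
 have est: "2 * pi * norm \<Sigma> \<le> 2 * pi * C / R" if R: "R > B" for R
 proof -
  have R0: "R > 0" using R B by simp
  have "contour_integral (circlepath 0 R) f = 2 * pi * \<i> * (\<Sum>p\<in>S. winding_number (circlepath 0 R) p * residue f p)"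
  proof (rule Residue_theorem[of UNIV])
   show "f holomorphic_on UNIV - S" using f by (simp add: Compl_eq_Diff_UNIV)
   show "path_image (circlepath 0 R) \<subseteq> UNIV - S"
    using R0 R B(1) by (fastforce simp: path_image_circlepath)
  qed (use S in auto)
  also have "(\<Sum>p\<in>S. winding_number (circlepath 0 R) p * residue f p) = \<Sigma>"
   unfolding \<Sigma>_def
  proof (rule sum.cong[OF refl])
   fix p assume "p \<in> S"
   then have "norm (p - 0) < R" using B(1) R by fastforce
   then show "winding_number (circlepath 0 R) p * residue f p = residue f p"
    by (simp add: winding_number_circlepath)
  qed
  finally have eq: "contour_integral (circlepath 0 R) f = 2 * pi * \<i> * \<Sigma>" .
  have img: "path_image (circlepath 0 R) \<subseteq> - S"
   using R0 R B(1) by (fastforce simp: path_image_circlepath)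
  have "open (- S)" using S by (simp add: finite_imp_closed open_Compl)
  then have ci: "f contour_integrable_on circlepath 0 R"
   by (rule contour_integrable_holomorphic_simple[OF f]) (use img in simp_all)
  have "(f has_contour_integral (2 * pi * \<i> * \<Sigma>)) (circlepath 0 R)"
   using has_contour_integral_integral[OF ci] unfolding eq .
  then have "norm (2 * pi * \<i> * \<Sigma>) \<le> C / R\<^sup>2 * (2 * pi * R)"
  proof (rule has_contour_integral_bound_circlepath)
   show "0 \<le> C / R\<^sup>2" using C by simp
   show "0 < R" by (rule R0)
   fix z assume z: "cmod (z - 0) = R"
   have "1 / d < norm z" using z less_trans[OF B(2) R] by simp
   from bnd[OF this] show "norm (f z) \<le> C / R\<^sup>2" using z by simp
  qed
  moreover have "norm (2 * pi * \<i> * \<Sigma>) = 2 * pi * norm \<Sigma>" by (simp add: norm_mult)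
  moreover have "C / R\<^sup>2 * (2 * pi * R) = 2 * pi * C / R" using R0 by (simp add: power2_eq_square)
  ultimately show ?thesis by simp
 qed
 have "norm \<Sigma> \<le> 0"
 proof (rule ccontr)
  assume "\<not> norm \<Sigma> \<le> 0"
  then have p: "norm \<Sigma> > 0" by simp
  define R where "R = max B (C / norm \<Sigma>) + 1"
  have R: "R > B" "R > C / norm \<Sigma>" unfolding R_def by linarith+
  have R0: "R > 0" by (rule less_trans[OF B(3) R(1)])
  have "C < R * norm \<Sigma>" using R(2) p by (simp add: pos_divide_less_eq)
  then have "C / R < norm \<Sigma>" using R0 by (simp add: pos_divide_less_eq mult.commute)
  then have "2 * pi * (C / R) < 2 * pi * norm \<Sigma>"
   by (rule mult_strict_left_mono) simp
  then show False using est[OF R(1)] by simp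
 qed
 then show ?thesis by (simp add: \<Sigma>_def)
qed

section \<open>One-forms on P1: coefficients in affine charts and chart-independent residues\<close>

lemma affine_chart_repr:
 assumes "br a b \<noteq> 0" "q \<in> fst (affine_chart a b)"
 shows "q = cfun.span {a + fscale (snd (affine_chart a b) q) b}"
 using affine_chart_inv(1)[OF assms(1), of "snd (affine_chart a b) q"] inv_into_f_f[OF affine_chart_inv(2)[OF assms(1)] assms(2)]
 by simp

lemma affine_in_points: "br a b \<noteq> 0 \<Longrightarrow> cfun.span {a + fscale \<zeta> b} \<in> points P1"
 unfolding points_P1 using affine_nonzero by blast

text \<open>The bracket of the vectors at \<open>\<zeta>\<^sub>0\<close> and \<open>\<zeta>\<close>
  is \<open>(\<zeta> - \<zeta>\<^sub>0) * br a b\<close>. It vanishes at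
  \<open>\<zeta>\<^sub>0\<close>, so only its derivative contributes there.\<close>

lemma omega_form_id:
 assumes w: "nonzero_bivector w" and ab: "br a b \<noteq> 0" and u: "br (a + fscale \<zeta>\<^sub>0 b) u \<noteq> 0"
 shows "omega_form w id (affine_chart a b) (cfun.span {a + fscale \<zeta>\<^sub>0 b}) u
  = w (1, 2) * br a b / (br (a + fscale \<zeta>\<^sub>0 b) u)\<^sup>2"
proof -
 let ?v = "a + fscale \<zeta>\<^sub>0 b"
 have ev: "\<forall>\<^sub>F \<zeta> in nhds \<zeta>\<^sub>0. br a u + \<zeta> * br b u \<noteq> 0"
  by (intro eventually_nhds_in_open[of "{\<zeta>. br a u + \<zeta> * br b u \<noteq> 0}", simplified] open_Collect_neq continuous_intros)
   (use u in \<open>simp add: br_add br_scale\<close>)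
 have "\<forall>\<^sub>F \<zeta> in nhds \<zeta>\<^sub>0. omega_section w (cfun.span {?v}) u (cfun.span {a + fscale \<zeta> b}) u
   = w (1, 2) * ((\<zeta> - \<zeta>\<^sub>0) * br a b) / (br ?v u * (br a u + \<zeta> * br b u))"
  using ev
 proof eventually_elim
  case (elim \<zeta>)
  have "br ?v (a + fscale \<zeta> b) = (\<zeta> - \<zeta>\<^sub>0) * br a b"
   using br_swap[of b a] by (simp add: br_add br_scale algebra_simps)
  moreover have d: "br (a + fscale \<zeta> b) u = br a u + \<zeta> * br b u" by (simp add: br_add br_scale)
  ultimately show ?case using elim by (simp add: omega_section_eq[OF w u])
 qed
 from deriv_cong_ev[OF this refl]
 have "omega_form w id (affine_chart a b) (cfun.span {?v}) u
   = deriv (\<lambda>\<zeta>. w (1, 2) * ((\<zeta> - \<zeta>\<^sub>0) * br a b) / (br ?v u * (br a u + \<zeta> * br b u))) \<zeta>\<^sub>0"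
  unfolding omega_form_def affine_chart_inv[OF ab] id_apply .
 also have "\<dots> = w (1, 2) * br a b / (br ?v u)\<^sup>2"
 proof (rule DERIV_imp_deriv)
  have v: "br ?v u = br a u + \<zeta>\<^sub>0 * br b u" by (simp add: br_add br_scale)
  show "((\<lambda>\<zeta>. w (1, 2) * ((\<zeta> - \<zeta>\<^sub>0) * br a b) / (br ?v u * (br a u + \<zeta> * br b u)))
    has_field_derivative w (1, 2) * br a b / (br ?v u)\<^sup>2) (at \<zeta>\<^sub>0)"
   unfolding v using u[unfolded v]
   by (auto intro!: derivative_eq_intros simp: power2_eq_square divide_simps)
 qed
 finally show ?thesis .
qed

text \<open>As \<open>u\<close> varies, \<open>h u\<close> scales like the square of
  \<open>br (a + fscale \<zeta> b) u\<close> and the form like its inverse; the product is the same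
  for every \<open>u\<close>, as the definite description requires.\<close>

lemma form_coeff_eq:
 assumes w: "nonzero_bivector w" and ab: "br a b \<noteq> 0" and u: "br (a + fscale \<zeta> b) u \<noteq> 0"
  and h: "h \<in> quot_power UNIV (cfun.span {a + fscale \<zeta> b}) (- 2)"
 shows "form_coeff w (affine_chart a b) (cfun.span {a + fscale \<zeta> b}) h
  = h u * (w (1, 2) * br a b / (br (a + fscale \<zeta> b) u)\<^sup>2)"
proof -
 let ?v = "a + fscale \<zeta> b"
 have v0: "?v \<noteq> 0" by (rule affine_nonzero[OF ab])
 obtain C where C: "h = (\<lambda>u. if br ?v u \<noteq> 0 then C * br ?v u powi (- (- 2)) else 0)"
  using h unfolding quot_power_line[OF v0] by blast
 have hv: "h u * (w (1, 2) * br a b / (br ?v u)\<^sup>2) = C * (w (1, 2) * br a b)" if "br ?v u \<noteq> 0" for u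
  using that by (simp add: C power_int_def nat_numeral)
 have eq: "(\<forall>u. u \<notin> cfun.span {?v} \<longrightarrow> c = h u * omega_form w id (affine_chart a b) (cfun.span {?v}) u) \<longleftrightarrow>
   c = C * (w (1, 2) * br a b)" for c
  using omega_form_id[OF w ab] hv u unfolding not_mem_line[OF v0] by auto
 show ?thesis unfolding form_coeff_def eq hv[OF u] by simp
qed

lemma local_coeff_eq:
 assumes w: "nonzero_bivector w" and ab: "br a b \<noteq> 0" and u: "br (a + fscale \<zeta> b) u \<noteq> 0"
  and h: "\<mu> (cfun.span {a + fscale \<zeta> b}) \<in> quot_power UNIV (cfun.span {a + fscale \<zeta> b}) (- 2)"
 shows "local_coeff w (affine_chart a b) \<mu> \<zeta>
  = \<mu> (cfun.span {a + fscale \<zeta> b}) u * (w (1, 2) * br a b / (br (a + fscale \<zeta> b) u)\<^sup>2)"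
 unfolding local_coeff_def Let_def affine_chart_inv[OF ab] by (rule form_coeff_eq[where \<zeta> = \<zeta>, OF w ab u h])

lemma local_coeff_diff:
 assumes w: "nonzero_bivector w" and ab: "br a b \<noteq> 0"
  and "\<mu> (cfun.span {a + fscale \<zeta> b}) \<in> quot_power UNIV (cfun.span {a + fscale \<zeta> b}) (- 2)"
  and "\<mu>' (cfun.span {a + fscale \<zeta> b}) \<in> quot_power UNIV (cfun.span {a + fscale \<zeta> b}) (- 2)"
 shows "local_coeff w (affine_chart a b) (\<mu> - \<mu>') \<zeta>
  = local_coeff w (affine_chart a b) \<mu> \<zeta> - local_coeff w (affine_chart a b) \<mu>' \<zeta>"
proof -
 have u: "br (a + fscale \<zeta> b) b \<noteq> 0" using ab by (simp add: br_add br_scale)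
 have "(\<mu> - \<mu>') (cfun.span {a + fscale \<zeta> b}) \<in> quot_power UNIV (cfun.span {a + fscale \<zeta> b}) (- 2)"
  using quot_power_subspace(3)[OF assms(3,4)] by simp
 from local_coeff_eq[where \<mu> = "\<mu> - \<mu>'", OF w ab u this] local_coeff_eq[where \<mu> = \<mu>, OF w ab u assms(3)]
  local_coeff_eq[where \<mu> = \<mu>', OF w ab u assms(4)]
 show ?thesis by (simp add: algebra_simps)
qed

lemma local_coeff_analytic:
 assumes w: "nonzero_bivector w" and ab: "br a b \<noteq> 0"
  and s: "s \<in> local_sections P1 (L_power (- 2)) (cfun.span {a + fscale \<zeta>\<^sub>0 b})"
 shows "local_coeff w (affine_chart a b) s analytic_on {\<zeta>\<^sub>0}"
proof -
 have u: "br (a + fscale \<zeta> b) b = br a b" for \<zeta> by (simp add: br_add br_scale)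
 have b: "b \<notin> cfun.span {a + fscale \<zeta>\<^sub>0 b}"
  using line_mem_iff[OF affine_nonzero[OF ab]] u ab by simp
 note L = L_local(1)[OF affine_in_points[OF ab] b, of s "- 2"]
 have 1: "\<forall>\<^sub>F \<zeta> in nhds \<zeta>\<^sub>0. s (cfun.span {a + fscale \<zeta> b}) \<in> quot_power UNIV (cfun.span {a + fscale \<zeta> b}) (- 2)"
  using s unfolding L eventually_P1[OF ab] by blast
 have 2: "(\<lambda>\<zeta>. s (cfun.span {a + fscale \<zeta> b}) b) analytic_on {\<zeta>\<^sub>0}"
  using s unfolding L hol_at_P1[OF ab] by blast
 have ev: "\<forall>\<^sub>F \<zeta> in nhds \<zeta>\<^sub>0. local_coeff w (affine_chart a b) s \<zeta> = s (cfun.span {a + fscale \<zeta> b}) b * (w (1, 2) * br a b / (br a b)\<^sup>2)"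
  using 1
 proof eventually_elim
  case (elim \<zeta>)
  show ?case using local_coeff_eq[where u = b and \<zeta> = \<zeta> and \<mu> = s, OF w ab _ elim] ab unfolding u by simp
 qed
 have "(\<lambda>\<zeta>. s (cfun.span {a + fscale \<zeta> b}) b * (w (1, 2) * br a b / (br a b)\<^sup>2)) analytic_on {\<zeta>\<^sub>0}"
  by (intro analytic_on_mult 2 analytic_on_const)
 then show ?thesis using analytic_at_cong[OF ev refl] by simp
qed

text \<open>The transition map \<phi> is a Moebius transformation whose derivative is the quotient
  of the two factors in \<open>local_coeff_eq\<close>, both read at the vector \<open>b\<close>. The
  claim becomes the change of variables for residues.\<close>

lemma residue_chart_independent:
 assumes w: "nonzero_bivector w" and ab: "br a b \<noteq> 0" and cd: "br c d \<noteq> 0"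
  and q: "q \<in> fst (affine_chart a b)" "q \<in> fst (affine_chart c d)"
  and \<mu>: "\<forall>\<^sub>F y in nhds_rs P1 q. y \<noteq> q \<longrightarrow> \<mu> y \<in> quot_power UNIV y (- 2)"
  and mer: "local_coeff w (affine_chart a b) \<mu> meromorphic_on {snd (affine_chart a b) q}"
 shows "residue (local_coeff w (affine_chart c d) \<mu>) (snd (affine_chart c d) q)
  = residue (local_coeff w (affine_chart a b) \<mu>) (snd (affine_chart a b) q)"
proof -
 define v where "v = snd (affine_chart c d) q"
 define f where "f = local_coeff w (affine_chart a b) \<mu>"
 let ?v = "\<lambda>\<zeta>. c + fscale \<zeta> d"
 define \<phi> where "\<phi> = (\<lambda>\<zeta>. br a (?v \<zeta>) / br (?v \<zeta>) b)"
 have qv: "q = cfun.span {?v v}" using affine_chart_repr[OF cd q(2)] by (simp add: v_def)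
 have "b \<notin> q" using q(1) affine_chart_dom[OF ab] by blast
 then have nz: "br (?v v) b \<noteq> 0" unfolding qv using line_mem_iff[OF affine_nonzero[OF cd]] by simp
 have \<phi>v: "\<phi> v = snd (affine_chart a b) q"
  unfolding qv affine_chart_coord[OF ab nz] \<phi>_def ..
 have lin: "br (?v \<zeta>) b = br c b + \<zeta> * br d b" "br a (?v \<zeta>) = br a c + \<zeta> * br a d" for \<zeta>
  by (simp_all add: br_add br_scale)
 have \<phi>an: "\<phi> analytic_on {v}"
  unfolding \<phi>_def lin using nz[unfolded lin] by (intro analytic_intros) auto
 have \<phi>': "deriv \<phi> \<zeta> = br a b * br c d / (br (?v \<zeta>) b)\<^sup>2" if "br (?v \<zeta>) b \<noteq> 0" for \<zeta>
 proof (rule DERIV_imp_deriv)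
  \<comment> \<open>The Pluecker relation: it makes the numerator in the quotient rule
    constant.\<close>
  have "br a d * br c b - br a c * br d b = br a b * br c d"
   by (simp add: br_def algebra_simps)
  then have e: "br a d * (br c b + \<zeta> * br d b) - (br a c + \<zeta> * br a d) * br d b = br a b * br c d"
   by (simp add: algebra_simps)
  have "((\<lambda>\<zeta>. (br a c + \<zeta> * br a d) / (br c b + \<zeta> * br d b)) has_field_derivative
    (br a d * (br c b + \<zeta> * br d b) - (br a c + \<zeta> * br a d) * br d b) / (br c b + \<zeta> * br d b)\<^sup>2) (at \<zeta>)"
   using that unfolding lin by (auto intro!: derivative_eq_intros simp: power2_eq_square)
  then show "(\<phi> has_field_derivative br a b * br c d / (br (?v \<zeta>) b)\<^sup>2) (at \<zeta>)"
   unfolding \<phi>_def lin e .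
 qed
 have ev: "\<forall>\<^sub>F \<zeta> in at v. local_coeff w (affine_chart c d) \<mu> \<zeta> = f (\<phi> \<zeta>) * deriv \<phi> \<zeta>"
 proof -
  have "\<forall>\<^sub>F \<zeta> in nhds v. br c b + \<zeta> * br d b \<noteq> 0"
   by (intro eventually_nhds_in_open[of "{\<zeta>. br c b + \<zeta> * br d b \<noteq> 0}", simplified] open_Collect_neq continuous_intros)
    (use nz in \<open>simp add: lin\<close>)
  moreover have "\<forall>\<^sub>F \<zeta> in nhds v. cfun.span {?v \<zeta>} \<noteq> q \<longrightarrow> \<mu> (cfun.span {?v \<zeta>}) \<in> quot_power UNIV (cfun.span {?v \<zeta>}) (- 2)"
   using \<mu> unfolding qv eventually_P1[OF cd] .
  ultimately show ?thesis unfolding eventually_at_filter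
  proof eventually_elim
   case (elim \<zeta>)
   show ?case
   proof (intro impI)
    assume "\<zeta> \<noteq> v"
    then have "cfun.span {?v \<zeta>} \<noteq> q"
     using affine_chart_inv(3)[OF cd, of \<zeta>] by (auto simp: v_def)
    then have h: "\<mu> (cfun.span {?v \<zeta>}) \<in> quot_power UNIV (cfun.span {?v \<zeta>}) (- 2)" using elim(2) by blast
    have n: "br (?v \<zeta>) b \<noteq> 0" using elim(1) by (simp add: lin)
    have y: "cfun.span {?v \<zeta>} = cfun.span {a + fscale (\<phi> \<zeta>) b}"
    proof -
     have "cfun.span {?v \<zeta>} \<in> fst (affine_chart a b)" unfolding affine_chart_dom'[OF ab] using n by blast
     from affine_chart_repr[OF ab this] show ?thesis unfolding affine_chart_coord[OF ab n] \<phi>_def .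
    qed
    have n2: "br (a + fscale (\<phi> \<zeta>) b) b \<noteq> 0" using ab by (simp add: br_add br_scale)
    have "f (\<phi> \<zeta>) = \<mu> (cfun.span {?v \<zeta>}) b * (w (1, 2) * br a b / (br (a + fscale (\<phi> \<zeta>) b) b)\<^sup>2)"
     unfolding f_def y by (rule local_coeff_eq[where \<mu> = \<mu>, OF w ab n2 h[unfolded y]])
    moreover have "br (a + fscale (\<phi> \<zeta>) b) b = br a b" by (simp add: br_add br_scale)
    moreover have "local_coeff w (affine_chart c d) \<mu> \<zeta> = \<mu> (cfun.span {?v \<zeta>}) b * (w (1, 2) * br c d / (br (?v \<zeta>) b)\<^sup>2)"
     by (rule local_coeff_eq[where \<mu> = \<mu>, OF w cd n h])
    ultimately show "local_coeff w (affine_chart c d) \<mu> \<zeta> = f (\<phi> \<zeta>) * deriv \<phi> \<zeta>"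
     using ab by (simp add: \<phi>'[OF n] power2_eq_square)
   qed
  qed
 qed
 have "deriv \<phi> v \<noteq> 0" using \<phi>'[OF nz] nz ab cd by simp
 from residue_change_of_variable[OF \<phi>an this, of f] mer
 have "residue (\<lambda>\<zeta>. f (\<phi> \<zeta>) * deriv \<phi> \<zeta>) v = residue f (snd (affine_chart a b) q)"
  by (simp add: \<phi>v f_def)
 then show ?thesis using residue_cong[OF ev refl] by (simp add: v_def f_def)
qed

lemma form_residue_eq:
 assumes w: "nonzero_bivector w" and ab: "br a b \<noteq> 0" and q: "q \<in> fst (affine_chart a b)"
  and \<mu>: "\<forall>\<^sub>F y in nhds_rs P1 q. y \<noteq> q \<longrightarrow> \<mu> y \<in> quot_power UNIV y (- 2)"
  and mer: "local_coeff w (affine_chart a b) \<mu> meromorphic_on {snd (affine_chart a b) q}"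
 shows "form_residue w q \<mu> = residue (local_coeff w (affine_chart a b) \<mu>) (snd (affine_chart a b) q)"
 unfolding form_residue_def
proof (rule the_equality)
 show "\<forall>\<kappa>\<in>P1. q \<in> fst \<kappa> \<longrightarrow> residue (local_coeff w (affine_chart a b) \<mu>) (snd (affine_chart a b) q)
   = residue (local_coeff w \<kappa> \<mu>) (snd \<kappa> q)"
 proof (intro ballI impI)
  fix \<kappa> assume "\<kappa> \<in> P1" and q': "q \<in> fst \<kappa>"
  then obtain c d where cd: "br c d \<noteq> 0" "\<kappa> = affine_chart c d" unfolding P1_iff by blast
  show "residue (local_coeff w (affine_chart a b) \<mu>) (snd (affine_chart a b) q)
   = residue (local_coeff w \<kappa> \<mu>) (snd \<kappa> q)"
   unfolding cd(2) by (rule residue_chart_independent[OF w ab cd(1) q q'[unfolded cd(2)] \<mu> mer, symmetric])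
 qed
next
 fix \<rho> assume "\<forall>\<kappa>\<in>P1. q \<in> fst \<kappa> \<longrightarrow> \<rho> = residue (local_coeff w \<kappa> \<mu>) (snd \<kappa> q)"
 then show "\<rho> = residue (local_coeff w (affine_chart a b) \<mu>) (snd (affine_chart a b) q)"
  using affine_chart_P1[OF ab] q by blast
qed

text \<open>P1 is the union of two closed discs: the line of \<open>v\<close> lies in one or the
  other according to which of \<open>norm (br a v)\<close> and \<open>norm (br v b)\<close> is
  larger. Each disc is compact, and the cover pulls back to open sets of its coordinate.\<close>

lemma P1_finite_subcover:
 assumes U: "open_cover U"
 obtains Q where "finite Q" "Q \<subseteq> points P1" "points P1 \<subseteq> (\<Union>q\<in>Q. U q)"
proof -
 have part: "\<exists>Q. finite Q \<and> Q \<subseteq> points P1 \<and> (\<lambda>\<zeta>. cfun.span {a + fscale \<zeta> b}) ` cball 0 1 \<subseteq> (\<Union>q\<in>Q. U q)"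
  if ab: "br a b \<noteq> 0" for a b
 proof -
  let ?f = "\<lambda>\<zeta>. cfun.span {a + fscale \<zeta> b}"
  let ?O = "\<lambda>q. {\<zeta>. ?f \<zeta> \<in> U q}"
  have op: "open (?O q)" if q: "q \<in> points P1" for q
  proof -
   have "open (snd (affine_chart a b) ` (U q \<inter> fst (affine_chart a b)))"
    using rs_openD[OF _ P1_chart(1)[OF ab]] open_coverD[OF U q] by blast
   moreover have "snd (affine_chart a b) ` (U q \<inter> fst (affine_chart a b)) = ?O q"
   proof (rule equalityI; rule subsetI)
    fix \<zeta> assume "\<zeta> \<in> snd (affine_chart a b) ` (U q \<inter> fst (affine_chart a b))"
    then obtain y where "y \<in> U q" "y \<in> fst (affine_chart a b)" "\<zeta> = snd (affine_chart a b) y" by blast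
    then show "\<zeta> \<in> ?O q" using affine_chart_repr[OF ab, of y] by simp
   next
    fix \<zeta> assume "\<zeta> \<in> ?O q"
    then show "\<zeta> \<in> snd (affine_chart a b) ` (U q \<inter> fst (affine_chart a b))"
     using affine_chart_inv(3,4)[OF ab, of \<zeta>] by (intro image_eqI[of _ _ "?f \<zeta>"]) auto
   qed
   ultimately show ?thesis by simp
  qed
  have "cball 0 1 \<subseteq> (\<Union>q\<in>points P1. ?O q)"
   using affine_in_points[OF ab] open_coverD[OF U] by blast
  then obtain Q where "Q \<subseteq> points P1" "finite Q" "cball 0 1 \<subseteq> (\<Union>q\<in>Q. ?O q)"
   using compactE_image[OF compact_cball, of "points P1" ?O] op by metis
  then show ?thesis by (intro exI[of _ Q]) auto
 qed
 obtain a b :: vec2 where ab: "br a b \<noteq> 0"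
 proof -
  have "(\<lambda>_. 1 :: complex) \<noteq> (0 :: vec2)" by (simp add: fun_eq_iff)
  then show ?thesis using br_exists that by metis
 qed
 have ba: "br b a \<noteq> 0" using ab br_swap[of b a] by simp
 obtain Q Q' where Q: "finite Q" "Q \<subseteq> points P1" "(\<lambda>\<zeta>. cfun.span {a + fscale \<zeta> b}) ` cball 0 1 \<subseteq> (\<Union>q\<in>Q. U q)"
  and Q': "finite Q'" "Q' \<subseteq> points P1" "(\<lambda>\<zeta>. cfun.span {b + fscale \<zeta> a}) ` cball 0 1 \<subseteq> (\<Union>q\<in>Q'. U q)"
  using part[OF ab] part[OF ba] by blast
 have "y \<in> (\<Union>q\<in>Q \<union> Q'. U q)" if y: "y \<in> points P1" for y
 proof -
  obtain v where v: "v \<noteq> 0" "y = cfun.span {v}" using y unfolding points_P1 by blast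
  have "br v b \<noteq> 0 \<or> br a v \<noteq> 0"
   using br_cramer[of a b v] ab v(1) by (auto simp: cfun.scale_zero_left cfun.scale_eq_0_iff)
  have repr: "\<exists>\<zeta>. norm \<zeta> \<le> 1 \<and> y = cfun.span {c + fscale \<zeta> d}"
   if cd: "br c d \<noteq> 0" and le: "norm (br c v) \<le> norm (br v d)" for c d
  proof -
   have n: "br v d \<noteq> 0"
   proof
    assume "br v d = 0"
    then have "br c v = 0" using le by simp
    then have "fscale (br c d) v = 0" using br_cramer[of c d v] \<open>br v d = 0\<close> by (simp add: cfun.scale_zero_left)
    then show False using cd v(1) by (simp add: cfun.scale_eq_0_iff)
   qed
   then have "y \<in> fst (affine_chart c d)" unfolding affine_chart_dom'[OF cd] v(2) by blast
   from affine_chart_repr[OF cd this]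
   have "y = cfun.span {c + fscale (br c v / br v d) d}" unfolding v(2) affine_chart_coord[OF cd n] .
   moreover have "norm (br c v / br v d) \<le> 1" using le n by (simp add: norm_divide)
   ultimately show ?thesis by blast
  qed
  show ?thesis
  proof (cases "norm (br a v) \<le> norm (br v b)")
   case True
   then show ?thesis using repr[OF ab] Q(3) by fastforce
  next
   case False
   then have "norm (br b v) \<le> norm (br v a)" using br_swap[of b v] br_swap[of v a] by simp
   then show ?thesis using repr[OF ba] Q'(3) by fastforce
  qed
 qed
 then have "points P1 \<subseteq> (\<Union>q\<in>Q \<union> Q'. U q)" by blast
 moreover have "finite (Q \<union> Q')" "Q \<union> Q' \<subseteq> points P1" using Q Q' by simp_all
 ultimately show ?thesis by (intro that)
qed

text \<open>There are infinitely many lines, and one outside \<open>Q\<close> can be taken as the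
  point at infinity, the only point that \<open>affine_chart a b\<close> misses.\<close>

lemma P1_avoid_finite:
 assumes "finite Q" obtains a b where "br a b \<noteq> 0" "cfun.span {b} \<notin> Q"
proof -
 obtain c d :: vec2 where cd: "br c d \<noteq> 0"
 proof -
  have "(\<lambda>_. 1 :: complex) \<noteq> (0 :: vec2)" by (simp add: fun_eq_iff)
  then show ?thesis using br_exists that by metis
 qed
 have "inj (\<lambda>\<zeta>. cfun.span {c + fscale \<zeta> d})"
  by (rule inj_on_inverseI[of _ "snd (affine_chart c d)"]) (rule affine_chart_inv(3)[OF cd])
 then have "infinite (range (\<lambda>\<zeta>. cfun.span {c + fscale \<zeta> d}))"
  using finite_imageD infinite_UNIV_char_0 by blast
 then obtain \<zeta> where \<zeta>: "cfun.span {c + fscale \<zeta> d} \<notin> Q"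
  using assms by (meson finite_subset image_subsetI)
 obtain a where "br a (c + fscale \<zeta> d) \<noteq> 0" using br_exists[OF affine_nonzero[OF cd]] .
 then show ?thesis using \<zeta> that by blast
qed

section \<open>Mittag-Leffler distributions and the Serre trace\<close>

definition mittag_leffler ::
  "(2 \<times> 2 \<Rightarrow> complex) \<Rightarrow> (pline \<Rightarrow> pline set) \<Rightarrow> (pline \<Rightarrow> pline \<Rightarrow> pline \<Rightarrow> vec2 \<Rightarrow> complex)
   \<Rightarrow> (pline \<Rightarrow> pline set) \<Rightarrow> (pline \<Rightarrow> pline \<Rightarrow> vec2 \<Rightarrow> complex) \<Rightarrow> bool" where
 "mittag_leffler w U c W \<mu> \<longleftrightarrow> open_cover W \<and>
  (\<forall>q\<in>points P1. W q \<subseteq> U q \<and> \<mu> q \<in> L_sheaf (- 2) (W q - {q}) \<and>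
    (\<forall>\<kappa>\<in>P1. q \<in> fst \<kappa> \<longrightarrow> local_coeff w \<kappa> (\<mu> q) meromorphic_on {snd \<kappa> q})) \<and>
  (\<forall>q\<in>points P1. \<forall>r\<in>points P1. \<forall>y\<in>W q \<inter> W r - {q, r}. c q r y = \<mu> r y - \<mu> q y)"

text \<open>Together with \<open>mittag_leffler\<close> this is the body of
  \<open>serre_trace\<close>, split so that independence of the distribution can be stated by
  itself.\<close>

definition total_residue :: "(2 \<times> 2 \<Rightarrow> complex) \<Rightarrow> (pline \<Rightarrow> pline \<Rightarrow> vec2 \<Rightarrow> complex) \<Rightarrow> complex" where
 "total_residue w \<mu> = (\<Sum>q | q \<in> points P1 \<and> form_residue w q (\<mu> q) \<noteq> 0. form_residue w q (\<mu> q))"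

lemma local_coeff_cong:
 assumes "br a b \<noteq> 0" "\<mu> (cfun.span {a + fscale \<zeta> b}) = \<mu>' (cfun.span {a + fscale \<zeta> b})"
 shows "local_coeff w (affine_chart a b) \<mu> \<zeta> = local_coeff w (affine_chart a b) \<mu>' \<zeta>"
 unfolding local_coeff_def Let_def affine_chart_inv[OF assms(1)] assms(2) ..

lemma eventually_punctured_chart:
 assumes ab: "br a b \<noteq> 0" and q: "q \<in> fst (affine_chart a b)" and P: "\<forall>\<^sub>F y in nhds_rs P1 q. y \<noteq> q \<longrightarrow> P y"
 shows "\<forall>\<^sub>F \<zeta> in at (snd (affine_chart a b) q). P (cfun.span {a + fscale \<zeta> b})"
proof -
 define v where "v = snd (affine_chart a b) q"
 have qv: "q = cfun.span {a + fscale v b}" using affine_chart_repr[OF ab q] by (simp add: v_def)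
 have "\<forall>\<^sub>F \<zeta> in nhds v. cfun.span {a + fscale \<zeta> b} \<noteq> q \<longrightarrow> P (cfun.span {a + fscale \<zeta> b})"
  using P unfolding qv eventually_P1[OF ab] .
 then show ?thesis unfolding eventually_at_filter v_def[symmetric]
 proof eventually_elim
  case (elim \<zeta>)
  show ?case
  proof (intro impI)
   assume "\<zeta> \<noteq> v"
   then have "cfun.span {a + fscale \<zeta> b} \<noteq> q"
    using affine_chart_inv(3)[OF ab, of \<zeta>] by (auto simp: v_def)
   then show "P (cfun.span {a + fscale \<zeta> b})" using elim by blast
  qed
 qed
qed

lemma chart_around:
 assumes "q \<in> points P1" obtains a b where "br a b \<noteq> 0" "q \<in> fst (affine_chart a b)"
proof -
 obtain v where v: "v \<noteq> 0" "q = cfun.span {v}" using assms unfolding points_P1 by blast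
 obtain b where "br b v \<noteq> 0" using br_exists[OF v(1)] .
 then have b: "br v b \<noteq> 0" using br_swap[of b v] by simp
 then have "q \<in> fst (affine_chart v b)" unfolding affine_chart_dom'[OF b] v(2) by blast
 then show ?thesis using b that by blast
qed

context
 fixes w U c W \<mu>
 assumes w: "nonzero_bivector w" and c: "(U, c) \<in> cech_cocycles (L_sheaf (- 2))"
  and ml: "mittag_leffler w U c W \<mu>"
begin

lemma ml_open_cover: "open_cover W"
 using ml by (simp add: mittag_leffler_def)

lemma ml_open: "q \<in> points P1 \<Longrightarrow> rs_open P1 (W q)" "q \<in> points P1 \<Longrightarrow> q \<in> W q"
 using open_coverD[OF ml_open_cover] by simp_all

lemma ml_local:
 assumes "q \<in> points P1" "y \<in> W q" "y \<noteq> q"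
 shows "\<mu> q \<in> local_sections P1 (L_power (- 2)) y"
proof -
 have "\<mu> q \<in> L_sheaf (- 2) (W q - {q})" using ml assms(1) by (simp add: mittag_leffler_def)
 then show ?thesis using L_sheaf_iff[OF rs_open_remove[OF ml_open(1)[OF assms(1)] assms(1)]] assms by blast
qed

lemma ml_meromorphic: "q \<in> points P1 \<Longrightarrow> \<kappa> \<in> P1 \<Longrightarrow> q \<in> fst \<kappa> \<Longrightarrow> local_coeff w \<kappa> (\<mu> q) meromorphic_on {snd \<kappa> q}"
 using ml by (simp add: mittag_leffler_def)

lemma ml_cocycle:
 assumes "q \<in> points P1" "r \<in> points P1" "y \<in> W q" "y \<in> W r" "y \<noteq> q" "y \<noteq> r"
 shows "c q r y = \<mu> r y - \<mu> q y"
 using ml assms by (simp add: mittag_leffler_def)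

lemma ml_punctured:
 assumes q: "q \<in> points P1"
 shows "\<forall>\<^sub>F y in nhds_rs P1 q. y \<noteq> q \<longrightarrow> \<mu> q y \<in> quot_power UNIV y (- 2)"
 using eventually_rs_open[OF complex_atlas_P1 ml_open(1)[OF q] ml_open(2)[OF q]]
proof eventually_elim
 case (elim y)
 show ?case
 proof
  assume "y \<noteq> q"
  moreover have "y \<in> points P1" using elim ml_open(1)[OF q] rs_open_subset by blast
  ultimately show "\<mu> q y \<in> quot_power UNIV y (- 2)" using local_section_value ml_local[OF q elim] by blast
 qed
qed

lemma ml_residue:
 assumes "br a b \<noteq> 0" "q \<in> fst (affine_chart a b)"
 shows "form_residue w q (\<mu> q) = residue (local_coeff w (affine_chart a b) (\<mu> q)) (snd (affine_chart a b) q)"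
proof -
 have q: "q \<in> points P1" using assms affine_chart_dom[OF assms(1)] by blast
 show ?thesis
  by (rule form_residue_eq[OF w assms ml_punctured[OF q] ml_meromorphic[OF q affine_chart_P1[OF assms(1)] assms(2)]])
qed

text \<open>Near \<open>q\<close> the cocycle relation continues \<open>\<mu> q\<close> by
  \<open>\<mu> q0 + c q0 q\<close>, which is holomorphic at \<open>q\<close>. Hence the centres of a
  finite subcover carry all residues, and the sum in \<open>total_residue\<close> is finite.\<close>

lemma ml_residue_zero:
 assumes q: "q \<in> points P1" and q0: "q0 \<in> points P1" "q \<in> W q0" "q \<noteq> q0"
 shows "form_residue w q (\<mu> q) = 0"
proof -
 obtain a b where ab: "br a b \<noteq> 0" "q \<in> fst (affine_chart a b)" using chart_around[OF q] .
 define t where "t = \<mu> q0 + c q0 q"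
 have WU: "W q0 \<subseteq> U q0" "W q \<subseteq> U q" using ml q q0(1) by (simp_all add: mittag_leffler_def)
 have "c q0 q \<in> L_sheaf (- 2) (U q0 \<inter> U q)"
  by (rule cech_cocyclesD(2)[OF additive_L_sheaf c q0(1) q])
 moreover have "rs_open P1 (U q0 \<inter> U q)"
  using cech_cocyclesD(1)[OF additive_L_sheaf c] q q0(1)
  by (intro rs_open_Int[OF complex_atlas_P1]) (auto dest: open_coverD)
 ultimately have "c q0 q \<in> local_sections P1 (L_power (- 2)) q"
  using L_sheaf_iff WU q0(2) ml_open(2)[OF q] by blast
 then have t: "t \<in> local_sections P1 (L_power (- 2)) q" unfolding t_def
  by (rule local_sections_add[OF complex_atlas_P1 vector_bundle_L q ml_local[OF q0]])
 have "\<forall>\<^sub>F y in nhds_rs P1 q. y \<noteq> q \<longrightarrow> \<mu> q y = t y"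
  using eventually_rs_open[OF complex_atlas_P1 ml_open[OF q]]
   eventually_rs_open[OF complex_atlas_P1 ml_open(1)[OF q0(1)] q0(2)]
   eventually_neq[OF q q0(3,1)]
 proof eventually_elim
  case (elim y)
  then show ?case using ml_cocycle[OF q0(1) q elim(2,1)] by (simp add: t_def)
 qed
 from eventually_punctured_chart[OF ab this]
 have "\<forall>\<^sub>F \<zeta> in at (snd (affine_chart a b) q).
   local_coeff w (affine_chart a b) (\<mu> q) \<zeta> = local_coeff w (affine_chart a b) t \<zeta>"
  by eventually_elim (rule local_coeff_cong[OF ab(1)])
 from residue_cong[OF this refl]
 have "form_residue w q (\<mu> q) = residue (local_coeff w (affine_chart a b) t) (snd (affine_chart a b) q)"
  using ml_residue[OF ab] by simp
 also have "\<dots> = 0"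
  by (intro residue_analytic local_coeff_analytic[OF w ab(1)]) (use t affine_chart_repr[OF ab] in simp)
 finally show ?thesis .
qed

lemma ml_total_residue:
 assumes Q: "finite Q" "Q \<subseteq> points P1" "\<And>q. q \<in> points P1 \<Longrightarrow> \<exists>q0\<in>Q. q \<in> W q0"
 shows "total_residue w \<mu> = (\<Sum>q\<in>Q. form_residue w q (\<mu> q))"
 unfolding total_residue_def
proof (rule sum.mono_neutral_left[OF Q(1)])
 show "{q \<in> points P1. form_residue w q (\<mu> q) \<noteq> 0} \<subseteq> Q"
 proof safe
  fix q assume q: "q \<in> points P1" "form_residue w q (\<mu> q) \<noteq> 0"
  obtain q0 where q0: "q0 \<in> Q" "q \<in> W q0" using Q(3)[OF q(1)] by blast
  then have "q = q0" using ml_residue_zero[OF q(1) _ q0(2)] q(2) Q(2) by blast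
  then show "q \<in> Q" using q0 by simp
 qed
qed (use Q(2) in auto)

end

lemma eventually_notin_finite:
 assumes "finite Q" "Q \<subseteq> points P1" "x \<in> points P1" "x \<notin> Q"
 shows "\<forall>\<^sub>F y in nhds_rs P1 x. y \<notin> Q"
proof -
 have "\<forall>\<^sub>F y in nhds_rs P1 x. \<forall>p\<in>Q. y \<noteq> p"
  using assms by (intro eventually_ball_finite ballI eventually_neq) auto
 then show ?thesis by eventually_elim auto
qed

text \<open>The difference of the two distributions, corrected by the 0-cochain \<open>g\<close>
  that relates the cocycles, agrees on overlaps and so is one global form \<open>G\<close> with
  poles only in \<open>Q\<close>. Its residues are the differences of the given ones, and they sum
  to zero by the residue theorem.\<close>

lemma total_residue_unique:
 assumes w: "nonzero_bivector w" and rel: "((U, c), (U', c')) \<in> cech_rel (L_sheaf (- 2))"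
  and ml: "mittag_leffler w U c W \<mu>" "mittag_leffler w U' c' W' \<mu>'"
 shows "total_residue w \<mu> = total_residue w \<mu>'"
proof (rule cech_relE[OF additive_L_sheaf rel])
 fix V g assume co: "(U, c) \<in> cech_cocycles (L_sheaf (- 2))" "(U', c') \<in> cech_cocycles (L_sheaf (- 2))"
  and V: "open_cover V" and g: "\<And>q. q \<in> points P1 \<Longrightarrow> g q \<in> L_sheaf (- 2) (V q)"
  and eq: "\<And>q r y. q \<in> points P1 \<Longrightarrow> r \<in> points P1 \<Longrightarrow> y \<in> V q \<Longrightarrow> y \<in> V r \<Longrightarrow> c q r y - c' q r y = g r y - g q y"
 note A = complex_atlas_P1
 note m1 = w co(1) ml(1)
 note m2 = w co(2) ml(2)
 define X where "X = (\<lambda>q. W q \<inter> W' q \<inter> V q)"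
 have X: "open_cover X" unfolding X_def
  by (intro open_cover_Int ml_open_cover[OF m1] ml_open_cover[OF m2] V)
 obtain Q where Q: "finite Q" "Q \<subseteq> points P1" "points P1 \<subseteq> (\<Union>q\<in>Q. X q)" using P1_finite_subcover[OF X] .
 \<comment> \<open>With the point at infinity outside \<open>Q\<close>, all possible poles are
   visible in this chart and \<open>G\<close> is regular at infinity.\<close>
 obtain a b where ab: "br a b \<noteq> 0" "cfun.span {b} \<notin> Q" using P1_avoid_finite[OF Q(1)] .
 have ba: "br b a \<noteq> 0" using ab(1) br_swap[of b a] by simp
 let ?\<kappa> = "affine_chart a b"
 have Q\<kappa>: "q \<in> fst ?\<kappa>" if q: "q \<in> Q" for q
 proof -
  have qp: "q \<in> points P1" using q Q(2) by blast
  then obtain v where v: "v \<noteq> 0" "q = cfun.span {v}" unfolding points_P1 by blast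
  have "q \<noteq> cfun.span {b}" using ab(2) q by blast
  then have "b \<notin> q" unfolding v(2) line_mem_iff[OF v(1)] using line_eq_iff[OF v(1) br_nonzero(2)[OF ab(1)]] by blast
  then show ?thesis using qp unfolding affine_chart_dom[OF ab(1)] by blast
 qed
 define \<nu> where "\<nu> = (\<lambda>q. \<mu> q - \<mu>' q - g q)"
 have gl: "g q \<in> local_sections P1 (L_power (- 2)) y" if "q \<in> points P1" "y \<in> V q" for q y
  using g[OF that(1)] L_sheaf_iff[of "V q"] open_coverD[OF V that(1)] that(2) by blast
 have Xp: "y \<in> points P1" if "q \<in> points P1" "y \<in> X q" for q y
  using open_coverD[OF X that(1)] that(2) rs_open_subset by blast
 have \<nu>l: "\<nu> q \<in> local_sections P1 (L_power (- 2)) y" if "q \<in> points P1" "y \<in> X q" "y \<noteq> q" for q y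
  unfolding \<nu>_def using that Xp[OF that(1,2)]
  by (intro local_sections_diff_L ml_local[OF m1] ml_local[OF m2] gl) (auto simp: X_def)
 have cons: "\<nu> q y = \<nu> r y" if "q \<in> points P1" "r \<in> points P1" "y \<in> X q" "y \<in> X r" "y \<noteq> q" "y \<noteq> r" for q r y
 proof -
  have m: "y \<in> W q" "y \<in> W r" "y \<in> W' q" "y \<in> W' r" "y \<in> V q" "y \<in> V r" using that by (auto simp: X_def)
  have "(\<mu> r y - \<mu> q y) - (\<mu>' r y - \<mu>' q y) = g r y - g q y"
   using eq[OF that(1,2) m(5,6)] ml_cocycle[OF m1 that(1,2) m(1,2) that(5,6)]
    ml_cocycle[OF m2 that(1,2) m(3,4) that(5,6)] by simp
  then show ?thesis by (simp add: \<nu>_def algebra_simps)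
 qed
 \<comment> \<open>A choice of patch for each point; off \<open>Q\<close> the value of
   \<open>G\<close> does not depend on it, by \<open>cons\<close>.\<close>
 define pk where "pk = (\<lambda>y. SOME q. q \<in> Q \<and> y \<in> X q)"
 have pk: "pk y \<in> Q" "y \<in> X (pk y)" if "y \<in> points P1" for y
 proof -
  have "\<exists>q. q \<in> Q \<and> y \<in> X q" using that Q(3) by blast
  from someI_ex[OF this] show "pk y \<in> Q" "y \<in> X (pk y)" by (simp_all add: pk_def)
 qed
 define G where "G = (\<lambda>y. \<nu> (pk y) y)"
 have G\<nu>: "G y = \<nu> q y" if "q \<in> points P1" "y \<in> X q" "y \<noteq> q" "y \<notin> Q" for q y
 proof -
  have y: "y \<in> points P1" by (rule Xp[OF that(1,2)])
  show ?thesis unfolding G_def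
   by (rule cons) (use that pk[OF y] Q(2) in auto)
 qed
 have Gloc: "\<forall>\<^sub>F y in nhds_rs P1 x. G y = \<nu> (pk x) y" if x: "x \<in> points P1" "x \<notin> Q" for x
 proof -
  have p: "pk x \<in> points P1" using pk(1)[OF x(1)] Q(2) by blast
  have "x \<noteq> pk x" using pk(1)[OF x(1)] x(2) by metis
  have "\<forall>\<^sub>F y in nhds_rs P1 x. y \<in> X (pk x)"
   using eventually_rs_open[OF A _ pk(2)[OF x(1)]] open_coverD[OF X p] by blast
  with eventually_neq[OF x(1) \<open>x \<noteq> pk x\<close> p] eventually_notin_finite[OF Q(1,2) x]
  show ?thesis by eventually_elim (rule G\<nu>[OF p])
 qed
 have \<nu>loc: "\<nu> (pk x) \<in> local_sections P1 (L_power (- 2)) x" if x: "x \<in> points P1" "x \<notin> Q" for x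
  using pk[OF x(1)] x Q(2) by (intro \<nu>l) auto
 have Gl: "G \<in> local_sections P1 (L_power (- 2)) x" if x: "x \<in> points P1" "x \<notin> Q" for x
  using local_sections_cong[OF A vector_bundle_L x(1) Gloc[OF x]] \<nu>loc[OF x] by simp
 define F where "F = local_coeff w ?\<kappa> G"
 have "F analytic_on {\<zeta>}" if "\<zeta> \<in> - (snd ?\<kappa> ` Q)" for \<zeta>
 proof -
  have "cfun.span {a + fscale \<zeta> b} \<notin> Q"
   using that affine_chart_inv(3)[OF ab(1), of \<zeta>] by (metis ComplD imageI)
  then show ?thesis unfolding F_def
   by (intro local_coeff_analytic[OF w ab(1)] Gl affine_in_points[OF ab(1)])
 qed
 then have "F analytic_on - (snd ?\<kappa> ` Q)" using analytic_on_analytic_at by blast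
 then have hol: "F holomorphic_on - (snd ?\<kappa> ` Q)" by (rule analytic_imp_holomorphic)
 have res0: "(\<Sum>p\<in>snd ?\<kappa> ` Q. residue F p) = 0"
 proof (rule sum_residues_zero[OF _ hol])
  show "finite (snd ?\<kappa> ` Q)" using Q(1) by simp
  have inf: "cfun.span {b + fscale 0 a} \<in> points P1" "cfun.span {b + fscale 0 a} \<notin> Q"
   using affine_in_points[OF ba, of 0] ab(2) by (simp_all add: cfun.scale_zero_left)
  have "a \<notin> cfun.span {b + fscale 0 a}"
   using line_mem_iff[OF affine_nonzero[OF ba, of 0], of a] ba by (simp add: cfun.scale_zero_left)
  note L = L_local(1)[OF inf(1) this, of G "- 2"]
  have h: "(\<lambda>\<zeta>. G (cfun.span {b + fscale \<zeta> a}) a) analytic_on {0}"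
   and ev: "\<forall>\<^sub>F \<zeta> in nhds 0. G (cfun.span {b + fscale \<zeta> a}) \<in> quot_power UNIV (cfun.span {b + fscale \<zeta> a}) (- 2)"
   using Gl[OF inf] unfolding L hol_at_P1[OF ba] eventually_P1[OF ba] by blast+
  let ?K = "w (1, 2) * br a b / (br b a)\<^sup>2"
  show "(\<lambda>\<zeta>. G (cfun.span {b + fscale \<zeta> a}) a * ?K) analytic_on {0}"
   by (intro analytic_on_mult h analytic_on_const)
  show "\<forall>\<^sub>F \<zeta> in at 0. F (1 / \<zeta>) = \<zeta>\<^sup>2 * (G (cfun.span {b + fscale \<zeta> a}) a * ?K)"
   unfolding eventually_at_filter using ev
  proof eventually_elim
   case (elim \<zeta>)
   show ?case
   proof (intro impI)
    assume z: "\<zeta> \<noteq> 0"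
    \<comment> \<open>Near infinity the line of \<open>b + fscale \<zeta> a\<close> is that of
      \<open>a + fscale (1 / \<zeta>) b\<close>, whose bracket with \<open>a\<close> is
      \<open>br b a / \<zeta>\<close>. Its square in the denominator of the coefficient produces the
      factor \<open>\<zeta>\<^sup>2\<close>.\<close>
    have y: "cfun.span {b + fscale \<zeta> a} = cfun.span {a + fscale (1 / \<zeta>) b}"
     using z br_swap[of b a] by (subst line_eq_iff[OF affine_nonzero[OF ba] affine_nonzero[OF ab(1)]])
      (simp add: br_add br_scale)
    have "br (a + fscale (1 / \<zeta>) b) a = br b a / \<zeta>" by (simp add: br_add br_scale)
    moreover from this have "br (a + fscale (1 / \<zeta>) b) a \<noteq> 0" using ba z by simp
    from local_coeff_eq[where \<mu> = G, OF w ab(1) this elim[unfolded y]]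
    have "F (1 / \<zeta>) = G (cfun.span {b + fscale \<zeta> a}) a * (w (1, 2) * br a b / (br (a + fscale (1 / \<zeta>) b) a)\<^sup>2)"
     unfolding F_def y .
    ultimately show "F (1 / \<zeta>) = \<zeta>\<^sup>2 * (G (cfun.span {b + fscale \<zeta> a}) a * ?K)"
     by (simp add: power_divide)
   qed
  qed
 qed
 have resq: "residue F (snd ?\<kappa> q) = form_residue w q (\<mu> q) - form_residue w q (\<mu>' q)" if q: "q \<in> Q" for q
 proof -
  let ?z = "snd ?\<kappa> q"
  note q\<kappa> = Q\<kappa>[OF q]
  have qp: "q \<in> points P1" using q Q(2) by blast
  have qr: "q = cfun.span {a + fscale ?z b}" by (rule affine_chart_repr[OF ab(1) q\<kappa>])
  have "\<forall>\<^sub>F y in nhds_rs P1 q. y \<notin> Q - {q}"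
   by (rule eventually_notin_finite) (use Q qp in auto)
  moreover have "\<forall>\<^sub>F y in nhds_rs P1 q. y \<in> X q"
   using open_coverD[OF X qp] by (intro eventually_rs_open[OF A]) auto
  ultimately have "\<forall>\<^sub>F y in nhds_rs P1 q. y \<noteq> q \<longrightarrow> G y = \<nu> q y"
   by eventually_elim (use G\<nu>[OF qp] in blast)
  moreover have "\<forall>\<^sub>F y in nhds_rs P1 q. g q y \<in> quot_power UNIV y (- 2)"
  proof -
   obtain u where u: "u \<notin> q" using points_P1_complement[OF qp] .
   have "g q \<in> local_sections P1 (L_power (- 2)) q" using gl[OF qp] open_coverD[OF V qp] by blast
   then show ?thesis using L_local(1)[OF qp u] by blast
  qed
  ultimately have "\<forall>\<^sub>F y in nhds_rs P1 q. y \<noteq> q \<longrightarrow> G y = \<nu> q y \<and> \<mu> q y \<in> quot_power UNIV y (- 2) \<and>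
    \<mu>' q y \<in> quot_power UNIV y (- 2) \<and> g q y \<in> quot_power UNIV y (- 2)"
   using ml_punctured[OF m1 qp] ml_punctured[OF m2 qp] by eventually_elim blast
  from eventually_punctured_chart[OF ab(1) q\<kappa> this]
  have "\<forall>\<^sub>F \<zeta> in at ?z. F \<zeta> = (local_coeff w ?\<kappa> (\<mu> q) \<zeta> - local_coeff w ?\<kappa> (\<mu>' q) \<zeta>) - local_coeff w ?\<kappa> (g q) \<zeta>"
  proof eventually_elim
   case (elim \<zeta>)
   let ?y = "cfun.span {a + fscale \<zeta> b}"
   have 1: "(\<mu> q - \<mu>' q) ?y \<in> quot_power UNIV ?y (- 2)"
    using quot_power_subspace(3)[of "\<mu> q ?y" UNIV ?y "-2" "\<mu>' q ?y"] elim by simp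
   have "F \<zeta> = local_coeff w ?\<kappa> (\<mu> q - \<mu>' q - g q) \<zeta>"
    unfolding F_def by (rule local_coeff_cong[OF ab(1)]) (use elim in \<open>simp add: \<nu>_def\<close>)
   also have "\<dots> = local_coeff w ?\<kappa> (\<mu> q - \<mu>' q) \<zeta> - local_coeff w ?\<kappa> (g q) \<zeta>"
    by (rule local_coeff_diff[where \<mu> = "\<mu> q - \<mu>' q" and \<mu>' = "g q", OF w ab(1) 1]) (use elim in blast)
   also have "local_coeff w ?\<kappa> (\<mu> q - \<mu>' q) \<zeta> = local_coeff w ?\<kappa> (\<mu> q) \<zeta> - local_coeff w ?\<kappa> (\<mu>' q) \<zeta>"
    by (rule local_coeff_diff[where \<mu> = "\<mu> q" and \<mu>' = "\<mu>' q", OF w ab(1)]) (use elim in blast)+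
   finally show ?case .
  qed
  from residue_cong[OF this refl]
  have r1: "residue F ?z = residue (\<lambda>\<zeta>. (local_coeff w ?\<kappa> (\<mu> q) \<zeta> - local_coeff w ?\<kappa> (\<mu>' q) \<zeta>) - local_coeff w ?\<kappa> (g q) \<zeta>) ?z" .
  have i1: "isolated_singularity_at (local_coeff w ?\<kappa> (\<mu> q)) ?z"
   using ml_meromorphic[OF m1 qp affine_chart_P1[OF ab(1)] q\<kappa>] meromorphic_at_iff by blast
  have i2: "isolated_singularity_at (local_coeff w ?\<kappa> (\<mu>' q)) ?z"
   using ml_meromorphic[OF m2 qp affine_chart_P1[OF ab(1)] q\<kappa>] meromorphic_at_iff by blast
  have ga: "local_coeff w ?\<kappa> (g q) analytic_on {?z}"
   by (rule local_coeff_analytic[OF w ab(1)]) (use gl[OF qp] open_coverD[OF V qp] qr in simp)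
  show ?thesis
   unfolding r1 residue_add_isolated(2)[OF residue_add_isolated(4)[OF i1 i2] isolated_analytic[OF ga]]
    residue_add_isolated(2)[OF i1 i2] residue_analytic[OF ga] ml_residue[OF m1 ab(1) q\<kappa>] ml_residue[OF m2 ab(1) q\<kappa>]
   by simp
 qed
 have "inj_on (snd ?\<kappa>) Q" using affine_chart_inv(2)[OF ab(1)] Q\<kappa> by (meson inj_on_subset subsetI)
 then have "(\<Sum>q\<in>Q. residue F (snd ?\<kappa> q)) = 0" using res0 by (simp add: sum.reindex)
 then have "(\<Sum>q\<in>Q. form_residue w q (\<mu> q)) = (\<Sum>q\<in>Q. form_residue w q (\<mu>' q))"
  using resq by (simp add: sum_subtractf)
 moreover have "\<exists>q0\<in>Q. q \<in> W q0" "\<exists>q0\<in>Q. q \<in> W' q0" if "q \<in> points P1" for q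
  using that Q(3) by (auto simp: X_def)
 ultimately show "total_residue w \<mu> = total_residue w \<mu>'"
  using ml_total_residue[OF m1 Q(1,2)] ml_total_residue[OF m2 Q(1,2)] by simp
qed

text \<open>By \<open>total_residue_unique\<close>, every representative of the class and every
  distribution for it give the same value, so one distribution computes the trace.\<close>

lemma serre_trace_eq:
 assumes w: "nonzero_bivector w" and c: "(U, c) \<in> cech_cocycles (L_sheaf (- 2))"
  and ml: "mittag_leffler w U c W \<mu>"
 shows "serre_trace w (cech_rel (L_sheaf (- 2)) `` {(U, c)}) = total_residue w \<mu>"
proof -
 let ?R = "cech_rel (L_sheaf (- 2))"
 have r: "((U, c), (U, c)) \<in> ?R"
  using equiv_cech_rel[OF additive_L_sheaf] c by (auto simp: equiv_def refl_on_def)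
 have "serre_trace w (?R `` {(U, c)}) =
  (THE \<rho>. \<exists>(U', c')\<in>?R `` {(U, c)}. \<exists>W \<mu>. mittag_leffler w U' c' W \<mu> \<and> \<rho> = total_residue w \<mu>)"
  unfolding serre_trace_def mittag_leffler_def total_residue_def conj_assoc ..
 also have "\<dots> = total_residue w \<mu>"
 proof (rule the_equality)
  show "\<exists>(U', c')\<in>?R `` {(U, c)}. \<exists>W' \<mu>'. mittag_leffler w U' c' W' \<mu>' \<and> total_residue w \<mu> = total_residue w \<mu>'"
   using r ml by blast
 next
  fix \<rho> assume "\<exists>(U', c')\<in>?R `` {(U, c)}. \<exists>W \<mu>. mittag_leffler w U' c' W \<mu> \<and> \<rho> = total_residue w \<mu>"
  then obtain U' c' W' \<mu>' where "((U, c), (U', c')) \<in> ?R" "mittag_leffler w U' c' W' \<mu>'" "\<rho> = total_residue w \<mu>'" by blast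
  then show "\<rho> = total_residue w \<mu>" using total_residue_unique[OF w _ ml] by simp
 qed
 finally show ?thesis .
qed

section \<open>Multiplication by powers of omega on cohomology: the projection formula\<close>

lemma omega_mult_sheaf:
 assumes w: "nonzero_bivector w" and p: "p \<in> points P1" "b \<notin> p" and U: "rs_open P1 U" and s: "s \<in> L_sheaf m U"
 shows "(\<lambda>y u. omega_section w p b y u ^ d * s y u) \<in> L_twisted_sheaf (m + int d) d p U"
proof -
 have sl: "s \<in> local_sections P1 (L_power m) x" "x \<in> points P1" if "x \<in> U" for x
  using s that rs_open_subset[OF U] unfolding L_sheaf_iff[OF U] by auto
 have "(\<lambda>y u. omega_section w p b y u ^ d * s y u) \<in> L_sheaf (m + int d) U"
  unfolding L_sheaf_iff[OF U] using omega_mult_local(1)[OF w p sl(2) sl(1)] by blast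
 moreover have "vanishes_to_order P1 (L_power (m + int d)) d p (\<lambda>y u. omega_section w p b y u ^ d * s y u)" if "p \<in> U"
  by (rule omega_mult_local(2)[OF w p p(1) sl(1)[OF that] refl])
 ultimately show ?thesis unfolding L_twisted_iff by blast
qed

lemma omega_mult_cocycle:
 assumes w: "nonzero_bivector w" and p: "p \<in> points P1" "b \<notin> p" and c: "(U, c) \<in> cech_cocycles (L_sheaf m)"
 shows "omega_multiple w d p b (U, c) \<in> cech_cocycles (L_twisted_sheaf (m + int d) d p)"
proof -
 note D = cech_cocyclesD[OF additive_L_sheaf c]
 have "(\<lambda>y u. omega_section w p b y u ^ d * c q r y u) \<in> L_twisted_sheaf (m + int d) d p (U q \<inter> U r)"
  if q: "q \<in> points P1" "r \<in> points P1" for q r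
  using D(1) q by (intro omega_mult_sheaf[OF w p] D(2) rs_open_Int[OF complex_atlas_P1]) (auto dest: open_coverD)
 moreover have "(\<lambda>u. omega_section w p b y u ^ d * c q r y u) + (\<lambda>u. omega_section w p b y u ^ d * c r t y u)
   = (\<lambda>u. omega_section w p b y u ^ d * c q t y u)"
  if "q \<in> points P1" "r \<in> points P1" "t \<in> points P1" "y \<in> U q" "y \<in> U r" "y \<in> U t" for q r t y
 proof
  fix u
  have "c q r y u + c r t y u = c q t y u" using fun_cong[OF D(3)[OF that], of u] by simp
  then show "((\<lambda>u. omega_section w p b y u ^ d * c q r y u) + (\<lambda>u. omega_section w p b y u ^ d * c r t y u)) u
   = omega_section w p b y u ^ d * c q t y u" by (simp flip: distrib_left)
 qed
 ultimately show ?thesis using D(1) by (simp add: omega_multiple_def cech_cocycles_def)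
qed

lemma omega_mult_rel:
 assumes w: "nonzero_bivector w" and p: "p \<in> points P1" "b \<notin> p"
  and rel: "((U, c), (U', c')) \<in> cech_rel (L_sheaf m)"
 shows "(omega_multiple w d p b (U, c), omega_multiple w d p b (U', c')) \<in> cech_rel (L_twisted_sheaf (m + int d) d p)"
proof (rule cech_relE[OF additive_L_sheaf rel])
 fix W g assume co: "(U, c) \<in> cech_cocycles (L_sheaf m)" "(U', c') \<in> cech_cocycles (L_sheaf m)"
  and W: "open_cover W" and sub: "\<And>q. q \<in> points P1 \<Longrightarrow> W q \<subseteq> U q \<inter> U' q"
  and g: "\<And>q. q \<in> points P1 \<Longrightarrow> g q \<in> L_sheaf m (W q)"
  and eq: "\<And>q r y. q \<in> points P1 \<Longrightarrow> r \<in> points P1 \<Longrightarrow> y \<in> W q \<Longrightarrow> y \<in> W r \<Longrightarrow> c q r y - c' q r y = g r y - g q y"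
 note co' = omega_mult_cocycle[OF w p co(1), of d] omega_mult_cocycle[OF w p co(2), of d]
 show ?thesis unfolding omega_multiple_def case_prod_conv
 proof (rule cech_relI[OF additive_L_twisted co'[unfolded omega_multiple_def case_prod_conv] W sub])
  show "(\<lambda>y u. omega_section w p b y u ^ d * g q y u) \<in> L_twisted_sheaf (m + int d) d p (W q)" if q: "q \<in> points P1" for q
   using open_coverD[OF W q] by (intro omega_mult_sheaf[OF w p] g q) auto
  show "(\<lambda>u. omega_section w p b y u ^ d * c q r y u) - (\<lambda>u. omega_section w p b y u ^ d * c' q r y u)
   = (\<lambda>u. omega_section w p b y u ^ d * g r y u) - (\<lambda>u. omega_section w p b y u ^ d * g q y u)"
   if "q \<in> points P1" "r \<in> points P1" "y \<in> W q" "y \<in> W r" for q r y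
  proof
   fix u
   have "c q r y u - c' q r y u = g r y u - g q y u" using fun_cong[OF eq[OF that], of u] by simp
   then show "((\<lambda>u. omega_section w p b y u ^ d * c q r y u) - (\<lambda>u. omega_section w p b y u ^ d * c' q r y u)) u
    = ((\<lambda>u. omega_section w p b y u ^ d * g r y u) - (\<lambda>u. omega_section w p b y u ^ d * g q y u)) u"
    by (simp flip: right_diff_distrib)
  qed
 qed
qed

text \<open>This is the injectivity behind the projection formula: the 0-cochain of the twisted
  sheaf is divided by the power of omega. The resulting identity can be cancelled only where omega
  is nonzero, so \<open>p\<close> needs separate care.\<close>

lemma omega_divide_rel:
 assumes w: "nonzero_bivector w" and p: "p \<in> points P1" "b \<notin> p" and d: "d > 0"
  and co: "(U, c) \<in> cech_cocycles (L_sheaf m)" "(U', c') \<in> cech_cocycles (L_sheaf m)"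
  and rel: "(omega_multiple w d p b (U, c), omega_multiple w d p b (U', c')) \<in> cech_rel (L_twisted_sheaf (m + int d) d p)"
 shows "((U, c), (U', c')) \<in> cech_rel (L_sheaf m)"
proof (rule cech_relE[OF additive_L_twisted rel[unfolded omega_multiple_def case_prod_conv]])
 fix W g assume W: "open_cover W" and sub: "\<And>q. q \<in> points P1 \<Longrightarrow> W q \<subseteq> U q \<inter> U' q"
  and g: "\<And>q. q \<in> points P1 \<Longrightarrow> g q \<in> L_twisted_sheaf (m + int d) d p (W q)"
  and eq: "\<And>q r y. q \<in> points P1 \<Longrightarrow> r \<in> points P1 \<Longrightarrow> y \<in> W q \<Longrightarrow> y \<in> W r \<Longrightarrow>
   (\<lambda>u. omega_section w p b y u ^ d * c q r y u) - (\<lambda>u. omega_section w p b y u ^ d * c' q r y u) = g r y - g q y"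
 have Wo: "rs_open P1 (W q)" "q \<in> W q" if "q \<in> points P1" for q using open_coverD[OF W that] by simp_all
 have "\<exists>t. t \<in> L_sheaf m (W q) \<and> (\<forall>y\<in>W q. g q y = (\<lambda>u. omega_section w p b y u ^ d * t y u))"
  if q: "q \<in> points P1" for q
  by (rule omega_divide[OF w p Wo(1)[OF q] d g[OF q]]) auto
 then obtain t where t: "\<And>q. q \<in> points P1 \<Longrightarrow> t q \<in> L_sheaf m (W q)"
  "\<And>q y. q \<in> points P1 \<Longrightarrow> y \<in> W q \<Longrightarrow> g q y = (\<lambda>u. omega_section w p b y u ^ d * t q y u)"
  by metis
 \<comment> \<open>Removing \<open>p\<close> from every patch except the one of index
   \<open>p\<close> leaves only the pair \<open>(p, p)\<close> over this point, and there cocycles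
   vanish.\<close>
 define W2 where "W2 = (\<lambda>q. if q = p then W q else W q - {p})"
 have W2: "open_cover W2" unfolding open_cover_def W2_def using Wo rs_open_remove[OF Wo(1) p(1)] by auto
 have W2s: "W2 q \<subseteq> W q" for q by (auto simp: W2_def)
 have Lq: "s y \<in> quot_power UNIV y m" if "s \<in> L_sheaf m V" "rs_open P1 V" "y \<in> V" for s V y
  using that rs_open_subset[OF that(2)] local_section_value unfolding L_sheaf_iff[OF that(2)] by blast
 show ?thesis
 proof (rule cech_relI[OF additive_L_sheaf co W2])
  show "W2 q \<subseteq> U q \<inter> U' q" if "q \<in> points P1" for q using sub[OF that] W2s by blast
  show "t q \<in> L_sheaf m (W2 q)" if q: "q \<in> points P1" for q
   using open_coverD[OF W2 q] by (intro sheaf_restrict[OF additive_L_sheaf t(1)[OF q] Wo(1)[OF q] _ W2s]) auto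
  show "c q r y - c' q r y = t r y - t q y" if q: "q \<in> points P1" "r \<in> points P1" "y \<in> W2 q" "y \<in> W2 r" for q r y
  proof (cases "y = p")
   case True
   then have "q = p" "r = p" using q by (auto simp: W2_def split: if_splits)
   moreover have "y \<in> U p" "y \<in> U' p" using True sub[OF p(1)] Wo(2)[OF p(1)] by auto
   ultimately show ?thesis
    using cech_cocycle_diag[OF additive_L_sheaf co(1) p(1)] cech_cocycle_diag[OF additive_L_sheaf co(2) p(1)] by simp
  next
   case False
   have yW: "y \<in> W q" "y \<in> W r" using q W2s by auto
   have yp: "y \<in> points P1" using yW(1) rs_open_subset[OF Wo(1)[OF q(1)]] by blast
   have UU: "rs_open P1 (U q \<inter> U r)" "rs_open P1 (U' q \<inter> U' r)"
    using cech_cocyclesD(1)[OF additive_L_sheaf co(1)] cech_cocyclesD(1)[OF additive_L_sheaf co(2)] q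
    by (auto intro!: rs_open_Int[OF complex_atlas_P1] dest: open_coverD)
   have y: "y \<in> U q \<inter> U r" "y \<in> U' q \<inter> U' r" using yW sub[OF q(1)] sub[OF q(2)] by auto
   have qp: "c q r y \<in> quot_power UNIV y m" "c' q r y \<in> quot_power UNIV y m"
    "t q y \<in> quot_power UNIV y m" "t r y \<in> quot_power UNIV y m"
    using Lq[OF cech_cocyclesD(2)[OF additive_L_sheaf co(1) q(1,2)] UU(1) y(1)]
     Lq[OF cech_cocyclesD(2)[OF additive_L_sheaf co(2) q(1,2)] UU(2) y(2)]
     Lq[OF t(1)[OF q(1)] Wo(1)[OF q(1)] yW(1)] Lq[OF t(1)[OF q(2)] Wo(1)[OF q(2)] yW(2)] .
   show ?thesis
   proof
    fix u
    show "(c q r y - c' q r y) u = (t r y - t q y) u"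
    proof (cases "u \<in> y")
     case True
     then show ?thesis using quot_power_zero[OF qp(1)] quot_power_zero[OF qp(2)] quot_power_zero[OF qp(3)] quot_power_zero[OF qp(4)] by simp
    next
     case u: False
     have "omega_section w p b y u ^ d * (c q r y u - c' q r y u) = omega_section w p b y u ^ d * (t r y u - t q y u)"
      using fun_cong[OF eq[OF q(1,2) yW], of u] t(2)[OF q(1) yW(1)] t(2)[OF q(2) yW(2)]
      by (simp add: right_diff_distrib)
     moreover have "omega_section w p b y u ^ d \<noteq> 0" using omega_nonzero[OF w p yp u] False by simp
     ultimately have "c q r y u - c' q r y u = t r y u - t q y u" using mult_left_cancel by blast
     then show ?thesis by simp
    qed
   qed
  qed
 qed
qed

section \<open>The connecting homomorphism and the trace for one explicit germ\<close>

context
 fixes w :: "2 \<times> 2 \<Rightarrow> complex" and n k :: nat and p :: pline and b :: vec2 and r c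
 assumes w: "nonzero_bivector w" and k: "k = n + 1" and p: "p \<in> points P1" "b \<notin> p"
  and r: "r \<in> local_sections P1 (L_power (int n)) p"
  and c: "vanish_at P1 (k + 1) p (\<lambda>y. r y b - c * omega_section w p b y b ^ k)"
begin

text \<open>A section of \<open>L\<^sup>n\<close> near \<open>p\<close> divided by the \<open>(k + 1)\<close>-st power of the section defined by \<open>w\<close> is a
 one-form whose only pole is \<open>p\<close>; its residue there is the leading coefficient \<open>c\<close>.\<close>

definition polar_part :: "pline \<Rightarrow> pline \<Rightarrow> vec2 \<Rightarrow> complex" where
 "polar_part q = (if q = p then (\<lambda>y u. r y u / omega_section w p b y u ^ (k + 1)) else 0)"

text \<open>At \<open>p\<close> the coefficient is a quotient of analytic functions of the chart
  coordinate; elsewhere the polar part is zero.\<close>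

lemma polar_part_meromorphic:
 assumes q: "q \<in> points P1" and ad: "br a d \<noteq> 0" "q \<in> fst (affine_chart a d)"
 shows "local_coeff w (affine_chart a d) (polar_part q) meromorphic_on {snd (affine_chart a d) q}"
proof (cases "q = p")
 case False
 have "polar_part q \<in> local_sections P1 (L_power (- 2)) q"
  using False zero_local_section[OF complex_atlas_P1 vector_bundle_L q] by (simp add: polar_part_def)
 then have "local_coeff w (affine_chart a d) (polar_part q) analytic_on {snd (affine_chart a d) q}"
  by (intro local_coeff_analytic[OF w ad(1)]) (use affine_chart_repr[OF ad] in simp)
 then show ?thesis by (rule analytic_on_imp_meromorphic_on)
next
 case True
 let ?z = "snd (affine_chart a d) q"
 let ?y = "\<lambda>\<zeta>. cfun.span {a + fscale \<zeta> d}"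
 have pz: "p = ?y ?z" using affine_chart_repr[OF ad] True by simp
 have rl: "\<forall>\<^sub>F y in nhds_rs P1 p. r y \<in> quot_power UNIV y (int n)" "hol_at P1 p (\<lambda>y. r y b)"
  using r L_local(1)[OF p] by blast+
 have an1: "(\<lambda>\<zeta>. r (?y \<zeta>) b) analytic_on {?z}" using rl(2) unfolding pz hol_at_P1[OF ad(1)] .
 have an2: "(\<lambda>\<zeta>. omega_section w p b (?y \<zeta>) b) analytic_on {?z}"
  using omega_hol_at[OF w p p] unfolding pz hol_at_P1[OF ad(1)] unfolding pz[symmetric] .
 have an3: "(\<lambda>\<zeta>. br (a + fscale \<zeta> d) b) analytic_on {?z}"
  unfolding br_add br_scale by (intro analytic_intros)
 have "\<forall>\<^sub>F y in nhds_rs P1 q. y \<noteq> q \<longrightarrow> polar_part q y \<in> quot_power UNIV y (- 2) \<and> b \<notin> y"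
  unfolding True using rl(1) eventually_points[OF p(1)] eventually_not_mem[OF p]
 proof eventually_elim
  case (elim y)
  have e: "int n - int (k + 1) = - 2" by (simp add: k)
  show ?case using omega_mult_quot_power(2)[OF w p elim(2,1), of "k + 1"] elim(3) unfolding e by (simp add: polar_part_def)
 qed
 from eventually_punctured_chart[OF ad this]
 have ev: "\<forall>\<^sub>F \<zeta> in at ?z. local_coeff w (affine_chart a d) (polar_part q) \<zeta> =
  r (?y \<zeta>) b / omega_section w p b (?y \<zeta>) b ^ (k + 1) * (w (1, 2) * br a d / (br (a + fscale \<zeta> d) b)\<^sup>2)"
 proof eventually_elim
  case (elim \<zeta>)
  have "br (a + fscale \<zeta> d) b \<noteq> 0" using elim line_mem_iff[OF affine_nonzero[OF ad(1)]] by simp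
  from local_coeff_eq[where \<mu> = "polar_part q", OF w ad(1) this] elim
  show ?case by (simp add: polar_part_def True)
 qed
 have "(\<lambda>\<zeta>. r (?y \<zeta>) b / omega_section w p b (?y \<zeta>) b ^ (k + 1) * (w (1, 2) * br a d / (br (a + fscale \<zeta> d) b)\<^sup>2)) meromorphic_on {?z}"
  by (intro meromorphic_intros analytic_on_imp_meromorphic_on[OF an1] analytic_on_imp_meromorphic_on[OF an2] analytic_on_imp_meromorphic_on[OF an3])
 moreover have "local_coeff w (affine_chart a d) (polar_part q) meromorphic_on {?z} \<longleftrightarrow>
   (\<lambda>\<zeta>. r (?y \<zeta>) b / omega_section w p b (?y \<zeta>) b ^ (k + 1) * (w (1, 2) * br a d / (br (a + fscale \<zeta> d) b)\<^sup>2)) meromorphic_on {?z}"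
  by (rule meromorphic_on_cong) (use ev in simp_all)
 ultimately show ?thesis by simp
qed

lemma polar_part_quot_power:
 assumes q: "q \<in> points P1"
 shows "\<forall>\<^sub>F y in nhds_rs P1 q. y \<noteq> q \<longrightarrow> polar_part q y \<in> quot_power UNIV y (- 2)"
proof (cases "q = p")
 case True
 have "\<forall>\<^sub>F y in nhds_rs P1 p. r y \<in> quot_power UNIV y (int n)"
  using r L_local(1)[OF p] by blast
 then show ?thesis unfolding True using eventually_points[OF p(1)]
 proof eventually_elim
  case (elim y)
  have e: "int n - int (k + 1) = - 2" by (simp add: k)
  show ?case using omega_mult_quot_power(2)[OF w p elim(2,1), of "k + 1"] unfolding e by (simp add: polar_part_def)
 qed
qed (simp add: polar_part_def quot_power_subspace)

text \<open>In the coordinate centred at \<open>p\<close> omega is \<open>K * \<zeta>\<close>, and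
  the form attached to [b]^-2 has the constant coefficient \<open>K\<close> as well. The polar term
  is therefore c / (K \<zeta>) times K, and the constant drops out.\<close>

lemma polar_part_residue: "form_residue w p (polar_part p) = c"
proof -
 obtain e where e: "p = cfun.span {e}" "br e b \<noteq> 0" using points_P1_affine[OF p] .
 let ?y = "\<lambda>\<zeta>. cfun.span {e + fscale \<zeta> b}"
 have p0: "?y 0 = p" by (simp add: e(1) cfun.scale_zero_left)
 define K where "K = w (1, 2) / br e b"
 have K: "K \<noteq> 0" using e bivector_entries[OF w] by (simp add: K_def)
 have brb: "br (e + fscale \<zeta> b) b = br e b" for \<zeta> by (simp add: br_add br_scale)
 have om: "omega_section w p b (?y \<zeta>) b = K * \<zeta>" for \<zeta>
  unfolding e(1) using e(2) by (subst omega_section_eq[OF w e(2)]) (simp_all add: br_add br_scale K_def)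
 have pd: "p \<in> fst (affine_chart e b)" using affine_chart_inv(4)[OF e(2), of 0] unfolding p0 .
 have z: "snd (affine_chart e b) p = 0" using affine_chart_inv(3)[OF e(2), of 0] unfolding p0 .
 obtain g where g: "hol_at P1 p g"
  "\<forall>\<^sub>F y in nhds_rs P1 p. r y b - c * omega_section w p b y b ^ k = omega_section w p b y b ^ (k + 1) * g y"
  using c unfolding vanish_at_uniformizer[OF complex_atlas_P1 omega_uniformizer[OF w p]] by blast
 have ga: "(\<lambda>\<zeta>. g (?y \<zeta>)) analytic_on {0}" using g(1) unfolding hol_at_P1[OF e(2), of 0, symmetric] p0 .
 have "\<forall>\<^sub>F y in nhds_rs P1 p. y \<noteq> p \<longrightarrow> polar_part p y \<in> quot_power UNIV y (- 2) \<and>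
   r y b - c * omega_section w p b y b ^ k = omega_section w p b y b ^ (k + 1) * g y"
  using g(2) polar_part_quot_power[OF p(1)] by eventually_elim blast
 note ep = eventually_punctured_chart[OF e(2) pd this]
 have div1: "(c * X ^ k + X ^ (k + 1) * h) / X ^ (k + 1) = c / X + h" if "X \<noteq> 0" for X h
  using that by (simp add: add_divide_distrib)
 have div2: "(c / (K * \<zeta>) + h) * K = (c + \<zeta> * (K * h)) / (\<zeta> - 0)" if "\<zeta> \<noteq> 0" for \<zeta> h
  using that K by (simp add: field_simps)
 from ep have ev: "\<forall>\<^sub>F \<zeta> in at 0. local_coeff w (affine_chart e b) (polar_part p) \<zeta> = (c + \<zeta> * (K * g (?y \<zeta>))) / (\<zeta> - 0)"
  unfolding z using eventually_neq_at_within[of 0 0 UNIV]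
 proof eventually_elim
  case (elim \<zeta>)
  have "br (e + fscale \<zeta> b) b \<noteq> 0" using e(2) brb by simp
  from local_coeff_eq[where \<mu> = "polar_part p", OF w e(2) this conjunct1[OF elim(1)]]
  have L1: "local_coeff w (affine_chart e b) (polar_part p) \<zeta> = r (?y \<zeta>) b / (K * \<zeta>) ^ (k + 1) * K"
   unfolding brb by (simp add: polar_part_def om K_def power2_eq_square)
  have L2: "r (?y \<zeta>) b = c * (K * \<zeta>) ^ k + (K * \<zeta>) ^ (k + 1) * g (?y \<zeta>)"
   using conjunct2[OF elim(1)] unfolding om by (simp add: algebra_simps)
  have L3: "K * \<zeta> \<noteq> 0" using K elim(2) by simp
  show ?case unfolding L1 L2 div1[OF L3] by (rule div2[OF elim(2)])
 qed
 have "(\<lambda>\<zeta>. c + \<zeta> * (K * g (?y \<zeta>))) analytic_on {0}" by (intro analytic_intros ga)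
 then obtain t where t: "open t" "0 \<in> t" "(\<lambda>\<zeta>. c + \<zeta> * (K * g (?y \<zeta>))) holomorphic_on t"
  unfolding analytic_at by blast
 have "form_residue w p (polar_part p) = residue (local_coeff w (affine_chart e b) (polar_part p)) 0"
  using form_residue_eq[OF w e(2) pd polar_part_quot_power[OF p(1)] polar_part_meromorphic[OF p(1) e(2) pd]]
  unfolding z .
 also have "\<dots> = residue (\<lambda>\<zeta>. (c + \<zeta> * (K * g (?y \<zeta>))) / (\<zeta> - 0)) 0"
  by (rule residue_cong[OF ev refl])
 also have "\<dots> = c" using residue_simple[OF t] by simp
 finally show ?thesis .
qed

lemma polar_part_total_residue: "total_residue w polar_part = c"
proof -
 have z: "form_residue w q (polar_part q) = 0" if q: "q \<in> points P1" "q \<noteq> p" for q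
 proof -
  obtain a d where ad: "br a d \<noteq> 0" "q \<in> fst (affine_chart a d)" using chart_around[OF q(1)] .
  have "polar_part q \<in> local_sections P1 (L_power (- 2)) q"
   using q zero_local_section[OF complex_atlas_P1 vector_bundle_L q(1)] by (simp add: polar_part_def)
  then have "local_coeff w (affine_chart a d) (polar_part q) analytic_on {snd (affine_chart a d) q}"
   by (intro local_coeff_analytic[OF w ad(1)]) (use affine_chart_repr[OF ad] in simp)
  then show ?thesis
   using form_residue_eq[OF w ad polar_part_quot_power[OF q(1)] polar_part_meromorphic[OF q(1) ad]]
    residue_analytic by simp
 qed
 have "total_residue w polar_part = (\<Sum>q\<in>{p}. form_residue w q (polar_part q))"
  unfolding total_residue_def by (rule sum.mono_neutral_left) (use z p(1) in auto)
 then show ?thesis using polar_part_residue by simp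
qed

text \<open>Two patches suffice: a neighbourhood \<open>V\<close> of \<open>p\<close> carrying
  \<open>r\<close>, and the complement of \<open>p\<close> carrying zero. Division by the power k +
  1 of omega turns the coboundary of this lift into that of \<open>polar_part\<close>, which is thus
  its own Mittag-Leffler distribution.\<close>

lemma top_jet_map_value: "top_jet_map w n k p (jet P1 (L_power (int n)) k p r) b = c"
proof -
 let ?j = "jet P1 (L_power (int n)) k p r"
 obtain V where V: "rs_open P1 V" "p \<in> V" "hol_section P1 (L_power (int n)) V r"
  using r unfolding local_sections_def by blast
 \<comment> \<open>Covers are indexed by points, so every index other than \<open>p\<close> receives
   the same patch.\<close>
 define U where "U = (\<lambda>q. if q = p then V else points P1 - {p})"
 define g where "g = (\<lambda>q. if q = p then r else 0)"
 define \<gamma> where "\<gamma> = (\<lambda>q s. polar_part s - polar_part q)"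
 have Uo: "rs_open P1 (U q)" for q
  unfolding U_def using V(1) rs_open_remove[OF rs_open_points[OF complex_atlas_P1] p(1)] by simp
 have U: "open_cover U" unfolding open_cover_def using Uo V(2) by (auto simp: U_def)
 have lift: "jet_lift n k p ?j U g"
  unfolding jet_lift_def
 proof (intro conjI ballI impI U)
  fix q show "g q \<in> L_sheaf (int n) (U q)"
   using V(3) sheaf_zero[OF additive_L_sheaf Uo[of q]] by (cases "q = p") (simp_all add: g_def U_def L_sheaf_def)
  assume "p \<in> U q" then show "jet P1 (L_power (int n)) k p (g q) = ?j"
   by (simp add: g_def U_def split: if_splits)
 qed
 \<comment> \<open>Here k = n + 1 makes the quotient a section of L^(-2), the canonical
   bundle.\<close>
 have kn: "- 2 + int (k + 1) = int n" "int n - int (k + 1) = - 2" by (simp_all add: k)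
 have pp: "polar_part q \<in> local_sections P1 (L_power (- 2)) y" if q: "y \<in> U q" "y \<noteq> p" for q y
 proof -
  have yp: "y \<in> points P1" using q(1) rs_open_subset[OF Uo] by blast
  show ?thesis
  proof (cases "q = p")
   case True
   then have "r \<in> local_sections P1 (L_power (int n)) y"
    using q V unfolding local_sections_def U_def by auto
   from omega_mult_local(3)[OF w p yp this q(2), of "k + 1"]
   show ?thesis using True unfolding kn by (simp add: polar_part_def)
  next
   case False
   then show ?thesis using zero_local_section[OF complex_atlas_P1 vector_bundle_L yp] by (simp add: polar_part_def)
  qed
 qed
 have \<gamma>s: "\<gamma> q s \<in> L_sheaf (- 2) (U q \<inter> U s)" for q s
 proof (cases "q = s")
  case True
  then have "\<gamma> q s = 0" by (simp add: \<gamma>_def)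
  then show ?thesis using sheaf_zero[OF additive_L_sheaf rs_open_Int[OF complex_atlas_P1 Uo Uo]] by simp
 next
  case False
  show ?thesis unfolding L_sheaf_iff[OF rs_open_Int[OF complex_atlas_P1 Uo Uo]]
  proof
   fix y assume y: "y \<in> U q \<inter> U s"
   then have n: "y \<noteq> p" using False by (auto simp: U_def split: if_splits)
   have "y \<in> points P1" using y rs_open_subset[OF Uo] by blast
   then show "\<gamma> q s \<in> local_sections P1 (L_power (- 2)) y" unfolding \<gamma>_def
    using y n by (intro local_sections_diff_L pp) auto
  qed
 qed
 have \<gamma>c: "(U, \<gamma>) \<in> cech_cocycles (L_sheaf (- 2))"
  unfolding cech_cocycles_def using U \<gamma>s by (simp add: \<gamma>_def)
 have ml: "mittag_leffler w U \<gamma> U polar_part"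
  unfolding mittag_leffler_def
 proof (intro conjI ballI impI U)
  fix q assume q: "q \<in> points P1"
  show "U q \<subseteq> U q" by simp
  show "polar_part q \<in> L_sheaf (- 2) (U q - {q})"
   unfolding L_sheaf_iff[OF rs_open_remove[OF Uo q]]
  proof
   fix y assume y: "y \<in> U q - {q}"
   then have "y \<noteq> p" by (auto simp: U_def split: if_splits)
   then show "polar_part q \<in> local_sections P1 (L_power (- 2)) y" using pp y by blast
  qed
  fix \<kappa> assume "\<kappa> \<in> P1" and q\<kappa>: "q \<in> fst \<kappa>"
  then obtain a d where ad: "br a d \<noteq> 0" "\<kappa> = affine_chart a d" unfolding P1_iff by blast
  show "local_coeff w \<kappa> (polar_part q) meromorphic_on {snd \<kappa> q}"
   unfolding ad(2) by (rule polar_part_meromorphic[OF q ad(1) q\<kappa>[unfolded ad(2)]])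
 next
  fix q s y show "\<gamma> q s y = polar_part s y - polar_part q y" by (simp add: \<gamma>_def)
 qed
 let ?T = "cech_rel (L_twisted_sheaf (int n) (k + 1) p)" and ?R = "cech_rel (L_sheaf (- 2))"
 let ?D = "(U, \<lambda>q s. g s - g q)"
 have eqT: "sym ?T" "trans_on UNIV ?T" using equiv_cech_rel[OF additive_L_twisted] by (simp_all add: equiv_def)
 have omc: "omega_multiple w (k + 1) p b (U, \<gamma>) \<in> cech_cocycles (L_twisted_sheaf (int n) (k + 1) p)"
  using omega_mult_cocycle[OF w p \<gamma>c, of "k + 1"] unfolding kn .
 have relD: "(?D, omega_multiple w (k + 1) p b (U, \<gamma>)) \<in> ?T"
  unfolding omega_multiple_def case_prod_conv
 proof (rule cech_relI[OF additive_L_twisted jet_lift_cocycle[OF p(1) lift] omc[unfolded omega_multiple_def case_prod_conv] U, of "\<lambda>_. 0"])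
  show "U q \<subseteq> U q \<inter> U q" for q by simp
  show "0 \<in> L_twisted_sheaf (int n) (k + 1) p (U q)" for q by (rule sheaf_zero[OF additive_L_twisted Uo])
  show "(g s - g q) y - (\<lambda>u. omega_section w p b y u ^ (k + 1) * \<gamma> q s y u) = 0 y - 0 y"
   if y: "y \<in> U q" "y \<in> U s" for q s y
  proof (cases "q = s")
   case True
   then show ?thesis by (simp add: \<gamma>_def fun_eq_iff)
  next
   case False
   then have n: "y \<noteq> p" using y by (auto simp: U_def split: if_splits)
   have yp: "y \<in> points P1" using y rs_open_subset[OF Uo] by blast
   have val: "omega_section w p b y u ^ (k + 1) * polar_part q y u = g q y u" if q: "y \<in> U q" for q u
   proof (cases "q = p")
    case True
    have "r \<in> local_sections P1 (L_power (int n)) y"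
     using q True V unfolding local_sections_def U_def by auto
    then have rq: "r y \<in> quot_power UNIV y (int n)" by (rule local_section_value[OF yp])
    show ?thesis
    proof (cases "u \<in> y")
     case u: True
     then show ?thesis using quot_power_zero[OF rq u] True by (simp add: polar_part_def g_def)
    next
     case u: False
     then show ?thesis using omega_nonzero[OF w p yp u] n True by (simp add: polar_part_def g_def)
    qed
   qed (simp add: polar_part_def g_def)
   show ?thesis
   proof
    fix u
    show "((g s - g q) y - (\<lambda>u. omega_section w p b y u ^ (k + 1) * \<gamma> q s y u)) u = (0 y - 0 y) u"
     using val[OF y(1), of u] val[OF y(2), of u] by (simp add: \<gamma>_def right_diff_distrib)
   qed
  qed
 qed
 have h: "connecting_hom n k p ?j = ?T `` {?D}" by (rule connecting_hom_eq[OF p(1) lift])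
 have "projection_formula w (int n) (k + 1) p b (connecting_hom n k p ?j) = ?R `` {(U, \<gamma>)}"
  unfolding projection_formula_def kn(2)
 proof (rule the_equality)
  show "?R `` {(U, \<gamma>)} \<in> H1 (L_sheaf (- 2)) \<and> (\<forall>C\<in>?R `` {(U, \<gamma>)}. omega_multiple w (k + 1) p b C \<in> connecting_hom n k p ?j)"
  proof (intro conjI ballI)
   show "?R `` {(U, \<gamma>)} \<in> H1 (L_sheaf (- 2))" unfolding H1_def by (rule quotientI[OF \<gamma>c])
   fix C assume C: "C \<in> ?R `` {(U, \<gamma>)}"
   obtain U' c' where C': "C = (U', c')" by (cases C)
   have "((U, \<gamma>), (U', c')) \<in> ?R" using C unfolding C' by blast
   from omega_mult_rel[OF w p this, of "k + 1"]
   have "(omega_multiple w (k + 1) p b (U, \<gamma>), omega_multiple w (k + 1) p b C) \<in> ?T" unfolding kn C' .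
   then show "omega_multiple w (k + 1) p b C \<in> connecting_hom n k p ?j"
    unfolding h using transD[OF eqT(2) relD] by blast
  qed
 next
  \<comment> \<open>Any other candidate class has a multiple cohomologous to that of
    \<open>\<gamma>\<close>, and \<open>omega_divide_rel\<close> undoes the multiplication.\<close>
  fix h' assume h': "h' \<in> H1 (L_sheaf (- 2)) \<and> (\<forall>C\<in>h'. omega_multiple w (k + 1) p b C \<in> connecting_hom n k p ?j)"
  then obtain C where C: "C \<in> cech_cocycles (L_sheaf (- 2))" "h' = ?R `` {C}"
   unfolding H1_def by (auto elim: quotientE)
  obtain U' c' where C': "C = (U', c')" by (cases C)
  have "C \<in> h'" unfolding C(2) by (rule equiv_class_self[OF equiv_cech_rel[OF additive_L_sheaf] C(1)])
  then have "(?D, omega_multiple w (k + 1) p b C) \<in> ?T" using h' unfolding h by blast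
  then have "(omega_multiple w (k + 1) p b (U, \<gamma>), omega_multiple w (k + 1) p b C) \<in> ?T"
   by (rule transD[OF eqT(2) symD[OF eqT(1) relD]])
  then have "((U, \<gamma>), (U', c')) \<in> ?R"
   by (intro omega_divide_rel[OF w p _ \<gamma>c C(1)[unfolded C'], of "k + 1"]) (unfold kn C', simp_all)
  then show "h' = ?R `` {(U, \<gamma>)}" unfolding C(2) C'
   by (rule equiv_class_eq[OF equiv_cech_rel[OF additive_L_sheaf], symmetric])
 qed
 then show ?thesis
  using serre_trace_eq[OF w \<gamma>c ml] polar_part_total_residue p(2) by (simp add: top_jet_map_def)
qed

end

section \<open>The jet isomorphism on the projective line\<close>

text \<open>A zero n-jet means order n + 1, which is k; passing to another representative of the
  same k-jet changes \<open>r\<close> only in order k + 1.\<close>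

lemma kernel_beta_iff:
 assumes p: "p \<in> points P1" "b \<notin> p" and k: "k = n + 1" and r: "r \<in> local_sections P1 (L_power (int n)) p"
 shows "jet P1 (L_power (int n)) k p r \<in> kernel_beta n k p \<longleftrightarrow> vanish_at P1 k p (\<lambda>y. r y b)"
proof -
 note A = complex_atlas_P1 and V = vector_bundle_L
 have zero: "jet P1 (L_power (int n)) n p s = jet P1 (L_power (int n)) n p 0 \<longleftrightarrow> vanish_at P1 k p (\<lambda>y. s y b)"
  if s: "s \<in> local_sections P1 (L_power (int n)) p" for s
  using jet_eq_iff[OF A V p(1) s zero_local_section[OF A V p(1)], of n] L_local(2)[OF p, of "int n" k s]
   L_local(1)[OF p, of s "int n"] s by (simp add: k)
 show ?thesis
 proof
  assume "jet P1 (L_power (int n)) k p r \<in> kernel_beta n k p"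
  then obtain s where s: "s \<in> local_sections P1 (L_power (int n)) p"
    "jet P1 (L_power (int n)) k p r = jet P1 (L_power (int n)) k p s"
    "jet P1 (L_power (int n)) n p s = jet P1 (L_power (int n)) n p 0"
   unfolding kernel_beta_def by blast
  have v: "vanish_at P1 k p (\<lambda>y. s y b)" using zero[OF s(1)] s(3) by simp
  have "vanishes_to_order P1 (L_power (int n)) (k + 1) p (r - s)"
   using jet_eq_iff[OF A V p(1) r s(1)] s(2) by simp
  then have "vanish_at P1 (k + 1) p (\<lambda>y. (r - s) y b)" unfolding L_local(2)[OF p] by blast
  from vanish_at_mono[OF A p(1) this, of k] have "vanish_at P1 k p (\<lambda>y. r y b - s y b)" by simp
  from vanish_at_add[OF A p(1) this v] show "vanish_at P1 k p (\<lambda>y. r y b)" by simp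
 next
  assume "vanish_at P1 k p (\<lambda>y. r y b)"
  then show "jet P1 (L_power (int n)) k p r \<in> kernel_beta n k p"
   unfolding kernel_beta_def using zero[OF r] r by blast
 qed
qed

text \<open>Let \<phi> be the transition function from [b] to [b']. Replacing \<open>b\<close> by
  \<open>b'\<close> multiplies the coefficient of \<open>r\<close> by \<phi>^n, omega by \<phi>
  \<phi>(p), and \<open>t\<close> by \<phi>(p)^(-(k+1)). For k = n + 1 what remains is the factor 1
  - \<phi>/\<phi>(p) on a term of order k; it vanishes at \<open>p\<close>, so the discrepancy has
  order k + 1.\<close>

lemma leading_coeff_change_basis:
 assumes w: "nonzero_bivector w" and p: "p \<in> points P1" "b \<notin> p" "b' \<notin> p" and k: "k = n + 1"
  and r: "r \<in> local_sections P1 (L_power (int n)) p"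
  and t: "t \<in> quot_power UNIV p (- int (k + 1))"
  and v: "vanish_at P1 (k + 1) p (\<lambda>y. r y b - t b * omega_section w p b y b ^ k)"
 shows "vanish_at P1 (k + 1) p (\<lambda>y. r y b' - t b' * omega_section w p b' y b' ^ k)"
proof -
 note A = complex_atlas_P1
 obtain e where e: "p = cfun.span {e}" "br e b \<noteq> 0" using points_P1_affine[OF p(1,2)] .
 have b': "br e b' \<noteq> 0" using p(3) line_mem_iff[OF br_nonzero(1)[OF e(2)]] by (simp add: e(1))
 note He = hyperplane_line[OF br_nonzero(1)[OF e(2)]]
 let ?\<phi> = "\<lambda>y. quot_frame UNIV y 1 b b'"
 let ?om = "\<lambda>y. omega_section w p b y b"
 have \<phi>h: "hol_at P1 p ?\<phi>" by (rule quot_frame_hol[OF p])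
 have \<phi>p: "?\<phi> p = br e b / br e b'" using b' by (simp add: e(1) quot_frame_value[OF He])
 have "(- (- int (k + 1))) = int (k + 1)" by simp
 then have tb': "t b' = t b * (br e b' / br e b) ^ (k + 1)"
  using quot_power_value[OF He t[unfolded e(1)] UNIV_I e(2), of b'] b' by (simp only: power_int_of_nat if_True UNIV_I simp_thms)
 have ev: "\<forall>\<^sub>F y in nhds_rs P1 p. r y b' - t b' * omega_section w p b' y b' ^ k =
   ?\<phi> y ^ n * (r y b - t b * ?om y ^ k) + ?om y ^ k * (t b * ?\<phi> y ^ n * (1 - ?\<phi> y / ?\<phi> p))"
  using conjunct1[OF r[unfolded L_local(1)[OF p(1,2)]]] eventually_points[OF p(1)]
   eventually_not_mem[OF p(1,2)] eventually_not_mem[OF p(1,3)]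
 proof eventually_elim
  case (elim y)
  obtain v where v: "y = cfun.span {v}" "br v b \<noteq> 0" using points_P1_affine[OF elim(2,3)] .
  have vb': "br v b' \<noteq> 0" using elim(4) line_mem_iff[OF br_nonzero(1)[OF v(2)]] by (simp add: v(1))
  note Hv = hyperplane_line[OF br_nonzero(1)[OF v(2)]]
  have \<phi>y: "?\<phi> y = br v b / br v b'" using vb' by (simp add: v(1) quot_frame_value[OF Hv])
  have "r y b' = r y b * (br v b' / br v b) powi (- int n)"
   using quot_power_value[OF Hv elim(1)[unfolded v(1)] UNIV_I v(2), of b'] vb' by (simp add: v(1))
  then have ry: "r y b' = r y b * ?\<phi> y ^ n"
   unfolding \<phi>y by (simp add: power_int_minus power_divide)
  have om1: "?om y = w (1, 2) * br e v / (br e b * br v b)"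
   unfolding e(1) v(1) by (rule omega_section_eq[OF w e(2) v(2)])
  have om2: "omega_section w p b' y b' = w (1, 2) * br e v / (br e b' * br v b')"
   unfolding e(1) v(1) by (rule omega_section_eq[OF w b' vb'])
  have om3: "omega_section w p b' y b' = ?om y * ?\<phi> y * ?\<phi> p"
   unfolding om1 om2 \<phi>y \<phi>p using e(2) v(2) by simp
  have c: "(br e b' / br e b) ^ (k + 1) * ?\<phi> p ^ k = 1 / ?\<phi> p"
   unfolding \<phi>p using e(2) b' by (simp add: power_divide)
  have "t b' * omega_section w p b' y b' ^ k = t b * ?om y ^ k * ?\<phi> y ^ k * ((br e b' / br e b) ^ (k + 1) * ?\<phi> p ^ k)"
   unfolding tb' om3 power_mult_distrib by (simp only: mult_ac)
  also have "\<dots> = t b * ?om y ^ k * ?\<phi> y ^ n * (?\<phi> y / ?\<phi> p)"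
   unfolding c by (simp add: k)
  finally show ?case unfolding ry by (simp add: algebra_simps)
 qed
 have h1: "hol_at P1 p (\<lambda>y. ?\<phi> y ^ n)" by (rule hol_at_power[OF A p(1) \<phi>h])
 have \<phi>0: "?\<phi> p \<noteq> 0" using \<phi>p e(2) b' by simp
 have "hol_at P1 p (\<lambda>y. t b * ?\<phi> y ^ n * (1 - ?\<phi> y / ?\<phi> p))"
  by (intro hol_at_mult[OF A p(1)] hol_at_diff[OF A p(1)] hol_at_const[OF A p(1)] hol_at_divide[OF A p(1)] h1 \<phi>h) (rule \<phi>0)
 then have "vanish_at P1 1 p (\<lambda>y. t b * ?\<phi> y ^ n * (1 - ?\<phi> y / ?\<phi> p))"
  by (rule vanish_at_1[OF A p(1)]) (use \<phi>0 in simp)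
 moreover have "vanish_at P1 k p (\<lambda>y. ?om y ^ k)"
  using vanish_at_uniformizer_power[OF A p(1) omega_uniformizer[OF w p(1,2)] hol_at_const[OF A p(1), of 1], of k] by simp
 ultimately have "vanish_at P1 (k + 1) p (\<lambda>y. ?om y ^ k * (t b * ?\<phi> y ^ n * (1 - ?\<phi> y / ?\<phi> p)))"
  by (intro vanish_at_mult[OF A p(1)])
 from vanish_at_add[OF A p(1) vanish_at_mult_hol[OF A p(1) h1 v] this]
 show ?thesis using vanish_at_cong[OF A p(1) ev] by simp
qed

text \<open>On the kernel of the projection to n-jets, \<open>top_jet_map\<close> reads off the
  coefficient of the k-th power of omega in the basis [b]. \<open>leading_coeff_change_basis\<close>
  carries this from one \<open>b\<close> to all others, which determines the whole element
  \<open>t\<close>.\<close>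

lemma top_jet_map_iff:
 assumes w: "nonzero_bivector w" and p: "p \<in> points P1" "b \<notin> p" and k: "k = n + 1"
  and r: "r \<in> local_sections P1 (L_power (int n)) p"
  and t: "t \<in> quot_power UNIV p (- int (k + 1))"
 shows "jet P1 (L_power (int n)) k p r \<in> kernel_beta n k p \<and> top_jet_map w n k p (jet P1 (L_power (int n)) k p r) = t
  \<longleftrightarrow> vanish_at P1 (k + 1) p (\<lambda>y. r y b - t b * omega_section w p b y b ^ k)"
proof -
 note A = complex_atlas_P1
 note om = omega_uniformizer[OF w p]
 let ?om = "\<lambda>y. omega_section w p b y b"
 have omk: "vanish_at P1 k p (\<lambda>y. c * ?om y ^ k)" for c
  using vanish_at_uniformizer_power[OF A p(1) om hol_at_const[OF A p(1), of c], of k] by (simp add: mult.commute)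
 show ?thesis unfolding kernel_beta_iff[OF p k r]
 proof
  assume *: "vanish_at P1 k p (\<lambda>y. r y b) \<and> top_jet_map w n k p (jet P1 (L_power (int n)) k p r) = t"
  obtain g where g: "hol_at P1 p g" "\<forall>\<^sub>F y in nhds_rs P1 p. r y b = ?om y ^ k * g y"
   using conjunct1[OF *] unfolding vanish_at_uniformizer[OF A om] by blast
  have "vanish_at P1 1 p (\<lambda>y. g y - g p)"
   by (intro vanish_at_1[OF A p(1)] hol_at_diff[OF A p(1)] g hol_at_const[OF A p(1)]) simp
  from vanish_at_mult[OF A p(1) _ this, of k "\<lambda>y. ?om y ^ k"] omk[of 1]
  have "vanish_at P1 (k + 1) p (\<lambda>y. ?om y ^ k * (g y - g p))" by simp
  moreover have ev: "\<forall>\<^sub>F y in nhds_rs P1 p. r y b - g p * ?om y ^ k = ?om y ^ k * (g y - g p)"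
   using g(2) by eventually_elim (simp add: algebra_simps)
  ultimately have v: "vanish_at P1 (k + 1) p (\<lambda>y. r y b - g p * ?om y ^ k)"
   using vanish_at_cong[OF A p(1) ev] by simp
  have "t b = g p" using top_jet_map_value[OF w k p r v] * by simp
  then show "vanish_at P1 (k + 1) p (\<lambda>y. r y b - t b * ?om y ^ k)" using v by simp
 next
  assume v: "vanish_at P1 (k + 1) p (\<lambda>y. r y b - t b * ?om y ^ k)"
  have "vanish_at P1 k p (\<lambda>y. r y b - t b * ?om y ^ k)" by (rule vanish_at_mono[OF A p(1) v]) simp
  from vanish_at_add[OF A p(1) this omk[of "t b"]] have 1: "vanish_at P1 k p (\<lambda>y. r y b)" by simp
  have "top_jet_map w n k p (jet P1 (L_power (int n)) k p r) b' = t b'" for b'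
  proof (cases "b' \<in> p")
   case True
   then show ?thesis using quot_power_zero[OF t] by (simp add: top_jet_map_def)
  next
   case False
   show ?thesis
    by (rule top_jet_map_value[OF w k p(1) False r leading_coeff_change_basis[OF w p False k r t v]])
  qed
  with 1 show "vanish_at P1 k p (\<lambda>y. r y b) \<and> top_jet_map w n k p (jet P1 (L_power (int n)) k p r) = t"
   by blast
 qed
qed

text \<open>\<open>r0\<close>, the section with coefficient \<open>t b\<close> times the k-th power
  of omega, represents the preimage of \<open>t\<close>, and every other representative has the same
  k-jet.\<close>

lemma jet_iso_P1_iff:
 assumes w: "nonzero_bivector w" and p: "p \<in> points P1" "b \<notin> p" and k: "k = n + 1"
  and P: "global_section P \<in> local_sections P1 (L_power (int n)) p"
  and t: "t \<in> quot_power UNIV p (- int (k + 1))"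
  and s: "s \<in> local_sections P1 (L_power (int n)) p"
 shows "jet P1 (L_power (int n)) k p s = jet_iso_P1 w n k p P t \<longleftrightarrow>
  vanish_at P1 (k + 1) p (\<lambda>y. s y b - global_section P y b - t b * omega_section w p b y b ^ k)"
proof -
 note A = complex_atlas_P1 and V = vector_bundle_L
 let ?ls = "local_sections P1 (L_power (int n)) p" and ?J = "jet P1 (L_power (int n)) k p"
 let ?om = "\<lambda>y. omega_section w p b y b"
 define r0 where "r0 = (\<lambda>y. fscale (t b * ?om y ^ k) (quot_frame UNIV y (int n) b))"
 have fr: "quot_frame UNIV y (int n) b \<in> quot_power UNIV y (int n)" "quot_frame UNIV y (int n) b b = 1"
  if y: "y \<in> points P1" "b \<notin> y" for y
 proof -
  obtain v where v: "y = cfun.span {v}" "br v b \<noteq> 0" using points_P1_affine[OF y] .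
  note H = hyperplane_line[OF br_nonzero(1)[OF v(2)]]
  have "fscale 1 (quot_frame UNIV y (int n) b) \<in> quot_power UNIV y (int n)"
   unfolding v(1) quot_power_frame[OF H UNIV_I v(2)] by (rule rangeI)
  then show "quot_frame UNIV y (int n) b \<in> quot_power UNIV y (int n)" by simp
  show "quot_frame UNIV y (int n) b b = 1" using v(2) by (simp add: v(1) quot_frame_value[OF H])
 qed
 have "\<forall>\<^sub>F y in nhds_rs P1 p. r0 y \<in> quot_power UNIV y (int n) \<and> r0 y b = t b * ?om y ^ k"
  using eventually_points[OF p(1)] eventually_not_mem[OF p]
 proof eventually_elim
  case (elim y)
  show ?case using quot_power_subspace(2)[OF fr(1)[OF elim] quot_power_subspace(1), of "t b * ?om y ^ k"] fr(2)[OF elim]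
   by (simp add: r0_def)
 qed
 then have r0e: "\<forall>\<^sub>F y in nhds_rs P1 p. r0 y \<in> quot_power UNIV y (int n)"
   "\<forall>\<^sub>F y in nhds_rs P1 p. r0 y b = t b * ?om y ^ k"
  by (auto simp: eventually_conj_iff)
 have "hol_at P1 p (\<lambda>y. t b * ?om y ^ k)"
  by (intro hol_at_mult[OF A p(1)] hol_at_const[OF A p(1)] hol_at_power[OF A p(1)] omega_hol_at[OF w p p])
 then have r0: "r0 \<in> ?ls" unfolding L_local(1)[OF p] using r0e(1) hol_at_cong[OF A p(1) r0e(2)] by simp
 have ev: "\<forall>\<^sub>F y in nhds_rs P1 p. r y b - r0 y b = r y b - t b * ?om y ^ k" for r
  using r0e(2) by eventually_elim simp
 have good: "(?J r \<in> kernel_beta n k p \<and> top_jet_map w n k p (?J r) = t) \<longleftrightarrow>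
   vanishes_to_order P1 (L_power (int n)) (k + 1) p (r - r0)" if r: "r \<in> ?ls" for r
 proof -
  have "r - r0 \<in> ?ls" by (rule local_sections_diff_L[OF p(1) r r0])
  then have "vanishes_to_order P1 (L_power (int n)) (k + 1) p (r - r0) \<longleftrightarrow> vanish_at P1 (k + 1) p (\<lambda>y. r y b - r0 y b)"
   unfolding L_local[OF p] by simp
  then show ?thesis using top_jet_map_iff[OF w p k r t] vanish_at_cong[OF A p(1) ev] by simp
 qed
 have gr: "(?J r \<in> kernel_beta n k p \<and> top_jet_map w n k p (?J r) = t) \<longleftrightarrow> ?J (global_section P + r) = ?J (global_section P + r0)"
  if r: "r \<in> ?ls" for r
  using good[OF r] jet_eq_iff[OF A V p(1) local_sections_add[OF A V p(1) P r] local_sections_add[OF A V p(1) P r0], of k]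
  by simp
 have "jet_iso_P1 w n k p P t = ?J (global_section P + r0)"
  unfolding jet_iso_P1_def
 proof (rule the_equality)
  show "\<exists>r\<in>?ls. ?J r \<in> kernel_beta n k p \<and> top_jet_map w n k p (?J r) = t \<and> ?J (global_section P + r0) = ?J (global_section P + r)"
   using gr[OF r0] r0 by blast
 next
  fix j assume "\<exists>r\<in>?ls. ?J r \<in> kernel_beta n k p \<and> top_jet_map w n k p (?J r) = t \<and> j = ?J (global_section P + r)"
  then show "j = ?J (global_section P + r0)" using gr by blast
 qed
 moreover have "?J s = ?J (global_section P + r0) \<longleftrightarrow>
   vanishes_to_order P1 (L_power (int n)) (k + 1) p (s - (global_section P + r0))"
  by (rule jet_eq_iff[OF A V p(1) s local_sections_add[OF A V p(1) P r0]])
 moreover have "s - (global_section P + r0) \<in> ?ls"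
  by (intro local_sections_diff_L[OF p(1) s] local_sections_add[OF A V p(1) P r0])
 then have "vanishes_to_order P1 (L_power (int n)) (k + 1) p (s - (global_section P + r0)) \<longleftrightarrow>
   vanish_at P1 (k + 1) p (\<lambda>y. s y b - (global_section P y b + r0 y b))"
  unfolding L_local[OF p] by simp
 moreover have ev2: "\<forall>\<^sub>F y in nhds_rs P1 p. s y b - (global_section P y b + r0 y b) =
   s y b - global_section P y b - t b * ?om y ^ k"
  using r0e(2) by eventually_elim simp
 ultimately show ?thesis using vanish_at_cong[OF A p(1) ev2] by simp
qed

lemma global_section_value:
 assumes "br v u \<noteq> 0"
 shows "global_section P (cfun.span {v}) u = P (\<lambda>x. br v x / br v u)"
proof -
 have "u \<notin> cfun.span {v}" using assms line_mem_iff[OF br_nonzero(1)[OF assms]] by simp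
 then show ?thesis by (simp add: global_section_def sym_quot_def quot_coord_line[OF assms])
qed

section \<open>Symmetric powers as spaces of binary forms\<close>

definition binary_form ::
  "('a \<Rightarrow> complex) set \<Rightarrow> ('a \<Rightarrow> complex) \<Rightarrow> ('a \<Rightarrow> complex) \<Rightarrow> nat \<Rightarrow> (nat \<Rightarrow> complex)
   \<Rightarrow> (('a \<Rightarrow> complex) \<Rightarrow> complex) \<Rightarrow> complex" where
 "binary_form S e b n c = (\<lambda>\<xi>. if \<xi> \<in> dual_space S then \<Sum>j\<le>n. c j * \<xi> e ^ j * \<xi> b ^ (n - j) else 0)"

text \<open>A product of vectors, each a combination of \<open>e\<close> and \<open>b\<close>, is
  expanded by induction on the number of factors; conversely each monomial is a symmetric product of
  copies of \<open>e\<close> and \<open>b\<close>.\<close>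

lemma sym_power_binary:
 fixes S :: "('a \<Rightarrow> complex) set"
 assumes S: "cfun.subspace S" and e: "e \<in> S" and b: "b \<in> S"
  and span: "\<And>v. v \<in> S \<Longrightarrow> \<exists>\<alpha> \<beta>. v = fscale \<alpha> e + fscale \<beta> b"
 shows "sym_power n S = range (binary_form S e b n)"
proof (rule equalityI)
 let ?G = "\<lambda>n. {(\<lambda>\<xi>. if \<xi> \<in> dual_space S then \<Prod>l<n. \<xi> (v l) else 0) |v :: nat \<Rightarrow> _. \<forall>l<n. v l \<in> S}"
 have sub: "cfun.subspace (range (binary_form S e b n))" for n
  unfolding cfun.subspace_def
 proof safe
  show "0 \<in> range (binary_form S e b n)"
   by (rule range_eqI[of _ _ "\<lambda>_. 0"]) (simp add: binary_form_def fun_eq_iff)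
  show "binary_form S e b n c + binary_form S e b n c' \<in> range (binary_form S e b n)" for c c'
   by (rule range_eqI[of _ _ "\<lambda>j. c j + c' j"]) (simp add: binary_form_def fun_eq_iff sum.distrib algebra_simps)
  show "fscale a (binary_form S e b n c) \<in> range (binary_form S e b n)" for a c
   by (rule range_eqI[of _ _ "\<lambda>j. a * c j"]) (simp add: binary_form_def fun_eq_iff sum_distrib_left algebra_simps)
 qed
 have lin: "\<xi> (fscale \<alpha> e + fscale \<beta> b) = \<alpha> * \<xi> e + \<beta> * \<xi> b" if "\<xi> \<in> dual_space S" for \<xi> \<alpha> \<beta>
 proof -
  have l: "\<xi> (fscale a u + v) = a * \<xi> u + \<xi> v" if "u \<in> S" "v \<in> S" for a u v
   using \<open>\<xi> \<in> dual_space S\<close> that by (simp add: dual_space_def linear_fun_on_def)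
  have z: "\<xi> 0 = 0" using l[of 0 0 "-1"] cfun.subspace_0[OF S] by (simp add: cfun.scale_zero_right)
  have "\<xi> (fscale \<beta> b) = \<beta> * \<xi> b" using l[OF b cfun.subspace_0[OF S], of \<beta>] z by simp
  then show ?thesis using l[OF e cfun.subspace_scale[OF S b]] by simp
 qed
 have mono: "\<exists>c. \<forall>\<xi>\<in>dual_space S. (\<Prod>l<n. \<xi> (v l)) = (\<Sum>j\<le>n. c j * \<xi> e ^ j * \<xi> b ^ (n - j))"
  if "\<forall>l<n. v l \<in> S" for n and v :: "nat \<Rightarrow> _"
  using that
 proof (induction n)
  case 0
  show ?case by (rule exI[of _ "\<lambda>_. 1"]) simp
 next
  case (Suc n)
  then obtain c where c: "\<forall>\<xi>\<in>dual_space S. (\<Prod>l<n. \<xi> (v l)) = (\<Sum>j\<le>n. c j * \<xi> e ^ j * \<xi> b ^ (n - j))" by auto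
  obtain \<alpha> \<beta> where ab: "v n = fscale \<alpha> e + fscale \<beta> b" using span Suc.prems by blast
  \<comment> \<open>Coefficients after multiplication by \<alpha> x + \<beta> y: the first term
    shifts \<open>c\<close> by one degree, the second keeps it, and entries out of range are set to
    zero.\<close>
  let ?c = "\<lambda>j. (if j = 0 then 0 else \<alpha> * c (j - 1)) + (if j = Suc n then 0 else \<beta> * c j)"
  show ?case
  proof (rule exI[of _ ?c], rule ballI)
   fix \<xi> assume \<xi>: "\<xi> \<in> dual_space S"
   let ?x = "\<xi> e" and ?y = "\<xi> b"
   have "(\<Sum>j\<le>Suc n. (if j = 0 then 0 else \<alpha> * c (j - 1)) * ?x ^ j * ?y ^ (Suc n - j))
     = (\<Sum>j\<le>n. \<alpha> * c j * ?x ^ Suc j * ?y ^ (n - j))"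
    by (subst sum.atMost_Suc_shift) simp
   moreover have "(\<Sum>j\<le>Suc n. (if j = Suc n then 0 else \<beta> * c j) * ?x ^ j * ?y ^ (Suc n - j))
     = (\<Sum>j\<le>n. \<beta> * c j * ?x ^ j * ?y ^ Suc (n - j))"
    by (auto intro!: sum.cong simp: Suc_diff_le)
   ultimately have "(\<Sum>j\<le>Suc n. ?c j * ?x ^ j * ?y ^ (Suc n - j)) =
     (\<Sum>j\<le>n. \<alpha> * c j * ?x ^ Suc j * ?y ^ (n - j)) + (\<Sum>j\<le>n. \<beta> * c j * ?x ^ j * ?y ^ Suc (n - j))"
    by (simp only: distrib_right sum.distrib)
   also have "\<dots> = (\<Sum>j\<le>n. c j * ?x ^ j * ?y ^ (n - j)) * (\<alpha> * ?x + \<beta> * ?y)"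
    unfolding sum_distrib_right sum.distrib[symmetric] by (intro sum.cong refl) (simp add: algebra_simps)
   also have "\<dots> = (\<Prod>l<Suc n. \<xi> (v l))" using c \<xi> lin[OF \<xi>] by (simp add: ab)
   finally show "(\<Prod>l<Suc n. \<xi> (v l)) = (\<Sum>j\<le>Suc n. ?c j * ?x ^ j * ?y ^ (Suc n - j))" by simp
  qed
 qed
 have "?G n \<subseteq> range (binary_form S e b n)"
 proof safe
  fix v :: "nat \<Rightarrow> _" assume "\<forall>l<n. v l \<in> S"
  then obtain c where c: "\<forall>\<xi>\<in>dual_space S. (\<Prod>l<n. \<xi> (v l)) = (\<Sum>j\<le>n. c j * \<xi> e ^ j * \<xi> b ^ (n - j))"
   using mono by blast
  show "(\<lambda>\<xi>. if \<xi> \<in> dual_space S then \<Prod>l<n. \<xi> (v l) else 0) \<in> range (binary_form S e b n)"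
   by (rule range_eqI[of _ _ c]) (simp add: binary_form_def fun_eq_iff c)
 qed
 then show "sym_power n S \<subseteq> range (binary_form S e b n)"
  unfolding sym_power_def by (rule cfun.span_minimal[OF _ sub])
 show "range (binary_form S e b n) \<subseteq> sym_power n S"
 proof safe
  fix c
  let ?m = "\<lambda>j \<xi>. if \<xi> \<in> dual_space S then \<Prod>l<n. \<xi> (if l < j then e else b) else 0"
  have "binary_form S e b n c = (\<Sum>j\<le>n. fscale (c j) (?m j))"
  proof
   fix \<xi> :: "('a \<Rightarrow> complex) \<Rightarrow> complex"
   have "(\<Prod>l<n. \<xi> (if l < j then e else b)) = \<xi> e ^ j * \<xi> b ^ (n - j)" if j: "j \<le> n" for j
   proof -
    have "{..<n} \<inter> {l. l < j} = {..<j}" "{..<n} \<inter> - {l. l < j} = {j..<n}" using j by auto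
    then show ?thesis by (simp add: if_distrib[of \<xi>] prod.If_cases)
   qed
   then show "binary_form S e b n c \<xi> = (\<Sum>j\<le>n. fscale (c j) (?m j)) \<xi>"
    by (auto simp: binary_form_def sum_fun_apply mult.assoc)
  qed
  also have "\<dots> \<in> sym_power n S" unfolding sym_power_def
   by (intro cfun.span_sum cfun.span_scale cfun.span_base) (use e b in auto)
  finally show "binary_form S e b n c \<in> sym_power n S" .
 qed
qed

section \<open>Holomorphic maps and germs\<close>

context
 fixes A :: "'p chart set" and A' :: "'q chart set" and U \<phi> x
 assumes A: "complex_atlas A" and A': "complex_atlas A'"
  and U: "rs_open A U" and \<phi>: "hol_map A A' U \<phi>" and x: "x \<in> U"
begin

lemma hol_map_chart:
 assumes "(D, z) \<in> A'" "\<phi> x \<in> D"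
 shows "\<forall>\<^sub>F y in nhds_rs A x. \<phi> y \<in> D" "hol_at A x (\<lambda>y. z (\<phi> y))"
proof -
 have o: "rs_open A (U \<inter> \<phi> -` D)" and h: "hol_fun A (U \<inter> \<phi> -` D) (z \<circ> \<phi>)"
  using \<phi> assms(1) unfolding hol_map_def by auto
 have xm: "x \<in> U \<inter> \<phi> -` D" using x assms(2) by simp
 show "\<forall>\<^sub>F y in nhds_rs A x. \<phi> y \<in> D"
  using eventually_rs_open[OF A o xm] by eventually_elim simp
 show "hol_at A x (\<lambda>y. z (\<phi> y))"
  unfolding hol_at_def using o h xm by (intro exI[of _ "U \<inter> \<phi> -` D"]) (simp add: comp_def)
qed

lemma hol_map_points: "x \<in> points A" "\<phi> x \<in> points A'"
 using rs_open_subset[OF U] x \<phi> unfolding hol_map_def by auto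

lemma hol_map_eventually:
 assumes P: "eventually P (nhds_rs A' (\<phi> x))"
 shows "\<forall>\<^sub>F y in nhds_rs A x. P (\<phi> y)"
proof -
 obtain D z where D: "(D, z) \<in> A'" "\<phi> x \<in> D" using points_E[OF hol_map_points(2)] .
 have "eventually (\<lambda>\<zeta>. P (inv_into D z \<zeta>)) (nhds (z (\<phi> x)))"
  using P unfolding eventually_nhds_rs_chart[OF A' D] .
 then have "\<forall>\<^sub>F y in nhds_rs A x. P (inv_into D z (z (\<phi> y)))"
  using tendsto_hol_at[OF A hol_map_points(1) hol_map_chart(2)[OF D]]
  by (rule eventually_compose_filterlim)
 then show ?thesis using hol_map_chart(1)[OF D]
  by eventually_elim (simp add: inv_into_f_f[OF atlasD(1)[OF A' D(1)]])
qed

lemma hol_map_hol_at: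
 assumes f: "hol_at A' (\<phi> x) f"
 shows "hol_at A x (\<lambda>y. f (\<phi> y))"
proof -
 obtain D z where D: "(D, z) \<in> A'" "\<phi> x \<in> D" using points_E[OF hol_map_points(2)] .
 have "(f \<circ> inv_into D z) analytic_on {z (\<phi> x)}" using f hol_at_chart[OF A' D] by blast
 from hol_at_compose[OF A hol_map_points(1) hol_map_chart(2)[OF D] this]
 have "hol_at A x (\<lambda>y. (f \<circ> inv_into D z) (z (\<phi> y)))" .
 moreover have ev: "\<forall>\<^sub>F y in nhds_rs A x. (f \<circ> inv_into D z) (z (\<phi> y)) = f (\<phi> y)"
  using hol_map_chart(1)[OF D] by eventually_elim (simp add: inv_into_f_f[OF atlasD(1)[OF A' D(1)]])
 ultimately show ?thesis using hol_at_cong[OF A hol_map_points(1) ev] by simp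
qed

end

section \<open>The bundles glued from a projective structure\<close>

lemma mat_act_entries:
 "mat_act g v 1 = g $ 1 $ 1 * v 1 + g $ 1 $ 2 * v 2"
 "mat_act g v 2 = g $ 2 $ 1 * v 1 + g $ 2 $ 2 * v 2"
 by (simp_all add: mat_act_def sum_2)

lemma mat_act_linear: "mat_act g (fscale c u + v) = fscale c (mat_act g u) + mat_act g v"
 and mat_act_scale: "mat_act g (fscale c u) = fscale c (mat_act g u)"
 and mat_act_zero: "mat_act g 0 = 0"
 and mat_act_mult: "mat_act (g ** h) v = mat_act g (mat_act h v)"
 and mat_act_one: "mat_act (mat 1) v = v"
 by (rule vec2_eqI; simp add: mat_act_entries algebra_simps matrix_matrix_mult_def sum_2 mat_def)+

lemma br_mat_act: "br (mat_act g u) (mat_act g v) = det g * br u v"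
 by (simp add: br_def mat_act_entries det_2 algebra_simps)

lemma mat_act_line: "mat_act g ` cfun.span {v} = cfun.span {mat_act g v}"
 by (auto simp: cfun.span_singleton image_image mat_act_scale)

lemma component_linear: "component i (fscale c u + v) = fscale c (component i u) + component i v"
 and component_zero: "component i 0 = 0"
 by (simp_all add: component_def fun_eq_iff)

lemma component_eqI: "(\<And>j. component j u = component j v) \<Longrightarrow> u = v"
 by (auto simp: component_def fun_eq_iff)

locale projective_surface =
 fixes A :: "'p chart set" and Q :: "('p, 'i) projective_atlas"
 assumes A: "complex_atlas A" and PS: "projective_structure A Q" and TL: "theta_lift Q"
begin

lemma trans_det: "i \<in> idx Q \<Longrightarrow> j \<in> idx Q \<Longrightarrow> x \<in> dom Q i \<Longrightarrow> x \<in> dom Q j \<Longrightarrow> det (trans Q i j) = 1"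
 and trans_dev: "i \<in> idx Q \<Longrightarrow> j \<in> idx Q \<Longrightarrow> x \<in> dom Q i \<Longrightarrow> x \<in> dom Q j \<Longrightarrow>
   dev Q i x = mat_act (trans Q i j) ` dev Q j x"
 and trans_comp: "i \<in> idx Q \<Longrightarrow> j \<in> idx Q \<Longrightarrow> l \<in> idx Q \<Longrightarrow> x \<in> dom Q i \<Longrightarrow> x \<in> dom Q j \<Longrightarrow> x \<in> dom Q l \<Longrightarrow>
   trans Q i j ** trans Q j l = trans Q i l"
 using TL unfolding theta_lift_def by blast+

text \<open>The cocycle condition makes the matrix idempotent, and an invertible idempotent is the
  identity.\<close>

lemma trans_refl:
 assumes "i \<in> idx Q" "x \<in> dom Q i" shows "trans Q i i = mat 1"
proof -
 let ?t = "trans Q i i"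
 have "det ?t \<noteq> 0" using trans_det[OF assms(1,1,2,2)] by simp
 then have "invertible ?t" by (simp add: invertible_det_nz)
 then obtain s where s: "?t ** s = mat 1" unfolding invertible_def by blast
 have "?t = ?t ** (?t ** s)" by (simp add: s)
 also have "\<dots> = (?t ** ?t) ** s" by (simp add: matrix_mul_assoc)
 also have "\<dots> = ?t ** s" by (simp add: trans_comp[OF assms(1,1,1,2,2,2)])
 finally show ?thesis by (simp add: s)
qed

lemma dev_embedding: "i \<in> idx Q \<Longrightarrow> hol_embedding A P1 (dom Q i) (dev Q i)"
 using PS by (simp add: projective_structure_def)

lemma dom_open: "i \<in> idx Q \<Longrightarrow> rs_open A (dom Q i)"
 and dev_open: "i \<in> idx Q \<Longrightarrow> rs_open P1 (dev Q i ` dom Q i)"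
 and dev_inj: "i \<in> idx Q \<Longrightarrow> inj_on (dev Q i) (dom Q i)"
 and dev_hol: "i \<in> idx Q \<Longrightarrow> hol_map A P1 (dom Q i) (dev Q i)"
 and dev_inv_hol: "i \<in> idx Q \<Longrightarrow> hol_map P1 A (dev Q i ` dom Q i) (inv_into (dom Q i) (dev Q i))"
 using dev_embedding by (simp_all add: hol_embedding_def)

lemma dom_cover: "x \<in> points A \<Longrightarrow> \<exists>i\<in>idx Q. x \<in> dom Q i"
 using PS unfolding projective_structure_def by blast

lemma dev_points: "i \<in> idx Q \<Longrightarrow> x \<in> dom Q i \<Longrightarrow> dev Q i x \<in> points P1"
 by (rule hol_map_points(2)[OF A complex_atlas_P1 dom_open dev_hol])

lemma dom_points: "i \<in> idx Q \<Longrightarrow> x \<in> dom Q i \<Longrightarrow> x \<in> points A"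
 using dom_open rs_open_subset by blast

lemma component_glue:
 "j \<in> idx Q \<Longrightarrow> x \<in> dom Q j \<Longrightarrow> component j (glue Q i x b) = mat_act (trans Q j i) b"
 "\<not> (j \<in> idx Q \<and> x \<in> dom Q j) \<Longrightarrow> component j (glue Q i x b) = 0"
 by (auto simp: component_def glue_def fun_eq_iff)

lemma component_glue_self: "i \<in> idx Q \<Longrightarrow> x \<in> dom Q i \<Longrightarrow> component i (glue Q i x b) = b"
 by (simp add: component_glue trans_refl mat_act_one)

lemma flat_fiberD:
 assumes "v \<in> flat_fiber Q x"
 shows "\<not> (j \<in> idx Q \<and> x \<in> dom Q j) \<Longrightarrow> component j v = 0"
  and "i \<in> idx Q \<Longrightarrow> j \<in> idx Q \<Longrightarrow> x \<in> dom Q i \<Longrightarrow> x \<in> dom Q j \<Longrightarrow> component i v = mat_act (trans Q i j) (component j v)"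
 using assms unfolding flat_fiber_def by blast+

lemma glue_flat: assumes "i \<in> idx Q" "x \<in> dom Q i" shows "glue Q i x b \<in> flat_fiber Q x"
 unfolding flat_fiber_def
proof (intro CollectI conjI allI impI ballI)
 fix j assume "\<not> (j \<in> idx Q \<and> x \<in> dom Q j)"
 then show "component j (glue Q i x b) = 0" by (rule component_glue(2))
next
 fix j l assume jl: "j \<in> idx Q" "l \<in> idx Q" "x \<in> dom Q j \<inter> dom Q l"
 then have "trans Q j l ** trans Q l i = trans Q j i" using trans_comp assms by blast
 then show "component j (glue Q i x b) = mat_act (trans Q j l) (component l (glue Q i x b))"
  using jl by (simp add: component_glue flip: mat_act_mult)
qed

text \<open>One representative determines all others through the transition matrices, so each chart
  identifies the fibre with V.\<close>

lemma flat_eq_glue: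
 assumes "i \<in> idx Q" "x \<in> dom Q i" "v \<in> flat_fiber Q x" shows "v = glue Q i x (component i v)"
proof (rule component_eqI)
 fix j
 show "component j v = component j (glue Q i x (component i v))"
 proof (cases "j \<in> idx Q \<and> x \<in> dom Q j")
  case True
  then show ?thesis using flat_fiberD(2)[OF assms(3), of j i] assms by (simp add: component_glue)
 next
  case False
  then show ?thesis using flat_fiberD(1)[OF assms(3) False] component_glue(2)[OF False] by simp
 qed
qed

lemma glue_change:
 assumes "i \<in> idx Q" "x \<in> dom Q i" "j \<in> idx Q" "x \<in> dom Q j"
 shows "glue Q i x b = glue Q j x (mat_act (trans Q j i) b)"
 using flat_eq_glue[OF assms(3,4) glue_flat[OF assms(1,2), of b]] assms by (simp add: component_glue)

lemma flat_fiber_lincomb: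
 assumes "u \<in> flat_fiber Q x" "v \<in> flat_fiber Q x" shows "fscale c u + v \<in> flat_fiber Q x"
 unfolding flat_fiber_def
proof (intro CollectI conjI allI impI ballI)
 fix j assume "\<not> (j \<in> idx Q \<and> x \<in> dom Q j)"
 then show "component j (fscale c u + v) = 0"
  using flat_fiberD(1)[OF assms(1)] flat_fiberD(1)[OF assms(2)] by (simp add: component_linear cfun.scale_zero_right)
next
 fix j l assume jl: "j \<in> idx Q" "l \<in> idx Q" "x \<in> dom Q j \<inter> dom Q l"
 show "component j (fscale c u + v) = mat_act (trans Q j l) (component l (fscale c u + v))"
  using flat_fiberD(2)[OF assms(1) jl(1,2)] flat_fiberD(2)[OF assms(2) jl(1,2)] jl(3)
  by (simp add: component_linear mat_act_linear)
qed

text \<open>Membership in the tautological line may be tested in one chart, since the transition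
  matrices carry the lines \<open>dev\<close> into each other. This makes the calculus of quotient
  powers available on M.\<close>

lemma flat_hyperplane:
 assumes i: "i \<in> idx Q" "x \<in> dom Q i" and e: "e \<noteq> 0" "dev Q i x = cfun.span {e}"
 shows "hyperplane_fun (flat_fiber Q x) (taut_fiber Q x) (\<lambda>v. br e (component i v))"
 unfolding hyperplane_fun_def
proof (intro conjI)
 show "cfun.subspace (flat_fiber Q x)"
  unfolding cfun.subspace_def
 proof (intro conjI ballI allI)
  show z: "0 \<in> flat_fiber Q x" by (simp add: flat_fiber_def component_zero mat_act_zero)
  show "u + v \<in> flat_fiber Q x" if uv: "u \<in> flat_fiber Q x" "v \<in> flat_fiber Q x" for u v
   using flat_fiber_lincomb[OF uv, of 1] by simp
  show "fscale c v \<in> flat_fiber Q x" if v: "v \<in> flat_fiber Q x" for c v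
   using flat_fiber_lincomb[OF v z, of c] by simp
 qed
 show "linear_fun_on (flat_fiber Q x) (\<lambda>v. br e (component i v))"
  unfolding linear_fun_on_def by (simp add: component_linear br_add br_scale)
 show "taut_fiber Q x = {v \<in> flat_fiber Q x. br e (component i v) = 0}"
 proof (rule equalityI; rule subsetI)
  fix v assume v: "v \<in> taut_fiber Q x"
  then have "component i v \<in> dev Q i x" using i by (simp add: taut_fiber_def)
  then show "v \<in> {v \<in> flat_fiber Q x. br e (component i v) = 0}"
   using v by (simp add: taut_fiber_def e(2) line_mem_iff[OF e(1)])
 next
  fix v assume v: "v \<in> {v \<in> flat_fiber Q x. br e (component i v) = 0}"
  then have m: "component i v \<in> dev Q i x" by (simp add: e(2) line_mem_iff[OF e(1)])
  have "component j v \<in> dev Q j x" if j: "j \<in> idx Q" "x \<in> dom Q j" for j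
   using flat_fiberD(2)[of v x j i] trans_dev[OF j(1) i(1) j(2) i(2)] m v i j by simp
  then show "v \<in> taut_fiber Q x" using v by (simp add: taut_fiber_def)
 qed
qed

lemma flat_subspace: "x \<in> points A \<Longrightarrow> cfun.subspace (flat_fiber Q x)"
proof -
 assume "x \<in> points A"
 then obtain i where i: "i \<in> idx Q" "x \<in> dom Q i" using dom_cover by blast
 obtain e where "e \<noteq> 0" "dev Q i x = cfun.span {e}" using dev_points[OF i] unfolding points_P1 by blast
 from flat_hyperplane[OF i this] show ?thesis by (simp add: hyperplane_fun_def)
qed

lemma chart_elem_quot_power:
 assumes i: "i \<in> idx Q" "x \<in> dom Q i" and f: "f \<in> quot_power (flat_fiber Q x) (taut_fiber Q x) m"
 shows "chart_elem Q i x f \<in> quot_power UNIV (dev Q i x) m"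
proof -
 obtain e where e: "e \<noteq> 0" "dev Q i x = cfun.span {e}" using dev_points[OF i] unfolding points_P1 by blast
 obtain C where "f = (\<lambda>u. if u \<in> flat_fiber Q x \<and> br e (component i u) \<noteq> 0 then C * br e (component i u) powi (- m) else 0)"
  using f unfolding quot_power_iff[OF flat_hyperplane[OF i e]] by blast
 then have "chart_elem Q i x f = (\<lambda>u. if br e u \<noteq> 0 then C * br e u powi (- m) else 0)"
  by (auto simp: fun_eq_iff chart_elem_def component_glue_self[OF i] glue_flat[OF i])
 then show ?thesis unfolding e(2) quot_power_line[OF e(1)] by blast
qed

lemma quot_frame_glue:
 assumes i: "i \<in> idx Q" "x \<in> dom Q i"
 shows "quot_frame (flat_fiber Q x) (taut_fiber Q x) m (glue Q i x b) (glue Q i x b') = quot_frame UNIV (dev Q i x) m b b'"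
proof -
 obtain e where e: "e \<noteq> 0" "dev Q i x = cfun.span {e}" using dev_points[OF i] unfolding points_P1 by blast
 show ?thesis
  unfolding quot_frame_value[where lam = "\<lambda>v. br e (component i v)" and b = "glue Q i x b", OF flat_hyperplane[OF i e] glue_flat[OF i]]
   e(2) quot_frame_value[where lam = "br e" and b = b, OF hyperplane_line[OF e(1)] UNIV_I]
  by (simp add: component_glue_self[OF i] glue_flat[OF i])
qed

lemma bL_frame_facts:
 assumes i: "i \<in> idx Q" "x \<in> dom Q i" and b: "b \<notin> dev Q i x"
 shows "quot_power (flat_fiber Q x) (taut_fiber Q x) m = range (\<lambda>c. fscale c (quot_frame (flat_fiber Q x) (taut_fiber Q x) m (glue Q i x b)))"
  and "quot_frame (flat_fiber Q x) (taut_fiber Q x) m (glue Q i x b) (glue Q i x b) = 1"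
proof -
 obtain e where e: "e \<noteq> 0" "dev Q i x = cfun.span {e}" using dev_points[OF i] unfolding points_P1 by blast
 have n: "br e (component i (glue Q i x b)) \<noteq> 0"
  using b unfolding component_glue_self[OF i] e(2) line_mem_iff[OF e(1)] .
 show "quot_power (flat_fiber Q x) (taut_fiber Q x) m = range (\<lambda>c. fscale c (quot_frame (flat_fiber Q x) (taut_fiber Q x) m (glue Q i x b)))"
  by (rule quot_power_frame[where lam = "\<lambda>v. br e (component i v)" and b = "glue Q i x b", OF flat_hyperplane[OF i e] glue_flat[OF i] n])
 show "quot_frame (flat_fiber Q x) (taut_fiber Q x) m (glue Q i x b) (glue Q i x b) = 1"
  unfolding quot_frame_glue[OF i] e(2) quot_frame_value[where lam = "br e" and b = b, OF hyperplane_line[OF e(1)] UNIV_I]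
  using n component_glue_self[OF i, of b] by simp
qed

lemma dev_preimage_open:
 assumes i: "i \<in> idx Q" and b: "b \<noteq> 0" shows "rs_open A {x \<in> dom Q i. b \<notin> dev Q i x}"
proof (rule rs_open_localI)
 fix x assume x: "x \<in> {x \<in> dom Q i. b \<notin> dev Q i x}"
 then have xi: "x \<in> dom Q i" "b \<notin> dev Q i x" by auto
 have xp: "x \<in> points A" by (rule dom_points[OF i xi(1)])
 have "\<forall>\<^sub>F y in nhds_rs A x. b \<notin> dev Q i y"
  by (rule hol_map_eventually[OF A complex_atlas_P1 dom_open[OF i] dev_hol[OF i] xi(1)
     eventually_not_mem[OF dev_points[OF i xi(1)] xi(2)]])
 then have "\<forall>\<^sub>F y in nhds_rs A x. b \<notin> dev Q i y \<and> y \<in> dom Q i"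
  using eventually_rs_open[OF A dom_open[OF i] xi(1)] by eventually_elim simp
 then show "\<exists>V. rs_open A V \<and> x \<in> V \<and> V \<subseteq> {x \<in> dom Q i. b \<notin> dev Q i x}"
  unfolding eventually_nhds_rs[OF A xp] by blast
qed

lemma dev_complement:
 assumes "i \<in> idx Q" "x \<in> dom Q i" obtains b where "b \<notin> dev Q i x" "b \<noteq> 0"
proof -
 obtain b where b: "b \<notin> dev Q i x" using points_P1_complement[OF dev_points[OF assms]] .
 moreover have "b \<noteq> 0" using b dev_points[OF assms] cfun.span_zero unfolding points_P1 by auto
 ultimately show ?thesis by (rule that)
qed

text \<open>Frames over different charts are compared by moving everything into the chart
  \<open>j\<close> with \<open>glue_change\<close>; there the transition coefficient is the pullback
  by \<open>dev Q j\<close> of one on P1, hence holomorphic.\<close>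

lemma line_bundle_bL: "line_bundle A (bL_power Q m)"
proof -
 let ?D = "\<lambda>i b. {x \<in> dom Q i. b \<notin> dev Q i x}"
 let ?f = "\<lambda>i b x. quot_frame (flat_fiber Q x) (taut_fiber Q x) m (glue Q i x b)"
 have fr: "frames (bL_power Q m) = {(?D i b, 1, \<lambda>_ x. ?f i b x) |i b. i \<in> idx Q \<and> b \<noteq> 0}"
  by (simp add: bL_power_def)
 have fib: "fiber (bL_power Q m) x = quot_power (flat_fiber Q x) (taut_fiber Q x) m" for x by (simp add: bL_power_def)
 have hol: "hol_section A (bL_power Q m) (?D i b) (?f i b)" if i: "i \<in> idx Q" "b \<noteq> 0" for i b
  unfolding hol_section_def fr
 proof safe
  fix j and b' :: vec2 assume j: "j \<in> idx Q" "b' \<noteq> 0"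
  let ?c = "\<lambda>x. ?f i b x (glue Q j x b')"
  have o: "rs_open A (?D i b \<inter> ?D j b')"
   by (intro rs_open_Int[OF A] dev_preimage_open i j)
  have "hol_at A x ?c" if x: "x \<in> ?D i b \<inter> ?D j b'" for x
  proof -
   have xd: "x \<in> dom Q i" "x \<in> dom Q j" "b \<notin> dev Q i x" "b' \<notin> dev Q j x" using x by auto
   have xp: "x \<in> points A" by (rule dom_points[OF i(1) xd(1)])
   let ?g = "mat_act (trans Q j i) b"
   have ev: "\<forall>\<^sub>F y in nhds_rs A x. ?c y = quot_frame UNIV (dev Q j y) m ?g b'"
    using eventually_rs_open[OF A dom_open[OF i(1)] xd(1)] eventually_rs_open[OF A dom_open[OF j(1)] xd(2)]
   proof eventually_elim
    case (elim y)
    show ?case unfolding glue_change[OF i(1) elim(1) j(1) elim(2)] by (rule quot_frame_glue[OF j(1) elim(2)])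
   qed
   obtain e where e: "e \<noteq> 0" "dev Q i x = cfun.span {e}" using dev_points[OF i(1) xd(1)] unfolding points_P1 by blast
   have dj: "dev Q j x = cfun.span {mat_act (trans Q j i) e}"
    unfolding trans_dev[OF j(1) i(1) xd(2,1)] e(2) mat_act_line ..
   have "br (mat_act (trans Q j i) e) ?g \<noteq> 0"
    unfolding br_mat_act trans_det[OF j(1) i(1) xd(2,1)] using xd(3) e line_mem_iff[OF e(1)] by simp
   then have "?g \<notin> dev Q j x" unfolding dj using line_mem_iff[OF br_nonzero(1)] by blast
   then have "hol_at P1 (dev Q j x) (\<lambda>q. quot_frame UNIV q m ?g b')"
    by (rule quot_frame_hol[OF dev_points[OF j(1) xd(2)] _ xd(4)])
   from hol_map_hol_at[OF A complex_atlas_P1 dom_open[OF j(1)] dev_hol[OF j(1)] xd(2) this]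
   show ?thesis using hol_at_cong[OF A xp ev] by simp
  qed
  then have h: "hol_fun A (?D i b \<inter> ?D j b') ?c" using hol_fun_iff_hol_at[OF A o] by blast
  have v: "?f i b x = fscale (?c x) (?f j b' x)" if x: "x \<in> ?D i b \<inter> ?D j b'" for x
  proof -
   have xd: "x \<in> dom Q i" "x \<in> dom Q j" "b \<notin> dev Q i x" "b' \<notin> dev Q j x" using x by auto
   have "fscale 1 (?f i b x) \<in> quot_power (flat_fiber Q x) (taut_fiber Q x) m"
    unfolding bL_frame_facts(1)[OF i(1) xd(1,3)] by (rule rangeI)
   then obtain a where a: "?f i b x = fscale a (?f j b' x)"
    unfolding bL_frame_facts(1)[OF j(1) xd(2,4)] by auto
   then have "?c x = a" using bL_frame_facts(2)[OF j(1) xd(2,4), of m] by simp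
   with a show ?thesis by simp
  qed
  show "\<exists>c. (\<forall>l<1. hol_fun A (?D i b \<inter> ?D j b') (c l)) \<and>
    (\<forall>x\<in>?D i b \<inter> ?D j b'. ?f i b x = (\<Sum>l<1. fscale (c (l::nat) x) (?f j b' x)))"
   by (intro exI[of _ "\<lambda>_. ?c"] conjI allI impI ballI) (use h v in simp_all)
 qed
 show ?thesis unfolding line_bundle_def vector_bundle_def
 proof (intro conjI)
  show "(\<Union>(D, r, b)\<in>frames (bL_power Q m). D) = points A"
  proof (rule equalityI; rule subsetI)
   fix x assume "x \<in> (\<Union>(D, r, b)\<in>frames (bL_power Q m). D)"
   then show "x \<in> points A" unfolding fr using dom_points by auto
  next
   fix x assume "x \<in> points A"
   then obtain i where i: "i \<in> idx Q" "x \<in> dom Q i" using dom_cover by blast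
   obtain b where b: "b \<notin> dev Q i x" "b \<noteq> 0" using dev_complement[OF i] .
   have "(?D i b, 1, \<lambda>_ x. ?f i b x) \<in> frames (bL_power Q m)" unfolding fr using i b by blast
   then show "x \<in> (\<Union>(D, r, b)\<in>frames (bL_power Q m). D)" using i b by (intro UN_I) auto
  qed
  show "\<forall>(D, r, b)\<in>frames (bL_power Q m). r = 1" by (auto simp: fr)
  show "\<forall>(D, r, b)\<in>frames (bL_power Q m). rs_open A D \<and>
    (\<forall>x\<in>D. fiber (bL_power Q m) x = cfun.span ((\<lambda>l. b l x) ` {..<r}) \<and>
        (\<forall>c. (\<Sum>l<r. fscale (c l) (b l x)) = 0 \<longrightarrow> (\<forall>l<r. c l = 0))) \<and>
    (\<forall>l<r. hol_section A (bL_power Q m) D (b l))"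
   unfolding fr
  proof (safe, goal_cases)
   case (1 _ _ _ i b) then show ?case by (intro dev_preimage_open)
  next
   case (2 _ _ _ i b x f) then show ?case by (simp add: fib bL_frame_facts(1)[of i x b] lessThan_Suc cfun.span_singleton)
  next
   case (3 _ _ _ i b x f) then show ?case by (simp add: fib bL_frame_facts(1)[of i x b] lessThan_Suc cfun.span_singleton)
  next
   case (4 _ _ _ i b x c l)
   then have s: "fscale (c 0) (?f i b x) = 0" by simp
   show ?case using fun_cong[OF s, of "glue Q i x b"] 4 bL_frame_facts(2)[of i x b m] by simp
  next
   case (5 _ _ _ i b l) then show ?case using hol[of i b] by simp
  qed
 qed
qed

lemma vector_bundle_bL: "vector_bundle A (bL_power Q m)"
 using line_bundle_bL by (simp add: line_bundle_def)

lemma fiber_bL: "fiber (bL_power Q m) x = quot_power (flat_fiber Q x) (taut_fiber Q x) m"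
 by (simp add: bL_power_def)

lemma bL_frame:
 assumes i: "i \<in> idx Q" "x \<in> dom Q i" and b: "b \<notin> dev Q i x"
 shows "({x \<in> dom Q i. b \<notin> dev Q i x}, 1, \<lambda>_ x. quot_frame (flat_fiber Q x) (taut_fiber Q x) m (glue Q i x b)) \<in> frames (bL_power Q m)"
proof -
 have "b \<noteq> 0" using b dev_points[OF i] cfun.span_zero unfolding points_P1 by auto
 then show ?thesis using i(1) unfolding bL_power_def by auto
qed

lemma bL_local:
 assumes i: "i \<in> idx Q" "x \<in> dom Q i" and b: "b \<notin> dev Q i x"
 shows "s \<in> local_sections A (bL_power Q m) x \<longleftrightarrow>
   (\<forall>\<^sub>F y in nhds_rs A x. s y \<in> quot_power (flat_fiber Q y) (taut_fiber Q y) m) \<and> hol_at A x (\<lambda>y. s y (glue Q i y b))"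
  and "vanishes_to_order A (bL_power Q m) d x s \<longleftrightarrow>
   (\<forall>\<^sub>F y in nhds_rs A x. s y \<in> quot_power (flat_fiber Q y) (taut_fiber Q y) m) \<and> vanish_at A d x (\<lambda>y. s y (glue Q i y b))"
proof -
 have xD: "x \<in> {x \<in> dom Q i. b \<notin> dev Q i x}" using i b by simp
 have u: "quot_frame (flat_fiber Q y) (taut_fiber Q y) m (glue Q i y b) (glue Q i y b) = 1"
  if "y \<in> {x \<in> dom Q i. b \<notin> dev Q i x}" for y
  using that bL_frame_facts(2)[OF i(1)] by simp
 show "s \<in> local_sections A (bL_power Q m) x \<longleftrightarrow>
   (\<forall>\<^sub>F y in nhds_rs A x. s y \<in> quot_power (flat_fiber Q y) (taut_fiber Q y) m) \<and> hol_at A x (\<lambda>y. s y (glue Q i y b))"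
  using line_local_sections_iff(1)[where u = "\<lambda>y. glue Q i y b", OF A line_bundle_bL bL_frame[OF i b] xD u]
  unfolding fiber_bL .
 show "vanishes_to_order A (bL_power Q m) d x s \<longleftrightarrow>
   (\<forall>\<^sub>F y in nhds_rs A x. s y \<in> quot_power (flat_fiber Q y) (taut_fiber Q y) m) \<and> vanish_at A d x (\<lambda>y. s y (glue Q i y b))"
  using line_local_sections_iff(2)[where u = "\<lambda>y. glue Q i y b", OF A line_bundle_bL bL_frame[OF i b] xD u]
  unfolding fiber_bL .
qed

end

text \<open>At the line of \<open>v\<close> the form is evaluated on \<open>br v\<close> divided by
  \<open>br v u\<close>. Homogeneity pulls out the n-th power of \<open>br v u\<close>, and what
  remains is a polynomial in the affine coordinate.\<close>

lemma binary_form_global_section: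
 assumes p: "p \<in> points P1"
 shows "global_section (binary_form UNIV e b n c) \<in> local_sections P1 (L_power (int n)) p"
proof -
 obtain u where u: "u \<notin> p" using points_P1_complement[OF p] .
 obtain a where a: "p = cfun.span {a}" "br a u \<noteq> 0" using points_P1_affine[OF p u] .
 have val: "global_section (binary_form UNIV e b n c) (cfun.span {v}) u =
   (\<Sum>j\<le>n. c j * br v e ^ j * br v b ^ (n - j)) / br v u ^ n" if vu: "br v u \<noteq> 0" for v u
 proof -
  have "(\<lambda>x. br v x / br v u) \<in> dual_space UNIV"
   by (simp add: dual_space_def linear_fun_on_def br_add br_scale add_divide_distrib)
  moreover have "(br v e / br v u) ^ j * (br v b / br v u) ^ (n - j) = br v e ^ j * br v b ^ (n - j) / br v u ^ n" if "j \<le> n" for j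
   using that by (simp add: power_divide flip: power_add)
  ultimately show ?thesis unfolding global_section_value[OF vu]
   by (simp add: binary_form_def sum_divide_distrib mult.assoc)
 qed
 have "global_section (binary_form UNIV e b n c) y \<in> quot_power UNIV y (int n)" if y: "y \<in> points P1" for y
 proof -
  obtain v where v: "v \<noteq> 0" "y = cfun.span {v}" using y unfolding points_P1 by blast
  have "global_section (binary_form UNIV e b n c) y u =
   (if br v u \<noteq> 0 then (\<Sum>j\<le>n. c j * br v e ^ j * br v b ^ (n - j)) * br v u powi (- int n) else 0)" for u
  proof (cases "br v u = 0")
   case True
   then show ?thesis using line_mem_iff[OF v(1), of u] by (simp add: global_section_def sym_quot_def v(2))
  next
   case False
   then show ?thesis unfolding v(2) val[OF False] by (simp add: power_int_minus divide_inverse)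
  qed
  then show ?thesis unfolding v(2) quot_power_line[OF v(1)] by blast
 qed
 then have "\<forall>\<^sub>F y in nhds_rs P1 p. global_section (binary_form UNIV e b n c) y \<in> quot_power UNIV y (int n)"
  using eventually_points[OF p] by (auto elim: eventually_mono)
 moreover have "hol_at P1 (cfun.span {a + fscale 0 u}) (\<lambda>y. global_section (binary_form UNIV e b n c) y u)"
 proof -
  have v: "br (a + fscale \<zeta> u) u = br a u" for \<zeta> by (simp add: br_add br_scale)
  then have n: "br (a + fscale \<zeta> u) u \<noteq> 0" for \<zeta> using a(2) by simp
  show ?thesis unfolding hol_at_P1[OF a(2)] val[OF n] v br_add br_scale
   using a(2) by (intro analytic_intros) auto
 qed
 then have "hol_at P1 p (\<lambda>y. global_section (binary_form UNIV e b n c) y u)"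
  by (simp add: a(1) cfun.scale_zero_left)
 ultimately show ?thesis unfolding L_local(1)[OF p u] by blast
qed

section \<open>Transfer of the jet isomorphism from the projective line to M\<close>

context projective_surface
begin

text \<open>Cramer's rule \<open>br_cramer\<close> for the component in the chart, glued
  back.\<close>

lemma flat_basis:
 assumes i: "i \<in> idx Q" "x \<in> dom Q i" and eb: "br e b \<noteq> 0" and v: "v \<in> flat_fiber Q x"
 shows "v = fscale (br (component i v) b / br e b) (glue Q i x e) + fscale (br e (component i v) / br e b) (glue Q i x b)" (is "v = ?r")
proof -
 have f: "glue Q i x u \<in> flat_fiber Q x" for u by (rule glue_flat[OF i])
 have z: "0 \<in> flat_fiber Q x" using flat_fiber_lincomb[OF v v, of "-1"] by simp
 have "fscale c (glue Q i x u) \<in> flat_fiber Q x" for c u using flat_fiber_lincomb[OF f z, of c] by simp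
 then have r: "?r \<in> flat_fiber Q x" using flat_fiber_lincomb[OF f] by blast
 have cs: "component i (fscale c u) = fscale c (component i u)" for c u
  by (simp add: component_def fun_eq_iff)
 have "fscale (br e b) (component i v) = fscale (br e b) (component i ?r)"
 proof -
  have "component i ?r = fscale (br (component i v) b / br e b) e + fscale (br e (component i v) / br e b) b"
   by (simp add: component_linear cs component_glue_self[OF i])
  moreover have "fscale (br e b) (fscale (br (component i v) b / br e b) e + fscale (br e (component i v) / br e b) b)
   = fscale (br (component i v) b) e + fscale (br e (component i v)) b"
   using eb by (simp add: fun_eq_iff algebra_simps)
  ultimately show ?thesis using br_cramer[of e b "component i v"] by simp
 qed
 then have "component i v = component i ?r" using eb by simp
 then show ?thesis using flat_eq_glue[OF i v] flat_eq_glue[OF i r] by simp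
qed

lemma sym_power_flat:
 assumes i: "i \<in> idx Q" "x \<in> dom Q i" and eb: "br e b \<noteq> 0"
 shows "sym_power n (flat_fiber Q x) = range (binary_form (flat_fiber Q x) (glue Q i x e) (glue Q i x b) n)"
 using flat_basis[OF i eb] flat_subspace[OF dom_points[OF i]] glue_flat[OF i]
 by (intro sym_power_binary) blast+

lemma dual_flat:
 assumes i: "i \<in> idx Q" "x \<in> dom Q i" and \<xi>: "\<xi> \<in> dual_space UNIV"
 shows "(\<lambda>v. if v \<in> flat_fiber Q x then \<xi> (component i v) else 0) \<in> dual_space (flat_fiber Q x)"
 using \<xi> flat_fiber_lincomb by (simp add: dual_space_def linear_fun_on_def component_linear)

lemma chart_sym_binary:
 assumes i: "i \<in> idx Q" "x \<in> dom Q i"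
 shows "chart_sym Q i x (binary_form (flat_fiber Q x) (glue Q i x e) (glue Q i x b) n c) = binary_form UNIV e b n c"
proof
 fix \<xi> :: "vec2 \<Rightarrow> complex"
 show "chart_sym Q i x (binary_form (flat_fiber Q x) (glue Q i x e) (glue Q i x b) n c) \<xi> = binary_form UNIV e b n c \<xi>"
 proof (cases "\<xi> \<in> dual_space UNIV")
  case True
  then show ?thesis using dual_flat[OF i True]
   by (simp add: chart_sym_def binary_form_def glue_flat[OF i] component_glue_self[OF i])
 qed (simp add: chart_sym_def binary_form_def)
qed

lemma dev_eventually:
 assumes i: "i \<in> idx Q" "x \<in> dom Q i"
 shows "eventually P (nhds_rs P1 (dev Q i x)) \<Longrightarrow> \<forall>\<^sub>F y in nhds_rs A x. P (dev Q i y)"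
  and "eventually R (nhds_rs A x) \<Longrightarrow> \<forall>\<^sub>F y in nhds_rs P1 (dev Q i x). R (inv_into (dom Q i) (dev Q i) y)"
  and "hol_at P1 (dev Q i x) F \<Longrightarrow> hol_at A x (\<lambda>y. F (dev Q i y))"
  and "hol_at A x f \<Longrightarrow> hol_at P1 (dev Q i x) (\<lambda>y. f (inv_into (dom Q i) (dev Q i) y))"
proof -
 have ix: "inv_into (dom Q i) (dev Q i) (dev Q i x) = x" by (rule inv_into_f_f[OF dev_inj[OF i(1)] i(2)])
 have d: "dev Q i x \<in> dev Q i ` dom Q i" using i by blast
 show "eventually P (nhds_rs P1 (dev Q i x)) \<Longrightarrow> \<forall>\<^sub>F y in nhds_rs A x. P (dev Q i y)"
  by (rule hol_map_eventually[OF A complex_atlas_P1 dom_open[OF i(1)] dev_hol[OF i(1)] i(2)])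
 show "hol_at P1 (dev Q i x) F \<Longrightarrow> hol_at A x (\<lambda>y. F (dev Q i y))"
  by (rule hol_map_hol_at[OF A complex_atlas_P1 dom_open[OF i(1)] dev_hol[OF i(1)] i(2)])
 show "eventually R (nhds_rs A x) \<Longrightarrow> \<forall>\<^sub>F y in nhds_rs P1 (dev Q i x). R (inv_into (dom Q i) (dev Q i) y)"
  using hol_map_eventually[OF complex_atlas_P1 A dev_open[OF i(1)] dev_inv_hol[OF i(1)] d, of R] unfolding ix .
 show "hol_at A x f \<Longrightarrow> hol_at P1 (dev Q i x) (\<lambda>y. f (inv_into (dom Q i) (dev Q i) y))"
  using hol_map_hol_at[OF complex_atlas_P1 A dev_open[OF i(1)] dev_inv_hol[OF i(1)] d, of f] unfolding ix .
qed

lemma eventually_dom: "i \<in> idx Q \<Longrightarrow> x \<in> dom Q i \<Longrightarrow> \<forall>\<^sub>F y in nhds_rs A x. y \<in> dom Q i"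
 by (rule eventually_rs_open[OF A dom_open])

lemma eventually_dev_image:
 assumes i: "i \<in> idx Q" "x \<in> dom Q i"
 shows "\<forall>\<^sub>F y in nhds_rs P1 (dev Q i x). y \<in> dev Q i ` dom Q i"
 by (rule eventually_rs_open[OF complex_atlas_P1 dev_open[OF i(1)]]) (use i in blast)

text \<open>A local isomorphism transports local parameters: a germ on M is moved to P1 by the
  inverse of \<open>dev\<close>, divided there, and the quotient is pulled back.\<close>

lemma dev_uniformizer:
 assumes w: "nonzero_bivector w" and i: "i \<in> idx Q" "x \<in> dom Q i" and b: "b \<notin> dev Q i x"
 shows "uniformizer A x (\<lambda>y. omega_section w (dev Q i x) b (dev Q i y) b)"
 unfolding uniformizer_def
proof (intro conjI allI impI)
 let ?\<iota> = "inv_into (dom Q i) (dev Q i)"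
 note p = dev_points[OF i] b
 note om = omega_uniformizer[OF w p]
 show "hol_at A x (\<lambda>y. omega_section w (dev Q i x) b (dev Q i y) b)"
  by (rule dev_eventually(3)[OF i omega_hol_at[OF w p p]])
 show "omega_section w (dev Q i x) b (dev Q i x) b = 0" using om by (simp add: uniformizer_def)
 have "\<forall>\<^sub>F y in nhds_rs A x. dev Q i y \<noteq> dev Q i x \<longrightarrow> omega_section w (dev Q i x) b (dev Q i y) b \<noteq> 0"
  by (rule dev_eventually(1)[OF i]) (use om in \<open>simp add: uniformizer_def\<close>)
 then show "\<forall>\<^sub>F y in nhds_rs A x. y \<noteq> x \<longrightarrow> omega_section w (dev Q i x) b (dev Q i y) b \<noteq> 0"
  using eventually_dom[OF i] by eventually_elim (use dev_inj[OF i(1)] i(2) in \<open>auto simp: inj_on_def\<close>)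
 fix f assume f: "hol_at A x f \<and> f x = 0"
 have "hol_at P1 (dev Q i x) (\<lambda>y. f (?\<iota> y))" by (rule dev_eventually(4)[OF i]) (use f in blast)
 moreover have "f (?\<iota> (dev Q i x)) = 0" using f inv_into_f_f[OF dev_inj[OF i(1)] i(2)] by simp
 ultimately obtain g where g: "hol_at P1 (dev Q i x) g"
   "\<forall>\<^sub>F y in nhds_rs P1 (dev Q i x). f (?\<iota> y) = omega_section w (dev Q i x) b y b * g y"
  using om unfolding uniformizer_def by blast
 have "\<forall>\<^sub>F y in nhds_rs A x. f y = omega_section w (dev Q i x) b (dev Q i y) b * g (dev Q i y)"
  using dev_eventually(1)[OF i g(2)] eventually_dom[OF i]
  by eventually_elim (simp add: inv_into_f_f[OF dev_inj[OF i(1)]])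
 then show "\<exists>g. hol_at A x g \<and> (\<forall>\<^sub>F y in nhds_rs A x. f y = omega_section w (dev Q i x) b (dev Q i y) b * g y)"
  using dev_eventually(3)[OF i g(1)] by (intro exI[of _ "\<lambda>y. g (dev Q i y)"]) simp
qed

text \<open>Omega and its pullback are uniformizers on the two sides, so the cofactor is simply
  transported.\<close>

lemma vanish_dev:
 assumes i: "i \<in> idx Q" "x \<in> dom Q i" and w: "nonzero_bivector w"
 shows "vanish_at P1 d (dev Q i x) F \<longleftrightarrow> vanish_at A d x (\<lambda>y. F (dev Q i y))"
proof -
 let ?\<iota> = "inv_into (dom Q i) (dev Q i)"
 obtain b where b: "b \<notin> dev Q i x" using dev_complement[OF i] by metis
 note p = dev_points[OF i] b
 note v1 = vanish_at_uniformizer[OF complex_atlas_P1 omega_uniformizer[OF w p]]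
 note v2 = vanish_at_uniformizer[OF A dev_uniformizer[OF w i b]]
 show ?thesis
 proof
  assume "vanish_at P1 d (dev Q i x) F"
  then obtain g where g: "hol_at P1 (dev Q i x) g"
    "\<forall>\<^sub>F y in nhds_rs P1 (dev Q i x). F y = omega_section w (dev Q i x) b y b ^ d * g y"
   unfolding v1 by blast
  show "vanish_at A d x (\<lambda>y. F (dev Q i y))" unfolding v2
   by (intro exI[of _ "\<lambda>y. g (dev Q i y)"] conjI dev_eventually(3)[OF i g(1)] dev_eventually(1)[OF i g(2)])
 next
  assume "vanish_at A d x (\<lambda>y. F (dev Q i y))"
  then obtain g where g: "hol_at A x g"
    "\<forall>\<^sub>F y in nhds_rs A x. F (dev Q i y) = omega_section w (dev Q i x) b (dev Q i y) b ^ d * g y"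
   unfolding v2 by blast
  have "\<forall>\<^sub>F y in nhds_rs P1 (dev Q i x). F y = omega_section w (dev Q i x) b y b ^ d * g (?\<iota> y)"
   using dev_eventually(2)[OF i g(2)] eventually_dev_image[OF i]
   by eventually_elim (simp add: f_inv_into_f)
  then show "vanish_at P1 d (dev Q i x) F" unfolding v1
   using dev_eventually(4)[OF i g(1)] by (intro exI[of _ "\<lambda>y. g (?\<iota> y)"]) simp
 qed
qed

lemma chart_section_dev: "i \<in> idx Q \<Longrightarrow> y \<in> dom Q i \<Longrightarrow> chart_section Q i s (dev Q i y) = chart_elem Q i y (s y)"
 by (simp add: chart_section_def inv_into_f_f[OF dev_inj])

lemma chart_section_local:
 assumes i: "i \<in> idx Q" "x \<in> dom Q i" and s: "s \<in> local_sections A (bL_power Q m) x"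
 shows "chart_section Q i s \<in> local_sections P1 (L_power m) (dev Q i x)"
proof -
 let ?\<iota> = "inv_into (dom Q i) (dev Q i)"
 obtain b where b: "b \<notin> dev Q i x" using dev_complement[OF i] by metis
 have s': "\<forall>\<^sub>F y in nhds_rs A x. s y \<in> quot_power (flat_fiber Q y) (taut_fiber Q y) m" "hol_at A x (\<lambda>y. s y (glue Q i y b))"
  using s bL_local(1)[OF i b] by blast+
 have "\<forall>\<^sub>F y in nhds_rs P1 (dev Q i x). chart_section Q i s y \<in> quot_power UNIV y m"
  using dev_eventually(2)[OF i s'(1)] eventually_dev_image[OF i]
 proof eventually_elim
  case (elim y)
  have "?\<iota> y \<in> dom Q i" using elim(2) by (rule inv_into_into)
  from chart_elem_quot_power[OF i(1) this elim(1)] show ?case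
   using elim(2) by (simp add: chart_section_def Let_def f_inv_into_f)
 qed
 moreover have "hol_at P1 (dev Q i x) (\<lambda>y. chart_section Q i s y b)"
  using dev_eventually(4)[OF i s'(2)] by (simp add: chart_section_def Let_def chart_elem_def)
 ultimately show ?thesis unfolding L_local(1)[OF dev_points[OF i] b] by blast
qed

text \<open>The coefficient of \<open>s\<close> in the frame [b]^n minus the expansion prescribed by
  \<open>P\<close> and \<open>t\<close>. That \<open>s\<close> represents the image of this pair
  will mean that the difference vanishes to order k + 1.\<close>

definition jet_defect ::
  "(2 \<times> 2 \<Rightarrow> complex) \<Rightarrow> nat \<Rightarrow> 'i \<Rightarrow> 'p \<Rightarrow> vec2 \<Rightarrow> ((('i \<times> 2 \<Rightarrow> complex) \<Rightarrow> complex) \<Rightarrow> complex)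
   \<Rightarrow> (('i \<times> 2 \<Rightarrow> complex) \<Rightarrow> complex) \<Rightarrow> ('p \<Rightarrow> ('i \<times> 2 \<Rightarrow> complex) \<Rightarrow> complex) \<Rightarrow> 'p \<Rightarrow> complex" where
 "jet_defect w k i x b P t s y = s y (glue Q i y b) - global_section (chart_sym Q i x P) (dev Q i y) b
  - t (glue Q i x b) * omega_section w (dev Q i x) b (dev Q i y) b ^ k"

lemma trans_complement:
 assumes "i \<in> idx Q" "x \<in> dom Q i" "j \<in> idx Q" "x \<in> dom Q j" "b \<notin> dev Q i x"
 shows "mat_act (trans Q j i) b \<notin> dev Q j x"
proof -
 obtain e where e: "e \<noteq> 0" "dev Q i x = cfun.span {e}" using dev_points[OF assms(1,2)] unfolding points_P1 by blast
 have n: "br (mat_act (trans Q j i) e) (mat_act (trans Q j i) b) \<noteq> 0"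
  unfolding br_mat_act trans_det[OF assms(3,1,4,2)] using assms(5) e line_mem_iff[OF e(1)] by simp
 show ?thesis unfolding trans_dev[OF assms(3,1,4,2)] e(2) mat_act_line line_mem_iff[OF br_nonzero(1)[OF n]] by (rule n)
qed

lemma omega_section_trans:
 assumes w: "nonzero_bivector w" and i: "i \<in> idx Q" "j \<in> idx Q" and x: "x \<in> dom Q i" "x \<in> dom Q j"
  and y: "y \<in> dom Q i" "y \<in> dom Q j" and b: "b \<notin> dev Q i x" "b \<notin> dev Q i y"
 shows "omega_section w (dev Q j x) (mat_act (trans Q j i) b) (dev Q j y) (mat_act (trans Q j i) b)
  = omega_section w (dev Q i x) b (dev Q i y) b"
proof -
 obtain e where e: "dev Q i x = cfun.span {e}" "br e b \<noteq> 0" using points_P1_affine[OF dev_points[OF i(1) x(1)] b(1)] .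
 obtain v where v: "dev Q i y = cfun.span {v}" "br v b \<noteq> 0" using points_P1_affine[OF dev_points[OF i(1) y(1)] b(2)] .
 let ?g = "mat_act (trans Q j i)"
 have d: "det (trans Q j i) = 1" by (rule trans_det[OF i(2,1) x(2,1)])
 have b': "br (?g u) (?g u') = br u u'" for u u' by (simp add: br_mat_act d)
 show ?thesis
  unfolding trans_dev[OF i(2,1) x(2,1)] trans_dev[OF i(2,1) y(2,1)] e(1) v(1) mat_act_line
  using omega_section_eq[OF w, of "?g e" "?g b" "?g v" "?g b"] omega_section_eq[OF w e(2) v(2)] e(2) v(2)
  by (simp add: b')
qed

text \<open>Changing the chart together with the vector \<open>b\<close> leaves the glued vectors
  alone, and it preserves all brackets because the transition matrix has determinant one; this is
  where the lift to SL(V) enters.\<close>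

lemma jet_defect_trans:
 assumes w: "nonzero_bivector w" and i: "i \<in> idx Q" "j \<in> idx Q" and x: "x \<in> dom Q i" "x \<in> dom Q j"
  and y: "y \<in> dom Q i" "y \<in> dom Q j" and b: "b \<notin> dev Q i x" "b \<notin> dev Q i y"
 shows "jet_defect w k j x (mat_act (trans Q j i) b) P t s y = jet_defect w k i x b P t s y"
proof -
 obtain v where v: "dev Q i y = cfun.span {v}" "br v b \<noteq> 0" using points_P1_affine[OF dev_points[OF i(1) y(1)] b(2)] .
 let ?g = "mat_act (trans Q j i)"
 have b': "br (?g u) (?g u') = br u u'" for u u' by (simp add: br_mat_act trans_det[OF i(2,1) x(2,1)])
 have vj: "dev Q j y = cfun.span {?g v}" unfolding trans_dev[OF i(2,1) y(2,1)] v(1) mat_act_line ..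
 have du: "(\<lambda>u. br a u / br a c) \<in> dual_space UNIV" for a c
  by (simp add: dual_space_def linear_fun_on_def br_add br_scale add_divide_distrib)
 have n: "br (?g v) (?g b) \<noteq> 0" using v(2) by (simp add: b')
 have cj: "component j u = ?g (component i u)" if "u \<in> flat_fiber Q x" for u
  by (rule flat_fiberD(2)[OF that i(2,1) x(2,1)])
 have "(\<lambda>u. if u \<in> flat_fiber Q x then br (?g v) (component j u) / br (?g v) (?g b) else 0)
   = (\<lambda>u. if u \<in> flat_fiber Q x then br v (component i u) / br v b else 0)"
  by (auto simp: fun_eq_iff cj b')
 then have "global_section (chart_sym Q j x P) (dev Q j y) (?g b) = global_section (chart_sym Q i x P) (dev Q i y) b"
  unfolding vj v(1) global_section_value[OF n] global_section_value[OF v(2)] by (simp add: chart_sym_def du)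
 then show ?thesis
  unfolding jet_defect_def omega_section_trans[OF w i x y b] glue_change[OF i(1) y(1) i(2) y(2), of b]
   glue_change[OF i(1) x(1) i(2) x(2), of b] by simp
qed

context
 fixes w :: "2 \<times> 2 \<Rightarrow> complex" and n k :: nat and x :: 'p
 assumes w: "nonzero_bivector w" and k: "k = n + 1" and xp: "x \<in> points A"
begin

lemma global_section_flat:
 assumes i: "i \<in> idx Q" "x \<in> dom Q i" and P: "P \<in> sym_power n (flat_fiber Q x)" and p: "p \<in> points P1"
 shows "global_section (chart_sym Q i x P) \<in> local_sections P1 (L_power (int n)) p"
proof -
 obtain e where e: "e \<noteq> 0" "dev Q i x = cfun.span {e}" using dev_points[OF i] unfolding points_P1 by blast
 obtain b where "br b e \<noteq> 0" using br_exists[OF e(1)] .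
 then have eb: "br e b \<noteq> 0" using br_swap[of b e] by simp
 obtain c where c: "P = binary_form (flat_fiber Q x) (glue Q i x e) (glue Q i x b) n c"
  using P unfolding sym_power_flat[OF i eb] by blast
 show ?thesis unfolding c chart_sym_binary[OF i] by (rule binary_form_global_section[OF p])
qed

lemma chart_jet_iff:
 assumes i: "i \<in> idx Q" "x \<in> dom Q i" and b: "b \<notin> dev Q i x" and P: "P \<in> sym_power n (flat_fiber Q x)"
  and t: "t \<in> fiber (bL_power Q (- int (k + 1))) x" and s: "s \<in> local_sections A (bL_power Q (int n)) x"
 shows "jet P1 (L_power (int n)) k (dev Q i x) (chart_section Q i s)
   = jet_iso_P1 w n k (dev Q i x) (chart_sym Q i x P) (chart_elem Q i x t)
  \<longleftrightarrow> vanish_at A (k + 1) x (jet_defect w k i x b P t s)"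
proof -
 note p = dev_points[OF i] b
 have t': "chart_elem Q i x t \<in> quot_power UNIV (dev Q i x) (- int (k + 1))"
  by (rule chart_elem_quot_power[OF i]) (use t in \<open>simp add: fiber_bL\<close>)
 have ev: "\<forall>\<^sub>F y in nhds_rs A x. chart_section Q i s (dev Q i y) b - global_section (chart_sym Q i x P) (dev Q i y) b -
   chart_elem Q i x t b * omega_section w (dev Q i x) b (dev Q i y) b ^ k = jet_defect w k i x b P t s y"
  using eventually_dom[OF i] by eventually_elim (simp add: chart_section_dev[OF i(1)] chart_elem_def jet_defect_def)
 show ?thesis
  unfolding jet_iso_P1_iff[OF w p k global_section_flat[OF i P p(1)] t' chart_section_local[OF i s]] vanish_dev[OF i w]
  by (rule vanish_at_cong[OF A xp ev])
qed

lemma vanish_defect_trans: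
 assumes i: "i \<in> idx Q" "x \<in> dom Q i" and j: "j \<in> idx Q" "x \<in> dom Q j" and b: "b \<notin> dev Q i x"
 shows "vanish_at A d x (jet_defect w k j x (mat_act (trans Q j i) b) P t s) \<longleftrightarrow> vanish_at A d x (jet_defect w k i x b P t s)"
proof -
 have "\<forall>\<^sub>F y in nhds_rs A x. b \<notin> dev Q i y" by (rule dev_eventually(1)[OF i eventually_not_mem[OF dev_points[OF i] b]])
 then have ev: "\<forall>\<^sub>F y in nhds_rs A x. jet_defect w k j x (mat_act (trans Q j i) b) P t s y = jet_defect w k i x b P t s y"
  using eventually_dom[OF i] eventually_dom[OF j]
  by eventually_elim (rule jet_defect_trans[OF w i(1) j(1) i(2) j(2) _ _ b])
 show ?thesis by (rule vanish_at_cong[OF A xp ev])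
qed

lemma omega_dev_hol:
 assumes i: "i \<in> idx Q" "x \<in> dom Q i" and b: "b \<notin> dev Q i x"
 shows "hol_at A x (\<lambda>y. omega_section w (dev Q i x) b (dev Q i y) b)"
 using dev_uniformizer[OF w i b] by (simp add: uniformizer_def)

lemma bL_section_exists:
 assumes i: "i \<in> idx Q" "x \<in> dom Q i" and b: "b \<notin> dev Q i x" and h: "hol_at A x h"
 obtains s where "s \<in> local_sections A (bL_power Q m) x" "\<forall>\<^sub>F y in nhds_rs A x. s y (glue Q i y b) = h y"
proof -
 let ?f = "\<lambda>y. quot_frame (flat_fiber Q y) (taut_fiber Q y) m (glue Q i y b)"
 define s where "s = (\<lambda>y. fscale (h y) (?f y))"
 have "\<forall>\<^sub>F y in nhds_rs A x. b \<notin> dev Q i y" by (rule dev_eventually(1)[OF i eventually_not_mem[OF dev_points[OF i] b]])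
 then have "\<forall>\<^sub>F y in nhds_rs A x. s y \<in> quot_power (flat_fiber Q y) (taut_fiber Q y) m \<and> s y (glue Q i y b) = h y"
  using eventually_dom[OF i]
  by eventually_elim (auto simp: s_def bL_frame_facts[OF i(1)])
 then have e: "\<forall>\<^sub>F y in nhds_rs A x. s y \<in> quot_power (flat_fiber Q y) (taut_fiber Q y) m"
   "\<forall>\<^sub>F y in nhds_rs A x. s y (glue Q i y b) = h y"
  by (auto simp: eventually_conj_iff)
 have "s \<in> local_sections A (bL_power Q m) x"
  unfolding bL_local(1)[OF i b] using e(1) hol_at_cong[OF A xp e(2)] h by simp
 then show ?thesis using e(2) by (rule that)
qed

text \<open>The description in \<open>jet_iso_bL\<close> ranges over all charts around
  \<open>x\<close>. By \<open>vanish_defect_trans\<close> they impose one and the same condition on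
  \<open>s\<close>, and \<open>s0\<close> is an explicit solution.\<close>

lemma jet_iso_bL_iff:
 assumes i: "i \<in> idx Q" "x \<in> dom Q i" and b: "b \<notin> dev Q i x" and P: "P \<in> sym_power n (flat_fiber Q x)"
  and t: "t \<in> fiber (bL_power Q (- int (k + 1))) x" and s: "s \<in> local_sections A (bL_power Q (int n)) x"
 shows "jet A (bL_power Q (int n)) k x s = jet_iso_bL A w Q n k x P t
  \<longleftrightarrow> vanish_at A (k + 1) x (jet_defect w k i x b P t s)"
proof -
 let ?ls = "local_sections A (bL_power Q (int n)) x" and ?J = "jet A (bL_power Q (int n)) k x"
 let ?C = "\<lambda>j s. jet P1 (L_power (int n)) k (dev Q j x) (chart_section Q j s)
   = jet_iso_P1 w n k (dev Q j x) (chart_sym Q j x P) (chart_elem Q j x t)"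
 have C: "?C j s \<longleftrightarrow> vanish_at A (k + 1) x (jet_defect w k i x b P t s)"
  if "j \<in> idx Q" "x \<in> dom Q j" "s \<in> ?ls" for j s
  using chart_jet_iff[OF that(1,2) trans_complement[OF i that(1,2) b] P t that(3)] vanish_defect_trans[OF i that(1,2) b] by blast
 have "hol_at P1 (dev Q i x) (\<lambda>y. global_section (chart_sym Q i x P) y b)"
  using global_section_flat[OF i P dev_points[OF i]] L_local(1)[OF dev_points[OF i] b] by blast
 then have "hol_at A x (\<lambda>y. global_section (chart_sym Q i x P) (dev Q i y) b)" by (rule dev_eventually(3)[OF i])
 then have "hol_at A x (\<lambda>y. global_section (chart_sym Q i x P) (dev Q i y) b
   + t (glue Q i x b) * omega_section w (dev Q i x) b (dev Q i y) b ^ k)"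
  by (intro hol_at_add[OF A xp] hol_at_mult[OF A xp] hol_at_const[OF A xp] hol_at_power[OF A xp] omega_dev_hol[OF i b])
 then obtain s0 where s0: "s0 \<in> ?ls" "\<forall>\<^sub>F y in nhds_rs A x. s0 y (glue Q i y b) =
   global_section (chart_sym Q i x P) (dev Q i y) b + t (glue Q i x b) * omega_section w (dev Q i x) b (dev Q i y) b ^ k"
  by (rule bL_section_exists[OF i b])
 have diff: "?J s = ?J s0 \<longleftrightarrow> vanish_at A (k + 1) x (jet_defect w k i x b P t s)" if s: "s \<in> ?ls" for s
 proof -
  have "s - s0 = (\<lambda>y. fscale (- 1) (s0 y) + s y)" by (auto simp: fun_eq_iff)
  then have "s - s0 \<in> ?ls" using local_sections_lincomb[OF A vector_bundle_bL xp s0(1) s, of "-1"] by simp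
  then have "?J s = ?J s0 \<longleftrightarrow> vanish_at A (k + 1) x (\<lambda>y. s y (glue Q i y b) - s0 y (glue Q i y b))"
   using jet_eq_iff[OF A vector_bundle_bL xp s s0(1), of k] bL_local[OF i b, where s = "s - s0" and m = "int n"] by simp
  moreover have ev: "\<forall>\<^sub>F y in nhds_rs A x. s y (glue Q i y b) - s0 y (glue Q i y b) = jet_defect w k i x b P t s y"
   using s0(2) by eventually_elim (simp add: jet_defect_def)
  ultimately show ?thesis using vanish_at_cong[OF A xp ev] by simp
 qed
 have "jet_iso_bL A w Q n k x P t = ?J s0"
  unfolding jet_iso_bL_def
 proof (rule the_equality)
  have "?C i s0" using C[OF i s0(1)] diff[OF s0(1)] by blast
  then show "\<exists>i\<in>idx Q. \<exists>s\<in>?ls. x \<in> dom Q i \<and> ?C i s \<and> ?J s0 = ?J s" using i s0(1) by blast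
 next
  fix j assume "\<exists>i\<in>idx Q. \<exists>s\<in>?ls. x \<in> dom Q i \<and> ?C i s \<and> j = ?J s"
  then obtain l s where l: "l \<in> idx Q" "s \<in> ?ls" "x \<in> dom Q l" "?C l s" "j = ?J s" by blast
  then have "vanish_at A (k + 1) x (jet_defect w k i x b P t s)" using C[OF l(1,3,2)] by blast
  then show "j = ?J s0" using diff[OF l(2)] l(5) by simp
 qed
 then show ?thesis using diff[OF s] by simp
qed

end

end

section \<open>Derivatives in charts and unipotent systems of germs\<close>

context
 fixes A :: "'p chart set" and D z and x :: 'p
 assumes A: "complex_atlas A" and D: "(D, z) \<in> A" and x: "x \<in> D"
begin

lemma eventually_coord: "eventually P (nhds (z x)) \<Longrightarrow> \<forall>\<^sub>F y in nhds_rs A x. P (z y)"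
 by (erule eventually_compose_filterlim) (rule tendsto_hol_at[OF A points_I[OF D x] hol_at_coord[OF A D x]])

text \<open>The derivative is the value at \<open>x\<close> of the cofactor of the coordinate
  difference. Cofactors multiply when the coordinate is changed, which gives the chain rule for
  germs.\<close>

lemma deriv_chart_factor:
 assumes g: "hol_at A x g" and ev: "\<forall>\<^sub>F y in nhds_rs A x. f y - f x = (z y - z x) * g y"
 shows "deriv (f \<circ> inv_into D z) (z x) = g x"
proof -
 define G where "G = g \<circ> inv_into D z"
 have Gx: "G (z x) = g x" by (simp add: G_def inv_chart_x[OF A D x])
 have "G analytic_on {z x}" using g hol_at_chart[OF A D x] unfolding G_def by blast
 then have "G field_differentiable (at (z x))"
  by (meson analytic_on_imp_differentiable_at singletonI)
 then obtain G' where "(G has_field_derivative G') (at (z x))" unfolding field_differentiable_def by blast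
 then have d: "((\<lambda>\<zeta>. f x + (\<zeta> - z x) * G \<zeta>) has_field_derivative g x) (at (z x))"
  by (auto intro!: derivative_eq_intros simp: Gx)
 have "\<forall>\<^sub>F \<zeta> in nhds (z x). (f \<circ> inv_into D z) \<zeta> = f x + (\<zeta> - z x) * G \<zeta>"
  using ev[unfolded eventually_nhds_rs_chart[OF A D x]] eventually_in_chart_image[OF A D x]
  by eventually_elim (simp add: G_def f_inv_into_f algebra_simps)
 then have "deriv (f \<circ> inv_into D z) (z x) = deriv (\<lambda>\<zeta>. f x + (\<zeta> - z x) * G \<zeta>) (z x)"
  by (rule deriv_cong_ev) simp
 then show ?thesis using DERIV_imp_deriv[OF d] by simp
qed

lemma deriv_chart_factorE:
 assumes f: "hol_at A x f"
 obtains g where "hol_at A x g" "\<forall>\<^sub>F y in nhds_rs A x. f y - f x = (z y - z x) * g y"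
  "g x = deriv (f \<circ> inv_into D z) (z x)"
proof -
 note xp = points_I[OF D x]
 have "hol_at A x (\<lambda>y. f y - f x)" by (intro hol_at_diff[OF A xp] f hol_at_const[OF A xp])
 then obtain g where g: "hol_at A x g" "\<forall>\<^sub>F y in nhds_rs A x. f y - f x = (z y - z x) * g y"
  using uniformizer_coord[OF A D x] unfolding uniformizer_def by force
 then show ?thesis using deriv_chart_factor[OF g] that[OF g] by simp
qed

end

lemma deriv_chart_change:
 assumes A: "complex_atlas A" and D: "(D, z) \<in> A" "x \<in> D" and D': "(D', z') \<in> A" "x \<in> D'" and f: "hol_at A x f"
 shows "deriv (f \<circ> inv_into D' z') (z' x) = deriv (f \<circ> inv_into D z) (z x) * coord_change (D, z) (D', z') x"
proof -
 note xp = points_I[OF D]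
 obtain g where g: "hol_at A x g" "\<forall>\<^sub>F y in nhds_rs A x. f y - f x = (z y - z x) * g y"
  "g x = deriv (f \<circ> inv_into D z) (z x)" using deriv_chart_factorE[OF A D f] .
 obtain g' where g': "hol_at A x g'" "\<forall>\<^sub>F y in nhds_rs A x. z y - z x = (z' y - z' x) * g' y"
  "g' x = deriv (z \<circ> inv_into D' z') (z' x)" by (rule deriv_chart_factorE[OF A D' hol_at_coord[OF A D]])
 have ev: "\<forall>\<^sub>F y in nhds_rs A x. f y - f x = (z' y - z' x) * (g y * g' y)"
  using g(2) g'(2) by eventually_elim simp
 show ?thesis
  using deriv_chart_factor[OF A D' hol_at_mult[OF A xp g(1) g'(1)] ev] g(3) g'(3)
  by (simp add: coord_change_def)
qed

lemma coord_change_self: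
 assumes A: "complex_atlas A" and D: "(D, z) \<in> A" "x \<in> D"
 shows "coord_change (D, z) (D, z) x = 1"
 using deriv_chart_factor[OF A D hol_at_const[OF A points_I[OF D], of 1], of z] by (simp add: coord_change_def)

section \<open>Systems of germs whose matrix is the identity at the base point\<close>

context
 fixes A :: "'p chart set" and x :: 'p and \<zeta> :: "'p \<Rightarrow> complex" and r :: nat and u :: "nat \<Rightarrow> nat \<Rightarrow> 'p \<Rightarrow> complex"
 assumes A: "complex_atlas A" and xp: "x \<in> points A" and \<zeta>: "uniformizer A x \<zeta>"
  and u: "\<And>m l. m < r \<Longrightarrow> l < r \<Longrightarrow> hol_at A x (u m l)"
  and u1: "\<And>m l. m < r \<Longrightarrow> l < r \<Longrightarrow> u m l x = (if l = m then 1 else 0)"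
begin

lemma unipotent_value: "l < r \<Longrightarrow> (\<Sum>m<r. u m l x * c m) = c l"
proof -
 assume l: "l < r"
 have "(\<Sum>m<r. u m l x * c m) = (\<Sum>m<r. if m = l then c m else 0)"
  by (rule sum.cong) (auto simp: u1 l)
 then show ?thesis using l by simp
qed

lemma unipotent_hol: "l < r \<Longrightarrow> (\<And>m. m < r \<Longrightarrow> hol_at A x (h m)) \<Longrightarrow> hol_at A x (\<lambda>y. \<Sum>m<r. u m l y * h m y)"
 by (intro hol_at_sum[OF A xp] hol_at_mult[OF A xp] u) auto

text \<open>If every \<open>h m\<close> is the d-th power of the parameter times \<open>g m\<close>,
  the combinations of the \<open>g m\<close> vanish at \<open>x\<close>. The matrix is the identity
  there, so each \<open>g m\<close> vanishes at \<open>x\<close> and one more order is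
  gained.\<close>

lemma unipotent_vanish:
 assumes "\<And>m. m < r \<Longrightarrow> hol_at A x (h m)" "\<And>l. l < r \<Longrightarrow> vanish_at A d x (\<lambda>y. \<Sum>m<r. u m l y * h m y)" "m < r"
 shows "vanish_at A d x (h m)"
 using assms
proof (induction d arbitrary: m)
 case 0
 then show ?case by (simp add: vanish_at_0[OF A xp])
next
 case (Suc d)
 have "vanish_at A d x (h m)" if m: "m < r" for m
 proof (rule Suc.IH)
  show "vanish_at A d x (\<lambda>y. \<Sum>m<r. u m l y * h m y)" if l: "l < r" for l
   by (rule vanish_at_mono[OF A xp Suc.prems(2)[OF l]]) simp
 qed (use Suc.prems(1) m in auto)
 then have ex: "\<forall>m. \<exists>g. m < r \<longrightarrow> hol_at A x g \<and> (\<forall>\<^sub>F y in nhds_rs A x. h m y = \<zeta> y ^ d * g y)"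
  unfolding vanish_at_uniformizer[OF A \<zeta>] by auto
 obtain g where gg: "\<forall>m. m < r \<longrightarrow> hol_at A x (g m) \<and> (\<forall>\<^sub>F y in nhds_rs A x. h m y = \<zeta> y ^ d * g m y)"
  using choice[OF ex] ..
 have g: "hol_at A x (g m)" "\<forall>\<^sub>F y in nhds_rs A x. h m y = \<zeta> y ^ d * g m y" if "m < r" for m
  using gg[rule_format, OF that] by simp_all
 have all: "\<forall>\<^sub>F y in nhds_rs A x. \<forall>m\<in>{..<r}. h m y = \<zeta> y ^ d * g m y"
  by (rule eventually_ball_finite) (use g(2) in auto)
 have "g l x = 0" if l: "l < r" for l
 proof -
  have ev: "\<forall>\<^sub>F y in nhds_rs A x. (\<Sum>m<r. u m l y * h m y) = \<zeta> y ^ d * (\<Sum>m<r. u m l y * g m y)"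
   using all by eventually_elim (simp add: sum_distrib_left mult.left_commute)
  have "vanish_at A (d + 1) x (\<lambda>y. \<zeta> y ^ d * (\<Sum>m<r. u m l y * g m y))"
   using Suc.prems(2)[OF l] vanish_at_cong[OF A xp ev] by simp
  then have "vanish_at A 1 x (\<lambda>y. \<Sum>m<r. u m l y * g m y)"
   using vanish_at_cancel_power[OF A xp \<zeta> unipotent_hol[where h = g, OF l g(1)]] by blast
  then have "(\<Sum>m<r. u m l x * g m x) = 0" using vanish_at_value[OF A xp] by fastforce
  then show ?thesis by (simp add: unipotent_value[OF l])
 qed
 then have "vanish_at A 1 x (g m)" using vanish_at_1[OF A xp g(1)] Suc.prems(3) by blast
 then have "vanish_at A (d + 1) x (\<lambda>y. \<zeta> y ^ d * g m y)"
  using vanish_at_cancel_power[OF A xp \<zeta> g(1)[OF Suc.prems(3)]] by blast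
 then show ?case using vanish_at_cong[OF A xp g(2)[OF Suc.prems(3)]] by simp
qed

text \<open>The next coefficient is the value of the cofactor at \<open>x\<close>, again because
  \<open>u\<close> is the identity there; the variation of \<open>u\<close> away from
  \<open>x\<close> only affects the following orders.\<close>

lemma unipotent_taylor:
 assumes "\<And>l. l < r \<Longrightarrow> hol_at A x (f l)"
 shows "\<exists>a. \<forall>l<r. vanish_at A d x (\<lambda>y. f l y - (\<Sum>m<r. u m l y * (\<Sum>j<d. a m j * \<zeta> y ^ j)))"
proof (induction d)
 case 0
 then show ?case using assms by (simp add: vanish_at_0[OF A xp])
next
 case (Suc d)
 then obtain a where a: "\<And>l. l < r \<Longrightarrow> vanish_at A d x (\<lambda>y. f l y - (\<Sum>m<r. u m l y * (\<Sum>j<d. a m j * \<zeta> y ^ j)))" by blast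
 then have ex: "\<forall>l. \<exists>g. l < r \<longrightarrow> hol_at A x g \<and> (\<forall>\<^sub>F y in nhds_rs A x. f l y - (\<Sum>m<r. u m l y * (\<Sum>j<d. a m j * \<zeta> y ^ j)) = \<zeta> y ^ d * g y)"
  unfolding vanish_at_uniformizer[OF A \<zeta>] by auto
 obtain g where gg: "\<forall>l. l < r \<longrightarrow> hol_at A x (g l) \<and> (\<forall>\<^sub>F y in nhds_rs A x. f l y - (\<Sum>m<r. u m l y * (\<Sum>j<d. a m j * \<zeta> y ^ j)) = \<zeta> y ^ d * g l y)"
  using choice[OF ex] ..
 have g: "hol_at A x (g l)" "\<forall>\<^sub>F y in nhds_rs A x. f l y - (\<Sum>m<r. u m l y * (\<Sum>j<d. a m j * \<zeta> y ^ j)) = \<zeta> y ^ d * g l y" if "l < r" for l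
  using gg[rule_format, OF that] by simp_all
 define a' where "a' = (\<lambda>m j. if j = d then g m x else a m j)"
 have "vanish_at A (Suc d) x (\<lambda>y. f l y - (\<Sum>m<r. u m l y * (\<Sum>j<Suc d. a' m j * \<zeta> y ^ j)))" if l: "l < r" for l
 proof -
  have h: "hol_at A x (\<lambda>y. g l y - (\<Sum>m<r. u m l y * g m x))"
   by (intro hol_at_diff[OF A xp] g(1)[OF l] unipotent_hol[OF l] hol_at_const[OF A xp])
  have "vanish_at A 1 x (\<lambda>y. g l y - (\<Sum>m<r. u m l y * g m x))"
   by (rule vanish_at_1[OF A xp h]) (simp add: unipotent_value[OF l])
  then have v: "vanish_at A (d + 1) x (\<lambda>y. \<zeta> y ^ d * (g l y - (\<Sum>m<r. u m l y * g m x)))"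
   using vanish_at_cancel_power[OF A xp \<zeta> h] by blast
  have ev: "\<forall>\<^sub>F y in nhds_rs A x. f l y - (\<Sum>m<r. u m l y * (\<Sum>j<Suc d. a' m j * \<zeta> y ^ j)) = \<zeta> y ^ d * (g l y - (\<Sum>m<r. u m l y * g m x))"
   using g(2)[OF l]
  proof eventually_elim
   case (elim y)
   have "(\<Sum>j<Suc d. a' m j * \<zeta> y ^ j) = (\<Sum>j<d. a m j * \<zeta> y ^ j) + g m x * \<zeta> y ^ d" for m
    by (simp add: a'_def)
   then have "(\<Sum>m<r. u m l y * (\<Sum>j<Suc d. a' m j * \<zeta> y ^ j))
     = (\<Sum>m<r. u m l y * (\<Sum>j<d. a m j * \<zeta> y ^ j)) + \<zeta> y ^ d * (\<Sum>m<r. u m l y * g m x)"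
    by (simp add: distrib_left sum.distrib sum_distrib_left mult_ac)
   then show ?case using elim by (simp add: right_diff_distrib)
  qed
  show ?thesis using v vanish_at_cong[OF A xp ev] by simp
 qed
 then show ?case by blast
qed

end

section \<open>Linear differential equations in a complex variable\<close>

text \<open>The radius is chosen so that one Picard step contracts by one half. The bound
  \<open>M\<close> exceeds the values at \<open>z\<close> by one, which leaves room for
  continuity.\<close>

lemma linear_ode_setup:
 fixes a :: "nat \<Rightarrow> nat \<Rightarrow> complex \<Rightarrow> complex"
 assumes a: "\<forall>m<r. \<forall>l<r. a m l analytic_on {z}" and d: "d > 0"
 obtains e M :: real where "0 < e" "e \<le> d" "0 \<le> M" "real r * M * e \<le> 1 / 2"
  "\<forall>m<r. \<forall>l<r. a m l holomorphic_on ball z e"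
  "\<forall>m<r. \<forall>l<r. \<forall>\<zeta>\<in>ball z e. norm (a m l \<zeta>) \<le> M"
proof -
 define M where "M = (\<Sum>m<r. \<Sum>l<r. norm (a m l z)) + 1"
 have M0: "M \<ge> 0" by (simp add: M_def sum_nonneg add_nonneg_nonneg)
 have le: "norm (a m l z) + 1 \<le> M" if "m < r" "l < r" for m l
 proof -
  have "norm (a m l z) \<le> (\<Sum>l<r. norm (a m l z))" using that by (intro member_le_sum) auto
  also have "\<dots> \<le> (\<Sum>m<r. \<Sum>l<r. norm (a m l z))"
   using that by (intro member_le_sum[of m "{..<r}" "\<lambda>m. \<Sum>l<r. norm (a m l z)"]) (auto intro: sum_nonneg)
  finally show ?thesis by (simp add: M_def)
 qed
 have "\<forall>\<^sub>F \<zeta> in nhds z. a m l analytic_on {\<zeta>} \<and> norm (a m l \<zeta>) \<le> M" if ml: "m < r" "l < r" for m l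
 proof -
  have an: "a m l analytic_on {z}" using a ml by blast
  then obtain S where S: "open S" "z \<in> S" "a m l holomorphic_on S" unfolding analytic_at by blast
  have "\<forall>\<^sub>F \<zeta> in nhds z. \<zeta> \<in> S" by (rule eventually_nhds_in_open[OF S(1,2)])
  moreover have "(a m l \<longlongrightarrow> a m l z) (nhds z)"
   using analytic_at_imp_isCont[OF an] by (simp add: isCont_def tendsto_nhds_iff)
  then have "\<forall>\<^sub>F \<zeta> in nhds z. dist (a m l \<zeta>) (a m l z) < 1" by (rule tendstoD) simp
  ultimately show ?thesis
  proof eventually_elim
   case (elim \<zeta>)
   have "norm (a m l \<zeta>) \<le> norm (a m l z) + 1"
    using elim(2) norm_triangle_ineq2[of "a m l \<zeta>" "a m l z"] by (simp add: dist_norm)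
   then show ?case using le[OF ml] S elim(1) unfolding analytic_at by fastforce
  qed
 qed
 then have "\<forall>\<^sub>F \<zeta> in nhds z. \<forall>m\<in>{..<r}. \<forall>l\<in>{..<r}. a m l analytic_on {\<zeta>} \<and> norm (a m l \<zeta>) \<le> M"
  by (intro eventually_ball_finite ballI) auto
 then obtain e0 where e0: "e0 > 0"
  "\<And>\<zeta> m l. dist \<zeta> z < e0 \<Longrightarrow> m < r \<Longrightarrow> l < r \<Longrightarrow> a m l analytic_on {\<zeta>} \<and> norm (a m l \<zeta>) \<le> M"
  unfolding eventually_nhds_metric by auto
 \<comment> \<open>The summand \<open>1\<close> in the denominator keeps it positive for
   \<open>r = 0\<close>.\<close>
 define e where "e = min (min d e0) (1 / (2 * (real r * M + 1)))"
 have pos: "real r * M + 1 > 0" using M0 by (simp add: add_nonneg_pos)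
 have e: "0 < e" "e \<le> d" "e \<le> e0" "e \<le> 1 / (2 * (real r * M + 1))"
  using d e0(1) pos by (auto simp: e_def)
 have "real r * M * e \<le> real r * M * (1 / (2 * (real r * M + 1)))"
  using e(4) M0 by (intro mult_left_mono) auto
 also have "\<dots> \<le> 1 / 2" using pos by (simp add: field_simps)
 finally have small: "real r * M * e \<le> 1 / 2" .
 have b: "a m l analytic_on {\<zeta>} \<and> norm (a m l \<zeta>) \<le> M" if "m < r" "l < r" "\<zeta> \<in> ball z e" for m l \<zeta>
  using e0(2)[of \<zeta> m l] that e(3) by (simp add: dist_commute)
 have "a m l analytic_on ball z e" if "m < r" "l < r" for m l
  using b[OF that] analytic_on_analytic_at[of "a m l" "ball z e"] by blast
 then have "\<forall>m<r. \<forall>l<r. a m l holomorphic_on ball z e" using analytic_imp_holomorphic by blast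
 then show ?thesis using b by (intro that[OF e(1,2) M0 small]) auto
qed

text \<open>Mean value inequality: the derivative is bounded by \<open>real r * M * C\<close>, and
  the distance to the centre is less than \<open>e\<close>.\<close>

lemma linear_ode_estimate:
 fixes f F :: "complex \<Rightarrow> complex" and a :: "nat \<Rightarrow> complex \<Rightarrow> complex"
 assumes F: "\<And>\<zeta>. \<zeta> \<in> ball z e \<Longrightarrow> (F has_field_derivative (\<Sum>l<r. a l \<zeta> * u l \<zeta>)) (at \<zeta>)" and F0: "F z = 0"
  and a: "\<And>l \<zeta>. l < r \<Longrightarrow> \<zeta> \<in> ball z e \<Longrightarrow> norm (a l \<zeta>) \<le> M"
  and u: "\<And>l \<zeta>. l < r \<Longrightarrow> \<zeta> \<in> ball z e \<Longrightarrow> norm (u l \<zeta>) \<le> C"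
  and M: "M \<ge> 0" and C: "C \<ge> 0" and small: "real r * M * e \<le> 1 / 2" and \<zeta>: "\<zeta> \<in> ball z e"
 shows "norm (F \<zeta>) \<le> C / 2"
proof -
 have e: "e > 0" using \<zeta> by (metis mem_ball dist_not_less_zero le_less_trans not_le)
 have bd: "norm (\<Sum>l<r. a l \<zeta> * u l \<zeta>) \<le> real r * M * C" if "\<zeta> \<in> ball z e" for \<zeta>
 proof -
  have "norm (\<Sum>l<r. a l \<zeta> * u l \<zeta>) \<le> (\<Sum>l<r. M * C)"
   by (rule sum_norm_le) (use a u that M in \<open>auto simp: norm_mult intro!: mult_mono\<close>)
  then show ?thesis by simp
 qed
 have "norm (F \<zeta> - F z) \<le> (real r * M * C) * norm (\<zeta> - z)"
  by (rule field_differentiable_bound[OF convex_ball])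
   (use F bd \<zeta> e in \<open>auto intro: has_field_derivative_at_within\<close>)
 also have "\<dots> \<le> (real r * M * C) * e"
  using \<zeta> M C by (intro mult_left_mono) (auto simp: dist_norm norm_minus_commute)
 also have "\<dots> = (real r * M * e) * C" by simp
 also have "\<dots> \<le> 1 / 2 * C" using small C by (rule mult_right_mono)
 finally show ?thesis using F0 by simp
qed

text \<open>A solution starting at zero is reproduced by the Picard step, so each application of the
  estimate halves its bound; the first bound comes from continuity on a closed ball.\<close>

lemma linear_ode_unique:
 fixes a :: "nat \<Rightarrow> nat \<Rightarrow> complex \<Rightarrow> complex"
 assumes a: "\<forall>m<r. \<forall>l<r. a m l analytic_on {z}"
  and u: "\<forall>\<^sub>F \<zeta> in nhds z. \<forall>m<r. (u m has_field_derivative (\<Sum>l<r. a m l \<zeta> * u l \<zeta>)) (at \<zeta>)"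
  and u0: "\<forall>m<r. u m z = 0"
 shows "\<forall>\<^sub>F \<zeta> in nhds z. \<forall>m<r. u m \<zeta> = 0"
proof -
 obtain d0 where d0: "d0 > 0"
  "\<And>\<zeta>. dist \<zeta> z < d0 \<Longrightarrow> \<forall>m<r. (u m has_field_derivative (\<Sum>l<r. a m l \<zeta> * u l \<zeta>)) (at \<zeta>)"
  using u unfolding eventually_nhds_metric by blast
 \<comment> \<open>Halving keeps the closed ball, and not only the open one, inside the region where
   the equation holds.\<close>
 have "d0 / 2 > 0" using d0(1) by simp
 then obtain e M where e: "0 < e" "e \<le> d0 / 2" and M: "0 \<le> M" and small: "real r * M * e \<le> 1 / 2"
  and bnd: "\<forall>m<r. \<forall>l<r. \<forall>\<zeta>\<in>ball z e. norm (a m l \<zeta>) \<le> M"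
  using linear_ode_setup[OF a] by metis
 have dist: "dist \<zeta> z < d0" if "\<zeta> \<in> cball z e" for \<zeta>
  using that e d0(1) by (simp add: dist_commute)
 have der: "(u m has_field_derivative (\<Sum>l<r. a m l \<zeta> * u l \<zeta>)) (at \<zeta>)" if "\<zeta> \<in> cball z e" "m < r" for \<zeta> m
  using d0(2)[OF dist[OF that(1)]] that(2) by blast
 have "\<exists>B. \<forall>\<zeta>\<in>cball z e. norm (u m \<zeta>) \<le> B" if "m < r" for m
 proof -
  have "continuous_on (cball z e) (u m)"
   by (intro continuous_at_imp_continuous_on ballI) (rule DERIV_isCont[OF der[OF _ that]])
  then have "bounded (u m ` cball z e)" by (intro compact_imp_bounded compact_continuous_image) auto
  then show ?thesis by (auto simp: bounded_iff)
 qed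
 then obtain B where B: "\<And>m \<zeta>. m < r \<Longrightarrow> \<zeta> \<in> cball z e \<Longrightarrow> norm (u m \<zeta>) \<le> B m" by metis
 define C where "C = (\<Sum>m<r. \<bar>B m\<bar>)"
 have C0: "C \<ge> 0" by (simp add: C_def sum_nonneg)
 have it: "norm (u m \<zeta>) \<le> C / 2 ^ N" if "m < r" "\<zeta> \<in> ball z e" for m \<zeta> N
  using that
 proof (induction N arbitrary: m \<zeta>)
  case 0
  have "norm (u m \<zeta>) \<le> \<bar>B m\<bar>" using B[OF 0(1), of \<zeta>] 0(2) by simp
  also have "\<dots> \<le> C" unfolding C_def using 0(1) by (intro member_le_sum) auto
  finally show ?case by simp
 next
  case (Suc N)
  have "norm (u m \<zeta>) \<le> (C / 2 ^ N) / 2"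
  proof (rule linear_ode_estimate[where F = "u m" and \<zeta> = \<zeta> and a = "a m" and u = u and M = M and e = e and z = z and r = r])
   show "(u m has_field_derivative (\<Sum>l<r. a m l \<zeta> * u l \<zeta>)) (at \<zeta>)" if "\<zeta> \<in> ball z e" for \<zeta>
    using der[of \<zeta> m] that Suc.prems by simp
   show "norm (u l \<zeta>) \<le> C / 2 ^ N" if "l < r" "\<zeta> \<in> ball z e" for l \<zeta> by (rule Suc.IH[OF that])
  qed (use u0 bnd M C0 small Suc.prems in auto)
  then show ?case by simp
 qed
 have "u m \<zeta> = 0" if "m < r" "\<zeta> \<in> ball z e" for m \<zeta>
 proof -
  have "(\<lambda>N. C * (1 / 2) ^ N) \<longlonglongrightarrow> C * 0" by (intro tendsto_mult tendsto_const LIMSEQ_power_zero) simp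
  then have "(\<lambda>N. C / 2 ^ N) \<longlonglongrightarrow> 0" by (simp add: power_one_over)
  then have "norm (u m \<zeta>) \<le> 0"
   by (rule LIMSEQ_le_const) (use it[OF that] in blast)
  then show ?thesis by simp
 qed
 then show ?thesis using e(1) unfolding eventually_nhds_metric
  by (intro exI[of _ e]) (auto simp: dist_commute)
qed

text \<open>Picard iteration: successive iterates differ by at most \<open>C / 2 ^ N\<close> and so
  converge uniformly, and a locally uniform limit of holomorphic functions may be differentiated
  termwise.\<close>

lemma linear_ode_exists:
 fixes a :: "nat \<Rightarrow> nat \<Rightarrow> complex \<Rightarrow> complex" and v :: "nat \<Rightarrow> complex"
 assumes a: "\<forall>m<r. \<forall>l<r. a m l analytic_on {z}"
 obtains u where "\<And>m. u m z = v m"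
  "\<forall>\<^sub>F \<zeta> in nhds z. \<forall>m<r. (u m has_field_derivative (\<Sum>l<r. a m l \<zeta> * u l \<zeta>)) (at \<zeta>)"
proof -
 obtain e M where e: "0 < e" and M: "0 \<le> M" and small: "real r * M * e \<le> 1 / 2"
  and hol: "\<forall>m<r. \<forall>l<r. a m l holomorphic_on ball z e"
  and bnd: "\<forall>m<r. \<forall>l<r. \<forall>\<zeta>\<in>ball z e. norm (a m l \<zeta>) \<le> M"
  using linear_ode_setup[OF a zero_less_one] by metis
 define prim where "prim = (\<lambda>f. SOME F. F z = 0 \<and> (\<forall>\<zeta>\<in>ball z e. (F has_field_derivative f \<zeta>) (at \<zeta>)))"
 have prim: "prim f z = 0 \<and> (\<forall>\<zeta>\<in>ball z e. (prim f has_field_derivative f \<zeta>) (at \<zeta>))"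
  if fh: "f holomorphic_on ball z e" for f :: "complex \<Rightarrow> complex"
 proof -
  obtain F where F: "\<And>\<zeta>. \<zeta> \<in> ball z e \<Longrightarrow> (F has_field_derivative f \<zeta>) (at \<zeta>)"
   using holomorphic_convex_primitive'[OF convex_ball open_ball fh] by (metis at_within_open open_ball)
  have "(\<lambda>\<zeta>. F \<zeta> - F z) z = 0 \<and> (\<forall>\<zeta>\<in>ball z e. ((\<lambda>\<zeta>. F \<zeta> - F z) has_field_derivative f \<zeta>) (at \<zeta>))"
   using F by (auto intro!: derivative_eq_intros)
  then show ?thesis unfolding prim_def by (rule someI[where P = "\<lambda>F. F z = 0 \<and> (\<forall>\<zeta>\<in>ball z e. (F has_field_derivative f \<zeta>) (at \<zeta>))"])
 qed
 define U where "U = rec_nat (\<lambda>m \<zeta>. v m) (\<lambda>_ W m \<zeta>. v m + prim (\<lambda>\<zeta>. \<Sum>l<r. a m l \<zeta> * W l \<zeta>) \<zeta>)"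
 have U0: "U 0 = (\<lambda>m \<zeta>. v m)" by (simp add: U_def)
 have US: "U (Suc N) = (\<lambda>m \<zeta>. v m + prim (\<lambda>\<zeta>. \<Sum>l<r. a m l \<zeta> * U N l \<zeta>) \<zeta>)" for N by (simp add: U_def)
 have Uh: "U N m holomorphic_on ball z e" if "m < r" for N m
  using that
 proof (induction N arbitrary: m)
  case (Suc N)
  have "(\<lambda>\<zeta>. \<Sum>l<r. a m l \<zeta> * U N l \<zeta>) holomorphic_on ball z e"
   using Suc hol by (intro holomorphic_intros) auto
  from prim[OF this] show ?case unfolding US
   by (intro holomorphic_intros) (auto simp: holomorphic_on_open)
 qed (simp add: U0)
 have Us: "(\<lambda>\<zeta>. \<Sum>l<r. a m l \<zeta> * U N l \<zeta>) holomorphic_on ball z e" if "m < r" for N m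
  using Uh hol that by (intro holomorphic_intros) auto
 have Ud: "(U (Suc N) m has_field_derivative (\<Sum>l<r. a m l \<zeta> * U N l \<zeta>)) (at \<zeta>)" if "m < r" "\<zeta> \<in> ball z e" for N m \<zeta>
  unfolding US using prim[OF Us[OF that(1)], of N] that(2) by (auto intro!: derivative_eq_intros)
 have Uz: "U N m z = v m" if "m < r" for N m
  using prim[OF Us[OF that]] by (cases N) (auto simp: U0 US)
 define C where "C = (\<Sum>m<r. norm (v m))"
 have C0: "C \<ge> 0" by (simp add: C_def sum_nonneg)
 have diff: "norm (U (Suc N) m \<zeta> - U N m \<zeta>) \<le> C / 2 ^ N" if "m < r" "\<zeta> \<in> ball z e" for N m \<zeta>
  using that
 proof (induction N arbitrary: m \<zeta>)
  case 0
  have "norm (U 1 m \<zeta> - v m) \<le> C / 2"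
  proof (rule linear_ode_estimate[where \<zeta> = \<zeta> and F = "\<lambda>\<zeta>. U 1 m \<zeta> - v m" and a = "a m" and u = "U 0" and M = M and e = e and z = z and r = r])
   show "((\<lambda>\<zeta>. U 1 m \<zeta> - v m) has_field_derivative (\<Sum>l<r. a m l \<zeta> * U 0 l \<zeta>)) (at \<zeta>)" if "\<zeta> \<in> ball z e" for \<zeta>
    using Ud[OF 0(1) that, of 0] by (auto intro!: derivative_eq_intros)
   show "norm (U 0 l \<zeta>) \<le> C" if "l < r" for l \<zeta>
    unfolding U0 C_def using that by (intro member_le_sum) auto
  qed (use bnd M C0 small 0 Uz[of m 1] in auto)
  then show ?case using C0 by (simp add: U0)
 next
  case (Suc N)
  have "norm (U (Suc (Suc N)) m \<zeta> - U (Suc N) m \<zeta>) \<le> (C / 2 ^ N) / 2"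
  proof (rule linear_ode_estimate[where \<zeta> = \<zeta> and F = "\<lambda>\<zeta>. U (Suc (Suc N)) m \<zeta> - U (Suc N) m \<zeta>" and a = "a m" and
     u = "\<lambda>l \<zeta>. U (Suc N) l \<zeta> - U N l \<zeta>" and M = M and e = e and z = z and r = r])
   show "((\<lambda>\<zeta>. U (Suc (Suc N)) m \<zeta> - U (Suc N) m \<zeta>) has_field_derivative
     (\<Sum>l<r. a m l \<zeta> * (U (Suc N) l \<zeta> - U N l \<zeta>))) (at \<zeta>)" if "\<zeta> \<in> ball z e" for \<zeta>
    using DERIV_diff[OF Ud[OF Suc.prems(1) that, of "Suc N"] Ud[OF Suc.prems(1) that, of N]]
    by (simp add: right_diff_distrib sum_subtractf)
   show "norm (U (Suc N) l \<zeta> - U N l \<zeta>) \<le> C / 2 ^ N" if "l < r" "\<zeta> \<in> ball z e" for l \<zeta> by (rule Suc.IH[OF that])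
  qed (use bnd M C0 small Suc.prems Uz[of m "Suc N"] Uz[of m "Suc (Suc N)"] in auto)
  then show ?case by simp
 qed
 \<comment> \<open>The limit of the iterates as a telescoping series, in the form needed for the
   Weierstrass test.\<close>
 define u where "u = (\<lambda>m \<zeta>. v m + suminf (\<lambda>N. U (Suc N) m \<zeta> - U N m \<zeta>))"
 have lim: "uniform_limit (ball z e) (\<lambda>N \<zeta>. U N m \<zeta>) (u m) sequentially" if m: "m < r" for m
 proof -
  have "summable (\<lambda>N. C * (1 / 2) ^ N)" by (intro summable_mult summable_geometric) simp
  then have "summable (\<lambda>N. C / 2 ^ N)" by (simp add: power_one_over)
  then have "uniform_limit (ball z e) (\<lambda>n \<zeta>. \<Sum>i<n. U (Suc i) m \<zeta> - U i m \<zeta>) (\<lambda>\<zeta>. suminf (\<lambda>i. U (Suc i) m \<zeta> - U i m \<zeta>)) sequentially"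
   by (intro Weierstrass_m_test) (use diff[OF m] in auto)
  then have "uniform_limit (ball z e) (\<lambda>n \<zeta>. v m + (\<Sum>i<n. U (Suc i) m \<zeta> - U i m \<zeta>)) (\<lambda>\<zeta>. v m + suminf (\<lambda>i. U (Suc i) m \<zeta> - U i m \<zeta>)) sequentially"
   by (intro uniform_limit_add uniform_limit_const)
  moreover have "v m + (\<Sum>i<n. U (Suc i) m \<zeta> - U i m \<zeta>) = U n m \<zeta>" for n \<zeta>
   using sum_lessThan_telescope[of "\<lambda>i. U i m \<zeta>" n] by (simp add: U0)
  ultimately show ?thesis by (simp add: u_def)
 qed
 have lim': "uniform_limit (ball z e) (\<lambda>N \<zeta>. U (Suc N) m \<zeta>) (u m) sequentially" if m: "m < r" for m
  using lim[OF m] by (rule filterlim_compose[OF _ filterlim_Suc])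
 have der: "(u m has_field_derivative (\<Sum>l<r. a m l \<zeta> * u l \<zeta>)) (at \<zeta>)" if m: "m < r" and \<zeta>: "\<zeta> \<in> ball z e" for m \<zeta>
 proof -
  have "\<exists>g'. \<forall>x\<in>ball z e. (u m has_field_derivative g' x) (at x) \<and>
    (\<lambda>N. (\<Sum>l<r. a m l x * U N l x)) \<longlonglongrightarrow> g' x"
  proof (rule has_complex_derivative_uniform_sequence[OF open_ball])
   show "(U (Suc N) m has_field_derivative (\<Sum>l<r. a m l x * U N l x)) (at x)" if "x \<in> ball z e" for N x
    by (rule Ud[OF m that])
   show "\<exists>d>0. cball x d \<subseteq> ball z e \<and> uniform_limit (cball x d) (\<lambda>N. U (Suc N) m) (u m) sequentially" if x: "x \<in> ball z e" for x
   proof -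
    obtain d where "d > 0" "cball x d \<subseteq> ball z e" using x open_contains_cball_eq[OF open_ball] by blast
    then show ?thesis using uniform_limit_on_subset[OF lim'[OF m]] by blast
   qed
  qed
  then obtain g' where g': "(u m has_field_derivative g' \<zeta>) (at \<zeta>)" "(\<lambda>N. (\<Sum>l<r. a m l \<zeta> * U N l \<zeta>)) \<longlonglongrightarrow> g' \<zeta>"
   using \<zeta> by blast
  have "(\<lambda>N. (\<Sum>l<r. a m l \<zeta> * U N l \<zeta>)) \<longlonglongrightarrow> (\<Sum>l<r. a m l \<zeta> * u l \<zeta>)"
   by (intro tendsto_sum tendsto_mult tendsto_const) (rule tendsto_uniform_limitI[OF lim \<zeta>], simp)
  then have "g' \<zeta> = (\<Sum>l<r. a m l \<zeta> * u l \<zeta>)" using g'(2) LIMSEQ_unique by blast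
  then show ?thesis using g'(1) by simp
 qed
 \<comment> \<open>Indices from \<open>r\<close> on get a constant function, so that the initial
   value holds for every index.\<close>
 define u' where "u' = (\<lambda>m. if m < r then u m else (\<lambda>_. v m))"
 have "u m z = v m" if "m < r" for m
  using Uz[OF that] by (simp add: u_def)
 then have "u' m z = v m" for m by (simp add: u'_def)
 moreover have "\<forall>\<^sub>F \<zeta> in nhds z. \<forall>m<r. (u' m has_field_derivative (\<Sum>l<r. a m l \<zeta> * u' l \<zeta>)) (at \<zeta>)"
  unfolding eventually_nhds_metric using e der by (intro exI[of _ e]) (auto simp: u'_def dist_commute)
 ultimately show ?thesis by (rule that)
qed

section \<open>Flat frames of a holomorphic connection\<close>

text \<open>This is dz for the chart \<kappa> = (D, z), recorded by its coefficients in all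
  charts.\<close>

definition coord_differential :: "'p chart set \<Rightarrow> 'p chart \<Rightarrow> 'p \<Rightarrow> 'p chart \<Rightarrow> complex" where
 "coord_differential A \<kappa> y = (\<lambda>\<kappa>'. if \<kappa>' \<in> A \<and> y \<in> fst \<kappa>' then coord_change \<kappa> \<kappa>' y else 0)"

lemma coord_differential_frame:
 assumes "(D, z) \<in> A" shows "(D, 1, \<lambda>_. coord_differential A (D, z)) \<in> frames (canonical_power A 1)"
 using assms by (force simp: canonical_power_def coord_differential_def fun_eq_iff)

lemma differential_coord:
 assumes A: "complex_atlas A" and D: "(D, z) \<in> A" "y \<in> D" and f: "hol_at A y f"
 shows "differential A f y = fscale (deriv (f \<circ> inv_into D z) (z y)) (coord_differential A (D, z) y)"
proof (rule ext, clarify)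
 fix D' z'
 show "differential A f y (D', z') = fscale (deriv (f \<circ> inv_into D z) (z y)) (coord_differential A (D, z) y) (D', z')"
  using deriv_chart_change[OF A D _ _ f, of D' z'] by (simp add: differential_def coord_differential_def)
qed

lemma hol_section_coeffs:
 assumes "hol_section A B U s" "(D, r, b) \<in> frames B"
 shows "\<exists>c. (\<forall>l<r. hol_fun A (U \<inter> D) (c l)) \<and> (\<forall>x\<in>U \<inter> D. s x = (\<Sum>l<r. fscale (c l x) (b l x)))"
 using bspec[OF assms(1)[unfolded hol_section_def] assms(2)] by simp

lemma hol_section_fscale:
 assumes f: "hol_fun A U f" and s: "hol_section A B U s"
 shows "hol_section A B U (\<lambda>y. fscale (f y) (s y))"
 unfolding hol_section_def
proof safe
 fix D r b assume D: "(D, r, b) \<in> frames B"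
 obtain c where c: "\<forall>l<r. hol_fun A (U \<inter> D) (c l)" "\<forall>x\<in>U \<inter> D. s x = (\<Sum>l<r. fscale (c l x) (b l x))"
  using hol_section_coeffs[OF s D] by blast
 show "\<exists>c. (\<forall>l<r. hol_fun A (U \<inter> D) (c l)) \<and> (\<forall>x\<in>U \<inter> D. fscale (f x) (s x) = (\<Sum>l<r. fscale (c l x) (b l x)))"
  using c hol_fun_mult[OF hol_fun_subset[OF f Int_lower1]]
  by (intro exI[of _ "\<lambda>l y. f y * c l y"] conjI allI impI ballI) (simp_all add: cfun.scale_sum_right)
qed

lemma hol_section_zero: "hol_section A B U (\<lambda>y. 0)"
 unfolding hol_section_def by (auto intro!: exI[of _ "\<lambda>_ _. 0"] simp: hol_fun_def comp_def cfun.scale_zero_left)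

lemma analytic_if_eventually_deriv:
 assumes "\<forall>\<^sub>F \<zeta> in nhds a. (f has_field_derivative f' \<zeta>) (at \<zeta>)" shows "f analytic_on {a}"
proof -
 obtain S where S: "open S" "a \<in> S" "\<And>\<zeta>. \<zeta> \<in> S \<Longrightarrow> (f has_field_derivative f' \<zeta>) (at \<zeta>)"
  using assms unfolding eventually_nhds by blast
 then have "f holomorphic_on S" unfolding holomorphic_on_open[OF S(1)] by blast
 then show ?thesis unfolding analytic_at using S by blast
qed

locale framed_connection =
 fixes A :: "'p chart set" and E :: "('p, 'e) vbundle"
  and conn :: "('p \<Rightarrow> 'e \<Rightarrow> complex) \<Rightarrow> 'p \<Rightarrow> 'e \<times> 'p chart \<Rightarrow> complex"
  and D :: "'p set" and r :: nat and b :: "nat \<Rightarrow> 'p \<Rightarrow> 'e \<Rightarrow> complex" and Dz :: "'p set" and z :: "'p \<Rightarrow> complex"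
 assumes A: "complex_atlas A" and E: "vector_bundle A E" and C: "hol_connection A E conn"
  and F: "(D, r, b) \<in> frames E" and K: "(Dz, z) \<in> A"
begin

abbreviation dz :: "'p \<Rightarrow> 'p chart \<Rightarrow> complex" where "dz \<equiv> coord_differential A (Dz, z)"

lemma conn_facts:
 assumes "rs_open A U" "hol_section A E U s"
 shows "hol_section A (tensor_bundle E (canonical_power A 1)) U (conn s)"
  and "hol_section A E U t \<Longrightarrow> y \<in> U \<Longrightarrow> conn (s + t) y = conn s y + conn t y"
  and "hol_section A E U t \<Longrightarrow> \<forall>y\<in>U. s y = t y \<Longrightarrow> y \<in> U \<Longrightarrow> conn s y = conn t y"
  and "hol_fun A U f \<Longrightarrow> y \<in> U \<Longrightarrow>
   conn (\<lambda>y. fscale (f y) (s y)) y = fscale (f y) (conn s y) + tens (s y) (differential A f y)"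
proof -
 note C' = C[unfolded hol_connection_def, THEN spec, THEN spec, THEN mp, OF conjI[OF assms]]
 show "hol_section A (tensor_bundle E (canonical_power A 1)) U (conn s)" by (rule C'[THEN conjunct1])
 note C1 = C'[THEN conjunct2, THEN conjunct1, THEN spec, THEN mp]
 show "conn (s + t) y = conn s y + conn t y" if "hol_section A E U t" "y \<in> U"
  by (rule C1[OF that(1), THEN conjunct1, THEN bspec, OF that(2)])
 show "conn s y = conn t y" if "hol_section A E U t" "\<forall>y\<in>U. s y = t y" "y \<in> U"
  by (rule C1[OF that(1), THEN conjunct2, THEN mp, THEN bspec, OF that(2,3)])
 show "conn (\<lambda>y. fscale (f y) (s y)) y = fscale (f y) (conn s y) + tens (s y) (differential A f y)"
  if "hol_fun A U f" "y \<in> U"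
  by (rule C'[THEN conjunct2, THEN conjunct2, THEN spec, THEN mp, THEN bspec, OF that])
qed

lemmas conn_section = conn_facts(1) and conn_add = conn_facts(2) and conn_cong = conn_facts(3)
 and conn_leibniz = conn_facts(4)

lemma conn_zero: assumes U: "rs_open A U" "y \<in> U" shows "conn (\<lambda>y. 0) y = 0"
proof -
 have eq: "(\<lambda>y. 0) + (\<lambda>y. 0) = (\<lambda>y. 0 :: 'e \<Rightarrow> complex)" by (simp add: fun_eq_iff)
 have "conn (\<lambda>y. 0) y + 0 = conn (\<lambda>y. 0) y + conn (\<lambda>y. 0) y"
  using conn_add[OF U(1) hol_section_zero hol_section_zero U(2), unfolded eq] by (simp only: add_0_right)
 then show ?thesis by (rule add_left_imp_eq[symmetric])
qed

lemma conn_sum: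
 fixes N :: nat
 assumes U: "rs_open A U" and s: "\<forall>l<N. hol_section A E U (s l)"
 shows "hol_section A E U (\<lambda>y. \<Sum>l<N. s l y) \<and> (\<forall>y\<in>U. conn (\<lambda>y. \<Sum>l<N. s l y) y = (\<Sum>l<N. conn (s l) y))"
 using s
proof (induction N)
 case 0
 show ?case unfolding lessThan_0 sum.empty using conn_zero[OF U] hol_section_zero by blast
next
 case (Suc N)
 then have IH: "hol_section A E U (\<lambda>y. \<Sum>l<N. s l y)" "\<And>y. y \<in> U \<Longrightarrow> conn (\<lambda>y. \<Sum>l<N. s l y) y = (\<Sum>l<N. conn (s l) y)"
  and sN: "hol_section A E U (s N)" by simp_all
 have eq: "(\<lambda>y. \<Sum>l<Suc N. s l y) = (\<lambda>y. \<Sum>l<N. s l y) + s N" by (simp add: fun_eq_iff)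
 have "hol_section A E U ((\<lambda>y. \<Sum>l<N. s l y) + s N)"
  unfolding hol_section_iff_local[OF A E U]
 proof
  fix y assume y: "y \<in> U"
  have yp: "y \<in> points A" using rs_open_subset[OF U] y by blast
  show "(\<lambda>y. \<Sum>l<N. s l y) + s N \<in> local_sections A E y"
   by (rule local_sections_add[OF A E yp]) (use IH(1) sN U y in \<open>auto simp: local_sections_def\<close>)
 qed
 then show ?case unfolding eq using conn_add[OF U IH(1) sN] IH(2) by simp
qed

text \<open>\<open>\<theta>\<close> is the connection matrix: the derivatives of the frame sections
  are expanded in the induced frame of the tensor product with K.\<close>

lemma conn_frame:
 "\<exists>\<theta>. (\<forall>m<r. \<forall>l<r. hol_fun A (D \<inter> Dz) (\<theta> m l)) \<and>
  (\<forall>l<r. \<forall>y\<in>D \<inter> Dz. conn (b l) y = (\<Sum>m<r. fscale (\<theta> m l y) (tens (b m y) (dz y))))"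
proof -
 have fr: "(D \<inter> Dz, r * 1, \<lambda>l x. tens (b (l div 1) x) (dz x)) \<in> frames (tensor_bundle E (canonical_power A 1))"
  unfolding tensor_bundle_def vbundle.select_convs
  by (intro CollectI exI[of _ D] exI[of _ r] exI[of _ b] exI[of _ Dz] exI[of _ 1] exI[of _ "\<lambda>_. dz"] conjI refl F
    coord_differential_frame[OF K])
 have ex: "\<exists>c. (\<forall>m<r. hol_fun A (D \<inter> Dz) (c m)) \<and> (\<forall>y\<in>D \<inter> Dz. conn (b l) y = (\<Sum>m<r. fscale (c m y) (tens (b m y) (dz y))))"
  if l: "l < r" for l
 proof -
  have "hol_section A (tensor_bundle E (canonical_power A 1)) D (conn (b l))"
   by (rule conn_section[OF vector_bundleD(1)[OF E F] vector_bundleD(4)[OF E F l]])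
  from hol_section_coeffs[OF this fr] show ?thesis by (simp add: Int_assoc[symmetric] Ball_def)
 qed
 then have "\<forall>l. \<exists>c. l < r \<longrightarrow> (\<forall>m<r. hol_fun A (D \<inter> Dz) (c m)) \<and> (\<forall>y\<in>D \<inter> Dz. conn (b l) y = (\<Sum>m<r. fscale (c m y) (tens (b m y) (dz y))))"
  by blast
 from choice[OF this] obtain c where c: "\<forall>l. l < r \<longrightarrow> (\<forall>m<r. hol_fun A (D \<inter> Dz) (c l m)) \<and>
   (\<forall>y\<in>D \<inter> Dz. conn (b l) y = (\<Sum>m<r. fscale (c l m y) (tens (b m y) (dz y))))" ..
 show ?thesis by (intro exI[of _ "\<lambda>m l. c l m"]) (use c in auto)
qed

lemma tens_dz_zero:
 assumes y: "y \<in> D" "y \<in> Dz" and z: "(\<Sum>m<r. fscale (c m) (tens (b m y) (dz y))) = 0"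
 shows "\<forall>m<r. c m = 0"
proof -
 have one: "dz y (Dz, z) = 1" using coord_change_self[OF A K y(2)] K y by (simp add: coord_differential_def)
 have "(\<Sum>m<r. fscale (c m) (b m y)) = 0"
 proof
  fix a
  show "(\<Sum>m<r. fscale (c m) (b m y)) a = 0 a"
   using fun_cong[OF z, of "(a, (Dz, z))"] by (simp add: sum_fun_apply one)
 qed
 then show ?thesis by (rule vector_bundleD(3)[OF E F y(1)])
qed

text \<open>The Leibniz rule turns flatness into the linear system dv/dz = -\<theta> v. In one
  complex variable such a system has no integrability condition.\<close>

lemma conn_zero_iff:
 assumes \<theta>': "\<forall>l<r. \<forall>y\<in>D \<inter> Dz. conn (b l) y = (\<Sum>m<r. fscale (\<theta> m l y) (tens (b m y) (dz y)))"
  and W: "rs_open A W" "W \<subseteq> D \<inter> Dz" "y \<in> W" and v': "\<forall>l<r. hol_fun A W (v l)"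
 shows "conn (\<lambda>y. \<Sum>l<r. fscale (v l y) (b l y)) y = 0
  \<longleftrightarrow> (\<forall>m<r. deriv (v m \<circ> inv_into Dz z) (z y) = (\<Sum>l<r. - \<theta> m l y * v l y))"
proof -
 have \<theta>: "conn (b l) y = (\<Sum>m<r. fscale (\<theta> m l y) (tens (b m y) (dz y)))" if "l < r" for l
  using \<theta>' that W(2,3) by blast
 have v: "hol_fun A W (v l)" if "l < r" for l using v' that by blast
 have yD: "y \<in> D" "y \<in> Dz" using W by auto
 have sb: "hol_section A E W (b l)" if "l < r" for l
  using hol_section_subset[OF vector_bundleD(4)[OF E F that]] W(2) by blast
 let ?c = "\<lambda>m. deriv (v m \<circ> inv_into Dz z) (z y) + (\<Sum>l<r. \<theta> m l y * v l y)"
 have hv: "hol_at A y (v l)" if "l < r" for l using v[OF that] W(3) hol_fun_iff_hol_at[OF A W(1)] by blast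
 have one: "conn (\<lambda>y. fscale (v l y) (b l y)) y
   = (\<Sum>m<r. fscale (v l y * \<theta> m l y) (tens (b m y) (dz y))) + fscale (deriv (v l \<circ> inv_into Dz z) (z y)) (tens (b l y) (dz y))"
  if l: "l < r" for l
  unfolding conn_leibniz[OF W(1) sb[OF l] v[OF l] W(3)] \<theta>[OF l] differential_coord[OF A K yD(2) hv[OF l]]
  by (simp add: tens_fscale_right cfun.scale_sum_right)
 have "conn (\<lambda>y. \<Sum>l<r. fscale (v l y) (b l y)) y = (\<Sum>l<r. conn (\<lambda>y. fscale (v l y) (b l y)) y)"
  using conn_sum[OF W(1), of r "\<lambda>l y. fscale (v l y) (b l y)"] hol_section_fscale[OF v sb] W(3) by simp
 also have "\<dots> = (\<Sum>l<r. \<Sum>m<r. fscale (v l y * \<theta> m l y) (tens (b m y) (dz y)))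
   + (\<Sum>l<r. fscale (deriv (v l \<circ> inv_into Dz z) (z y)) (tens (b l y) (dz y)))"
  by (simp add: one sum.distrib)
 also have "(\<Sum>l<r. \<Sum>m<r. fscale (v l y * \<theta> m l y) (tens (b m y) (dz y))) = (\<Sum>m<r. \<Sum>l<r. fscale (v l y * \<theta> m l y) (tens (b m y) (dz y)))"
  by (rule sum.swap)
 also have "\<dots> + (\<Sum>l<r. fscale (deriv (v l \<circ> inv_into Dz z) (z y)) (tens (b l y) (dz y))) = (\<Sum>m<r. fscale (?c m) (tens (b m y) (dz y)))"
  by (simp add: cfun.scale_sum_left cfun.scale_left_distrib sum.distrib mult.commute)
 finally have eq: "conn (\<lambda>y. \<Sum>l<r. fscale (v l y) (b l y)) y = (\<Sum>m<r. fscale (?c m) (tens (b m y) (dz y)))" .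
 have "conn (\<lambda>y. \<Sum>l<r. fscale (v l y) (b l y)) y = 0 \<longleftrightarrow> (\<forall>m<r. ?c m = 0)"
  unfolding eq using tens_dz_zero[OF yD, of ?c] by (auto intro!: sum.neutral simp: cfun.scale_zero_left)
 then show ?thesis by (simp add: sum_negf eq_neg_iff_add_eq_0)
qed

text \<open>The solutions with unit vectors as initial values form the frame. An arbitrary flat
  section is the constant combination with the same value at \<open>x\<close>, by uniqueness for the
  difference; this last clause makes parallel translation independent of the flat sections
  chosen.\<close>

theorem flat_frame:
 assumes x: "x \<in> D" "x \<in> Dz"
 shows "\<exists>u. (\<forall>m<r. \<forall>l<r. hol_at A x (u m l)) \<and> (\<forall>m<r. \<forall>l<r. u m l x = (if l = m then 1 else 0)) \<and>
  (\<forall>m<r. flat_near A E conn x (\<lambda>y. \<Sum>l<r. fscale (u m l y) (b l y))) \<and>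
  (\<forall>e. flat_near A E conn x e \<longrightarrow>
   (\<exists>a. \<forall>\<^sub>F y in nhds_rs A x. e y = (\<Sum>m<r. fscale (a m) (\<Sum>l<r. fscale (u m l y) (b l y)))))"
proof -
 let ?i = "inv_into Dz z"
 note xp = points_I[OF K x(2)]
 obtain \<theta> where \<theta>': "(\<forall>m<r. \<forall>l<r. hol_fun A (D \<inter> Dz) (\<theta> m l)) \<and>
  (\<forall>l<r. \<forall>y\<in>D \<inter> Dz. conn (b l) y = (\<Sum>m<r. fscale (\<theta> m l y) (tens (b m y) (dz y))))"
  using conn_frame ..
 have \<theta>h: "hol_fun A (D \<inter> Dz) (\<theta> m l)" if "m < r" "l < r" for m l using \<theta>' that by simp
 note \<theta> = \<theta>'[THEN conjunct2]
 have DDo: "rs_open A (D \<inter> Dz)" by (intro rs_open_Int[OF A] vector_bundleD(1)[OF E F] rs_open_chart_dom[OF A K])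
 have DD: "\<forall>\<^sub>F y in nhds_rs A x. y \<in> D \<inter> Dz" by (rule eventually_rs_open[OF A DDo]) (use x in blast)
 have \<theta>x: "hol_at A x (\<theta> m l)" if "m < r" "l < r" for m l
  using \<theta>h[OF that] x hol_fun_iff_hol_at[OF A DDo] by blast
 define \<alpha> where "\<alpha> = (\<lambda>m l \<zeta>. - (\<theta> m l \<circ> ?i) \<zeta>)"
 have \<alpha>: "\<forall>m<r. \<forall>l<r. \<alpha> m l analytic_on {z x}"
  unfolding \<alpha>_def using \<theta>x hol_at_chart[OF A K x(2)] by (auto intro!: analytic_on_neg simp: comp_def)
 let ?ode = "\<lambda>v y. \<forall>m<r. deriv (v m \<circ> ?i) (z y) = (\<Sum>l<r. - \<theta> m l y * v l y)"
 have flatI: "flat_near A E conn x (\<lambda>y. \<Sum>l<r. fscale (v l y) (b l y))"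
  if v: "\<And>l. l < r \<Longrightarrow> hol_at A x (v l)" and o: "\<forall>\<^sub>F y in nhds_rs A x. ?ode v y" for v
 proof -
  have ev: "\<forall>\<^sub>F y in nhds_rs A x. y \<in> D \<inter> Dz \<and> ?ode v y" using DD o by eventually_elim simp
  show ?thesis
  proof (rule hol_section_germ[OF A E F x(1) v ev])
   fix U assume U: "rs_open A U" "x \<in> U" "\<And>l. l < r \<Longrightarrow> hol_fun A U (v l)" "\<And>y. y \<in> U \<Longrightarrow> y \<in> D \<inter> Dz \<and> ?ode v y"
    "hol_section A E U (\<lambda>y. \<Sum>l<r. fscale (v l y) (b l y))"
   have UD: "U \<subseteq> D \<inter> Dz" using U(4) by blast
   have hU: "\<forall>l<r. hol_fun A U (v l)" using U(3) by simp
   have "\<forall>y\<in>U. conn (\<lambda>y. \<Sum>l<r. fscale (v l y) (b l y)) y = 0"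
   proof
    fix y assume y: "y \<in> U"
    show "conn (\<lambda>y. \<Sum>l<r. fscale (v l y) (b l y)) y = 0"
     unfolding conn_zero_iff[OF \<theta> U(1) UD y hU] by (rule U(4)[OF y, THEN conjunct2])
   qed
   then show ?thesis unfolding flat_near_def using U(1,2,5) by blast
  qed
 qed
 have flatD: "\<exists>v. (\<forall>l<r. hol_at A x (v l)) \<and> (\<forall>\<^sub>F y in nhds_rs A x. ?ode v y \<and> e y = (\<Sum>l<r. fscale (v l y) (b l y)))"
  if e: "flat_near A E conn x e" for e
 proof -
  obtain U where U: "rs_open A U" "x \<in> U" "hol_section A E U e" "\<forall>y\<in>U. conn e y = 0"
   using e unfolding flat_near_def by blast
  let ?W = "U \<inter> (D \<inter> Dz)"
  have W: "rs_open A ?W" by (rule rs_open_Int[OF A U(1) DDo])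
  obtain v where v: "\<forall>l<r. hol_fun A (U \<inter> D) (v l)" "\<forall>y\<in>U \<inter> D. e y = (\<Sum>l<r. fscale (v l y) (b l y))"
   using hol_section_coeffs[OF U(3) F] by blast
  have vW: "hol_fun A ?W (v l)" if "l < r" for l by (rule hol_fun_subset[OF v(1)[rule_format, OF that]]) blast
  have hW: "\<forall>l<r. hol_fun A ?W (v l)" using vW by simp
  have sW: "hol_section A E ?W (\<lambda>y. \<Sum>l<r. fscale (v l y) (b l y))"
   by (rule hol_section_frame[OF A E F _ vW]) auto
  have eW: "hol_section A E ?W e" by (rule hol_section_subset[OF U(3)]) blast
  have eq: "\<forall>y\<in>?W. e y = (\<Sum>l<r. fscale (v l y) (b l y))" using v(2) by blast
  have ode: "?ode v y" if y: "y \<in> ?W" for y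
  proof -
   have "conn (\<lambda>y. \<Sum>l<r. fscale (v l y) (b l y)) y = 0"
    using conn_cong[OF W eW sW eq y] U(4) y by simp
   then show ?thesis unfolding conn_zero_iff[OF \<theta> W Int_lower2 y hW] .
  qed
  have "\<forall>\<^sub>F y in nhds_rs A x. y \<in> ?W" by (rule eventually_rs_open[OF A W]) (use U(2) x in blast)
  then have "\<forall>\<^sub>F y in nhds_rs A x. ?ode v y \<and> e y = (\<Sum>l<r. fscale (v l y) (b l y))"
   by eventually_elim (use ode eq in blast)
  moreover have "\<forall>l<r. hol_at A x (v l)" using vW hol_fun_iff_hol_at[OF A W] U(2) x by blast
  ultimately show ?thesis by blast
 qed
 have sol: "\<exists>U. (\<forall>l. U l (z x) = (if l = m then 1 else 0)) \<and>
   (\<forall>\<^sub>F \<zeta> in nhds (z x). \<forall>m<r. (U m has_field_derivative (\<Sum>l<r. \<alpha> m l \<zeta> * U l \<zeta>)) (at \<zeta>))" for m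
  by (rule linear_ode_exists[OF \<alpha>, of "\<lambda>l. if l = m then 1 else 0"]) blast
 have "\<forall>m. \<exists>U. (\<forall>l. U l (z x) = (if l = m then 1 else 0)) \<and>
   (\<forall>\<^sub>F \<zeta> in nhds (z x). \<forall>m<r. (U m has_field_derivative (\<Sum>l<r. \<alpha> m l \<zeta> * U l \<zeta>)) (at \<zeta>))"
  using sol by (rule allI)
 from choice[OF this] obtain U where UU: "\<forall>m. (\<forall>l. U m l (z x) = (if l = m then 1 else 0)) \<and>
   (\<forall>\<^sub>F \<zeta> in nhds (z x). \<forall>l<r. (U m l has_field_derivative (\<Sum>j<r. \<alpha> l j \<zeta> * U m j \<zeta>)) (at \<zeta>))" ..
 have U1: "U m l (z x) = (if l = m then 1 else 0)" for m l using UU by blast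
 have Ud: "\<forall>\<^sub>F \<zeta> in nhds (z x). \<forall>l<r. (U m l has_field_derivative (\<Sum>j<r. \<alpha> l j \<zeta> * U m j \<zeta>)) (at \<zeta>)" for m using UU by blast
 define u where "u = (\<lambda>m l y. U m l (z y))"
 have uh: "hol_at A x (u m l)" if "l < r" for m l
 proof -
  have "\<forall>\<^sub>F \<zeta> in nhds (z x). (U m l has_field_derivative (\<Sum>j<r. \<alpha> l j \<zeta> * U m j \<zeta>)) (at \<zeta>)"
   using Ud[of m] by eventually_elim (use that in blast)
  then have "U m l analytic_on {z x}" by (rule analytic_if_eventually_deriv)
  then show ?thesis unfolding u_def by (rule hol_at_compose[OF A xp hol_at_coord[OF A K x(2)]])
 qed
 have uo: "\<forall>\<^sub>F y in nhds_rs A x. ?ode (u m) y" for m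
  using eventually_coord[OF A K x(2) Ud[of m]] DD
 proof eventually_elim
  case (elim y)
  then have y: "y \<in> Dz" by blast
  have "deriv (u m l \<circ> ?i) (z y) = (\<Sum>j<r. - \<theta> l j y * u m j y)" if l: "l < r" for l
  proof -
   have ev: "\<forall>\<^sub>F \<zeta> in nhds (z y). (u m l \<circ> ?i) \<zeta> = U m l \<zeta>"
    using eventually_in_chart_image[OF A K y] by eventually_elim (simp add: u_def f_inv_into_f)
   have "deriv (u m l \<circ> ?i) (z y) = deriv (U m l) (z y)" by (rule deriv_cong_ev[OF ev refl])
   also have "\<dots> = (\<Sum>j<r. \<alpha> l j (z y) * U m j (z y))" using elim l by (intro DERIV_imp_deriv) blast
   finally show ?thesis by (simp add: \<alpha>_def u_def inv_chart_x[OF A K y])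
  qed
  then show ?case by blast
 qed
 show ?thesis
 proof (intro exI[of _ u] conjI allI impI)
  show "hol_at A x (u m l)" if "m < r" "l < r" for m l by (rule uh[OF that(2)])
  show "u m l x = (if l = m then 1 else 0)" for m l by (simp add: u_def U1)
  show "flat_near A E conn x (\<lambda>y. \<Sum>l<r. fscale (u m l y) (b l y))" if "m < r" for m
   by (rule flatI[OF uh uo])
  show "\<exists>a. \<forall>\<^sub>F y in nhds_rs A x. e y = (\<Sum>m<r. fscale (a m) (\<Sum>l<r. fscale (u m l y) (b l y)))"
   if e: "flat_near A E conn x e" for e
  proof -
   obtain v where vh: "\<forall>l<r. hol_at A x (v l)"
    and vo: "\<forall>\<^sub>F y in nhds_rs A x. ?ode v y \<and> e y = (\<Sum>l<r. fscale (v l y) (b l y))" using flatD[OF e] by blast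
   \<comment> \<open>The difference between the given solution and the combination with the same
     initial value: it solves the system and starts at zero.\<close>
   let ?w = "\<lambda>l \<zeta>. v l (?i \<zeta>) - (\<Sum>m<r. v m x * U m l \<zeta>)"
   have "\<forall>\<^sub>F y in nhds_rs A x. \<forall>l\<in>{..<r}. hol_at A y (v l)"
    by (rule eventually_ball_finite) (use vh hol_at_eventually[OF A xp] in auto)
   then have "\<forall>\<^sub>F y in nhds_rs A x. (\<forall>l\<in>{..<r}. hol_at A y (v l)) \<and> ?ode v y \<and> y \<in> Dz"
    using vo DD by eventually_elim blast
   then have ev: "\<forall>\<^sub>F \<zeta> in nhds (z x). (\<forall>l\<in>{..<r}. hol_at A (?i \<zeta>) (v l)) \<and> ?ode v (?i \<zeta>) \<and> ?i \<zeta> \<in> Dz"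
    unfolding eventually_nhds_rs_chart[OF A K x(2)] .
   have all: "\<forall>\<^sub>F \<zeta> in nhds (z x). \<forall>m\<in>{..<r}. \<forall>l<r. (U m l has_field_derivative (\<Sum>j<r. \<alpha> l j \<zeta> * U m j \<zeta>)) (at \<zeta>)"
    by (rule eventually_ball_finite) (use Ud in auto)
   have "\<forall>\<^sub>F \<zeta> in nhds (z x). \<forall>l<r. (?w l has_field_derivative (\<Sum>j<r. \<alpha> l j \<zeta> * ?w j \<zeta>)) (at \<zeta>)"
    using ev all eventually_in_chart_image[OF A K x(2)]
   proof eventually_elim
    case (elim \<zeta>)
    have zi: "z (?i \<zeta>) = \<zeta>" using elim(3) by (rule f_inv_into_f)
    show ?case
    proof (intro allI impI)
     fix l assume l: "l < r"
     have "hol_at A (?i \<zeta>) (v l)" using elim(1) l by blast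
     then have "(v l \<circ> ?i) analytic_on {\<zeta>}" using hol_at_chart[OF A K, of "?i \<zeta>" "v l"] elim(1) zi by simp
     then have "(v l \<circ> ?i) field_differentiable (at \<zeta>)" by (meson analytic_on_imp_differentiable_at singletonI)
     then have "((v l \<circ> ?i) has_field_derivative deriv (v l \<circ> ?i) \<zeta>) (at \<zeta>)"
      by (simp add: DERIV_deriv_iff_field_differentiable)
     moreover have "deriv (v l \<circ> ?i) \<zeta> = (\<Sum>j<r. \<alpha> l j \<zeta> * v j (?i \<zeta>))"
      using elim(1) l zi by (simp add: \<alpha>_def)
     ultimately have dv: "((\<lambda>\<zeta>. v l (?i \<zeta>)) has_field_derivative (\<Sum>j<r. \<alpha> l j \<zeta> * v j (?i \<zeta>))) (at \<zeta>)"
      by (simp add: comp_def)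
     have dU: "((\<lambda>\<zeta>. \<Sum>m<r. v m x * U m l \<zeta>) has_field_derivative (\<Sum>m<r. v m x * (\<Sum>j<r. \<alpha> l j \<zeta> * U m j \<zeta>))) (at \<zeta>)"
      by (intro DERIV_sum DERIV_cmult) (use elim(2) l in blast)
     have sw: "(\<Sum>m<r. v m x * (\<Sum>j<r. \<alpha> l j \<zeta> * U m j \<zeta>)) = (\<Sum>j<r. \<alpha> l j \<zeta> * (\<Sum>m<r. v m x * U m j \<zeta>))"
      unfolding sum_distrib_left by (subst sum.swap) (simp add: mult.left_commute)
     show "(?w l has_field_derivative (\<Sum>j<r. \<alpha> l j \<zeta> * ?w j \<zeta>)) (at \<zeta>)"
      using DERIV_diff[OF dv dU] by (simp add: sw right_diff_distrib sum_subtractf)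
    qed
   qed
   moreover have "\<forall>l<r. ?w l (z x) = 0"
   proof (intro allI impI)
    fix l assume "l < r"
    then have "(\<Sum>m<r. v m x * (if l = m then 1 else 0)) = v l x" by (simp add: if_distrib cong: if_cong)
    then show "?w l (z x) = 0" by (simp add: U1 inv_chart_x[OF A K x(2)])
   qed
   ultimately have "\<forall>\<^sub>F \<zeta> in nhds (z x). \<forall>l<r. ?w l \<zeta> = 0" by (intro linear_ode_unique[OF \<alpha>])
   from eventually_coord[OF A K x(2) this] vo DD
   have "\<forall>\<^sub>F y in nhds_rs A x. e y = (\<Sum>m<r. fscale (v m x) (\<Sum>l<r. fscale (u m l y) (b l y)))"
   proof eventually_elim
    case (elim y)
    then have "v l y = (\<Sum>m<r. v m x * u m l y)" if "l < r" for l
     using that inv_chart_x[OF A K, of y] by (simp add: u_def)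
    then have "e y = (\<Sum>l<r. \<Sum>m<r. fscale (v m x * u m l y) (b l y))"
     using elim(2) by (simp add: cfun.scale_sum_left)
    also have "\<dots> = (\<Sum>m<r. \<Sum>l<r. fscale (v m x * u m l y) (b l y))" by (rule sum.swap)
    finally show ?case by (simp add: cfun.scale_sum_right)
   qed
   then show ?thesis by (intro exI[of _ "\<lambda>m. v m x"])
  qed
 qed
qed

end

section \<open>Jets in coordinates\<close>

locale pointed_surface = projective_surface A Q
 for A :: "'p chart set" and Q :: "('p, 'i) projective_atlas" +
 fixes w :: "2 \<times> 2 \<Rightarrow> complex" and n k :: nat and x :: 'p and i :: 'i and e b :: vec2
 assumes w: "nonzero_bivector w" and k: "k = n + 1" and i: "i \<in> idx Q" "x \<in> dom Q i"
  and e: "dev Q i x = cfun.span {e}" and eb: "br e b \<noteq> 0"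
begin

lemma bx: "b \<notin> dev Q i x" unfolding e line_mem_iff[OF br_nonzero(1)[OF eb]] by (rule eb)

lemma xp: "x \<in> points A" by (rule dom_points[OF i])

lemma flat_hyp: "hyperplane_fun (flat_fiber Q x) (taut_fiber Q x) (\<lambda>v. br e (component i v))"
 by (rule flat_hyperplane[OF i br_nonzero(1)[OF eb] e])

definition om :: "'p \<Rightarrow> complex" where "om y = omega_section w (dev Q i x) b (dev Q i y) b"

definition fr :: "int \<Rightarrow> 'p \<Rightarrow> ('i \<times> 2 \<Rightarrow> complex) \<Rightarrow> complex" where
 "fr m y = quot_frame (flat_fiber Q y) (taut_fiber Q y) m (glue Q i y b)"

text \<open>Near \<open>x\<close> omega is \<open>- (w (1, 2) / br e b)\<close> times
  \<open>br v e / br v b\<close>. The powers of this constant are inserted so that the section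
  defined by the form becomes the polynomial in omega with coefficients \<open>d j\<close>.\<close>

definition rep_sym :: "(nat \<Rightarrow> complex) \<Rightarrow> (('i \<times> 2 \<Rightarrow> complex) \<Rightarrow> complex) \<Rightarrow> complex" where
 "rep_sym d = binary_form (flat_fiber Q x) (glue Q i x e) (glue Q i x b) n (\<lambda>j. d j * (- (w (1, 2) / br e b)) ^ j)"

text \<open>Packs Taylor coefficients in omega up to degree k: degrees 0 to n go to the symmetric
  power, degree k = n + 1 to the line spanned by [b]^(-(k+1)).\<close>

definition rep :: "(nat \<Rightarrow> complex) \<Rightarrow> (('i \<times> 2 \<Rightarrow> complex) \<Rightarrow> complex) + ('i \<times> 2 \<Rightarrow> complex) \<Rightarrow> complex" where
 "rep d = case_sum (rep_sym d) (fscale (d k) (fr (- int (k + 1)) x))"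

lemma om_uniformizer: "uniformizer A x om"
 unfolding om_def by (rule dev_uniformizer[OF w i bx])

lemma om_hol: "hol_at A x om" and om_x: "om x = 0"
 using om_uniformizer by (simp_all add: uniformizer_def)

lemma poly_hol: "hol_at A x (\<lambda>y. \<Sum>j<m. a j * om y ^ j)"
 by (intro hol_at_sum[OF A xp] hol_at_mult[OF A xp] hol_at_const[OF A xp] hol_at_power[OF A xp] om_hol)

lemma eventually_complement: "\<forall>\<^sub>F y in nhds_rs A x. y \<in> dom Q i \<and> b \<notin> dev Q i y"
 using eventually_dom[OF i] dev_eventually(1)[OF i eventually_not_mem[OF dev_points[OF i] bx]]
 by eventually_elim simp

lemma rep_sym_global_section:
 "\<forall>\<^sub>F y in nhds_rs A x. global_section (chart_sym Q i x (rep_sym d)) (dev Q i y) b = (\<Sum>j\<le>n. d j * om y ^ j)"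
 using eventually_complement
proof eventually_elim
 case (elim y)
 then obtain v where v: "dev Q i y = cfun.span {v}" "br v b \<noteq> 0"
  using points_P1_affine[OF dev_points[OF i(1)]] by metis
 let ?K = "w (1, 2) / br e b"
 have K: "?K \<noteq> 0" using eb bivector_entries(4)[OF w] by simp
 have "om y = - ?K * (br v e / br v b)"
  unfolding om_def e v(1) omega_section_eq[OF w eb v(2)] using br_swap[of e v] by simp
 then have "om y ^ j = (- ?K) ^ j * (br v e / br v b) ^ j" for j by (simp only: power_mult_distrib)
 moreover have "(\<lambda>a. br v a / br v b) \<in> dual_space UNIV"
  by (simp add: dual_space_def linear_fun_on_def br_add br_scale add_divide_distrib)
 ultimately show ?case
  unfolding v(1) global_section_value[OF v(2)] rep_sym_def chart_sym_binary[OF i]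
  using v(2) by (simp add: binary_form_def mult.assoc)
qed

lemma rep_sym_mem: "rep_sym d \<in> sym_power n (flat_fiber Q x)"
 unfolding sym_power_flat[OF i eb] rep_sym_def by (rule rangeI)

lemma fiber_fr: "fiber (bL_power Q m) x = range (\<lambda>c. fscale c (fr m x))"
 unfolding fiber_bL fr_def by (rule bL_frame_facts(1)[OF i bx])

lemma fr_self: "y \<in> dom Q i \<Longrightarrow> b \<notin> dev Q i y \<Longrightarrow> fr m y (glue Q i y b) = 1"
 unfolding fr_def by (rule bL_frame_facts(2)[OF i(1)])

lemma bL_value:
 assumes y: "y \<in> dom Q i" "b \<notin> dev Q i y" and h: "h \<in> quot_power (flat_fiber Q y) (taut_fiber Q y) m"
 shows "h = fscale (h (glue Q i y b)) (fr m y)"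
proof -
 obtain c where c: "h = fscale c (fr m y)" using h unfolding bL_frame_facts(1)[OF i(1) y] fr_def by blast
 have "h (glue Q i y b) = c" unfolding c using fr_self[OF y] by simp
 then show ?thesis using c by simp
qed

lemma sum_fiber_rep: "sum_fiber Q n k x = range rep"
proof (rule equalityI; rule subsetI)
 fix T assume "T \<in> sum_fiber Q n k x"
 then obtain c a where T: "T = case_sum (binary_form (flat_fiber Q x) (glue Q i x e) (glue Q i x b) n c) (fscale a (fr (- int (k + 1)) x))"
  unfolding sum_fiber_def direct_sum_def sym_power_flat[OF i eb] fiber_fr by blast
 let ?K = "- (w (1, 2) / br e b)"
 have K: "?K \<noteq> 0" using eb bivector_entries(4)[OF w] by simp
 define d where "d = (\<lambda>j. if j = k then a else c j / ?K ^ j)"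
 have "rep_sym d = binary_form (flat_fiber Q x) (glue Q i x e) (glue Q i x b) n c"
  unfolding rep_sym_def binary_form_def fun_eq_iff d_def using K by (auto intro!: sum.cong simp: k)
 then have "T = rep d" unfolding T rep_def by (simp add: d_def)
 then show "T \<in> range rep" by blast
next
 fix T assume "T \<in> range rep"
 then obtain d where d: "T = rep d" by blast
 show "T \<in> sum_fiber Q n k x"
  unfolding d rep_def sum_fiber_def direct_sum_def fiber_fr using rep_sym_mem[of d] by blast
qed

lemma rep_lincomb: "rep (\<lambda>j. c * d j + d' j) = fscale c (rep d) + rep d'"
proof
 fix z show "rep (\<lambda>j. c * d j + d' j) z = (fscale c (rep d) + rep d') z"
  by (cases z) (simp_all add: rep_def rep_sym_def binary_form_def sum.distrib sum_distrib_left algebra_simps)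
qed

lemma rep_zero: "rep (\<lambda>_. 0) = 0"
 using rep_lincomb[of "-1" "\<lambda>_. 0" "\<lambda>_. 0"] by (simp add: fun_eq_iff)

lemma rep_sum: "rep (\<lambda>j. \<Sum>l<N. c l * d l j) = (\<Sum>l<N::nat. fscale (c l) (rep (d l)))"
proof (induction N)
 case (Suc N)
 have "rep (\<lambda>j. \<Sum>l<Suc N. c l * d l j) = rep (\<lambda>j. c N * d N j + (\<Sum>l<N. c l * d l j))" by (simp add: add.commute)
 also have "\<dots> = fscale (c N) (rep (d N)) + (\<Sum>l<N. fscale (c l) (rep (d l)))" by (simp only: rep_lincomb Suc)
 finally show ?case by (simp only: sum.lessThan_Suc add.commute)
qed (simp add: rep_zero)

lemma rep_cong:
 assumes d: "\<And>j. j < k + 1 \<Longrightarrow> d j = d' j" shows "rep d = rep d'"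
proof -
 have "rep_sym d \<xi> = rep_sym d' \<xi>" for \<xi>
  by (cases "\<xi> \<in> dual_space (flat_fiber Q x)") (auto simp: rep_sym_def binary_form_def k d intro!: sum.cong)
 then have "rep_sym d = rep_sym d'" by (simp add: fun_eq_iff)
 then show ?thesis using d[of k] by (simp add: rep_def)
qed

lemma jet_rep_iff:
 assumes P: "P \<in> sym_power n (flat_fiber Q x)" and t: "t \<in> fiber (bL_power Q (- int (k + 1))) x"
  and s: "s \<in> local_sections A (bL_power Q (int n)) x" and rep: "case_sum P t = rep d"
 shows "jet A (bL_power Q (int n)) k x s = jet_iso_bL A w Q n k x P t
  \<longleftrightarrow> vanish_at A (k + 1) x (\<lambda>y. s y (glue Q i y b) - (\<Sum>j<k + 1. d j * om y ^ j))"
proof -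
 have P': "P = rep_sym d" and t': "t = fscale (d k) (fr (- int (k + 1)) x)"
  using rep unfolding rep_def fun_eq_iff by (metis sum.case(1), metis sum.case(2))
 have ev: "\<forall>\<^sub>F y in nhds_rs A x. jet_defect w k i x b P t s y = s y (glue Q i y b) - (\<Sum>j<k + 1. d j * om y ^ j)"
  using rep_sym_global_section[of d]
  by eventually_elim (simp add: jet_defect_def P' t' fr_self[OF i(2) bx] k lessThan_Suc_atMost flip: om_def)
 show ?thesis unfolding jet_iso_bL_iff[OF w k xp i bx P t s] by (rule vanish_at_cong[OF A xp ev])
qed

text \<open>The argument passes through jets: the zero section represents
  \<open>rep (\<lambda>_. 0)\<close>, hence also \<open>rep d\<close>, so the polynomial with
  coefficients \<open>d\<close> vanishes to order k + 1 and \<open>taylor_unique\<close>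
  applies.\<close>

lemma rep_eq_zero:
 assumes "rep d = 0" shows "\<forall>j<k + 1. d j = 0"
proof -
 let ?t = "fscale (d k) (fr (- int (k + 1)) x)"
 have t: "?t \<in> fiber (bL_power Q (- int (k + 1))) x" unfolding fiber_fr by (rule rangeI)
 have s: "0 \<in> local_sections A (bL_power Q (int n)) x" by (rule zero_local_section[OF A vector_bundle_bL xp])
 have r1: "case_sum (rep_sym d) ?t = rep d" by (simp only: rep_def)
 have r2: "case_sum (rep_sym d) ?t = rep (\<lambda>_. 0)" by (simp only: r1 assms rep_zero)
 have "vanish_at A (k + 1) x (\<lambda>y. 0 - (\<Sum>j<k + 1. 0 * om y ^ j))" using vanish_at_zero[OF A xp] by simp
 then have "vanish_at A (k + 1) x (\<lambda>y. 0 - (\<Sum>j<k + 1. d j * om y ^ j))"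
  using jet_rep_iff[OF rep_sym_mem t s r1] jet_rep_iff[OF rep_sym_mem t s r2] by simp
 from vanish_at_uminus[OF A xp this] have "vanish_at A (k + 1) x (\<lambda>y. \<Sum>j<k + 1. d j * om y ^ j)" by (simp only: minus_diff_eq diff_0_right)
 then show ?thesis by (rule taylor_unique[OF A xp om_uniformizer])
qed

lemma om_derivE:
 assumes D: "(D, z) \<in> A" "x \<in> D"
 obtains g where "hol_at A x g" "\<forall>\<^sub>F y in nhds_rs A x. om y = (z y - z x) * g y" "g x = deriv (om \<circ> inv_into D z) (z x)"
proof (rule deriv_chart_factorE[OF A D om_hol])
 fix g assume "hol_at A x g" "\<forall>\<^sub>F y in nhds_rs A x. om y - om x = (z y - z x) * g y" "g x = deriv (om \<circ> inv_into D z) (z x)"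
 then show ?thesis using that[of g] by (simp add: om_x)
qed

text \<open>Replacing [b] by the class of \<open>u\<close> multiplies omega by
  \<open>?\<phi> * \<psi> y\<close>, whose value at \<open>x\<close> is the square of
  \<open>br e b / br e (component i u)\<close>. Since omega vanishes at \<open>x\<close>, only this
  value enters the derivative, and it is the same in every chart of the projective
  structure.\<close>

lemma bL_form_eq:
 assumes D: "(D, z) \<in> A" "x \<in> D" and u: "u \<in> flat_fiber Q x" "br e (component i u) \<noteq> 0"
 shows "bL_form w Q (D, z) x u = deriv (om \<circ> inv_into D z) (z x) * (br e b / br e (component i u)) ^ 2"
  (is "_ = ?c")
proof -
 let ?b = "component i u" and ?\<phi> = "br e b / br e (component i u)"
 have b': "?b \<notin> dev Q i x" unfolding e line_mem_iff[OF br_nonzero(1)[OF eb]] by (rule u(2))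
 define \<psi> where "\<psi> = (\<lambda>y. quot_frame UNIV (dev Q i y) 1 b ?b)"
 have \<psi>: "\<psi> y = br v b / br v ?b" if "dev Q i y = cfun.span {v}" "br v ?b \<noteq> 0" for y v
  unfolding \<psi>_def that(1) quot_frame_value[where lam = "br v" and b = b, OF hyperplane_line[OF br_nonzero(1)[OF that(2)]] UNIV_I]
  using that(2) by simp
 have \<psi>h: "hol_at A x \<psi>" unfolding \<psi>_def
  by (rule dev_eventually(3)[OF i quot_frame_hol[OF dev_points[OF i] bx b']])
 obtain g where g: "hol_at A x g" "\<forall>\<^sub>F y in nhds_rs A x. om y = (z y - z x) * g y" "g x = deriv (om \<circ> inv_into D z) (z x)"
  using om_derivE[OF D] .
 have om_b: "\<forall>\<^sub>F y in nhds_rs A x. omega_section w (dev Q j x) (component j u) (dev Q j y) (component j u)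
   = om y * (?\<phi> * \<psi> y)" if j: "j \<in> idx Q" "x \<in> dom Q j" for j
  using eventually_complement eventually_dom[OF j]
   dev_eventually(1)[OF i eventually_not_mem[OF dev_points[OF i] b']]
 proof eventually_elim
  case (elim y)
  then obtain v where v: "dev Q i y = cfun.span {v}" "br v b \<noteq> 0"
   using points_P1_affine[OF dev_points[OF i(1)]] by metis
  have vb: "br v ?b \<noteq> 0" using elim(3) unfolding v(1) line_mem_iff[OF br_nonzero(1)[OF v(2)]] .
  have "omega_section w (dev Q j x) (component j u) (dev Q j y) (component j u)
    = omega_section w (dev Q i x) ?b (dev Q i y) ?b"
   unfolding flat_fiberD(2)[OF u(1) j(1) i(1) j(2) i(2)]
   by (rule omega_section_trans[OF w i(1) j(1) i(2) j(2) _ elim(2) b' elim(3)]) (use elim(1) in simp)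
  also have "\<dots> = om y * (?\<phi> * \<psi> y)"
   unfolding \<psi>[OF v(1) vb] om_def e v(1) omega_section_eq[OF w eb v(2)] omega_section_eq[OF w u(2) vb]
   using eb v(2) u(2) vb by (simp add: field_simps)
  finally show ?case .
 qed
 have form: "omega_form w (dev Q j) (D, z) x (component j u) = ?c" if j: "j \<in> idx Q" "x \<in> dom Q j" for j
 proof -
  let ?f = "\<lambda>y. omega_section w (dev Q j x) (component j u) (dev Q j y) (component j u)"
  have f0: "?f x = 0" using eventually_nhds_rs_x[OF A xp om_b[OF j]] by (simp add: om_x)
  have "hol_at A x (\<lambda>y. g y * (?\<phi> * \<psi> y))" by (intro hol_at_mult[OF A xp] g(1) hol_at_const[OF A xp] \<psi>h)
  moreover have "\<forall>\<^sub>F y in nhds_rs A x. ?f y - ?f x = (z y - z x) * (g y * (?\<phi> * \<psi> y))"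
   using om_b[OF j] g(2) unfolding f0 by eventually_elim simp
  ultimately have "deriv (?f \<circ> inv_into D z) (z x) = g x * (?\<phi> * \<psi> x)" by (rule deriv_chart_factor[OF A D])
  then show ?thesis by (simp add: omega_form_def comp_def g(3) \<psi>[OF e u(2)] power2_eq_square)
 qed
 show ?thesis unfolding bL_form_def
 proof (rule the_equality)
  show "\<forall>j\<in>idx Q. x \<in> dom Q j \<longrightarrow> ?c = omega_form w (dev Q j) (D, z) x (component j u)" using form by simp
  show "c = ?c" if "\<forall>j\<in>idx Q. x \<in> dom Q j \<longrightarrow> c = omega_form w (dev Q j) (D, z) x (component j u)" for c
   using that form[OF i] i by simp
 qed
qed

text \<open>The ratio \<open>br e b / br e (component i u)\<close> has exponent -(k + 1) from the
  frame and 2k from the form, in total n. This is where the identification of K with the power -2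
  meets k = n + 1.\<close>

lemma fr_bL_form:
 assumes D: "(D, z) \<in> A" "x \<in> D"
 shows "fr (- int (k + 1)) x u * bL_form w Q (D, z) x u ^ k = deriv (om \<circ> inv_into D z) (z x) ^ k * fr (int n) x u"
proof -
 have fv: "fr m x u = (if u \<in> flat_fiber Q x \<and> br e (component i u) \<noteq> 0 then (br e b / br e (component i u)) powi m else 0)" for m
  unfolding fr_def quot_frame_value[where lam = "\<lambda>v. br e (component i v)" and b = "glue Q i x b", OF flat_hyp glue_flat[OF i]]
  by (simp add: component_glue_self[OF i])
 show ?thesis
 proof (cases "u \<in> flat_fiber Q x \<and> br e (component i u) \<noteq> 0")
  case True
  define c where "c = br e b / br e (component i u)"
  have c: "c \<noteq> 0" using True eb by (simp add: c_def)
  have "2 * k = (k + 1) + n" by (simp add: k)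
  then have "c ^ (2 * k) = c ^ (k + 1) * c ^ n" by (simp only: power_add)
  then have "inverse (c ^ (k + 1)) * c ^ (2 * k) = c ^ n" using c by (simp add: field_simps)
  then have eq: "c powi (- int (k + 1)) * (c ^ 2) ^ k = c powi int n"
   by (simp only: power_int_minus power_int_of_nat flip: power_mult)
  have F: "fr m x u = c powi m" for m unfolding fv if_P[OF True] c_def ..
  have B: "bL_form w Q (D, z) x u = deriv (om \<circ> inv_into D z) (z x) * c ^ 2"
   unfolding c_def using True by (intro bL_form_eq[OF D]) blast+
  show ?thesis unfolding F B power_mult_distrib eq[symmetric] by (rule mult.left_commute)
 qed (simp only: fv if_False mult_zero_left mult_zero_right)
qed

end

lemma vanishes_1I:
 assumes A: "complex_atlas A" and B: "vector_bundle A B" and x: "x \<in> points A"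
  and s: "s \<in> local_sections A B x" "s x = 0"
 shows "vanishes_to_order A B 1 x s"
proof -
 obtain D r b where D: "(D, r, b) \<in> frames B" "x \<in> D" using vector_bundle_frame[OF B x] .
 obtain c where c: "\<forall>l<r. hol_at A x (c l)" "\<forall>\<^sub>F y in nhds_rs A x. s y = (\<Sum>l<r. fscale (c l y) (b l y))"
  using s(1) unfolding local_sections_iff[OF A B D] by blast
 have "(\<Sum>l<r. fscale (c l x) (b l x)) = 0" using eventually_nhds_rs_x[OF A x c(2)] s(2) by simp
 then have "\<forall>l<r. c l x = 0" by (rule vector_bundleD(3)[OF B D])
 then show ?thesis unfolding vanishes_to_order_iff[OF A B D]
  using c vanish_at_1[OF A x] by (intro exI[of _ c]) simp
qed

lemma vanishes_mult:
 assumes A: "complex_atlas A" and B: "vector_bundle A B" and x: "x \<in> points A"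
  and f: "vanish_at A l x f" and v: "vanishes_to_order A B d x s"
 shows "vanishes_to_order A B (l + d) x (\<lambda>y. fscale (f y) (s y))"
proof -
 obtain D r b where D: "(D, r, b) \<in> frames B" "x \<in> D" using vector_bundle_frame[OF B x] .
 obtain c where c: "\<forall>l<r. vanish_at A d x (c l)" "\<forall>\<^sub>F y in nhds_rs A x. s y = (\<Sum>l<r. fscale (c l y) (b l y))"
  using v unfolding vanishes_to_order_iff[OF A B D] by blast
 have "\<forall>\<^sub>F y in nhds_rs A x. fscale (f y) (s y) = (\<Sum>l<r. fscale (f y * c l y) (b l y))"
  using c(2) by eventually_elim (simp add: cfun.scale_sum_right)
 moreover have "\<forall>j<r. vanish_at A (l + d) x (\<lambda>y. f y * c j y)" using vanish_at_mult[OF A x f] c(1) by blast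
 ultimately show ?thesis unfolding vanishes_to_order_iff[OF A B D]
  by (intro exI[of _ "\<lambda>j y. f y * c j y"]) simp
qed

section \<open>The canonical isomorphism and the symbol\<close>

locale flat_pointed_surface = pointed_surface A Q w n k x i e b
 for A :: "'p chart set" and Q :: "('p, 'i) projective_atlas" and w n k x i e b +
 fixes E :: "('p, 'e) vbundle" and conn :: "('p \<Rightarrow> 'e \<Rightarrow> complex) \<Rightarrow> 'p \<Rightarrow> 'e \<times> 'p chart \<Rightarrow> complex"
  and D :: "'p set" and r :: nat and \<beta> :: "nat \<Rightarrow> 'p \<Rightarrow> 'e \<Rightarrow> complex" and u :: "nat \<Rightarrow> nat \<Rightarrow> 'p \<Rightarrow> complex"
 assumes E: "vector_bundle A E" and F: "(D, r, \<beta>) \<in> frames E" and xD: "x \<in> D"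
  and u: "\<And>m l. m < r \<Longrightarrow> l < r \<Longrightarrow> hol_at A x (u m l)"
  and u1: "\<And>m l. m < r \<Longrightarrow> l < r \<Longrightarrow> u m l x = (if l = m then 1 else 0)"
  and flat: "\<And>m. m < r \<Longrightarrow> flat_near A E conn x (\<lambda>y. \<Sum>l<r. fscale (u m l y) (\<beta> l y))"
  and flat_complete: "\<And>h. flat_near A E conn x h \<Longrightarrow>
   \<exists>a. \<forall>\<^sub>F y in nhds_rs A x. h y = (\<Sum>m<r. fscale (a m) (\<Sum>l<r. fscale (u m l y) (\<beta> l y)))"
begin

abbreviation B :: "('p, 'e \<times> ('i \<times> 2 \<Rightarrow> complex)) vbundle" where "B \<equiv> tensor_bundle E (bL_power Q (int n))"

definition f :: "nat \<Rightarrow> 'p \<Rightarrow> 'e \<Rightarrow> complex" where "f m y = (\<Sum>l<r. fscale (u m l y) (\<beta> l y))"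

text \<open>Sections written in the flat frame \<open>f\<close> of E rather than in the given one,
  so that parallel translation leaves the coefficients \<open>h m\<close> alone.\<close>

definition mk :: "(nat \<Rightarrow> 'p \<Rightarrow> complex) \<Rightarrow> 'p \<Rightarrow> 'e \<times> ('i \<times> 2 \<Rightarrow> complex) \<Rightarrow> complex" where
 "mk h y = (\<Sum>m<r. tens (f m y) (fscale (h m y) (fr (int n) y)))"

text \<open>Coefficients in the flat frame are polynomials in omega. Such sections represent every
  k-jet (\<open>model_approx\<close>), and the jet determines their coefficients up to degree
  k.\<close>

definition model :: "(nat \<Rightarrow> nat \<Rightarrow> complex) \<Rightarrow> 'p \<Rightarrow> 'e \<times> ('i \<times> 2 \<Rightarrow> complex) \<Rightarrow> complex" where
 "model a = mk (\<lambda>m y. \<Sum>j<k + 1. a m j * om y ^ j)"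

text \<open>The tensor with the same coefficients as \<open>model a\<close>; in these coordinates
  \<open>canonical_iso\<close> will be the identity.\<close>

definition Tr :: "(nat \<Rightarrow> nat \<Rightarrow> complex) \<Rightarrow> 'e \<times> ((('i \<times> 2 \<Rightarrow> complex) \<Rightarrow> complex) + ('i \<times> 2 \<Rightarrow> complex)) \<Rightarrow> complex" where
 "Tr a = (\<Sum>m<r. tens (\<beta> m x) (rep (a m)))"

lemma B: "vector_bundle A B" by (rule vector_bundle_tensor_line[OF A E line_bundle_bL])

lemma B_frame:
 "(D \<inter> {y \<in> dom Q i. b \<notin> dev Q i y}, r, \<lambda>l y. tens (\<beta> l y) (fr (int n) y)) \<in> frames B"
 unfolding frames_tensor_line[OF line_bundle_bL] fr_def
 by (intro CollectI exI[of _ D] exI[of _ r] exI[of _ \<beta>] exI[of _ "{y \<in> dom Q i. b \<notin> dev Q i y}"]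
   exI[of _ "\<lambda>_ y. quot_frame (flat_fiber Q y) (taut_fiber Q y) (int n) (glue Q i y b)"] conjI refl F bL_frame[OF i bx])

lemma B_dom: "x \<in> D \<inter> {y \<in> dom Q i. b \<notin> dev Q i y}" using xD i bx by simp

lemma f_x: "m < r \<Longrightarrow> f m x = \<beta> m x"
proof -
 assume m: "m < r"
 have "f m x = (\<Sum>l<r. if l = m then \<beta> l x else 0)"
  unfolding f_def by (rule sum.cong) (auto simp: u1 m cfun.scale_zero_left)
 then show ?thesis using m by simp
qed

lemma mk_frame: "mk h y = (\<Sum>l<r. fscale (\<Sum>m<r. u m l y * h m y) (tens (\<beta> l y) (fr (int n) y)))"
proof -
 have "mk h y = (\<Sum>m<r. \<Sum>l<r. fscale (u m l y * h m y) (tens (\<beta> l y) (fr (int n) y)))"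
  by (simp add: mk_def f_def tens_sum_left tens_fscale_left tens_fscale_right cfun.scale_sum_right mult.commute)
 also have "\<dots> = (\<Sum>l<r. \<Sum>m<r. fscale (u m l y * h m y) (tens (\<beta> l y) (fr (int n) y)))" by (rule sum.swap)
 finally show ?thesis by (simp add: cfun.scale_sum_left)
qed

lemma mk_coeff_hol: "(\<And>m. m < r \<Longrightarrow> hol_at A x (h m)) \<Longrightarrow> l < r \<Longrightarrow> hol_at A x (\<lambda>y. \<Sum>m<r. u m l y * h m y)"
 by (intro hol_at_sum[OF A xp] hol_at_mult[OF A xp] u) auto

lemma mk_local:
 assumes h: "\<And>m. m < r \<Longrightarrow> hol_at A x (h m)" shows "mk h \<in> local_sections A B x"
 unfolding local_sections_iff[OF A B B_frame B_dom]
proof (intro exI[of _ "\<lambda>l y. \<Sum>m<r. u m l y * h m y"] conjI allI impI)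
 show "hol_at A x (\<lambda>y. \<Sum>m<r. u m l y * h m y)" if "l < r" for l by (rule mk_coeff_hol[OF h that])
qed (simp add: mk_frame)

text \<open>The matrix \<open>u\<close> relates the flat frame to the given one and is the identity
  at \<open>x\<close>, so \<open>unipotent_vanish\<close> recovers the order of each flat
  coefficient.\<close>

lemma mk_vanishes:
 assumes h: "\<And>m. m < r \<Longrightarrow> hol_at A x (h m)"
 shows "vanishes_to_order A B d x (mk h) \<longleftrightarrow> (\<forall>m<r. vanish_at A d x (h m))"
proof -
 have "vanishes_to_order A B d x (mk h) \<longleftrightarrow> (\<forall>l<r. vanish_at A d x (\<lambda>y. \<Sum>m<r. u m l y * h m y))"
 proof (rule vanishes_coeff_iff[OF A B B_frame B_dom])
  show "hol_at A x (\<lambda>y. \<Sum>m<r. u m l y * h m y)" if "l < r" for l by (rule mk_coeff_hol[OF h that])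
 qed (simp add: mk_frame)
 also have "\<dots> \<longleftrightarrow> (\<forall>m<r. vanish_at A d x (h m))"
 proof (intro iffI allI impI)
  fix m assume v: "\<forall>l<r. vanish_at A d x (\<lambda>y. \<Sum>m<r. u m l y * h m y)" and m: "m < r"
  have v': "vanish_at A d x (\<lambda>y. \<Sum>m<r. u m l y * h m y)" if "l < r" for l using v that by blast
  show "vanish_at A d x (h m)"
   by (rule unipotent_vanish[where u = u, OF A xp om_uniformizer u u1 h v' m])
 next
  fix l assume v: "\<forall>m<r. vanish_at A d x (h m)" and l: "l < r"
  show "vanish_at A d x (\<lambda>y. \<Sum>m<r. u m l y * h m y)"
   by (rule vanish_at_sum[OF A xp], rule vanish_at_mult_hol[OF A xp u[OF _ l]]) (use v in auto)
 qed
 finally show ?thesis .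
qed

lemma mk_lincomb: "mk (\<lambda>m y. c * h m y + h' m y) y = fscale c (mk h y) + mk h' y"
 unfolding mk_def cfun.scale_sum_right sum.distrib[symmetric]
 by (rule sum.cong) (auto simp: fun_eq_iff algebra_simps)

lemma mk_diff: "mk (\<lambda>m y. h m y - h' m y) = mk h - mk h'"
 using mk_lincomb[of "-1" h' h] by (auto simp: fun_eq_iff)

lemma model_local: "model a \<in> local_sections A B x"
 unfolding model_def by (rule mk_local) (rule poly_hol)

lemma model_lincomb: "model (\<lambda>m j. c * a m j + a' m j) y = fscale c (model a y) + model a' y"
proof -
 have "(\<lambda>m y. \<Sum>j<k + 1. (c * a m j + a' m j) * om y ^ j)
   = (\<lambda>m y. c * (\<Sum>j<k + 1. a m j * om y ^ j) + (\<Sum>j<k + 1. a' m j * om y ^ j))"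
  by (simp only: sum.distrib sum_distrib_left distrib_right mult.assoc)
 then show ?thesis unfolding model_def mk_lincomb[symmetric] by simp
qed

text \<open>The holomorphic coefficients in the given frame are expanded by
  \<open>unipotent_taylor\<close>, which turns them into polynomials in omega in the flat
  frame.\<close>

lemma model_approx:
 assumes s: "s \<in> local_sections A B x" shows "\<exists>a. jet A B k x s = jet A B k x (model a)"
proof -
 obtain c where c: "\<forall>l<r. hol_at A x (c l)" "\<forall>\<^sub>F y in nhds_rs A x. s y = (\<Sum>l<r. fscale (c l y) (tens (\<beta> l y) (fr (int n) y)))"
  using s unfolding local_sections_iff[OF A B B_frame B_dom] by blast
 have ch: "hol_at A x (c l)" if "l < r" for l using c(1) that by blast
 have "\<exists>a. \<forall>l<r. vanish_at A (k + 1) x (\<lambda>y. c l y - (\<Sum>m<r. u m l y * (\<Sum>j<k + 1. a m j * om y ^ j)))"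
  by (rule unipotent_taylor[where u = u, OF A xp om_uniformizer u u1 ch])
 then obtain a where a: "\<forall>l<r. vanish_at A (k + 1) x (\<lambda>y. c l y - (\<Sum>m<r. u m l y * (\<Sum>j<k + 1. a m j * om y ^ j)))" ..
 have ev: "\<forall>\<^sub>F y in nhds_rs A x. (s - model a) y = (\<Sum>l<r. fscale (c l y - (\<Sum>m<r. u m l y * (\<Sum>j<k + 1. a m j * om y ^ j))) (tens (\<beta> l y) (fr (int n) y)))"
  using c(2) by eventually_elim (simp only: minus_apply model_def mk_frame cfun.scale_left_diff_distrib sum_subtractf)
 have "vanishes_to_order A B (k + 1) x (s - model a)"
  unfolding vanishes_to_order_iff[OF A B B_frame B_dom] using a ev
  by (intro exI[of _ "\<lambda>l y. c l y - (\<Sum>m<r. u m l y * (\<Sum>j<k + 1. a m j * om y ^ j))"] conjI)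
 then show ?thesis using jet_eq_iff[OF A B xp s model_local] by blast
qed

lemma tensor_fiber:
 assumes "cfun.subspace T"
 shows "tensor_space (fiber E x) T = {\<Sum>m<r. tens (\<beta> m x) (v m) |v. \<forall>m<r. v m \<in> T}"
 unfolding vector_bundleD(2)[OF E F xD] using tensor_space_frame[OF assms, of "\<lambda>l. \<beta> l x" r] .

lemma tensor_sum_fiber: "tensor_space (fiber E x) (sum_fiber Q n k x) = range Tr"
proof -
 have sub: "cfun.subspace (range rep)" unfolding cfun.subspace_def
 proof (intro conjI ballI allI)
  show "0 \<in> range rep" using rep_zero by (metis rangeI)
  show "p + q \<in> range rep" if pq: "p \<in> range rep" "q \<in> range rep" for p q
  proof -
   obtain d d' where "p = rep d" "q = rep d'" using pq by blast
   then have "p + q = rep (\<lambda>j. 1 * d j + d' j)" unfolding rep_lincomb by simp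
   then show ?thesis by blast
  qed
  show "fscale c p \<in> range rep" if p: "p \<in> range rep" for c p
  proof -
   obtain d where "p = rep d" using p by blast
   then have "fscale c p = rep (\<lambda>j. c * d j + 0)" using rep_lincomb[of c d "\<lambda>_. 0"] rep_zero by simp
   then show ?thesis by blast
  qed
 qed
 show ?thesis unfolding sum_fiber_rep tensor_fiber[OF sub]
 proof (rule equalityI; rule subsetI)
  fix T assume "T \<in> {\<Sum>m<r. tens (\<beta> m x) (v m) |v. \<forall>m<r. v m \<in> range rep}"
  then obtain v where v: "T = (\<Sum>m<r. tens (\<beta> m x) (v m))" "\<forall>m<r. v m \<in> range rep" by blast
  have "\<forall>m. \<exists>d. m < r \<longrightarrow> v m = rep d" using v(2) by blast
  from choice[OF this] obtain a where a: "\<forall>m. m < r \<longrightarrow> v m = rep (a m)" ..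
  have "T = Tr a" unfolding v(1) Tr_def by (rule sum.cong) (use a in auto)
  then show "T \<in> range Tr" by blast
 next
  fix T assume "T \<in> range Tr"
  then obtain a where "T = Tr a" by blast
  then show "T \<in> {\<Sum>m<r. tens (\<beta> m x) (v m) |v. \<forall>m<r. v m \<in> range rep}"
   by (intro CollectI exI[of _ "\<lambda>m. rep (a m)"]) (simp add: Tr_def)
 qed
qed

lemma Tr_lincomb: "Tr (\<lambda>m j. c * a m j + a' m j) = fscale c (Tr a) + Tr a'"
 unfolding Tr_def rep_lincomb by (simp only: tens_add_right tens_fscale_right sum.distrib cfun.scale_sum_right)

lemma Tr_cong: "(\<And>m j. m < r \<Longrightarrow> j < k + 1 \<Longrightarrow> a m j = a' m j) \<Longrightarrow> Tr a = Tr a'"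
 unfolding Tr_def by (intro sum.cong refl arg_cong2[where f = tens] rep_cong) simp_all

lemma Tr_inj:
 assumes "Tr a = Tr a'" "m < r" "j < k + 1" shows "a m j = a' m j"
proof -
 have "(\<Sum>m<r. tens (\<beta> m x) (rep (\<lambda>j. - 1 * a' m j + a m j))) = 0"
  using Tr_lincomb[of "-1" a' a] assms(1) unfolding Tr_def by (simp add: fun_eq_iff)
 then have "rep (\<lambda>j. - 1 * a' m j + a m j) = 0"
  by (rule tens_frame_zero[rotated]) (use vector_bundleD(3)[OF E F xD] assms(2) in auto)
 then have "\<forall>j<k + 1. - 1 * a' m j + a m j = 0" by (rule rep_eq_zero)
 then show ?thesis using assms(3) by simp
qed

lemma model_jet_inj:
 assumes "jet A B k x (model a) = jet A B k x (model a')" shows "Tr a = Tr a'"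
proof (rule Tr_cong)
 fix m j assume m: "m < r" and j: "j < k + 1"
 have "vanishes_to_order A B (k + 1) x (model a - model a')"
  using assms jet_eq_iff[OF A B xp model_local model_local] by blast
 then have "vanishes_to_order A B (k + 1) x (mk (\<lambda>m y. (\<Sum>j<k + 1. a m j * om y ^ j) - (\<Sum>j<k + 1. a' m j * om y ^ j)))"
  unfolding model_def mk_diff .
 then have "vanish_at A (k + 1) x (\<lambda>y. (\<Sum>j<k + 1. a m j * om y ^ j) - (\<Sum>j<k + 1. a' m j * om y ^ j))"
  using mk_vanishes[where d = "k + 1" and h = "\<lambda>m y. (\<Sum>j<k + 1. a m j * om y ^ j) - (\<Sum>j<k + 1. a' m j * om y ^ j)",
    OF hol_at_diff[OF A xp poly_hol poly_hol]] m by blast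
 then have "vanish_at A (k + 1) x (\<lambda>y. \<Sum>j<k + 1. (a m j - a' m j) * om y ^ j)"
  by (simp only: left_diff_distrib sum_subtractf)
 then have "\<forall>j<k + 1. a m j - a' m j = 0" by (rule taylor_unique[OF A xp om_uniformizer])
 then show "a m j = a' m j" using j by simp
qed

text \<open>The flat frame and the sections with polynomial coefficients are one presentation of
  \<open>Tr a\<close>. Any other presentation has flat sections that are constant combinations of
  the frame; its coefficients add up to those of \<open>a\<close>, so it yields the same
  jet.\<close>

lemma canonical_iso_Tr: "canonical_iso A w Q E conn n k x (Tr a) = jet A B k x (model a)"
 unfolding canonical_iso_def
proof (rule the_equality)
 define s where "s = (\<lambda>m y. fscale (\<Sum>j<k + 1. a m j * om y ^ j) (fr (int n) y))"
 define t where "t = (\<lambda>m. fscale (a m k) (fr (- int (k + 1)) x))"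
 have val: "\<forall>\<^sub>F y in nhds_rs A x. s m y (glue Q i y b) = (\<Sum>j<k + 1. a m j * om y ^ j)" for m
  using eventually_complement by eventually_elim (simp add: s_def fr_self)
 have s: "s m \<in> local_sections A (bL_power Q (int n)) x" for m
  unfolding bL_local(1)[OF i bx]
 proof
  show "\<forall>\<^sub>F y in nhds_rs A x. s m y \<in> quot_power (flat_fiber Q y) (taut_fiber Q y) (int n)"
   using eventually_complement
  proof eventually_elim
   case (elim y)
   then show ?case unfolding bL_frame_facts(1)[OF i(1) elim[THEN conjunct1] elim[THEN conjunct2]] s_def fr_def by (intro rangeI)
  qed
  show "hol_at A x (\<lambda>y. s m y (glue Q i y b))"
   unfolding hol_at_cong[OF A xp val] by (rule poly_hol)
 qed
 have t: "t m \<in> fiber (bL_power Q (- int (k + 1))) x" for m unfolding t_def fiber_fr by (rule rangeI)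
 have rp: "case_sum (rep_sym (a m)) (t m) = rep (a m)" for m by (simp only: rep_def t_def)
 have ev0: "\<forall>\<^sub>F y in nhds_rs A x. s m y (glue Q i y b) - (\<Sum>j<k + 1. a m j * om y ^ j) = 0" for m
  using val[of m] by eventually_elim simp
 have "jet A (bL_power Q (int n)) k x (s m) = jet_iso_bL A w Q n k x (rep_sym (a m)) (t m)" for m
  unfolding jet_rep_iff[OF rep_sym_mem t s rp] vanish_at_cong[OF A xp ev0] by (rule vanish_at_zero[OF A xp])
 moreover have "Tr a = (\<Sum>m<r. tens (f m x) (case_sum (rep_sym (a m)) (t m)))"
  unfolding Tr_def rp by (rule sum.cong) (simp_all add: f_x)
 moreover have "model a = (\<lambda>y. \<Sum>m<r. tens (f m y) (s m y))" by (intro ext) (simp only: model_def mk_def s_def)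
 moreover have "flat_near A E conn x (f m)" if "m < r" for m using flat[OF that] unfolding f_def .
 ultimately show "\<exists>(N::nat) e P t s. (\<forall>l<N. flat_near A E conn x (e l) \<and> P l \<in> sym_power n (flat_fiber Q x) \<and>
   t l \<in> fiber (bL_power Q (- int (k + 1))) x \<and> s l \<in> local_sections A (bL_power Q (int n)) x \<and>
   jet A (bL_power Q (int n)) k x (s l) = jet_iso_bL A w Q n k x (P l) (t l)) \<and>
  Tr a = (\<Sum>l<N. tens (e l x) (case_sum (P l) (t l))) \<and>
  jet A B k x (model a) = jet A B k x (\<lambda>y. \<Sum>l<N. tens (e l y) (s l y))"
  using s t rep_sym_mem by (intro exI[of _ r] exI[of _ f] exI[of _ "\<lambda>m. rep_sym (a m)"] exI[of _ t] exI[of _ s]) simp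
next
 fix j assume "\<exists>(N::nat) e P t s. (\<forall>l<N. flat_near A E conn x (e l) \<and> P l \<in> sym_power n (flat_fiber Q x) \<and>
   t l \<in> fiber (bL_power Q (- int (k + 1))) x \<and> s l \<in> local_sections A (bL_power Q (int n)) x \<and>
   jet A (bL_power Q (int n)) k x (s l) = jet_iso_bL A w Q n k x (P l) (t l)) \<and>
  Tr a = (\<Sum>l<N. tens (e l x) (case_sum (P l) (t l))) \<and>
  j = jet A B k x (\<lambda>y. \<Sum>l<N. tens (e l y) (s l y))"
 then obtain N :: nat and g P t s where H: "\<forall>l<N. flat_near A E conn x (g l) \<and> P l \<in> sym_power n (flat_fiber Q x) \<and>
   t l \<in> fiber (bL_power Q (- int (k + 1))) x \<and> s l \<in> local_sections A (bL_power Q (int n)) x \<and>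
   jet A (bL_power Q (int n)) k x (s l) = jet_iso_bL A w Q n k x (P l) (t l)"
  and T: "Tr a = (\<Sum>l<N. tens (g l x) (case_sum (P l) (t l)))"
  and j: "j = jet A B k x (\<lambda>y. \<Sum>l<N. tens (g l y) (s l y))" by blast
 let ?S = "\<lambda>y. \<Sum>l<N. tens (g l y) (s l y)"
 have "\<forall>l. \<exists>c. l < N \<longrightarrow> (\<forall>\<^sub>F y in nhds_rs A x. g l y = (\<Sum>m<r. fscale (c m) (f m y)))"
  using flat_complete H unfolding f_def by blast
 from choice[OF this] obtain c where c: "\<forall>l. l < N \<longrightarrow> (\<forall>\<^sub>F y in nhds_rs A x. g l y = (\<Sum>m<r. fscale (c l m) (f m y)))" ..
 have "case_sum (P l) (t l) \<in> range rep" if "l < N" for l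
  unfolding sum_fiber_rep[symmetric] sum_fiber_def direct_sum_def using H that by blast
 then have "\<forall>l. \<exists>d. l < N \<longrightarrow> case_sum (P l) (t l) = rep d" by blast
 from choice[OF this] obtain d where d: "\<forall>l. l < N \<longrightarrow> case_sum (P l) (t l) = rep (d l)" ..
 have gx: "g l x = (\<Sum>m<r. fscale (c l m) (\<beta> m x))" if "l < N" for l
  using eventually_nhds_rs_x[OF A xp c[rule_format, OF that]] by (simp add: f_x)
 have "Tr a = (\<Sum>l<N. \<Sum>m<r. tens (\<beta> m x) (fscale (c l m) (rep (d l))))"
  unfolding T using d gx by (intro sum.cong) (simp_all add: tens_sum_left tens_fscale_left tens_fscale_right)
 also have "\<dots> = (\<Sum>m<r. \<Sum>l<N. tens (\<beta> m x) (fscale (c l m) (rep (d l))))" by (rule sum.swap)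
 also have "\<dots> = Tr (\<lambda>m j. \<Sum>l<N. c l m * d l j)"
  unfolding Tr_def rep_sum by (simp only: tens_sum_right)
 \<comment> \<open>By \<open>Tr_inj\<close> this fixes the sums of coefficients in all degrees up to
   k, although the single summands of a presentation are arbitrary.\<close>
 finally have aT: "Tr a = Tr (\<lambda>m j. \<Sum>l<N. c l m * d l j)" .
 define h where "h = (\<lambda>m y. \<Sum>l<N. c l m * s l y (glue Q i y b))"
 have sl: "\<forall>\<^sub>F y in nhds_rs A x. s l y \<in> quot_power (flat_fiber Q y) (taut_fiber Q y) (int n)"
   "hol_at A x (\<lambda>y. s l y (glue Q i y b))" if "l < N" for l
  using H that bL_local(1)[OF i bx] by blast+
 have hh: "hol_at A x (h m)" for m
  unfolding h_def by (intro hol_at_sum[OF A xp] hol_at_mult[OF A xp] hol_at_const[OF A xp] sl(2)) simp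
 have all: "\<forall>\<^sub>F y in nhds_rs A x. \<forall>l\<in>{..<N}. g l y = (\<Sum>m<r. fscale (c l m) (f m y)) \<and>
   s l y \<in> quot_power (flat_fiber Q y) (taut_fiber Q y) (int n)"
 proof (rule eventually_ball_finite)
  show "\<forall>l\<in>{..<N}. \<forall>\<^sub>F y in nhds_rs A x. g l y = (\<Sum>m<r. fscale (c l m) (f m y)) \<and>
   s l y \<in> quot_power (flat_fiber Q y) (taut_fiber Q y) (int n)"
   using c sl(1) by (simp add: eventually_conj_iff)
 qed simp
 have S: "\<forall>\<^sub>F y in nhds_rs A x. ?S y = mk h y"
  using all eventually_complement
 proof eventually_elim
  case (elim y)
  have "?S y = (\<Sum>l<N. \<Sum>m<r. tens (f m y) (fscale (c l m * s l y (glue Q i y b)) (fr (int n) y)))"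
  proof (rule sum.cong[OF refl])
   fix l assume l: "l \<in> {..<N}"
   have sy: "s l y = fscale (s l y (glue Q i y b)) (fr (int n) y)"
    by (rule bL_value) (use elim l in blast)+
   have gy: "g l y = (\<Sum>m<r. fscale (c l m) (f m y))" using elim l by blast
   have "tens (g l y) (s l y) = tens (\<Sum>m<r. fscale (c l m) (f m y)) (fscale (s l y (glue Q i y b)) (fr (int n) y))"
    using gy sy by metis
   then show "tens (g l y) (s l y) = (\<Sum>m<r. tens (f m y) (fscale (c l m * s l y (glue Q i y b)) (fr (int n) y)))"
    by (simp only: tens_sum_left tens_fscale_left tens_fscale_right cfun.scale_sum_right cfun.scale_scale mult.commute)
  qed
  also have "\<dots> = (\<Sum>m<r. \<Sum>l<N. tens (f m y) (fscale (c l m * s l y (glue Q i y b)) (fr (int n) y)))" by (rule sum.swap)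
  finally show ?case unfolding mk_def h_def by (simp only: cfun.scale_sum_left tens_sum_right)
 qed
 have Sl: "?S \<in> local_sections A B x"
  unfolding local_sections_cong[OF A B xp S] by (rule mk_local[OF hh])
 have ev: "\<forall>\<^sub>F y in nhds_rs A x. (?S - model a) y = mk (\<lambda>m y. h m y - (\<Sum>j<k + 1. a m j * om y ^ j)) y"
  using S by eventually_elim (simp only: minus_apply mk_diff model_def)
 have "vanish_at A (k + 1) x (\<lambda>y. h m y - (\<Sum>j<k + 1. a m j * om y ^ j))" if m: "m < r" for m
 proof -
  have am: "a m j = (\<Sum>l<N. c l m * d l j)" if "j < k + 1" for j using Tr_inj[OF aT m that] .
  have "vanish_at A (k + 1) x (\<lambda>y. \<Sum>l<N. c l m * (s l y (glue Q i y b) - (\<Sum>j<k + 1. d l j * om y ^ j)))"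
  proof (rule vanish_at_sum[OF A xp], rule vanish_at_cmult[OF A xp])
   fix l assume "l \<in> {..<N}"
   then have l: "l < N" by simp
   then show "vanish_at A (k + 1) x (\<lambda>y. s l y (glue Q i y b) - (\<Sum>j<k + 1. d l j * om y ^ j))"
    using H jet_rep_iff[of "P l" "t l" "s l" "d l"] d by blast
  qed
  moreover have "(\<Sum>l<N. c l m * (s l y (glue Q i y b) - (\<Sum>j<k + 1. d l j * om y ^ j))) = h m y - (\<Sum>j<k + 1. a m j * om y ^ j)" for y
  proof -
   have "(\<Sum>j<k + 1. a m j * om y ^ j) = (\<Sum>j<k + 1. \<Sum>l<N. c l m * (d l j * om y ^ j))"
    by (rule sum.cong) (simp_all add: am sum_distrib_right mult.assoc)
   also have "\<dots> = (\<Sum>l<N. \<Sum>j<k + 1. c l m * (d l j * om y ^ j))" by (rule sum.swap)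
   finally show ?thesis by (simp only: h_def right_diff_distrib sum_subtractf sum_distrib_left)
  qed
  ultimately show ?thesis by simp
 qed
 then have "vanishes_to_order A B (k + 1) x (?S - model a)"
  unfolding vanishes_cong[OF A B xp ev] using mk_vanishes[where d = "k + 1" and h = "\<lambda>m y. h m y - (\<Sum>j<k + 1. a m j * om y ^ j)", OF hol_at_diff[OF A xp hh poly_hol]] by blast
 then show "j = jet A B k x (model a)" unfolding j jet_eq_iff[OF A B xp Sl model_local] .
qed

text \<open>Through \<open>Tr\<close> and \<open>model\<close> the map is linear in the coefficients
  \<open>a\<close>; it is onto by Taylor expansion in the flat frame and injective by uniqueness of
  Taylor coefficients.\<close>

lemma canonical_iso_linear: "jet_linear_iso A B k x (tensor_space (fiber E x) (sum_fiber Q n k x)) (canonical_iso A w Q E conn n k x)"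
 unfolding jet_linear_iso_def tensor_sum_fiber bij_betw_def
proof (intro conjI ballI allI)
 show "inj_on (canonical_iso A w Q E conn n k x) (range Tr)"
  by (rule inj_onI) (auto simp: canonical_iso_Tr intro: model_jet_inj)
 show "canonical_iso A w Q E conn n k x ` range Tr = jet_fiber A B k x"
  unfolding jet_fiber_def
 proof (rule equalityI; rule subsetI)
  fix j assume "j \<in> canonical_iso A w Q E conn n k x ` range Tr"
  then show "j \<in> jet A B k x ` local_sections A B x" using canonical_iso_Tr model_local by auto
 next
  fix j assume "j \<in> jet A B k x ` local_sections A B x"
  then obtain s where s: "s \<in> local_sections A B x" "j = jet A B k x s" by blast
  obtain a where "jet A B k x s = jet A B k x (model a)" using model_approx[OF s(1)] ..
  then have "j = canonical_iso A w Q E conn n k x (Tr a)" using s(2) canonical_iso_Tr by simp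
  then show "j \<in> canonical_iso A w Q E conn n k x ` range Tr" by blast
 qed
next
 fix p q c s t assume pq: "p \<in> range Tr" "q \<in> range Tr"
  and st: "s \<in> canonical_iso A w Q E conn n k x p" "t \<in> canonical_iso A w Q E conn n k x q"
 obtain a a' where a: "p = Tr a" "q = Tr a'" using pq by blast
 have s: "s \<in> local_sections A B x" "vanishes_to_order A B (k + 1) x (s - model a)"
  and t: "t \<in> local_sections A B x" "vanishes_to_order A B (k + 1) x (t - model a')"
  using st unfolding a canonical_iso_Tr jet_def by blast+
 have "(\<lambda>y. fscale c ((s - model a) y) + (t - model a') y)
   = (\<lambda>y. fscale c (s y) + t y) - model (\<lambda>m j. c * a m j + a' m j)"
  unfolding fun_eq_iff[of _ "_ - _"] minus_apply model_lincomb by (simp add: fun_eq_iff algebra_simps)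
 then have "vanishes_to_order A B (k + 1) x ((\<lambda>y. fscale c (s y) + t y) - model (\<lambda>m j. c * a m j + a' m j))"
  using vanishes_lincomb[OF A B xp s(2) t(2), of c] by simp
 then show "canonical_iso A w Q E conn n k x (fscale c p + q) = jet A B k x (\<lambda>y. fscale c (s y) + t y)"
  unfolding a Tr_lincomb[symmetric] canonical_iso_Tr
  using jet_eq_iff[OF A B xp local_sections_lincomb[OF A B xp s(1) t(1)] model_local] by blast
qed

section \<open>The symbol on the summand with the power -(k + 1)\<close>

context
 fixes \<alpha> :: "nat \<Rightarrow> complex" and T :: "'e \<times> ('i \<times> 2 \<Rightarrow> complex) \<Rightarrow> complex"
 assumes T: "T = (\<Sum>m<r. tens (\<beta> m x) (fscale (\<alpha> m) (fr (- int (k + 1)) x)))"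
begin

lemma embed_Tr: "(\<lambda>(a, q). case q of Inl p \<Rightarrow> 0 | Inr c \<Rightarrow> T (a, c)) = Tr (\<lambda>m j. if j = k then \<alpha> m else 0)"
proof (rule ext, clarify)
 fix a q
 have z: "rep_sym (\<lambda>j. if j = k then \<alpha> m else 0) = 0" for m
  unfolding rep_sym_def binary_form_def by (auto simp: fun_eq_iff k intro!: sum.neutral)
 show "(case q of Inl p \<Rightarrow> 0 | Inr c \<Rightarrow> T (a, c)) = Tr (\<lambda>m j. if j = k then \<alpha> m else 0) (a, q)"
  by (cases q) (simp_all add: T Tr_def sum_fun_apply rep_def z)
qed

lemma model_top: "model (\<lambda>m j. if j = k then \<alpha> m else 0) = mk (\<lambda>m y. \<alpha> m * om y ^ k)"
 unfolding model_def by (simp add: if_distrib[of "\<lambda>c. c * _"] cong: if_cong)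

lemma twist_eq:
 assumes "(D', z) \<in> A" "x \<in> D'"
 shows "twist_by_K A w Q k x T (p, (D', z)) = deriv (om \<circ> inv_into D' z) (z x) ^ k * mk (\<lambda>m y. \<alpha> m) x p"
proof (cases p)
 case (Pair a q)
 have "T (a, q) * bL_form w Q (D', z) x q ^ k
   = (\<Sum>m<r. \<beta> m x a * \<alpha> m) * (fr (- int (k + 1)) x q * bL_form w Q (D', z) x q ^ k)"
  by (simp add: T sum_fun_apply sum_distrib_right mult.assoc)
 also have "\<dots> = deriv (om \<circ> inv_into D' z) (z x) ^ k * mk (\<lambda>m y. \<alpha> m) x p"
  unfolding fr_bL_form[OF assms] by (simp add: mk_def Pair sum_fun_apply f_x sum_distrib_left sum_distrib_right mult_ac)
 finally show ?thesis using assms by (simp add: twist_by_K_def Pair)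
qed

text \<open>By \<open>twist_eq\<close> the twist is a pure tensor whose second factor
  \<open>\<sigma>\<close> is the k-th power of the differential of omega at \<open>x\<close>; its
  coefficients obey the chain rule \<open>deriv_chart_change\<close>.\<close>

lemma twist_mem: "twist_by_K A w Q k x T \<in> fiber (tensor_bundle B (canonical_power A k)) x"
proof -
 define \<sigma> where "\<sigma> = (\<lambda>\<kappa>. if \<kappa> \<in> A \<and> x \<in> fst \<kappa> then deriv (om \<circ> inv_into (fst \<kappa>) (snd \<kappa>)) (snd \<kappa> x) ^ k else 0)"
 have "twist_by_K A w Q k x T (p, D', z) = tens (mk (\<lambda>m y. \<alpha> m) x) \<sigma> (p, D', z)" for p D' z
  using twist_eq[of D' z p] by (cases p) (auto simp: \<sigma>_def twist_by_K_def)
 then have "twist_by_K A w Q k x T = tens (mk (\<lambda>m y. \<alpha> m) x) \<sigma>" by (auto simp: fun_eq_iff)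
 moreover have "mk (\<lambda>m y. \<alpha> m) x \<in> fiber B x"
 proof -
  have "fscale c (fr (int n) x) \<in> fiber (bL_power Q (int n)) x" for c unfolding fiber_fr by (rule rangeI)
  moreover have "\<beta> m x \<in> fiber E x" if "m < r" for m
   unfolding vector_bundleD(2)[OF E F xD] using that by (intro cfun.span_base) blast
  ultimately show ?thesis
   unfolding tensor_bundle_def vbundle.select_convs tensor_space_def mk_def
   by (intro cfun.span_sum cfun.span_base) (auto simp: f_x)
 qed
 moreover have "\<sigma> \<in> fiber (canonical_power A k) x"
  unfolding canonical_power_def vbundle.select_convs mem_Collect_eq
 proof (intro conjI allI impI ballI)
  show "\<sigma> \<kappa> = 0" if "\<not> (\<kappa> \<in> A \<and> x \<in> fst \<kappa>)" for \<kappa> using that by (auto simp: \<sigma>_def)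
  show "\<sigma> \<kappa>' = coord_change \<kappa> \<kappa>' x ^ k * \<sigma> \<kappa>" if H: "\<kappa> \<in> A" "\<kappa>' \<in> A" "x \<in> fst \<kappa> \<inter> fst \<kappa>'" for \<kappa> \<kappa>'
  proof -
   obtain D1 z1 D2 z2 where c: "\<kappa> = (D1, z1)" "\<kappa>' = (D2, z2)" by (cases \<kappa>, cases \<kappa>')
   show ?thesis
    using deriv_chart_change[OF A _ _ _ _ om_hol, of D1 z1 D2 z2] H
    by (simp add: c \<sigma>_def power_mult_distrib mult.commute)
  qed
 qed
 ultimately show ?thesis
  unfolding tensor_bundle_def[of B] vbundle.select_convs tensor_space_def by (auto intro: cfun.span_base)
qed

text \<open>Omega is (z - z x) times a germ whose value at \<open>x\<close> is the derivative of
  omega. Hence the k-th power of z - z x times \<open>s\<close> and the model of degree k have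
  cofactors with the same value at \<open>x\<close>, and they agree modulo order k + 1 for every
  admissible chart and \<open>s\<close>.\<close>

lemma jet_incl_twist: "jet_incl A B k x (twist_by_K A w Q k x T) = jet A B k x (mk (\<lambda>m y. \<alpha> m * om y ^ k))"
proof -
 have key: "jet A B k x (\<lambda>y. fscale ((z y - z x) ^ k) (s y)) = jet A B k x (mk (\<lambda>m y. \<alpha> m * om y ^ k))"
  if D': "(D', z) \<in> A" "x \<in> D'" and s: "s \<in> local_sections A B x" "s x = (\<lambda>p. twist_by_K A w Q k x T (p, (D', z)))" for D' z s
 proof -
  let ?h = "deriv (om \<circ> inv_into D' z) (z x)" and ?\<zeta> = "\<lambda>y. z y - z x"
  note U = uniformizer_coord[OF A D']
  obtain g where g: "hol_at A x g" "\<forall>\<^sub>F y in nhds_rs A x. om y = (z y - z x) * g y" "g x = ?h"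
   using om_derivE[OF D'] .
  \<comment> \<open>Constant coefficients in the flat frame and the same value at \<open>x\<close>
    as \<open>s\<close>: the two differ by a section vanishing at \<open>x\<close>, which the factor
    of order k raises to order k + 1.\<close>
  let ?M = "mk (\<lambda>m y. \<alpha> m * ?h ^ k)"
  have Ml: "?M \<in> local_sections A B x" by (rule mk_local) (rule hol_at_const[OF A xp])
  have "?M x = s x" unfolding s(2) using twist_eq[OF D']
   by (simp add: fun_eq_iff mk_def sum_fun_apply sum_distrib_left split: prod.splits) (simp add: mult_ac)
  then have "(\<lambda>y. fscale (- 1) (?M y) + s y) x = 0" by (simp add: fun_eq_iff)
  note V1 = vanishes_1I[OF A B xp local_sections_lincomb[OF A B xp Ml s(1)] this]
  have "vanish_at A k x (\<lambda>y. ?\<zeta> y ^ k)"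
   using vanish_at_uniformizer_power[OF A xp U hol_at_const[OF A xp, of 1], of k] by simp
  from vanishes_mult[OF A B xp this V1]
  have "vanishes_to_order A B (k + 1) x (\<lambda>y. fscale (?\<zeta> y ^ k) (fscale (- 1) (?M y) + s y))" .
  moreover have "vanishes_to_order A B (k + 1) x (mk (\<lambda>m y. ?\<zeta> y ^ k * (\<alpha> m * ?h ^ k) - \<alpha> m * om y ^ k))"
  proof -
   have hol: "hol_at A x (\<lambda>y. ?\<zeta> y ^ k * (\<alpha> m * ?h ^ k) - \<alpha> m * om y ^ k)" for m
    by (intro hol_at_diff[OF A xp] hol_at_mult[OF A xp] hol_at_power[OF A xp] hol_at_const[OF A xp] hol_at_coord[OF A D'] om_hol)
   have "vanish_at A (k + 1) x (\<lambda>y. ?\<zeta> y ^ k * (\<alpha> m * ?h ^ k) - \<alpha> m * om y ^ k)" for m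
   proof -
    have G: "hol_at A x (\<lambda>y. \<alpha> m * ?h ^ k - \<alpha> m * g y ^ k)"
     by (intro hol_at_diff[OF A xp] hol_at_mult[OF A xp] hol_at_power[OF A xp] hol_at_const[OF A xp] g(1))
    have "vanish_at A 1 x (\<lambda>y. \<alpha> m * ?h ^ k - \<alpha> m * g y ^ k)" by (rule vanish_at_1[OF A xp G]) (simp add: g(3))
    then have "vanish_at A (k + 1) x (\<lambda>y. ?\<zeta> y ^ k * (\<alpha> m * ?h ^ k - \<alpha> m * g y ^ k))"
     using vanish_at_cancel_power[OF A xp U G] by blast
    moreover have ev: "\<forall>\<^sub>F y in nhds_rs A x. ?\<zeta> y ^ k * (\<alpha> m * ?h ^ k) - \<alpha> m * om y ^ k = ?\<zeta> y ^ k * (\<alpha> m * ?h ^ k - \<alpha> m * g y ^ k)"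
     using g(2) by eventually_elim (simp add: power_mult_distrib right_diff_distrib mult.left_commute)
    ultimately show ?thesis using vanish_at_cong[OF A xp ev] by simp
   qed
   then show ?thesis using mk_vanishes[where d = "k + 1" and h = "\<lambda>m y. ?\<zeta> y ^ k * (\<alpha> m * ?h ^ k) - \<alpha> m * om y ^ k", OF hol] by blast
  qed
  ultimately have "vanishes_to_order A B (k + 1) x
    (\<lambda>y. fscale 1 (fscale (?\<zeta> y ^ k) (fscale (- 1) (?M y) + s y)) + mk (\<lambda>m y. ?\<zeta> y ^ k * (\<alpha> m * ?h ^ k) - \<alpha> m * om y ^ k) y)"
   by (rule vanishes_lincomb[OF A B xp])
  moreover have "fscale 1 (fscale (?\<zeta> y ^ k) (fscale (- 1) (?M y) + s y)) + mk (\<lambda>m y. ?\<zeta> y ^ k * (\<alpha> m * ?h ^ k) - \<alpha> m * om y ^ k) y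
    = fscale (?\<zeta> y ^ k) (s y) - mk (\<lambda>m y. \<alpha> m * om y ^ k) y" for y
  proof -
   have "mk (\<lambda>m y. ?\<zeta> y ^ k * (\<alpha> m * ?h ^ k)) y = fscale (?\<zeta> y ^ k) (?M y)"
    by (simp only: mk_def cfun.scale_sum_right tens_fscale_right cfun.scale_scale)
   then show ?thesis unfolding mk_diff minus_apply by (simp add: fun_eq_iff algebra_simps)
  qed
  ultimately have V: "vanishes_to_order A B (k + 1) x ((\<lambda>y. fscale (?\<zeta> y ^ k) (s y)) - mk (\<lambda>m y. \<alpha> m * om y ^ k))"
   by (simp add: fun_diff_def)
  have l1: "mk (\<lambda>m y. \<alpha> m * om y ^ k) \<in> local_sections A B x"
   by (intro mk_local hol_at_mult[OF A xp] hol_at_power[OF A xp] hol_at_const[OF A xp] om_hol)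
  have "(\<lambda>y. fscale 1 (((\<lambda>y. fscale (?\<zeta> y ^ k) (s y)) - mk (\<lambda>m y. \<alpha> m * om y ^ k)) y) + mk (\<lambda>m y. \<alpha> m * om y ^ k) y) \<in> local_sections A B x"
   by (rule local_sections_lincomb[OF A B xp vanishes_local_section[OF A B xp V] l1])
  then have l2: "(\<lambda>y. fscale (?\<zeta> y ^ k) (s y)) \<in> local_sections A B x" by simp
  show ?thesis unfolding jet_eq_iff[OF A B xp l2 l1] by (rule V)
 qed
 show ?thesis unfolding jet_incl_def
 proof (rule the_equality)
  obtain D' z where D': "(D', z) \<in> A" "x \<in> D'" using points_E[OF xp] .
  let ?M = "mk (\<lambda>m y. \<alpha> m * deriv (om \<circ> inv_into D' z) (z x) ^ k)"
  have M: "?M \<in> local_sections A B x" by (rule mk_local) (rule hol_at_const[OF A xp])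
  have Mx: "?M x = (\<lambda>p. twist_by_K A w Q k x T (p, (D', z)))" using twist_eq[OF D']
   by (simp add: fun_eq_iff mk_def sum_fun_apply sum_distrib_left split: prod.splits) (simp add: mult_ac)
  show "\<exists>(D', z)\<in>A. \<exists>s\<in>local_sections A B x. x \<in> D' \<and> s x = (\<lambda>p. twist_by_K A w Q k x T (p, D', z)) \<and>
    jet A B k x (mk (\<lambda>m y. \<alpha> m * om y ^ k)) = jet A B k x (\<lambda>y. fscale ((z y - z x) ^ k) (s y))"
   using key[OF D' M Mx] D' M Mx by (intro bexI[of _ "(D', z)"]) auto
 next
  fix j assume "\<exists>(D', z)\<in>A. \<exists>s\<in>local_sections A B x. x \<in> D' \<and> s x = (\<lambda>p. twist_by_K A w Q k x T (p, D', z)) \<and>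
    j = jet A B k x (\<lambda>y. fscale ((z y - z x) ^ k) (s y))"
  then obtain D' z s where "(D', z) \<in> A" "x \<in> D'" "s \<in> local_sections A B x" "s x = (\<lambda>p. twist_by_K A w Q k x T (p, D', z))"
   "j = jet A B k x (\<lambda>y. fscale ((z y - z x) ^ k) (s y))" by blast
  with key show "j = jet A B k x (mk (\<lambda>m y. \<alpha> m * om y ^ k))" by simp
 qed
qed

lemma symbol_twist:
 "symbol A B k x \<delta> (twist_by_K A w Q k x T)
  = \<delta> (canonical_iso A w Q E conn n k x (\<lambda>(a, q). case q of Inl p \<Rightarrow> 0 | Inr c \<Rightarrow> T (a, c)))"
 using twist_mem unfolding symbol_def by (simp add: jet_incl_twist embed_Tr canonical_iso_Tr model_top)

end

text \<open>In the flat frame an element of the second summand has one coefficient per frame vector.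
  For these coordinates \<open>jet_incl\<close> and \<open>canonical_iso\<close> produce the same
  jet, and \<open>\<delta>\<close> is applied to it on both sides.\<close>

lemma symbol_is_projection:
 "(\<lambda>T\<in>tensor_space (fiber E x) (fiber (bL_power Q (- int (k + 1))) x). symbol A B k x \<delta> (twist_by_K A w Q k x T))
  = Id_tensor_projection (fiber E x) (fiber (bL_power Q (- int (k + 1))) x) (\<lambda>T. \<delta> (canonical_iso A w Q E conn n k x T))"
 unfolding Id_tensor_projection_def
proof (rule restrict_ext)
 fix T assume T: "T \<in> tensor_space (fiber E x) (fiber (bL_power Q (- int (k + 1))) x)"
 have sub: "cfun.subspace (fiber (bL_power Q (- int (k + 1))) x)"
  unfolding vector_bundleD(2)[OF vector_bundle_bL bL_frame[OF i bx] conjunct2[OF B_dom[unfolded Int_iff]]] by (rule cfun.subspace_span)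
 obtain v where v: "T = (\<Sum>m<r. tens (\<beta> m x) (v m))" "\<forall>m<r. v m \<in> fiber (bL_power Q (- int (k + 1))) x"
  using T unfolding tensor_fiber[OF sub] by blast
 have "\<forall>m. \<exists>a. m < r \<longrightarrow> v m = fscale a (fr (- int (k + 1)) x)" using v(2) unfolding fiber_fr by blast
 from choice[OF this] obtain \<alpha> where \<alpha>: "\<forall>m. m < r \<longrightarrow> v m = fscale (\<alpha> m) (fr (- int (k + 1)) x)" ..
 have "T = (\<Sum>m<r. tens (\<beta> m x) (fscale (\<alpha> m) (fr (- int (k + 1)) x)))"
  unfolding v(1) by (rule sum.cong) (use \<alpha> in auto)
 then show "symbol A B k x \<delta> (twist_by_K A w Q k x T)
   = \<delta> (canonical_iso A w Q E conn n k x (\<lambda>(a, q). case q of Inl b \<Rightarrow> 0 | Inr c \<Rightarrow> T (a, c)))"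
  by (rule symbol_twist)
qed

end

theorem corollary4p11:
 fixes A :: "'p chart set"
  and w :: "2 \<times> 2 \<Rightarrow> complex"
  and Q :: "('p, 'i) projective_atlas"
  and E :: "('p, 'e) vbundle"
  and conn :: "('p \<Rightarrow> 'e \<Rightarrow> complex) \<Rightarrow> 'p \<Rightarrow> 'e \<times> 'p chart \<Rightarrow> complex"
  and F :: "('p, 'f) vbundle"
  and g k n :: nat
 assumes "nonzero_bivector w"
  and "riemann_surface A"
  and "compact_space (rs_topology A)"
  and "connected_space (rs_topology A)"
  and "has_genus A g" and "g \<ge> 1"
  and "projective_structure A Q"
  and "theta_lift Q"
  and "vector_bundle A E"
  and "hol_connection A E conn"
  and "vector_bundle A F"
  and "k = n + 1"
 shows "\<forall>x\<in>points A.
  jet_linear_iso A (tensor_bundle E (bL_power Q (int n))) k x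
   (tensor_space (fiber E x) (sum_fiber Q n k x)) (canonical_iso A w Q E conn n k x) \<and>
  (\<forall>\<delta>\<in>diff_fiber A (tensor_bundle E (bL_power Q (int n))) F k x.
   (\<lambda>T\<in>tensor_space (fiber E x) (fiber (bL_power Q (- int (k + 1))) x).
     symbol A (tensor_bundle E (bL_power Q (int n))) k x \<delta> (twist_by_K A w Q k x T))
   = Id_tensor_projection (fiber E x) (fiber (bL_power Q (- int (k + 1))) x)
     (\<lambda>T. \<delta> (canonical_iso A w Q E conn n k x T)))"
proof
 fix x assume x: "x \<in> points A"
 note A = riemann_surface_atlas[OF assms(2)]
 interpret projective_surface A Q by unfold_locales (fact A assms(7,8))+
 \<comment> \<open>Auxiliary data at the point: a chart of the projective structure, a vector off
   the line \<open>dev Q i x\<close>, a frame of E and a coordinate of M. The claim mentions none of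
   them, so any choice serves.\<close>
 obtain i where i: "i \<in> idx Q" "x \<in> dom Q i" using dom_cover[OF x] by blast
 obtain b where b: "b \<notin> dev Q i x" using dev_complement[OF i] by metis
 obtain v where v: "dev Q i x = cfun.span {v}" "br v b \<noteq> 0" using points_P1_affine[OF dev_points[OF i] b] .
 obtain D r \<beta> where D: "(D, r, \<beta>) \<in> frames E" "x \<in> D" using vector_bundle_frame[OF assms(9) x] .
 obtain Dz z where z: "(Dz, z) \<in> A" "x \<in> Dz" using points_E[OF x] .
 interpret framed_connection A E conn D r \<beta> Dz z by unfold_locales (fact A assms(9,10) D(1) z(1))+
 obtain u where u: "\<forall>m<r. \<forall>l<r. hol_at A x (u m l)" "\<forall>m<r. \<forall>l<r. u m l x = (if l = m then 1 else 0)"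
  "\<forall>m<r. flat_near A E conn x (\<lambda>y. \<Sum>l<r. fscale (u m l y) (\<beta> l y))"
  "\<forall>h. flat_near A E conn x h \<longrightarrow> (\<exists>a. \<forall>\<^sub>F y in nhds_rs A x. h y = (\<Sum>m<r. fscale (a m) (\<Sum>l<r. fscale (u m l y) (\<beta> l y))))"
  using flat_frame[OF D(2) z(2)] by (elim exE conjE)
 interpret flat_pointed_surface A Q w n k x i v b E conn D r \<beta> u
  by unfold_locales (use assms(1,12) i v assms(9) D u in blast)+
 show "jet_linear_iso A (tensor_bundle E (bL_power Q (int n))) k x
   (tensor_space (fiber E x) (sum_fiber Q n k x)) (canonical_iso A w Q E conn n k x) \<and>
  (\<forall>\<delta>\<in>diff_fiber A (tensor_bundle E (bL_power Q (int n))) F k x.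
   (\<lambda>T\<in>tensor_space (fiber E x) (fiber (bL_power Q (- int (k + 1))) x).
     symbol A (tensor_bundle E (bL_power Q (int n))) k x \<delta> (twist_by_K A w Q k x T))
   = Id_tensor_projection (fiber E x) (fiber (bL_power Q (- int (k + 1))) x)
     (\<lambda>T. \<delta> (canonical_iso A w Q E conn n k x T)))"
  using canonical_iso_linear symbol_is_projection by blast
qed

end
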